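(* Let $k$ be an algebraically closed field of characteristic $0$, and let $\pi:X=\operatorname{Spec}L\to Y=\operatorname{Spec}K$ correspond to a finite Galois extension $L/K$ of fields finitely generated over $k$. If $N_Y$ is a simple primitive $\mathcal D_Y$-module (of finite dimension over $K$), then $\pi^!(N_Y)=M^e$ where $M$ is a simple $\mathcal D_X$-module and $e$ is some integer.
   Context: $\mathcal D_X=\mathcal D_L$, $\mathcal D_Y=\mathcal D_K$ are the rings of $k$-linear differential operators of the fields. $\pi^!(N)=L\otimes_KN$ as a module over $\mathcal D_L=L\otimes_K\mathcal D_K$. For a finite morphism $q:Z\to Y$ given by a finite field extension, $q_+(N_Z)$ is $N_Z$ restricted to $\mathcal D_Y\subset\mathcal D_Z$. A $\mathcal D_Y$-module $N_Y$ is primitive if it is not the direct image of a module under a non-trivial finite map: whenever $q_+(N_Z)= N_Y$ for a finite morphism $q:Z\to Y$ and some $\mathcal D_Z$-module $N_Z$, then $q$ is an isomorphism. *)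

theory Defs
  imports "HOL-Algebra.Algebra"
begin

section \<open>Modules over a not necessarily commutative ring\<close>

text \<open>The locale \<^locale>\<open>module\<close> of the library is restricted to commutative rings; its record
  type and \<^locale>\<open>submodule\<close> are not. As usual for this record type, the \<^const>\<open>monoid.mult\<close> and
  \<^const>\<open>one\<close> fields of a module are irrelevant.\<close>

locale left_module = R?: ring R + M?: abelian_group M
  for R :: "('r, 'c) ring_scheme" (structure) and M :: "('r, 'm, 'x) module_scheme" (structure) +
  assumes smult_closed:
      "\<lbrakk>a \<in> carrier R; x \<in> carrier M\<rbrakk> \<Longrightarrow> a \<odot>\<^bsub>M\<^esub> x \<in> carrier M"
    and smult_l_distr:
      "\<lbrakk>a \<in> carrier R; b \<in> carrier R; x \<in> carrier M\<rbrakk> \<Longrightarrow>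
        (a \<oplus>\<^bsub>R\<^esub> b) \<odot>\<^bsub>M\<^esub> x = a \<odot>\<^bsub>M\<^esub> x \<oplus>\<^bsub>M\<^esub> b \<odot>\<^bsub>M\<^esub> x"
    and smult_r_distr:
      "\<lbrakk>a \<in> carrier R; x \<in> carrier M; y \<in> carrier M\<rbrakk> \<Longrightarrow>
        a \<odot>\<^bsub>M\<^esub> (x \<oplus>\<^bsub>M\<^esub> y) = a \<odot>\<^bsub>M\<^esub> x \<oplus>\<^bsub>M\<^esub> a \<odot>\<^bsub>M\<^esub> y"
    and smult_assoc:
      "\<lbrakk>a \<in> carrier R; b \<in> carrier R; x \<in> carrier M\<rbrakk> \<Longrightarrow>
        (a \<otimes>\<^bsub>R\<^esub> b) \<odot>\<^bsub>M\<^esub> x = a \<odot>\<^bsub>M\<^esub> (b \<odot>\<^bsub>M\<^esub> x)"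
    and smult_one: "x \<in> carrier M \<Longrightarrow> \<one>\<^bsub>R\<^esub> \<odot>\<^bsub>M\<^esub> x = x"

definition simple_module :: "('r, 'c) ring_scheme \<Rightarrow> ('r, 'm) module \<Rightarrow> bool" where
  "simple_module R M \<longleftrightarrow> left_module R M \<and> carrier M \<noteq> {\<zero>\<^bsub>M\<^esub>} \<and>
     (\<forall>H. submodule H R M \<longrightarrow> H = {\<zero>\<^bsub>M\<^esub>} \<or> H = carrier M)"

definition modules_isomorphic ::
  "('r, 'c) ring_scheme \<Rightarrow> ('r, 'm) module \<Rightarrow> ('r, 'n) module \<Rightarrow> bool" where
  "modules_isomorphic R M N \<longleftrightarrow> (\<exists>f. bij_betw f (carrier M) (carrier N) \<and>
     (\<forall>x\<in>carrier M. \<forall>y\<in>carrier M. f (x \<oplus>\<^bsub>M\<^esub> y) = f x \<oplus>\<^bsub>N\<^esub> f y) \<and>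
     (\<forall>r\<in>carrier R. \<forall>x\<in>carrier M. f (r \<odot>\<^bsub>M\<^esub> x) = r \<odot>\<^bsub>N\<^esub> f x))"

definition module_power :: "('r, 'm) module \<Rightarrow> nat \<Rightarrow> ('r, nat \<Rightarrow> 'm) module" where
  "module_power M e =
     \<lparr>carrier = {..<e} \<rightarrow>\<^sub>E carrier M, monoid.mult = undefined, one = undefined,
      ring.zero = (\<lambda>i\<in>{..<e}. \<zero>\<^bsub>M\<^esub>),
      ring.add = (\<lambda>v w. \<lambda>i\<in>{..<e}. v i \<oplus>\<^bsub>M\<^esub> w i),
      smult = (\<lambda>r v. \<lambda>i\<in>{..<e}. r \<odot>\<^bsub>M\<^esub> v i)\<rparr>"

definition restrict_scalars :: "('r \<Rightarrow> 's) \<Rightarrow> ('s, 'm) module \<Rightarrow> ('r, 'm) module" where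
  "restrict_scalars \<phi> M =
     \<lparr>carrier = carrier M, monoid.mult = monoid.mult M, one = one M, ring.zero = ring.zero M, ring.add = ring.add M,
      smult = (\<lambda>r x. \<phi> r \<odot>\<^bsub>M\<^esub> x)\<rparr>"

definition finitely_generated_module :: "('r, 'c) ring_scheme \<Rightarrow> ('r, 'm) module \<Rightarrow> bool" where
  "finitely_generated_module R M \<longleftrightarrow> (\<exists>B. finite B \<and> B \<subseteq> carrier M \<and>
     (\<forall>x\<in>carrier M. \<exists>c\<in>B \<rightarrow> carrier R. x = (\<Oplus>\<^bsub>M\<^esub>b\<in>B. c b \<odot>\<^bsub>M\<^esub> b)))"


section \<open>Field extensions\<close>

text \<open>Subfields are subsets of the carrier, as in the library. Extensions \<open>L/K\<close> of fields with
  different carriers are given by ring homomorphisms \<open>q\<close> from \<open>K\<close> to \<open>L\<close>, so that the subfield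
  in question is \<open>q ` carrier K\<close>.\<close>

definition finitely_generated_field :: "('a, 'c) ring_scheme \<Rightarrow> 'a set \<Rightarrow> bool" where
  "finitely_generated_field K k \<longleftrightarrow>
     (\<exists>S. finite S \<and> S \<subseteq> carrier K \<and> generate_field K (k \<union> S) = carrier K)"

definition field_automorphisms :: "('a, 'c) ring_scheme \<Rightarrow> 'a set \<Rightarrow> ('a \<Rightarrow> 'a) set" where
  "field_automorphisms L K = {\<sigma> \<in> ring_iso L L. \<forall>x\<in>K. \<sigma> x = x}"

definition finite_galois_extension :: "('a, 'c) ring_scheme \<Rightarrow> 'a set \<Rightarrow> bool" where
  "finite_galois_extension L K \<longleftrightarrow> ring.finite_dimension L K (carrier L) \<and>
     {x \<in> carrier L. \<forall>\<sigma>\<in>field_automorphisms L K. \<sigma> x = x} = K"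


section \<open>Differential operators\<close>

definition linear_endos :: "'a set \<Rightarrow> ('a, 'c) ring_scheme \<Rightarrow> ('a \<Rightarrow> 'a) set" where
  "linear_endos k K = {P \<in> carrier K \<rightarrow>\<^sub>E carrier K.
     (\<forall>x\<in>carrier K. \<forall>y\<in>carrier K. P (x \<oplus>\<^bsub>K\<^esub> y) = P x \<oplus>\<^bsub>K\<^esub> P y) \<and>
     (\<forall>c\<in>k. \<forall>x\<in>carrier K. P (c \<otimes>\<^bsub>K\<^esub> x) = c \<otimes>\<^bsub>K\<^esub> P x)}"

definition mult_op :: "('a, 'c) ring_scheme \<Rightarrow> 'a \<Rightarrow> 'a \<Rightarrow> 'a" where
  "mult_op K a = (\<lambda>x\<in>carrier K. a \<otimes>\<^bsub>K\<^esub> x)"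

definition op_commutator :: "('a, 'c) ring_scheme \<Rightarrow> ('a \<Rightarrow> 'a) \<Rightarrow> 'a \<Rightarrow> 'a \<Rightarrow> 'a" where
  "op_commutator K P a = (\<lambda>x\<in>carrier K. P (a \<otimes>\<^bsub>K\<^esub> x) \<ominus>\<^bsub>K\<^esub> a \<otimes>\<^bsub>K\<^esub> P x)"

text \<open>Grothendieck's definition; \<open>diffops_less k K n\<close> consists of the operators of order
  strictly less than \<open>n\<close>.\<close>

primrec diffops_less :: "'a set \<Rightarrow> ('a, 'c) ring_scheme \<Rightarrow> nat \<Rightarrow> ('a \<Rightarrow> 'a) set" where
  "diffops_less k K 0 = {\<lambda>x\<in>carrier K. \<zero>\<^bsub>K\<^esub>}"
| "diffops_less k K (Suc n) =
     {P \<in> linear_endos k K. \<forall>a\<in>carrier K. op_commutator K P a \<in> diffops_less k K n}"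

definition diffop_ring :: "'a set \<Rightarrow> ('a, 'c) ring_scheme \<Rightarrow> ('a \<Rightarrow> 'a) ring" where
  "diffop_ring k K =
     \<lparr>carrier = (\<Union>n. diffops_less k K n),
      monoid.mult = compose (carrier K),
      one = (\<lambda>x\<in>carrier K. x),
      ring.zero = (\<lambda>x\<in>carrier K. \<zero>\<^bsub>K\<^esub>),
      ring.add = (\<lambda>P Q. \<lambda>x\<in>carrier K. P x \<oplus>\<^bsub>K\<^esub> Q x)\<rparr>"

text \<open>For a finite extension \<open>q : K \<rightarrow> Z\<close> of fields of characteristic 0, every differential
  operator of \<open>K\<close> extends uniquely to one of \<open>Z\<close>. This is the inclusion of the ring of
  differential operators of \<open>K\<close> into that of \<open>Z\<close>.\<close>

definition diffop_ext ::
  "'a set \<Rightarrow> ('a, 'c) ring_scheme \<Rightarrow> ('z, 'd) ring_scheme \<Rightarrow> ('a \<Rightarrow> 'z) \<Rightarrow> ('a \<Rightarrow> 'a) \<Rightarrow> 'z \<Rightarrow> 'z" where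
  "diffop_ext k K Z q P =
     (THE Q. Q \<in> carrier (diffop_ring (q ` k) Z) \<and> (\<forall>x\<in>carrier K. Q (q x) = q (P x)))"


section \<open>Direct and inverse images\<close>

definition direct_image ::
  "'a set \<Rightarrow> ('a, 'c) ring_scheme \<Rightarrow> ('z, 'd) ring_scheme \<Rightarrow> ('a \<Rightarrow> 'z) \<Rightarrow>
    ('z \<Rightarrow> 'z, 'm) module \<Rightarrow> ('a \<Rightarrow> 'a, 'm) module" where
  "direct_image k K Z q N = restrict_scalars (diffop_ext k K Z q) N"

text \<open>The quantification over \<open>Z\<close> and \<open>N\<^sub>Z\<close> is over fields and modules with carriers in the
  types of \<open>K\<close> and \<open>N\<close>. This loses no generality: a finite extension of an infinite field has
  the same cardinality as that field, and a module and its direct image have the same carrier,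
  so that both structures can be transported to these types.\<close>

definition primitive_module ::
  "'a set \<Rightarrow> 'a ring \<Rightarrow> ('a \<Rightarrow> 'a, 'm) module \<Rightarrow> bool" where
  "primitive_module k K N \<longleftrightarrow>
     (\<forall>(Z :: 'a ring) (q :: 'a \<Rightarrow> 'a) (N\<^sub>Z :: ('a \<Rightarrow> 'a, 'm) module).
        field Z \<and> q \<in> ring_hom K Z \<and> ring.finite_dimension Z (q ` carrier K) (carrier Z) \<and>
        left_module (diffop_ring (q ` k) Z) N\<^sub>Z \<and>
        modules_isomorphic (diffop_ring k K) (direct_image k K Z q N\<^sub>Z) N
        \<longrightarrow> q \<in> ring_iso K Z)"

text \<open>The tensor product \<open>L \<otimes>\<^sub>K N\<close> along \<open>q : K \<rightarrow> L\<close>, for a \<open>K\<close>-module \<open>N\<close>: the free abelian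
  group on all pairs modulo the biadditivity and balancing relations.\<close>

definition tensor_relations ::
  "('a, 'c) ring_scheme \<Rightarrow> ('b, 'd) ring_scheme \<Rightarrow> ('a \<Rightarrow> 'b) \<Rightarrow> ('a, 'm) module \<Rightarrow>
    ('b \<times> 'm \<Rightarrow>\<^sub>0 int) set" where
  "tensor_relations K L q N =
     {frag_of (l \<oplus>\<^bsub>L\<^esub> l', n) - frag_of (l, n) - frag_of (l', n) | l l' n.
        l \<in> carrier L \<and> l' \<in> carrier L \<and> n \<in> carrier N} \<union>
     {frag_of (l, n \<oplus>\<^bsub>N\<^esub> n') - frag_of (l, n) - frag_of (l, n') | l n n'.
        l \<in> carrier L \<and> n \<in> carrier N \<and> n' \<in> carrier N} \<union>
     {frag_of (l \<otimes>\<^bsub>L\<^esub> q a, n) - frag_of (l, a \<odot>\<^bsub>N\<^esub> n) | l a n.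
        l \<in> carrier L \<and> a \<in> carrier K \<and> n \<in> carrier N}"

definition tensor_kernel ::
  "('a, 'c) ring_scheme \<Rightarrow> ('b, 'd) ring_scheme \<Rightarrow> ('a \<Rightarrow> 'b) \<Rightarrow> ('a, 'm) module \<Rightarrow>
    ('b \<times> 'm \<Rightarrow>\<^sub>0 int) set" where
  "tensor_kernel K L q N =
     generate (free_Abelian_group (carrier L \<times> carrier N)) (tensor_relations K L q N)"

definition tensor_group ::
  "('a, 'c) ring_scheme \<Rightarrow> ('b, 'd) ring_scheme \<Rightarrow> ('a \<Rightarrow> 'b) \<Rightarrow> ('a, 'm) module \<Rightarrow>
    ('b \<times> 'm \<Rightarrow>\<^sub>0 int) set monoid" where
  "tensor_group K L q N =
     free_Abelian_group (carrier L \<times> carrier N) Mod tensor_kernel K L q N"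

definition pure_tensor ::
  "('a, 'c) ring_scheme \<Rightarrow> ('b, 'd) ring_scheme \<Rightarrow> ('a \<Rightarrow> 'b) \<Rightarrow> ('a, 'm) module \<Rightarrow>
    'b \<Rightarrow> 'm \<Rightarrow> ('b \<times> 'm \<Rightarrow>\<^sub>0 int) set" where
  "pure_tensor K L q N l n =
     tensor_kernel K L q N #>\<^bsub>free_Abelian_group (carrier L \<times> carrier N)\<^esub> frag_of (l, n)"

definition tensor_module ::
  "('a, 'c) ring_scheme \<Rightarrow> ('b, 'd) ring_scheme \<Rightarrow> ('a \<Rightarrow> 'b) \<Rightarrow> ('a, 'm) module \<Rightarrow>
    ('r \<Rightarrow> ('b \<times> 'm \<Rightarrow>\<^sub>0 int) set \<Rightarrow> ('b \<times> 'm \<Rightarrow>\<^sub>0 int) set) \<Rightarrow>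
    ('r, ('b \<times> 'm \<Rightarrow>\<^sub>0 int) set) module" where
  "tensor_module K L q N s =
     \<lparr>carrier = carrier (tensor_group K L q N), monoid.mult = undefined, one = undefined,
      ring.zero = one (tensor_group K L q N), ring.add = monoid.mult (tensor_group K L q N), smult = s\<rparr>"

text \<open>\<open>L \<otimes>\<^sub>K N\<close> as a module over the differential operators \<open>D\<^sub>L = L \<otimes>\<^sub>K D\<^sub>K\<close>: \<open>L\<close> acts on the left
  factor, and \<open>D\<^sub>K\<close> acts on the elements \<open>1 \<otimes> n\<close> through \<open>N\<close>. As \<open>L\<close> and \<open>D\<^sub>K\<close> generate \<open>D\<^sub>L\<close> when
  \<open>L/K\<close> is finite of characteristic 0, this determines the action on the carrier; the choice
  operator only leaves open its values outside.\<close>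

definition inverse_image_action ::
  "'a set \<Rightarrow> ('a, 'c) ring_scheme \<Rightarrow> ('b, 'd) ring_scheme \<Rightarrow> ('a \<Rightarrow> 'b) \<Rightarrow>
    ('a \<Rightarrow> 'a, 'm) module \<Rightarrow>
    (('b \<Rightarrow> 'b) \<Rightarrow> ('b \<times> 'm \<Rightarrow>\<^sub>0 int) set \<Rightarrow> ('b \<times> 'm \<Rightarrow>\<^sub>0 int) set) \<Rightarrow> bool" where
  "inverse_image_action k K L q N s \<longleftrightarrow>
     (let N' = restrict_scalars (mult_op K) N; t = pure_tensor K L q N' in
        left_module (diffop_ring (q ` k) L) (tensor_module K L q N' s) \<and>
        (\<forall>f\<in>carrier L. \<forall>l\<in>carrier L. \<forall>n\<in>carrier N.
           s (mult_op L f) (t l n) = t (f \<otimes>\<^bsub>L\<^esub> l) n) \<and>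
        (\<forall>P\<in>carrier (diffop_ring k K). \<forall>n\<in>carrier N.
           s (diffop_ext k K L q P) (t \<one>\<^bsub>L\<^esub> n) = t \<one>\<^bsub>L\<^esub> (P \<odot>\<^bsub>N\<^esub> n)))"

definition inverse_image ::
  "'a set \<Rightarrow> ('a, 'c) ring_scheme \<Rightarrow> ('b, 'd) ring_scheme \<Rightarrow> ('a \<Rightarrow> 'b) \<Rightarrow>
    ('a \<Rightarrow> 'a, 'm) module \<Rightarrow> ('b \<Rightarrow> 'b, ('b \<times> 'm \<Rightarrow>\<^sub>0 int) set) module" where
  "inverse_image k K L q N =
     tensor_module K L q (restrict_scalars (mult_op K) N)
       (SOME s. inverse_image_action k K L q N s)"

end

theory Submission
  imports Defs
begin

text \<open>Choose a simple submodule \<open>W\<close> of \<open>V = L \<otimes>\<^sub>K N\<close>, which has finite dimension over \<open>L\<close>.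
  The Galois group \<open>G\<close> acts semilinearly on \<open>V\<close>, and \<open>V\<close> has no proper \<open>G\<close>-stable submodules, since by Galois descent these come from submodules of the simple module \<open>N\<close>.
  Hence \<open>V\<close> is the sum of the conjugates of \<open>W\<close>, so it is semisimple, and \<open>G\<close> permutes its isotypic components
  transitively. Let \<open>H\<close> be the stabilizer of the component \<open>U\<close> of \<open>W\<close> and \<open>Z\<close> the fixed field of \<open>H\<close>. The projection
  \<open>V \<rightarrow> U\<close> identifies \<open>N = V\<^sup>G\<close> with \<open>U\<^sup>H\<close>, on which the differential operators of \<open>Z\<close> act. So \<open>N\<close> is a direct image
  from \<open>Z\<close>, primitivity gives \<open>Z = K\<close>, thus \<open>H = G\<close>, and \<open>V = U\<close> is isotypic.

  Traces \<open>tr = \<Sum>\<^sub>\<sigma> \<sigma>\<close> and dual bases \<open>u, v\<close> with \<open>y = \<Sum>\<^sub>j u\<^sub>j tr(v\<^sub>j y)\<close> make all of this explicit; for example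
  \<open>\<Sum>\<^sub>i u\<^sub>i tr(v\<^sub>i Q)\<close> writes an operator \<open>Q\<close> of \<open>L\<close> in terms of operators of \<open>K\<close>.\<close>

section \<open>Differential operators\<close>

text \<open>Operators are known only through iterated commutators, so no derivations or coordinates
  are at hand when they are carried from \<open>K\<close> to \<open>L\<close>. The separability
  idempotent, the sum of u_j \<otimes> v_j, does that work instead: averaging an operator against it
  converts commutators with elements of \<open>L\<close> into commutators with elements of
  \<open>K\<close>, and extension and uniqueness become inductions on the order. The stabilizer
  \<open>H\<close> need not be normal, so \<open>Z\<close> over \<open>K\<close> need not be Galois.
  Whatever concerns \<open>Z\<close> is therefore checked inside \<open>L\<close>, which is Galois
  over \<open>Z\<close> with group \<open>H\<close>. That the projection identifies V^G with U^H
  rests on two facts: an element of \<open>G\<close> outside \<open>H\<close> moves \<open>U\<close>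
  into a part which the projection kills, so projecting a full trace leaves an
  \<open>H\<close>-trace; and \<open>L\<close> contains an element whose \<open>H\<close>-trace is
  1. Primitivity speaks only of fields and modules living in the types of \<open>K\<close> and
  \<open>N\<close>. So \<open>Z\<close> is copied along an injection of \<open>L\<close> into the
  type of \<open>K\<close>, and the module over it keeps the carrier of \<open>N\<close>.\<close>

lemma (in abelian_monoid) finsum_swap:
  assumes "finite A" "finite B" "\<And>a b. a \<in> A \<Longrightarrow> b \<in> B \<Longrightarrow> f a b \<in> carrier G"
  shows "(\<Oplus>a\<in>A. \<Oplus>b\<in>B. f a b) = (\<Oplus>b\<in>B. \<Oplus>a\<in>A. f a b)"
  using assms(1,3)
proof (induction A)
  case empty
  show ?case by simp
next
  case (insert x A)
  have "(\<Oplus>b\<in>B. \<Oplus>a\<in>insert x A. f a b) = (\<Oplus>b\<in>B. f x b \<oplus> (\<Oplus>a\<in>A. f a b))"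
    using insert by (intro finsum_cong') (auto intro!: finsum_insert)
  also have "\<dots> = (\<Oplus>b\<in>B. f x b) \<oplus> (\<Oplus>b\<in>B. \<Oplus>a\<in>A. f a b)"
    using insert by (intro finsum_addf) auto
  finally show ?case
    using insert by (simp add: Pi_def)
qed

text \<open>Grothendieck's order condition with the multipliers \<open>I\<close> and the domain
  \<open>D\<close> as separate parameters, because three versions are compared below: commutators
  with \<open>L\<close> on \<open>L\<close>, with \<open>K\<^sub>0\<close> on \<open>L\<close>, and
  with \<open>K\<^sub>0\<close> on \<open>K\<^sub>0\<close>. The bound is strict, so 0 forces
  \<open>f\<close> to vanish on \<open>D\<close>. Linearity and extensionality are left out, so that
  plain lambda terms can be used.\<close>

primrec dord :: "('a, 'c) ring_scheme \<Rightarrow> 'a set \<Rightarrow> 'a set \<Rightarrow> nat \<Rightarrow> ('a \<Rightarrow> 'a) \<Rightarrow> bool" where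
  "dord R I D 0 f \<longleftrightarrow> (\<forall>x\<in>D. f x = \<zero>\<^bsub>R\<^esub>)"
| "dord R I D (Suc n) f \<longleftrightarrow> (\<forall>a\<in>I. dord R I D n (\<lambda>x. f (a \<otimes>\<^bsub>R\<^esub> x) \<ominus>\<^bsub>R\<^esub> a \<otimes>\<^bsub>R\<^esub> f x))"

text \<open>The domain is a parameter because operators from the subfield \<open>K\<^sub>0\<close>
  to the larger \<open>L\<close> occur as well.\<close>

definition klin :: "('a, 'c) ring_scheme \<Rightarrow> 'a set \<Rightarrow> 'a set \<Rightarrow> ('a \<Rightarrow> 'a) \<Rightarrow> bool" where
  "klin R k D f \<longleftrightarrow> f \<in> D \<rightarrow> carrier R \<and>
     (\<forall>x\<in>D. \<forall>y\<in>D. f (x \<oplus>\<^bsub>R\<^esub> y) = f x \<oplus>\<^bsub>R\<^esub> f y) \<and>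
     (\<forall>c\<in>k. \<forall>x\<in>D. f (c \<otimes>\<^bsub>R\<^esub> x) = c \<otimes>\<^bsub>R\<^esub> f x)"

lemma klinD:
  assumes "klin R k D f"
  shows "x \<in> D \<Longrightarrow> f x \<in> carrier R"
    and "x \<in> D \<Longrightarrow> y \<in> D \<Longrightarrow> f (x \<oplus>\<^bsub>R\<^esub> y) = f x \<oplus>\<^bsub>R\<^esub> f y"
    and "c \<in> k \<Longrightarrow> x \<in> D \<Longrightarrow> f (c \<otimes>\<^bsub>R\<^esub> x) = c \<otimes>\<^bsub>R\<^esub> f x"
  using assms unfolding klin_def by auto

lemma klinI:
  assumes "\<And>x. x \<in> D \<Longrightarrow> f x \<in> carrier R"
    and "\<And>x y. x \<in> D \<Longrightarrow> y \<in> D \<Longrightarrow> f (x \<oplus>\<^bsub>R\<^esub> y) = f x \<oplus>\<^bsub>R\<^esub> f y"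
    and "\<And>c x. c \<in> k \<Longrightarrow> x \<in> D \<Longrightarrow> f (c \<otimes>\<^bsub>R\<^esub> x) = c \<otimes>\<^bsub>R\<^esub> f x"
  shows "klin R k D f"
  using assms unfolding klin_def by auto

locale order_context = cring R for R (structure) +
  fixes I D
  assumes I_sub: "I \<subseteq> carrier R" and D_sub: "D \<subseteq> carrier R"
    and mult_D: "a \<in> I \<Longrightarrow> x \<in> D \<Longrightarrow> a \<otimes> x \<in> D"
begin

lemma I_carr: "a \<in> I \<Longrightarrow> a \<in> carrier R"
  and D_carr [simp, intro]: "a \<in> D \<Longrightarrow> a \<in> carrier R"
  using I_sub D_sub by auto

context
  notes I_carr [simp, intro] D_carr [simp, intro]
begin

lemma dord_cong: "(\<And>x. x \<in> D \<Longrightarrow> f x = g x) \<Longrightarrow> dord R I D n f \<longleftrightarrow> dord R I D n g"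
proof (induction n arbitrary: f g)
  case (Suc n)
  show ?case
    unfolding dord.simps by (intro ball_cong refl Suc.IH) (simp add: Suc.prems mult_D)
qed auto

lemma dord_add:
  "\<lbrakk>f \<in> D \<rightarrow> carrier R; g \<in> D \<rightarrow> carrier R; dord R I D n f; dord R I D n g\<rbrakk>
     \<Longrightarrow> dord R I D n (\<lambda>x. f x \<oplus> g x)"
proof (induction n arbitrary: f g)
  case (Suc n)
  show ?case
    unfolding dord.simps
  proof
    fix a assume a: "a \<in> I"
    have "dord R I D n (\<lambda>x. (f (a \<otimes> x) \<ominus> a \<otimes> f x) \<oplus> (g (a \<otimes> x) \<ominus> a \<otimes> g x))"
      using Suc.prems a by (intro Suc.IH) (auto simp: Pi_iff mult_D)
    moreover have "(f (a \<otimes> x) \<ominus> a \<otimes> f x) \<oplus> (g (a \<otimes> x) \<ominus> a \<otimes> g x)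
        = f (a \<otimes> x) \<oplus> g (a \<otimes> x) \<ominus> a \<otimes> (f x \<oplus> g x)" if "x \<in> D" for x
    proof -
      have "f x \<in> carrier R" "g x \<in> carrier R" "f (a \<otimes> x) \<in> carrier R" "g (a \<otimes> x) \<in> carrier R" "a \<in> carrier R"
        using Suc.prems a that mult_D by (auto simp: Pi_iff)
      then show ?thesis by algebra
    qed
    ultimately show "dord R I D n (\<lambda>x. f (a \<otimes> x) \<oplus> g (a \<otimes> x) \<ominus> a \<otimes> (f x \<oplus> g x))"
      by (subst (asm) dord_cong) auto
  qed
qed (auto simp: Pi_iff)

lemma dord_zero: "dord R I D n (\<lambda>x. \<zero>)"
  by (induction n) (auto simp: minus_eq)

lemma dord_lmult:
  "\<lbrakk>f \<in> D \<rightarrow> carrier R; c \<in> carrier R; dord R I D n f\<rbrakk> \<Longrightarrow> dord R I D n (\<lambda>x. c \<otimes> f x)"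
proof (induction n arbitrary: f)
  case (Suc n)
  show ?case
    unfolding dord.simps
  proof
    fix a assume a: "a \<in> I"
    have "dord R I D n (\<lambda>x. c \<otimes> (f (a \<otimes> x) \<ominus> a \<otimes> f x))"
      using Suc.prems a by (intro Suc.IH) (auto simp: Pi_iff mult_D)
    moreover have "c \<otimes> (f (a \<otimes> x) \<ominus> a \<otimes> f x) = c \<otimes> f (a \<otimes> x) \<ominus> a \<otimes> (c \<otimes> f x)" if "x \<in> D" for x
    proof -
      have "f x \<in> carrier R" "f (a \<otimes> x) \<in> carrier R" "a \<in> carrier R" "c \<in> carrier R"
        using Suc.prems a that mult_D by (auto simp: Pi_iff)
      then show ?thesis by algebra
    qed
    ultimately show "dord R I D n (\<lambda>x. c \<otimes> f (a \<otimes> x) \<ominus> a \<otimes> (c \<otimes> f x))"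
      by (subst (asm) dord_cong) auto
  qed
qed auto

text \<open>Multiplications commute, so precomposing with \<open>c\<close> passes through every
  commutator.\<close>

lemma dord_rmult:
  "\<lbrakk>c \<in> carrier R; \<And>x. x \<in> D \<Longrightarrow> c \<otimes> x \<in> D; dord R I D n f\<rbrakk> \<Longrightarrow> dord R I D n (\<lambda>x. f (c \<otimes> x))"
proof (induction n arbitrary: f)
  case (Suc n)
  show ?case
    unfolding dord.simps
  proof
    fix a assume a: "a \<in> I"
    have "dord R I D n (\<lambda>x. f (a \<otimes> (c \<otimes> x)) \<ominus> a \<otimes> f (c \<otimes> x))"
      using Suc.prems a Suc.IH[of "\<lambda>x. f (a \<otimes> x) \<ominus> a \<otimes> f x"] by auto
    moreover have "a \<otimes> (c \<otimes> x) = c \<otimes> (a \<otimes> x)" if "x \<in> D" for x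
      using a Suc.prems that by (simp add: m_lcomm)
    ultimately show "dord R I D n (\<lambda>x. f (c \<otimes> (a \<otimes> x)) \<ominus> a \<otimes> f (c \<otimes> x))"
      by (subst (asm) dord_cong) auto
  qed
qed auto

lemma dord_finsum:
  assumes "finite A" "\<And>i. i \<in> A \<Longrightarrow> f i \<in> D \<rightarrow> carrier R" "\<And>i. i \<in> A \<Longrightarrow> dord R I D n (f i)"
  shows "dord R I D n (\<lambda>x. \<Oplus>i\<in>A. f i x)"
  using assms
proof (induction A)
  case empty
  then show ?case by (simp add: dord_zero)
next
  case (insert j A)
  have "dord R I D n (\<lambda>x. f j x \<oplus> (\<Oplus>i\<in>A. f i x))"
    using insert by (intro dord_add) (auto simp: Pi_iff intro!: finsum_closed)
  moreover have "f j x \<oplus> (\<Oplus>i\<in>A. f i x) = (\<Oplus>i\<in>insert j A. f i x)" if "x \<in> D" for x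
    using insert that by (subst finsum_insert) (auto simp: Pi_iff)
  ultimately show ?case
    by (subst (asm) dord_cong) auto
qed

lemma dord_minus:
  assumes "f \<in> D \<rightarrow> carrier R" "g \<in> D \<rightarrow> carrier R" "dord R I D n f" "dord R I D n g"
  shows "dord R I D n (\<lambda>x. f x \<ominus> g x)"
proof -
  have "dord R I D n (\<lambda>x. f x \<oplus> (\<ominus> \<one>) \<otimes> g x)"
    using assms by (intro dord_add dord_lmult) auto
  moreover have "f x \<oplus> (\<ominus> \<one>) \<otimes> g x = f x \<ominus> g x" if "x \<in> D" for x
  proof -
    have "f x \<in> carrier R" "g x \<in> carrier R" using assms that by auto
    then show ?thesis by algebra
  qed
  ultimately show ?thesis
    by (subst (asm) dord_cong) auto
qed

lemma dord_Suc: "dord R I D n f \<Longrightarrow> dord R I D (Suc n) f"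
proof (induction n arbitrary: f)
  case 0
  then show ?case by (auto simp: mult_D minus_eq)
next
  case (Suc n)
  show ?case
    unfolding dord.simps(2)[of R I D "Suc n"]
  proof
    fix a assume "a \<in> I"
    with Suc.prems show "dord R I D (Suc n) (\<lambda>x. f (a \<otimes> x) \<ominus> a \<otimes> f x)"
      by (intro Suc.IH) (simp only: dord.simps)
  qed
qed

lemma dord_mono: "dord R I D n f \<Longrightarrow> n \<le> m \<Longrightarrow> dord R I D m f"
  by (induction m) (auto simp: le_Suc_eq simp del: dord.simps intro: dord_Suc)

lemma dord_subset:
  assumes "I' \<subseteq> I" "D' \<subseteq> D" "\<And>a x. a \<in> I' \<Longrightarrow> x \<in> D' \<Longrightarrow> a \<otimes> x \<in> D'"
  shows "dord R I D n f \<Longrightarrow> dord R I' D' n f"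
  using assms by (induction n arbitrary: f) auto

end

end

lemma order_context_self: "cring R \<Longrightarrow> order_context R (carrier R) (carrier R)"
  unfolding order_context_def order_context_axioms_def
  by (simp add: cring.axioms(1) ring.ring_simprules(5))

section \<open>Composition and the ring of differential operators\<close>

context cring
begin

lemma self_order: "order_context R (carrier R) (carrier R)"
  by (rule order_context_self) (rule is_cring)

lemma klin_cong:
  assumes "klin R k (carrier R) f" "k \<subseteq> carrier R" "\<And>x. x \<in> carrier R \<Longrightarrow> f x = g x"
  shows "klin R k (carrier R) g"
  using assms(2) klinD[OF assms(1)]
  by (intro klinI) (simp_all add: assms(3)[symmetric] subset_iff)

lemma klin_compose:
  assumes "klin R k (carrier R) P" "klin R k (carrier R) Q"
  shows "klin R k (carrier R) (\<lambda>x. P (Q x))"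
  using assms by (intro klinI) (simp_all add: klinD)

lemma klin_zero:
  assumes "klin R k (carrier R) P" shows "P \<zero> = \<zero>"
  using klinD(2)[OF assms, of \<zero> \<zero>] klinD(1)[OF assms, of \<zero>]
  by (metis add.r_cancel_one' r_zero zero_closed)

lemma klin_minus:
  assumes "klin R k (carrier R) P" "x \<in> carrier R" "y \<in> carrier R" shows "P (x \<ominus> y) = P x \<ominus> P y"
proof -
  have "P x = P (x \<ominus> y) \<oplus> P y"
    using assms klinD(2)[OF assms(1), of "x \<ominus> y" y] by (simp add: minus_eq a_assoc l_neg)
  moreover have "P x \<in> carrier R" "P (x \<ominus> y) \<in> carrier R" "P y \<in> carrier R"
    using assms by (simp_all add: klinD)
  ultimately show ?thesis by algebra
qed

lemma klin_commutator:
  assumes P: "klin R k (carrier R) P" and k: "k \<subseteq> carrier R" and a: "a \<in> carrier R"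
  shows "klin R k (carrier R) (\<lambda>x. P (a \<otimes> x) \<ominus> a \<otimes> P x)"
proof (rule klinI)
  fix x y assume xy: "x \<in> carrier R" "y \<in> carrier R"
  note c = klinD(1)[OF P]
  have "P (a \<otimes> x) \<in> carrier R" "P x \<in> carrier R" "P (a \<otimes> y) \<in> carrier R" "P y \<in> carrier R"
    using xy a c by auto
  then have "P (a \<otimes> x) \<oplus> P (a \<otimes> y) \<ominus> a \<otimes> (P x \<oplus> P y) = P (a \<otimes> x) \<ominus> a \<otimes> P x \<oplus> (P (a \<otimes> y) \<ominus> a \<otimes> P y)"
    using a by algebra
  then show "P (a \<otimes> (x \<oplus> y)) \<ominus> a \<otimes> P (x \<oplus> y) = P (a \<otimes> x) \<ominus> a \<otimes> P x \<oplus> (P (a \<otimes> y) \<ominus> a \<otimes> P y)"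
    using xy a by (simp add: r_distr klinD(2)[OF P])
next
  fix c x assume xy: "c \<in> k" "x \<in> carrier R"
  then have cc: "c \<in> carrier R" using k by auto
  have m: "P (a \<otimes> x) \<in> carrier R" "P x \<in> carrier R" using xy a klinD(1)[OF P] by auto
  have "P (a \<otimes> (c \<otimes> x)) = c \<otimes> P (a \<otimes> x)"
    using klinD(3)[OF P, of c "a \<otimes> x"] xy a cc by (simp add: m_lcomm)
  moreover have "P (c \<otimes> x) = c \<otimes> P x"
    using klinD(3)[OF P] xy by simp
  moreover have "c \<otimes> P (a \<otimes> x) \<ominus> a \<otimes> (c \<otimes> P x) = c \<otimes> (P (a \<otimes> x) \<ominus> a \<otimes> P x)"
    using m cc a by algebra
  ultimately show "P (a \<otimes> (c \<otimes> x)) \<ominus> a \<otimes> P (c \<otimes> x) = c \<otimes> (P (a \<otimes> x) \<ominus> a \<otimes> P x)"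
    by simp
qed (use assms in \<open>simp add: klinD\<close>)

text \<open>Leibniz rule [PQ, a] = P[Q, a] + [P, a]Q, with induction on \<open>m + n\<close>. If
  \<open>m\<close> or \<open>n\<close> is 0, one factor vanishes and so does the composite. The
  bound is one more than the sharp one, which is harmless since only some bound is ever asked
  for.\<close>

lemma dord_compose:
  assumes "k \<subseteq> carrier R"
  shows "\<lbrakk>klin R k (carrier R) P; klin R k (carrier R) Q;
    dord R (carrier R) (carrier R) m P; dord R (carrier R) (carrier R) n Q\<rbrakk>
    \<Longrightarrow> dord R (carrier R) (carrier R) (m + n) (\<lambda>x. P (Q x))"
proof (induction "m + n" arbitrary: m n P Q)
  case (Suc N)
  show ?case
  proof (cases "m = 0 \<or> n = 0")
    case True
    then have "dord R (carrier R) (carrier R) 0 (\<lambda>x. P (Q x))"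
      using Suc.prems klin_zero by (auto simp: klinD)
    then show ?thesis using order_context.dord_mono[OF self_order] by blast
  next
    case False
    then obtain m' n' where mn: "m = Suc m'" "n = Suc n'" by (meson not0_implies_Suc)
    have "dord R (carrier R) (carrier R) N (\<lambda>x. P (Q (a \<otimes> x)) \<ominus> a \<otimes> P (Q x))" if a: "a \<in> carrier R" for a
    proof -
      have "dord R (carrier R) (carrier R) (m + n') (\<lambda>x. P (Q (a \<otimes> x) \<ominus> a \<otimes> Q x))"
        using Suc.prems Suc.hyps(2) mn a
        by (intro Suc.hyps(1)[of m n' P "\<lambda>x. Q (a \<otimes> x) \<ominus> a \<otimes> Q x"] klin_commutator assms) auto
      moreover have "dord R (carrier R) (carrier R) (m' + n) (\<lambda>x. P (a \<otimes> Q x) \<ominus> a \<otimes> P (Q x))"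
        using Suc.prems Suc.hyps(2) mn a
        by (intro Suc.hyps(1)[of m' n "\<lambda>x. P (a \<otimes> x) \<ominus> a \<otimes> P x" Q] klin_commutator assms) auto
      moreover have "m + n' = N" "m' + n = N" using Suc.hyps(2) mn by auto
      ultimately have "dord R (carrier R) (carrier R) N
          (\<lambda>x. P (Q (a \<otimes> x) \<ominus> a \<otimes> Q x) \<oplus> (P (a \<otimes> Q x) \<ominus> a \<otimes> P (Q x)))"
        using Suc.prems a by (intro order_context.dord_add[OF self_order]) (auto simp: klinD)
      moreover have "P (Q (a \<otimes> x) \<ominus> a \<otimes> Q x) \<oplus> (P (a \<otimes> Q x) \<ominus> a \<otimes> P (Q x)) = P (Q (a \<otimes> x)) \<ominus> a \<otimes> P (Q x)"
        if x: "x \<in> carrier R" for x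
      proof -
        have "Q x \<in> carrier R" "Q (a \<otimes> x) \<in> carrier R"
          using Suc.prems(2) a x by (auto simp: klinD)
        moreover from this have "P (Q x) \<in> carrier R" "P (Q (a \<otimes> x)) \<in> carrier R" "P (a \<otimes> Q x) \<in> carrier R"
          using Suc.prems(1) a x by (auto simp: klinD)
        ultimately show ?thesis
          using a by (simp add: klin_minus[OF Suc.prems(1)]) algebra
      qed
      ultimately show ?thesis
        by (subst (asm) order_context.dord_cong[OF self_order]) auto
    qed
    then show ?thesis
      unfolding Suc.hyps(2)[symmetric] by simp
  qed
qed (auto intro: klin_zero)

lemma linear_endos_iff:
  "P \<in> linear_endos k R \<longleftrightarrow> P \<in> extensional (carrier R) \<and> klin R k (carrier R) P"
  unfolding linear_endos_def klin_def PiE_def by auto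

text \<open>Commutators inherit \<open>k\<close>-linearity from the operator, so linearity has to be
  checked only once, outside the recursion.\<close>

lemma diffops_less_iff:
  assumes k: "k \<subseteq> carrier R"
  shows "P \<in> diffops_less k R n \<longleftrightarrow> P \<in> linear_endos k R \<and> dord R (carrier R) (carrier R) n P"
proof (induction n arbitrary: P)
  case 0
  have "(\<lambda>x\<in>carrier R. \<zero>) \<in> linear_endos k R"
    using k by (auto simp: linear_endos_iff intro!: klinI)
  moreover have "P = (\<lambda>x\<in>carrier R. \<zero>)" if "P \<in> extensional (carrier R)" "\<forall>x\<in>carrier R. P x = \<zero>"
    using that by (intro extensionalityI[of _ "carrier R"]) auto
  ultimately show ?case
    by (auto simp: linear_endos_iff)
next
  case (Suc n)
  have "op_commutator R P a \<in> linear_endos k R" if "P \<in> linear_endos k R" "a \<in> carrier R" for a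
  proof -
    have "klin R k (carrier R) (\<lambda>x. P (a \<otimes> x) \<ominus> a \<otimes> P x)"
      using that k by (intro klin_commutator) (auto simp: linear_endos_iff)
    moreover have "c \<otimes> x \<in> carrier R" if "c \<in> k" "x \<in> carrier R" for c x using that k by auto
    ultimately show ?thesis
      unfolding linear_endos_iff op_commutator_def klin_def by auto
  qed
  moreover have "dord R (carrier R) (carrier R) n (op_commutator R P a) \<longleftrightarrow>
      dord R (carrier R) (carrier R) n (\<lambda>x. P (a \<otimes> x) \<ominus> a \<otimes> P x)" for a
    by (rule order_context.dord_cong[OF self_order]) (simp add: op_commutator_def)
  ultimately show ?case
    by (auto simp: Suc)
qed

lemma carrier_diffop_ring:
  assumes "k \<subseteq> carrier R"
  shows "P \<in> carrier (diffop_ring k R) \<longleftrightarrow>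
    P \<in> extensional (carrier R) \<and> klin R k (carrier R) P \<and> (\<exists>n. dord R (carrier R) (carrier R) n P)"
  by (auto simp: diffop_ring_def diffops_less_iff[OF assms] linear_endos_iff)

lemma diffop_ringI:
  assumes k: "k \<subseteq> carrier R" and "klin R k (carrier R) f" "dord R (carrier R) (carrier R) n f"
  shows "(\<lambda>x\<in>carrier R. f x) \<in> carrier (diffop_ring k R)"
proof -
  have "dord R (carrier R) (carrier R) n (\<lambda>x\<in>carrier R. f x)"
    using assms(3) by (subst order_context.dord_cong[OF self_order, where g = f]) auto
  moreover have "c \<otimes> x \<in> carrier R" if "c \<in> k" "x \<in> carrier R" for c x using that k by auto
  ultimately show ?thesis
    using assms(2) unfolding carrier_diffop_ring[OF k] klin_def by (auto simp: Pi_iff)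
qed

lemma diffop_ring_simps:
  "P \<otimes>\<^bsub>diffop_ring k R\<^esub> Q = (\<lambda>x\<in>carrier R. P (Q x))"
  "\<one>\<^bsub>diffop_ring k R\<^esub> = (\<lambda>x\<in>carrier R. x)"
  "\<zero>\<^bsub>diffop_ring k R\<^esub> = (\<lambda>x\<in>carrier R. \<zero>)"
  "P \<oplus>\<^bsub>diffop_ring k R\<^esub> Q = (\<lambda>x\<in>carrier R. P x \<oplus> Q x)"
  by (auto simp: diffop_ring_def compose_def)

lemma mult_op_diffop:
  assumes k: "k \<subseteq> carrier R" and a: "a \<in> carrier R"
  shows "mult_op R a \<in> carrier (diffop_ring k R)"
proof -
  have "klin R k (carrier R) (\<lambda>x. a \<otimes> x)"
    using k a by (intro klinI) (auto simp: r_distr m_lcomm)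
  moreover have "dord R (carrier R) (carrier R) (Suc 0) (\<lambda>x. a \<otimes> x)"
    using a by (auto simp: m_lcomm[of a] minus_eq r_neg)
  ultimately show ?thesis
    unfolding mult_op_def by (rule diffop_ringI[OF k])
qed

lemma diffop_add:
  assumes k: "k \<subseteq> carrier R" and P: "P \<in> carrier (diffop_ring k R)" and Q: "Q \<in> carrier (diffop_ring k R)"
  shows "P \<oplus>\<^bsub>diffop_ring k R\<^esub> Q \<in> carrier (diffop_ring k R)"
proof -
  obtain m n where m: "dord R (carrier R) (carrier R) m P" and n: "dord R (carrier R) (carrier R) n Q"
    and lin: "klin R k (carrier R) P" "klin R k (carrier R) Q"
    using P Q unfolding carrier_diffop_ring[OF k] by blast
  have "dord R (carrier R) (carrier R) (max m n) P" "dord R (carrier R) (carrier R) (max m n) Q"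
    using m n order_context.dord_mono[OF self_order] by auto
  then have "dord R (carrier R) (carrier R) (max m n) (\<lambda>x. P x \<oplus> Q x)"
    using lin by (intro order_context.dord_add[OF self_order]) (auto simp: klinD)
  moreover have "klin R k (carrier R) (\<lambda>x. P x \<oplus> Q x)"
    using lin k by (intro klinI) (auto simp: klinD r_distr a_ac subset_iff)
  ultimately show ?thesis
    unfolding diffop_ring_simps by (intro diffop_ringI[OF k])
qed

lemma diffop_mult:
  assumes k: "k \<subseteq> carrier R" and P: "P \<in> carrier (diffop_ring k R)" and Q: "Q \<in> carrier (diffop_ring k R)"
  shows "P \<otimes>\<^bsub>diffop_ring k R\<^esub> Q \<in> carrier (diffop_ring k R)"
proof -
  obtain m n where ord: "dord R (carrier R) (carrier R) m P" "dord R (carrier R) (carrier R) n Q"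
    and lin: "klin R k (carrier R) P" "klin R k (carrier R) Q"
    using P Q unfolding carrier_diffop_ring[OF k] by blast
  show ?thesis
    unfolding diffop_ring_simps
    by (rule diffop_ringI[OF k klin_compose[OF lin] dord_compose[OF k lin ord]])
qed

lemma diffop_ring_ring:
  assumes k: "k \<subseteq> carrier R"
  shows "ring (diffop_ring k R)"
proof -
  let ?D = "diffop_ring k R"
  have mem: "P x \<in> carrier R" if "P \<in> carrier ?D" "x \<in> carrier R" for P x
    using that unfolding carrier_diffop_ring[OF k] by (auto simp: klinD)
  have lin: "klin R k (carrier R) P" if "P \<in> carrier ?D" for P
    using that unfolding carrier_diffop_ring[OF k] by auto
  have ext: "P \<in> extensional (carrier R)" if "P \<in> carrier ?D" for P
    using that unfolding carrier_diffop_ring[OF k] by auto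
  \<comment> \<open>The negative is a composite with multiplication by -1, so closure under
    composition already covers it.\<close>
  have neg: "(\<lambda>x\<in>carrier R. \<ominus> P x) \<in> carrier ?D" if "P \<in> carrier ?D" for P
  proof -
    have "mult_op R (\<ominus> \<one>) \<otimes>\<^bsub>?D\<^esub> P \<in> carrier ?D"
      using that k by (intro diffop_mult mult_op_diffop) auto
    moreover have "mult_op R (\<ominus> \<one>) \<otimes>\<^bsub>?D\<^esub> P = (\<lambda>x\<in>carrier R. \<ominus> P x)"
      using mem[OF that] by (auto simp: diffop_ring_simps mult_op_def l_minus)
    ultimately show ?thesis by simp
  qed
  have one: "\<one>\<^bsub>?D\<^esub> = mult_op R \<one>"
    by (auto simp: diffop_ring_simps mult_op_def)
  have zero: "\<zero>\<^bsub>?D\<^esub> = mult_op R \<zero>"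
    by (auto simp: diffop_ring_simps mult_op_def)
  show ?thesis
  proof (intro ringI abelian_groupI monoidI)
    fix P assume P: "P \<in> carrier ?D"
    show "\<exists>y\<in>carrier ?D. y \<oplus>\<^bsub>?D\<^esub> P = \<zero>\<^bsub>?D\<^esub>"
      using neg[OF P] mem[OF P] by (auto simp: diffop_ring_simps l_neg intro!: bexI[of _ "\<lambda>x\<in>carrier R. \<ominus> P x"])
  next
    fix P Q assume P: "P \<in> carrier ?D" and Q: "Q \<in> carrier ?D"
    show "P \<oplus>\<^bsub>?D\<^esub> Q \<in> carrier ?D" by (rule diffop_add[OF k P Q])
    show "P \<otimes>\<^bsub>?D\<^esub> Q \<in> carrier ?D" by (rule diffop_mult[OF k P Q])
    show "P \<oplus>\<^bsub>?D\<^esub> Q = Q \<oplus>\<^bsub>?D\<^esub> P"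
      using mem P Q by (auto simp: diffop_ring_simps a_comm)
    fix S assume S: "S \<in> carrier ?D"
    show "P \<oplus>\<^bsub>?D\<^esub> Q \<oplus>\<^bsub>?D\<^esub> S = P \<oplus>\<^bsub>?D\<^esub> (Q \<oplus>\<^bsub>?D\<^esub> S)"
      using mem P Q S by (auto simp: diffop_ring_simps a_assoc)
    show "P \<otimes>\<^bsub>?D\<^esub> Q \<otimes>\<^bsub>?D\<^esub> S = P \<otimes>\<^bsub>?D\<^esub> (Q \<otimes>\<^bsub>?D\<^esub> S)"
      using mem P Q S by (auto simp: diffop_ring_simps)
    show "(P \<oplus>\<^bsub>?D\<^esub> Q) \<otimes>\<^bsub>?D\<^esub> S = P \<otimes>\<^bsub>?D\<^esub> S \<oplus>\<^bsub>?D\<^esub> Q \<otimes>\<^bsub>?D\<^esub> S"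
      using mem P Q S by (auto simp: diffop_ring_simps)
    show "S \<otimes>\<^bsub>?D\<^esub> (P \<oplus>\<^bsub>?D\<^esub> Q) = S \<otimes>\<^bsub>?D\<^esub> P \<oplus>\<^bsub>?D\<^esub> S \<otimes>\<^bsub>?D\<^esub> Q"
      using mem P Q S by (auto simp: diffop_ring_simps klinD(2)[OF lin[OF S]])
  next
    fix P assume P: "P \<in> carrier ?D"
    show "\<zero>\<^bsub>?D\<^esub> \<oplus>\<^bsub>?D\<^esub> P = P" "\<one>\<^bsub>?D\<^esub> \<otimes>\<^bsub>?D\<^esub> P = P" "P \<otimes>\<^bsub>?D\<^esub> \<one>\<^bsub>?D\<^esub> = P"
      using mem[OF P] ext[OF P] by (auto simp: diffop_ring_simps fun_eq_iff extensional_def)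
  qed (use k in \<open>auto simp: one zero intro: mult_op_diffop\<close>)
qed

end

section \<open>Unique extension of differential operators along a trace with dual families\<close>

lemma (in abelian_group) eq_minusI:
  "\<lbrakk>a = b \<oplus> c; b \<in> carrier G; c \<in> carrier G\<rbrakk> \<Longrightarrow> b = a \<ominus> c"
  by (simp add: minus_eq a_assoc r_neg)

text \<open>Abstracts what a Galois extension of \<open>K\<^sub>0\<close> supplies: a trace, and
  dual families whose tensor is the separability idempotent. \<open>expand_u\<close> and
  \<open>expand_v\<close> reconstruct an element from its trace coordinates on either side;
  \<open>sum_uv\<close> says that multiplication sends the idempotent to 1.\<close>

locale separable_trace = cring L for L (structure) +
  fixes K\<^sub>0 k :: "'a set" and tr :: "'a \<Rightarrow> 'a" and m :: nat and u v :: "nat \<Rightarrow> 'a"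
  assumes K0_sub: "K\<^sub>0 \<subseteq> carrier L" and k_sub: "k \<subseteq> K\<^sub>0"
    and K0_one: "\<one> \<in> K\<^sub>0" and K0_mult: "a \<in> K\<^sub>0 \<Longrightarrow> b \<in> K\<^sub>0 \<Longrightarrow> a \<otimes> b \<in> K\<^sub>0"
    and tr_mem: "x \<in> carrier L \<Longrightarrow> tr x \<in> K\<^sub>0"
    and tr_add: "x \<in> carrier L \<Longrightarrow> y \<in> carrier L \<Longrightarrow> tr (x \<oplus> y) = tr x \<oplus> tr y"
    and tr_mult: "c \<in> K\<^sub>0 \<Longrightarrow> x \<in> carrier L \<Longrightarrow> tr (c \<otimes> x) = c \<otimes> tr x"
    and u_mem: "j < m \<Longrightarrow> u j \<in> carrier L" and v_mem: "j < m \<Longrightarrow> v j \<in> carrier L"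
    and expand_u: "y \<in> carrier L \<Longrightarrow> (\<Oplus>j\<in>{..<m}. u j \<otimes> tr (v j \<otimes> y)) = y"
    and expand_v: "y \<in> carrier L \<Longrightarrow> (\<Oplus>j\<in>{..<m}. tr (y \<otimes> u j) \<otimes> v j) = y"
    and sum_uv: "(\<Oplus>j\<in>{..<m}. u j \<otimes> v j) = \<one>"
begin

lemma K0_carr [simp]: "a \<in> K\<^sub>0 \<Longrightarrow> a \<in> carrier L"
  using K0_sub by auto

lemma k_carr: "k \<subseteq> carrier L"
  using K0_sub k_sub by auto

lemma tr_carr [simp]: "x \<in> carrier L \<Longrightarrow> tr x \<in> carrier L"
  using tr_mem by auto

lemma LL: "order_context L (carrier L) (carrier L)"
  by (rule order_context_self) (rule is_cring)
lemma KL: "order_context L K\<^sub>0 (carrier L)"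
  by unfold_locales auto
lemma KK: "order_context L K\<^sub>0 K\<^sub>0"
  by unfold_locales (auto simp: K0_mult)

lemma klin_finsum:
  assumes "klin L k' (carrier L) R" "finite A" "\<And>i. i \<in> A \<Longrightarrow> f i \<in> carrier L"
  shows "R (\<Oplus>i\<in>A. f i) = (\<Oplus>i\<in>A. R (f i))"
  using assms(2,3)
proof (induction A)
  case empty
  then show ?case using klin_zero[OF assms(1)] by simp
next
  case (insert x A)
  then show ?case
    using klinD(1,2)[OF assms(1)] by (simp add: Pi_def)
qed

text \<open>The average of \<open>R\<close> against the separability idempotent. It fixes
  multiplication operators, since the u_j v_j add up to 1, and it turns a
  \<open>K\<^sub>0\<close>-linear \<open>R\<close> into an \<open>L\<close>-linear map.\<close>

definition eps :: "('a \<Rightarrow> 'a) \<Rightarrow> 'a \<Rightarrow> 'a" where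
  "eps R y = (\<Oplus>j\<in>{..<m}. u j \<otimes> R (v j \<otimes> y))"

lemma eps_carr: "R \<in> carrier L \<rightarrow> carrier L \<Longrightarrow> y \<in> carrier L \<Longrightarrow> eps R y \<in> carrier L"
  unfolding eps_def by (intro finsum_closed) (auto simp: u_mem v_mem Pi_iff)

lemma eps_klin:
  assumes k': "k' \<subseteq> carrier L" and R: "klin L k' (carrier L) R"
  shows "klin L k' (carrier L) (eps R)"
proof (rule klinI)
  fix x assume x: "x \<in> carrier L"
  show "eps R x \<in> carrier L"
    using x klinD(1)[OF R] by (intro eps_carr) auto
  fix y assume y: "y \<in> carrier L"
  have "eps R (x \<oplus> y) = (\<Oplus>j\<in>{..<m}. u j \<otimes> R (v j \<otimes> x) \<oplus> u j \<otimes> R (v j \<otimes> y))"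
    unfolding eps_def using x y
    by (intro finsum_cong') (auto simp: u_mem v_mem klinD[OF R] r_distr)
  also have "\<dots> = eps R x \<oplus> eps R y"
    unfolding eps_def using x y
    by (intro finsum_addf) (auto simp: u_mem v_mem klinD[OF R])
  finally show "eps R (x \<oplus> y) = eps R x \<oplus> eps R y" .
next
  fix c x assume c: "c \<in> k'" and x: "x \<in> carrier L"
  have c': "c \<in> carrier L" using c k' by auto
  have "eps R (c \<otimes> x) = (\<Oplus>j\<in>{..<m}. c \<otimes> (u j \<otimes> R (v j \<otimes> x)))"
    unfolding eps_def
  proof (intro finsum_cong' refl)
    fix j assume "j \<in> {..<m}"
    then have j: "u j \<in> carrier L" "v j \<in> carrier L" by (auto simp: u_mem v_mem)
    then have "v j \<otimes> (c \<otimes> x) = c \<otimes> (v j \<otimes> x)" using x c' by (simp add: m_lcomm)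
    then show "u j \<otimes> R (v j \<otimes> (c \<otimes> x)) = c \<otimes> (u j \<otimes> R (v j \<otimes> x))"
      using j x c' klinD[OF R] c by (simp add: m_lcomm)
  qed (use x c' klinD(1)[OF R] in \<open>auto simp: u_mem v_mem\<close>)
  also have "\<dots> = c \<otimes> eps R x"
    unfolding eps_def using x c' klinD(1)[OF R]
    by (intro finsum_rdistr[symmetric]) (auto simp: u_mem v_mem)
  finally show "eps R (c \<otimes> x) = c \<otimes> eps R x" .
qed

lemma eps_cong:
  assumes "\<And>y. y \<in> carrier L \<Longrightarrow> R y = R' y" "R' \<in> carrier L \<rightarrow> carrier L" "y \<in> carrier L"
  shows "eps R y = eps R' y"
  unfolding eps_def using assms(1,3) funcset_mem[OF assms(2)]
  by (intro finsum_cong') (auto simp: u_mem v_mem)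

lemma eps_pow_carr:
  "R \<in> carrier L \<rightarrow> carrier L \<Longrightarrow> (eps ^^ n) R \<in> carrier L \<rightarrow> carrier L"
  by (induction n) (auto intro: eps_carr)

lemma eps_pow_klin:
  "k' \<subseteq> carrier L \<Longrightarrow> klin L k' (carrier L) R \<Longrightarrow> klin L k' (carrier L) ((eps ^^ n) R)"
  by (induction n) (auto intro: eps_klin)

lemma eps_pow_cong:
  assumes "\<And>y. y \<in> carrier L \<Longrightarrow> R y = R' y" "R' \<in> carrier L \<rightarrow> carrier L" "y \<in> carrier L"
  shows "(eps ^^ n) R y = (eps ^^ n) R' y"
  using assms(3)
proof (induction n arbitrary: y)
  case (Suc n)
  show ?case
    using Suc eps_pow_carr[OF assms(2), of n] by (auto intro!: eps_cong)
qed (use assms in auto)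

text \<open>The weights u_j and v_j are multiplications, which commute with multiplication by
  \<open>b\<close>; so averaging and forming the commutator with \<open>b\<close> can be
  interchanged.\<close>

lemma eps_ad:
  assumes R: "R \<in> carrier L \<rightarrow> carrier L" and b: "b \<in> carrier L" and y: "y \<in> carrier L"
  shows "eps (\<lambda>x. R (b \<otimes> x) \<ominus> b \<otimes> R x) y = eps R (b \<otimes> y) \<ominus> b \<otimes> eps R y"
proof -
  have Rc: "R x \<in> carrier L" if "x \<in> carrier L" for x using R that by auto
  have mem: "u j \<otimes> R (v j \<otimes> (b \<otimes> y)) \<in> carrier L" "u j \<otimes> R (v j \<otimes> y) \<in> carrier L" if "j < m" for j
    using that Rc b y by (auto simp: u_mem v_mem)
  have "eps R (b \<otimes> y) = (\<Oplus>j\<in>{..<m}. u j \<otimes> (R (b \<otimes> (v j \<otimes> y)) \<ominus> b \<otimes> R (v j \<otimes> y)) \<oplus> b \<otimes> (u j \<otimes> R (v j \<otimes> y)))"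
    unfolding eps_def
  proof (intro finsum_cong' refl)
    fix j assume "j \<in> {..<m}"
    then have j: "u j \<in> carrier L" "v j \<in> carrier L" by (auto simp: u_mem v_mem)
    have "v j \<otimes> (b \<otimes> y) = b \<otimes> (v j \<otimes> y)" using j b y by (simp add: m_lcomm)
    moreover have "R (b \<otimes> (v j \<otimes> y)) \<in> carrier L" "R (v j \<otimes> y) \<in> carrier L" using Rc j b y by auto
    then have "u j \<otimes> R (b \<otimes> (v j \<otimes> y)) = u j \<otimes> (R (b \<otimes> (v j \<otimes> y)) \<ominus> b \<otimes> R (v j \<otimes> y)) \<oplus> b \<otimes> (u j \<otimes> R (v j \<otimes> y))"
      using j b by algebra
    ultimately show "u j \<otimes> R (v j \<otimes> (b \<otimes> y)) = u j \<otimes> (R (b \<otimes> (v j \<otimes> y)) \<ominus> b \<otimes> R (v j \<otimes> y)) \<oplus> b \<otimes> (u j \<otimes> R (v j \<otimes> y))"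
      by simp
  qed (use Rc b y in \<open>auto simp: u_mem v_mem\<close>)
  also have "\<dots> = eps (\<lambda>x. R (b \<otimes> x) \<ominus> b \<otimes> R x) y \<oplus> (\<Oplus>j\<in>{..<m}. b \<otimes> (u j \<otimes> R (v j \<otimes> y)))"
    unfolding eps_def using Rc b y by (intro finsum_addf) (auto simp: u_mem v_mem)
  also have "(\<Oplus>j\<in>{..<m}. b \<otimes> (u j \<otimes> R (v j \<otimes> y))) = b \<otimes> eps R y"
    unfolding eps_def using mem b by (intro finsum_rdistr[symmetric]) auto
  finally have "eps R (b \<otimes> y) = eps (\<lambda>x. R (b \<otimes> x) \<ominus> b \<otimes> R x) y \<oplus> b \<otimes> eps R y" .
  moreover have "eps (\<lambda>x. R (b \<otimes> x) \<ominus> b \<otimes> R x) y \<in> carrier L" "eps R y \<in> carrier L"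
    by (intro eps_carr; use Rc b y in simp)+
  ultimately show ?thesis using b by (intro eq_minusI) auto
qed

lemma eps_pow_ad:
  assumes R: "R \<in> carrier L \<rightarrow> carrier L" and b: "b \<in> carrier L" and y: "y \<in> carrier L"
  shows "(eps ^^ n) (\<lambda>x. R (b \<otimes> x) \<ominus> b \<otimes> R x) y = (eps ^^ n) R (b \<otimes> y) \<ominus> b \<otimes> (eps ^^ n) R y"
  using y
proof (induction n arbitrary: y)
  case (Suc n)
  have c: "(eps ^^ n) R \<in> carrier L \<rightarrow> carrier L" by (rule eps_pow_carr[OF R])
  have "(eps ^^ Suc n) (\<lambda>x. R (b \<otimes> x) \<ominus> b \<otimes> R x) y
      = eps (\<lambda>x. (eps ^^ n) R (b \<otimes> x) \<ominus> b \<otimes> (eps ^^ n) R x) y"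
    using Suc funcset_mem[OF c] b by (simp, intro eps_cong) auto
  also have "\<dots> = (eps ^^ Suc n) R (b \<otimes> y) \<ominus> b \<otimes> (eps ^^ Suc n) R y"
    using eps_ad[OF c b Suc.prems] by simp
  finally show ?case .
qed simp

text \<open>The matrix entries tr(v_j b u_i) of multiplication by \<open>b\<close> rewrite both
  terms: v_j b is expanded in the v_i, and b u_i in the u_j. The commutator with an arbitrary
  element of \<open>L\<close> thereby becomes a combination of commutators of \<open>R\<close> with
  elements of \<open>K\<^sub>0\<close>.\<close>

lemma eps_commutator:
  assumes R: "klin L k' (carrier L) R" and b: "b \<in> carrier L" and y: "y \<in> carrier L"
  shows "eps R (b \<otimes> y) \<ominus> b \<otimes> eps R y =
    (\<Oplus>j\<in>{..<m}. \<Oplus>i\<in>{..<m}. u j \<otimes> (R (tr (v j \<otimes> b \<otimes> u i) \<otimes> (v i \<otimes> y)) \<ominus> tr (v j \<otimes> b \<otimes> u i) \<otimes> R (v i \<otimes> y)))"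
proof -
  note Rc = klinD(1)[OF R]
  define c where "c i j = tr (v j \<otimes> b \<otimes> u i)" for i j
  define RHS where "RHS = (\<Oplus>j\<in>{..<m}. \<Oplus>i\<in>{..<m}. u j \<otimes> (R (c i j \<otimes> (v i \<otimes> y)) \<ominus> c i j \<otimes> R (v i \<otimes> y)))"
  let ?A = "\<Oplus>j\<in>{..<m}. \<Oplus>i\<in>{..<m}. u j \<otimes> R (c i j \<otimes> (v i \<otimes> y))"
  let ?B = "\<Oplus>j\<in>{..<m}. \<Oplus>i\<in>{..<m}. u j \<otimes> (c i j \<otimes> R (v i \<otimes> y))"
  have cm: "i < m \<Longrightarrow> j < m \<Longrightarrow> c i j \<in> carrier L" for i j using b by (simp add: u_mem v_mem c_def)
  have "eps R (b \<otimes> y) = ?A"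
    unfolding eps_def
  proof (intro finsum_cong' refl)
    fix j assume j: "j \<in> {..<m}"
    have "v j \<otimes> (b \<otimes> y) = (\<Oplus>i\<in>{..<m}. c i j \<otimes> v i) \<otimes> y"
      unfolding c_def using j b y by (subst expand_v) (auto simp: v_mem m_assoc)
    also have "\<dots> = (\<Oplus>i\<in>{..<m}. c i j \<otimes> v i \<otimes> y)"
      using j b y cm by (intro finsum_ldistr) (auto simp: v_mem)
    also have "\<dots> = (\<Oplus>i\<in>{..<m}. c i j \<otimes> (v i \<otimes> y))"
      using j b y cm by (intro finsum_cong') (auto simp: v_mem m_assoc)
    finally have "R (v j \<otimes> (b \<otimes> y)) = (\<Oplus>i\<in>{..<m}. R (c i j \<otimes> (v i \<otimes> y)))"
      using j cm y by (simp only:) (intro klin_finsum[OF R]; auto simp: v_mem)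
    then show "u j \<otimes> R (v j \<otimes> (b \<otimes> y)) = (\<Oplus>i\<in>{..<m}. u j \<otimes> R (c i j \<otimes> (v i \<otimes> y)))"
      using j cm y by (simp add: finsum_rdistr u_mem v_mem Rc Pi_iff)
  qed (use cm y Rc in \<open>auto simp: u_mem v_mem intro!: finsum_closed\<close>)
  moreover have "b \<otimes> eps R y = ?B"
  proof -
    have "b \<otimes> eps R y = (\<Oplus>i\<in>{..<m}. b \<otimes> (u i \<otimes> R (v i \<otimes> y)))"
      unfolding eps_def using b y Rc by (intro finsum_rdistr) (auto simp: u_mem v_mem)
    also have "\<dots> = (\<Oplus>i\<in>{..<m}. \<Oplus>j\<in>{..<m}. u j \<otimes> (c i j \<otimes> R (v i \<otimes> y)))"
    proof (intro finsum_cong' refl)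
      fix i assume i: "i \<in> {..<m}"
      have "b \<otimes> (u i \<otimes> R (v i \<otimes> y)) = (b \<otimes> u i) \<otimes> R (v i \<otimes> y)"
        using i b y Rc by (simp add: m_assoc u_mem v_mem)
      also have "b \<otimes> u i = (\<Oplus>j\<in>{..<m}. u j \<otimes> tr (v j \<otimes> (b \<otimes> u i)))"
        using i b by (subst expand_u) (auto simp: u_mem)
      also have "\<dots> = (\<Oplus>j\<in>{..<m}. u j \<otimes> c i j)"
        unfolding c_def using i b by (intro finsum_cong') (auto simp: u_mem v_mem m_assoc)
      also have "\<dots> \<otimes> R (v i \<otimes> y) = (\<Oplus>j\<in>{..<m}. u j \<otimes> c i j \<otimes> R (v i \<otimes> y))"
        using i y Rc cm by (intro finsum_ldistr) (auto simp: u_mem v_mem)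
      also have "\<dots> = (\<Oplus>j\<in>{..<m}. u j \<otimes> (c i j \<otimes> R (v i \<otimes> y)))"
        using i y Rc cm by (intro finsum_cong') (auto simp: u_mem v_mem m_assoc)
      finally show "b \<otimes> (u i \<otimes> R (v i \<otimes> y)) = (\<Oplus>j\<in>{..<m}. u j \<otimes> (c i j \<otimes> R (v i \<otimes> y)))" .
    qed (use cm y Rc in \<open>auto simp: u_mem v_mem intro!: finsum_closed\<close>)
    also have "\<dots> = ?B"
      using cm y Rc by (intro finsum_swap) (auto simp: u_mem v_mem)
    finally show ?thesis .
  qed
  moreover have "?A = RHS \<oplus> ?B"
  proof -
    have "RHS \<oplus> ?B = (\<Oplus>j\<in>{..<m}. (\<Oplus>i\<in>{..<m}. u j \<otimes> (R (c i j \<otimes> (v i \<otimes> y)) \<ominus> c i j \<otimes> R (v i \<otimes> y)))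
        \<oplus> (\<Oplus>i\<in>{..<m}. u j \<otimes> (c i j \<otimes> R (v i \<otimes> y))))"
      unfolding RHS_def using cm y Rc by (intro finsum_addf[symmetric]) (auto simp: u_mem v_mem intro!: finsum_closed)
    also have "\<dots> = ?A"
    proof (intro finsum_cong' refl)
      fix j assume j: "j \<in> {..<m}"
      have "(\<Oplus>i\<in>{..<m}. u j \<otimes> (R (c i j \<otimes> (v i \<otimes> y)) \<ominus> c i j \<otimes> R (v i \<otimes> y)))
        \<oplus> (\<Oplus>i\<in>{..<m}. u j \<otimes> (c i j \<otimes> R (v i \<otimes> y))) =
        (\<Oplus>i\<in>{..<m}. u j \<otimes> (R (c i j \<otimes> (v i \<otimes> y)) \<ominus> c i j \<otimes> R (v i \<otimes> y)) \<oplus> u j \<otimes> (c i j \<otimes> R (v i \<otimes> y)))"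
        using cm y Rc j by (intro finsum_addf[symmetric]) (auto simp: u_mem v_mem)
      also have "\<dots> = (\<Oplus>i\<in>{..<m}. u j \<otimes> R (c i j \<otimes> (v i \<otimes> y)))"
      proof (intro finsum_cong' refl)
        fix i assume i: "i \<in> {..<m}"
        have "R (c i j \<otimes> (v i \<otimes> y)) \<in> carrier L" "R (v i \<otimes> y) \<in> carrier L" "c i j \<in> carrier L" "u j \<in> carrier L"
          using i j cm y Rc by (auto simp: u_mem v_mem)
        then show "u j \<otimes> (R (c i j \<otimes> (v i \<otimes> y)) \<ominus> c i j \<otimes> R (v i \<otimes> y)) \<oplus> u j \<otimes> (c i j \<otimes> R (v i \<otimes> y)) =
          u j \<otimes> R (c i j \<otimes> (v i \<otimes> y))"
          by algebra
      qed (use cm y Rc j in \<open>auto simp: u_mem v_mem\<close>)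
      finally show "(\<Oplus>i\<in>{..<m}. u j \<otimes> (R (c i j \<otimes> (v i \<otimes> y)) \<ominus> c i j \<otimes> R (v i \<otimes> y)))
        \<oplus> (\<Oplus>i\<in>{..<m}. u j \<otimes> (c i j \<otimes> R (v i \<otimes> y))) =
        (\<Oplus>i\<in>{..<m}. u j \<otimes> R (c i j \<otimes> (v i \<otimes> y)))" .
    qed (use cm y Rc in \<open>auto simp: u_mem v_mem intro!: finsum_closed\<close>)
    finally show ?thesis by simp
  qed
  moreover have "RHS \<in> carrier L" "?B \<in> carrier L"
    unfolding RHS_def using cm y Rc by (auto simp: u_mem v_mem intro!: finsum_closed)
  ultimately have "RHS = eps R (b \<otimes> y) \<ominus> b \<otimes> eps R y" by (simp add: eq_minusI)
  then show ?thesis unfolding RHS_def c_def by simp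
qed

text \<open>One average pays for one commutator: [eps R, b] has smaller order over
  \<open>K\<^sub>0\<close>, the remaining averages are applied to it by induction, and they commute
  with the commutator by \<open>b\<close>. Hence \<open>n\<close> averages upgrade a bound over
  \<open>K\<^sub>0\<close> to the same bound over \<open>L\<close>.\<close>

lemma dord_eps_pow:
  "klin L k (carrier L) R \<Longrightarrow> dord L K\<^sub>0 (carrier L) n R
    \<Longrightarrow> dord L (carrier L) (carrier L) n ((eps ^^ n) R)"
proof (induction n arbitrary: R)
  case (Suc n)
  note R = Suc.prems(1) and Rc = klinD(1)[OF Suc.prems(1)]
  show ?case
    unfolding dord.simps
  proof
    fix b assume b: "b \<in> carrier L"
    define c where "c i j = tr (v j \<otimes> b \<otimes> u i)" for i j
    have c: "c i j \<in> K\<^sub>0" if "i < m" "j < m" for i j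
      using that b unfolding c_def by (intro tr_mem) (auto simp: u_mem v_mem)
    define T where "T y = (\<Oplus>j\<in>{..<m}. \<Oplus>i\<in>{..<m}. u j \<otimes> (R (c i j \<otimes> (v i \<otimes> y)) \<ominus> c i j \<otimes> R (v i \<otimes> y)))" for y
    have T: "eps R (b \<otimes> y) \<ominus> b \<otimes> eps R y = T y" if "y \<in> carrier L" for y
      unfolding T_def c_def by (rule eps_commutator[OF R b that])
    have eR: "klin L k (carrier L) (eps R)" by (rule eps_klin[OF k_carr R])
    have "klin L k (carrier L) (\<lambda>y. eps R (b \<otimes> y) \<ominus> b \<otimes> eps R y)"
      by (rule klin_commutator[OF eR k_carr b])
    then have klinT: "klin L k (carrier L) T"
      by (rule klin_cong) (auto simp: T k_carr subsetD[OF k_carr])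
    \<comment> \<open>Every summand is a commutator of \<open>R\<close> with some c_ij in
      \<open>K\<^sub>0\<close>, composed with multiplications, so the order over
      \<open>K\<^sub>0\<close> has dropped by one.\<close>
    have "dord L K\<^sub>0 (carrier L) n T"
      unfolding T_def
    proof (intro order_context.dord_finsum[OF KL] order_context.dord_lmult[OF KL])
      fix i j assume ij: "j \<in> {..<m}" "i \<in> {..<m}"
      have cc: "c i j \<in> K\<^sub>0" using c ij by auto
      show "dord L K\<^sub>0 (carrier L) n (\<lambda>y. R (c i j \<otimes> (v i \<otimes> y)) \<ominus> c i j \<otimes> R (v i \<otimes> y))"
        using Suc.prems(2) cc ij
        by (intro order_context.dord_rmult[OF KL, of "v i" n "\<lambda>y. R (c i j \<otimes> y) \<ominus> c i j \<otimes> R y"]) (auto simp: v_mem)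
    qed (use c Rc in \<open>auto simp: u_mem v_mem intro!: finsum_closed\<close>)
    from Suc.IH[OF klinT this] have "dord L (carrier L) (carrier L) n ((eps ^^ n) T)" .
    moreover have "(eps ^^ n) T y = (eps ^^ Suc n) R (b \<otimes> y) \<ominus> b \<otimes> (eps ^^ Suc n) R y" if y: "y \<in> carrier L" for y
    proof -
      have "(eps ^^ n) T y = (eps ^^ n) (\<lambda>y. eps R (b \<otimes> y) \<ominus> b \<otimes> eps R y) y"
        using T klinD(1)[OF klinT] klinD(1)[OF eR] b y by (intro eps_pow_cong) auto
      also have "\<dots> = (eps ^^ n) (eps R) (b \<otimes> y) \<ominus> b \<otimes> (eps ^^ n) (eps R) y"
        using klinD(1)[OF eR] by (intro eps_pow_ad b y) auto
      finally show ?thesis by (simp add: funpow_swap1)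
    qed
    ultimately show "dord L (carrier L) (carrier L) n (\<lambda>y. (eps ^^ Suc n) R (b \<otimes> y) \<ominus> b \<otimes> (eps ^^ Suc n) R y)"
      by (subst (asm) order_context.dord_cong[OF LL]) auto
  qed
qed auto

text \<open>Applies \<open>P\<close> to the trace coordinates of \<open>y\<close> with respect to
  the u_j. This makes sense on all of \<open>L\<close>, but on \<open>K\<^sub>0\<close> it need not
  agree with \<open>P\<close>; only the leading part survives, see
  \<open>dord_symbol\<close>.\<close>

definition tr_lift :: "('a \<Rightarrow> 'a) \<Rightarrow> 'a \<Rightarrow> 'a" where
  "tr_lift P y = (\<Oplus>j\<in>{..<m}. u j \<otimes> P (tr (v j \<otimes> y)))"

lemma tr_lift_carr: "P \<in> K\<^sub>0 \<rightarrow> carrier L \<Longrightarrow> y \<in> carrier L \<Longrightarrow> tr_lift P y \<in> carrier L"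
  unfolding tr_lift_def
  by (intro finsum_closed Pi_I m_closed) (auto simp: u_mem v_mem tr_mem intro!: funcset_mem[of P K\<^sub>0])

lemma tr_lift_klin:
  assumes P: "klin L k K\<^sub>0 P" shows "klin L k (carrier L) (tr_lift P)"
proof (rule klinI)
  fix x assume x: "x \<in> carrier L"
  show "tr_lift P x \<in> carrier L"
    using x klinD(1)[OF P] by (intro tr_lift_carr) auto
  fix y assume y: "y \<in> carrier L"
  have "tr_lift P (x \<oplus> y) = (\<Oplus>j\<in>{..<m}. u j \<otimes> P (tr (v j \<otimes> x)) \<oplus> u j \<otimes> P (tr (v j \<otimes> y)))"
    unfolding tr_lift_def using x y
    by (intro finsum_cong') (auto simp: u_mem v_mem tr_mem klinD[OF P] r_distr tr_add)
  also have "\<dots> = tr_lift P x \<oplus> tr_lift P y"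
    unfolding tr_lift_def using x y
    by (intro finsum_addf) (auto simp: u_mem v_mem tr_mem klinD[OF P])
  finally show "tr_lift P (x \<oplus> y) = tr_lift P x \<oplus> tr_lift P y" .
next
  fix c x assume c: "c \<in> k" and x: "x \<in> carrier L"
  have c': "c \<in> K\<^sub>0" "c \<in> carrier L" using c k_sub by auto
  have "tr_lift P (c \<otimes> x) = (\<Oplus>j\<in>{..<m}. c \<otimes> (u j \<otimes> P (tr (v j \<otimes> x))))"
    unfolding tr_lift_def
  proof (intro finsum_cong' refl)
    fix j assume "j \<in> {..<m}"
    then have j: "u j \<in> carrier L" "v j \<in> carrier L" by (auto simp: u_mem v_mem)
    then have "tr (v j \<otimes> (c \<otimes> x)) = c \<otimes> tr (v j \<otimes> x)"
      using x c' by (simp add: m_lcomm[of "v j"] tr_mult)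
    then show "u j \<otimes> P (tr (v j \<otimes> (c \<otimes> x))) = c \<otimes> (u j \<otimes> P (tr (v j \<otimes> x)))"
      using j x c' klinD[OF P] c by (simp add: m_lcomm tr_mem)
  qed (use x c' klinD(1)[OF P] in \<open>auto simp: u_mem v_mem tr_mem\<close>)
  also have "\<dots> = c \<otimes> tr_lift P x"
    unfolding tr_lift_def using x c' klinD(1)[OF P]
    by (intro finsum_rdistr[symmetric]) (auto simp: u_mem v_mem tr_mem)
  finally show "tr_lift P (c \<otimes> x) = c \<otimes> tr_lift P x" .
qed

text \<open>Multiplication by \<open>a\<close> in \<open>K\<^sub>0\<close> passes through the
  coordinates because \<open>tr\<close> is \<open>K\<^sub>0\<close>-linear; this is what transfers
  the order bound of \<open>P\<close> to its lift.\<close>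

lemma tr_lift_ad:
  assumes P: "P \<in> K\<^sub>0 \<rightarrow> carrier L" and a: "a \<in> K\<^sub>0" and y: "y \<in> carrier L"
  shows "tr_lift (\<lambda>x. P (a \<otimes> x) \<ominus> a \<otimes> P x) y = tr_lift P (a \<otimes> y) \<ominus> a \<otimes> tr_lift P y"
proof -
  have Pc: "P (tr (v j \<otimes> y)) \<in> carrier L" "P (a \<otimes> tr (v j \<otimes> y)) \<in> carrier L" if "j < m" for j
    using that funcset_mem[OF P] a y by (auto simp: v_mem tr_mem K0_mult)
  have "tr_lift P (a \<otimes> y) = (\<Oplus>j\<in>{..<m}. u j \<otimes> (P (a \<otimes> tr (v j \<otimes> y)) \<ominus> a \<otimes> P (tr (v j \<otimes> y)))
      \<oplus> a \<otimes> (u j \<otimes> P (tr (v j \<otimes> y))))"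
    unfolding tr_lift_def
  proof (intro finsum_cong' refl)
    fix j assume "j \<in> {..<m}"
    then have j: "u j \<in> carrier L" "v j \<in> carrier L" "P (tr (v j \<otimes> y)) \<in> carrier L" "P (a \<otimes> tr (v j \<otimes> y)) \<in> carrier L"
      using Pc by (auto simp: u_mem v_mem)
    have "tr (v j \<otimes> (a \<otimes> y)) = a \<otimes> tr (v j \<otimes> y)" using j a y by (simp add: m_lcomm[of "v j"] tr_mult)
    moreover have "u j \<otimes> P (a \<otimes> tr (v j \<otimes> y)) = u j \<otimes> (P (a \<otimes> tr (v j \<otimes> y)) \<ominus> a \<otimes> P (tr (v j \<otimes> y)))
      \<oplus> a \<otimes> (u j \<otimes> P (tr (v j \<otimes> y)))"
      using j K0_carr[OF a] by algebra
    ultimately show "u j \<otimes> P (tr (v j \<otimes> (a \<otimes> y))) = u j \<otimes> (P (a \<otimes> tr (v j \<otimes> y)) \<ominus> a \<otimes> P (tr (v j \<otimes> y)))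
      \<oplus> a \<otimes> (u j \<otimes> P (tr (v j \<otimes> y)))"
      by simp
  qed (use Pc a y in \<open>auto simp: u_mem v_mem\<close>)
  also have "\<dots> = tr_lift (\<lambda>x. P (a \<otimes> x) \<ominus> a \<otimes> P x) y \<oplus> (\<Oplus>j\<in>{..<m}. a \<otimes> (u j \<otimes> P (tr (v j \<otimes> y))))"
    unfolding tr_lift_def using Pc a y by (intro finsum_addf) (auto simp: u_mem v_mem)
  also have "(\<Oplus>j\<in>{..<m}. a \<otimes> (u j \<otimes> P (tr (v j \<otimes> y)))) = a \<otimes> tr_lift P y"
    unfolding tr_lift_def using Pc a by (intro finsum_rdistr[symmetric]) (auto simp: u_mem)
  finally have "tr_lift P (a \<otimes> y) = tr_lift (\<lambda>x. P (a \<otimes> x) \<ominus> a \<otimes> P x) y \<oplus> a \<otimes> tr_lift P y" .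
  moreover have "tr_lift (\<lambda>x. P (a \<otimes> x) \<ominus> a \<otimes> P x) y \<in> carrier L" "tr_lift P y \<in> carrier L"
    by (intro tr_lift_carr; use funcset_mem[OF P] a y K0_mult in simp)+
  ultimately show ?thesis using K0_carr[OF a] by (intro eq_minusI) auto
qed

lemma dord_tr_lift:
  "P \<in> K\<^sub>0 \<rightarrow> carrier L \<Longrightarrow> dord L K\<^sub>0 K\<^sub>0 n P \<Longrightarrow> dord L K\<^sub>0 (carrier L) n (tr_lift P)"
proof (induction n arbitrary: P)
  case 0
  then show ?case
    by (auto simp: tr_lift_def v_mem u_mem tr_mem intro!: add.finprod_one_eqI)
next
  case (Suc n)
  show ?case
    unfolding dord.simps
  proof
    fix a assume a: "a \<in> K\<^sub>0"
    have "dord L K\<^sub>0 (carrier L) n (tr_lift (\<lambda>x. P (a \<otimes> x) \<ominus> a \<otimes> P x))"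
    proof (rule Suc.IH)
      show "(\<lambda>x. P (a \<otimes> x) \<ominus> a \<otimes> P x) \<in> K\<^sub>0 \<rightarrow> carrier L"
        using funcset_mem[OF Suc.prems(1)] a by (simp add: K0_mult)
    qed (use Suc.prems(2) a in simp)
    then show "dord L K\<^sub>0 (carrier L) n (\<lambda>y. tr_lift P (a \<otimes> y) \<ominus> a \<otimes> tr_lift P y)"
      using tr_lift_ad[OF Suc.prems(1) a] by (subst (asm) order_context.dord_cong[OF KL]) auto
  qed
qed

text \<open>Multiplication by \<open>p\<close> passes through the average, whose weights u_j v_j add
  up to 1.\<close>

lemma eps_pow_mult:
  assumes p: "p \<in> carrier L" and y: "y \<in> carrier L"
  shows "(eps ^^ r) (\<lambda>y. y \<otimes> p) y = y \<otimes> p"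
  using y
proof (induction r arbitrary: y)
  case (Suc r)
  have "(eps ^^ Suc r) (\<lambda>y. y \<otimes> p) y = eps (\<lambda>y. y \<otimes> p) y"
    using Suc p by (simp, intro eps_cong) auto
  also have "\<dots> = (\<Oplus>j\<in>{..<m}. u j \<otimes> v j \<otimes> (y \<otimes> p))"
    unfolding eps_def using p Suc.prems by (intro finsum_cong') (auto simp: u_mem v_mem m_assoc)
  also have "\<dots> = (\<Oplus>j\<in>{..<m}. u j \<otimes> v j) \<otimes> (y \<otimes> p)"
    using p Suc.prems by (intro finsum_ldistr[symmetric]) (auto simp: u_mem v_mem)
  finally show ?case using p Suc.prems by (simp add: sum_uv)
qed auto

text \<open>\<^const>\<open>tr_lift\<close> preserves the leading symbol of \<open>P\<close>, and so do the powers of \<^const>\<open>eps\<close>,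
  as both commute with commutators by elements of \<open>K\<^sub>0\<close>.\<close>

lemma dord_symbol:
  "P \<in> K\<^sub>0 \<rightarrow> carrier L \<Longrightarrow> dord L K\<^sub>0 K\<^sub>0 (Suc n) P
    \<Longrightarrow> dord L K\<^sub>0 K\<^sub>0 n (\<lambda>x. P x \<ominus> (eps ^^ r) (tr_lift P) x)"
proof (induction n arbitrary: P)
  case 0
  \<comment> \<open>Order below 1 on \<open>K\<^sub>0\<close> means commuting with
    \<open>K\<^sub>0\<close>, so \<open>P\<close> is multiplication by its value at 1; the lift and
    the averages reproduce such an operator exactly.\<close>
  define p where "p = P \<one>"
  have p: "p \<in> carrier L" using 0 K0_one by (auto simp: p_def)
  have P: "P x = x \<otimes> p" if x: "x \<in> K\<^sub>0" for x
  proof -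
    have "P (x \<otimes> \<one>) \<ominus> x \<otimes> P \<one> = \<zero>" using 0(2) x K0_one unfolding dord.simps by blast
    then show ?thesis
      using x 0(1) p K0_one unfolding p_def by (simp add: Pi_iff)
  qed
  have lift: "tr_lift P y = y \<otimes> p" if y: "y \<in> carrier L" for y
  proof -
    have "tr_lift P y = (\<Oplus>j\<in>{..<m}. u j \<otimes> tr (v j \<otimes> y) \<otimes> p)"
      unfolding tr_lift_def using p y by (intro finsum_cong') (auto simp: u_mem v_mem P tr_mem m_assoc)
    also have "\<dots> = (\<Oplus>j\<in>{..<m}. u j \<otimes> tr (v j \<otimes> y)) \<otimes> p"
      using p y by (intro finsum_ldistr[symmetric]) (auto simp: u_mem v_mem)
    finally show ?thesis by (simp only: expand_u[OF y])
  qed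
  have "(eps ^^ r) (tr_lift P) x = x \<otimes> p" if "x \<in> carrier L" for x
    using lift p that eps_pow_mult[OF p that] by (subst eps_pow_cong[where R' = "\<lambda>y. y \<otimes> p"]) auto
  then show ?case
    using P p by (auto simp: minus_eq r_neg)
next
  case (Suc n)
  have lc: "tr_lift P \<in> carrier L \<rightarrow> carrier L" using Suc.prems tr_lift_carr by auto
  have elc: "(eps ^^ r) (tr_lift P) \<in> carrier L \<rightarrow> carrier L" by (rule eps_pow_carr[OF lc])
  have "dord L K\<^sub>0 K\<^sub>0 n (\<lambda>x. P (a \<otimes> x) \<ominus> (eps ^^ r) (tr_lift P) (a \<otimes> x)
      \<ominus> a \<otimes> (P x \<ominus> (eps ^^ r) (tr_lift P) x))" if a: "a \<in> K\<^sub>0" for a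
  proof -
    let ?P = "\<lambda>x. P (a \<otimes> x) \<ominus> a \<otimes> P x"
    have "dord L K\<^sub>0 K\<^sub>0 n (\<lambda>x. ?P x \<ominus> (eps ^^ r) (tr_lift ?P) x)"
    proof (rule Suc.IH)
      show "?P \<in> K\<^sub>0 \<rightarrow> carrier L"
        using funcset_mem[OF Suc.prems(1)] a by (simp add: K0_mult)
      show "dord L K\<^sub>0 K\<^sub>0 (Suc n) ?P"
        using Suc.prems(2) a unfolding dord.simps(2)[of L K\<^sub>0 K\<^sub>0 "Suc n" P] by (rule bspec)
    qed
    moreover have "?P x \<ominus> (eps ^^ r) (tr_lift ?P) x = P (a \<otimes> x) \<ominus> (eps ^^ r) (tr_lift P) (a \<otimes> x)
      \<ominus> a \<otimes> (P x \<ominus> (eps ^^ r) (tr_lift P) x)" if x: "x \<in> K\<^sub>0" for x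
    proof -
      have "(eps ^^ r) (tr_lift ?P) x = (eps ^^ r) (\<lambda>y. tr_lift P (a \<otimes> y) \<ominus> a \<otimes> tr_lift P y) x"
        using tr_lift_ad[OF Suc.prems(1) a] funcset_mem[OF lc] a x by (intro eps_pow_cong) auto
      also have "\<dots> = (eps ^^ r) (tr_lift P) (a \<otimes> x) \<ominus> a \<otimes> (eps ^^ r) (tr_lift P) x"
        using a x by (intro eps_pow_ad[OF lc]) auto
      finally have e: "(eps ^^ r) (tr_lift ?P) x = (eps ^^ r) (tr_lift P) (a \<otimes> x) \<ominus> a \<otimes> (eps ^^ r) (tr_lift P) x" .
      have "P (a \<otimes> x) \<in> carrier L" "P x \<in> carrier L" "(eps ^^ r) (tr_lift P) x \<in> carrier L"
        "(eps ^^ r) (tr_lift P) (a \<otimes> x) \<in> carrier L" "a \<in> carrier L"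
        using funcset_mem[OF Suc.prems(1)] funcset_mem[OF elc] a x by (auto simp: K0_mult)
      then show ?thesis unfolding e by algebra
    qed
    ultimately show ?thesis
      by (subst (asm) order_context.dord_cong[OF KK]) auto
  qed
  then show ?case by simp
qed

text \<open>Induction on the order. The averaged lift \<open>Q\<^sub>1\<close> is an operator of
  \<open>L\<close> with the right leading part, so \<open>P\<close> minus its restriction has
  smaller order and extends by induction; the sum of \<open>Q\<^sub>1\<close> and that extension is
  the desired operator.\<close>

lemma diffop_extension_exists:
  "klin L k K\<^sub>0 P \<Longrightarrow> dord L K\<^sub>0 K\<^sub>0 n P \<Longrightarrow>
    \<exists>Q. klin L k (carrier L) Q \<and> dord L (carrier L) (carrier L) n Q \<and> (\<forall>x\<in>K\<^sub>0. Q x = P x)"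
proof (induction n arbitrary: P)
  case 0
  have "klin L k (carrier L) (\<lambda>x. \<zero>)"
    using k_carr by (auto intro!: klinI)
  with 0 show ?case by (intro exI[of _ "\<lambda>x. \<zero>"]) auto
next
  case (Suc n)
  have P: "P \<in> K\<^sub>0 \<rightarrow> carrier L" using klinD(1)[OF Suc.prems(1)] by auto
  \<comment> \<open>As many averages as the order bound of \<open>P\<close>: this is what
    \<open>dord_eps_pow\<close> asks for in order to bound the order over all of
    \<open>L\<close>.\<close>
  define Q\<^sub>1 where "Q\<^sub>1 = (eps ^^ Suc n) (tr_lift P)"
  have Q1: "klin L k (carrier L) Q\<^sub>1"
    unfolding Q\<^sub>1_def by (rule eps_pow_klin[OF k_carr tr_lift_klin[OF Suc.prems(1)]])
  have o1: "dord L (carrier L) (carrier L) (Suc n) Q\<^sub>1"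
    unfolding Q\<^sub>1_def by (rule dord_eps_pow[OF tr_lift_klin[OF Suc.prems(1)] dord_tr_lift[OF P Suc.prems(2)]])
  have "dord L K\<^sub>0 K\<^sub>0 n (\<lambda>x. P x \<ominus> Q\<^sub>1 x)"
    unfolding Q\<^sub>1_def by (rule dord_symbol[OF P Suc.prems(2)])
  moreover have "klin L k K\<^sub>0 (\<lambda>x. P x \<ominus> Q\<^sub>1 x)"
  proof (rule klinI)
    fix x y assume xy: "x \<in> K\<^sub>0" "y \<in> K\<^sub>0"
    have "P x \<in> carrier L" "P y \<in> carrier L" "Q\<^sub>1 x \<in> carrier L" "Q\<^sub>1 y \<in> carrier L"
      using xy klinD(1)[OF Suc.prems(1)] klinD(1)[OF Q1] by auto
    then show "P (x \<oplus> y) \<ominus> Q\<^sub>1 (x \<oplus> y) = P x \<ominus> Q\<^sub>1 x \<oplus> (P y \<ominus> Q\<^sub>1 y)"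
      using xy by (simp add: klinD(2)[OF Suc.prems(1)] klinD(2)[OF Q1]) algebra
  next
    fix c x assume cx: "c \<in> k" "x \<in> K\<^sub>0"
    have "P x \<in> carrier L" "Q\<^sub>1 x \<in> carrier L" "c \<in> carrier L"
      using cx klinD(1)[OF Suc.prems(1)] klinD(1)[OF Q1] k_carr by auto
    then show "P (c \<otimes> x) \<ominus> Q\<^sub>1 (c \<otimes> x) = c \<otimes> (P x \<ominus> Q\<^sub>1 x)"
      using cx by (simp add: klinD(3)[OF Suc.prems(1)] klinD(3)[OF Q1]) algebra
  qed (use P klinD(1)[OF Q1] in auto)
  ultimately obtain Q\<^sub>2 where Q2: "klin L k (carrier L) Q\<^sub>2" "dord L (carrier L) (carrier L) n Q\<^sub>2"
    "\<And>x. x \<in> K\<^sub>0 \<Longrightarrow> Q\<^sub>2 x = P x \<ominus> Q\<^sub>1 x"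
    using Suc.IH by blast
  show ?case
  proof (intro exI[of _ "\<lambda>x. Q\<^sub>1 x \<oplus> Q\<^sub>2 x"] conjI ballI)
    show "klin L k (carrier L) (\<lambda>x. Q\<^sub>1 x \<oplus> Q\<^sub>2 x)"
      using Q1 Q2(1) k_carr by (intro klinI) (auto simp: klinD r_distr a_ac subset_iff)
    show "dord L (carrier L) (carrier L) (Suc n) (\<lambda>x. Q\<^sub>1 x \<oplus> Q\<^sub>2 x)"
      using o1 order_context.dord_Suc[OF LL, OF Q2(2)] klinD(1)[OF Q1] klinD(1)[OF Q2(1)] by (intro order_context.dord_add[OF LL]) auto
    fix x assume x: "x \<in> K\<^sub>0"
    have "P x \<in> carrier L" "Q\<^sub>1 x \<in> carrier L"
      using x P klinD(1)[OF Q1] by auto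
    then show "Q\<^sub>1 x \<oplus> Q\<^sub>2 x = P x"
      using Q2(3)[OF x] by (simp, algebra)
  qed
qed

text \<open>The reason is separability: \<open>L\<close> has no nonzero
  \<open>K\<^sub>0\<close>-linear derivations. Write C_j for the commutator of \<open>Q\<close> with
  v_j and T for the sum of the u_j C_j; then eps Q = T + Q. Here T is \<open>L\<close>-linear
  because the C_j are, by induction on the order, and eps Q is \<open>L\<close>-linear because
  \<open>Q\<close> commutes with \<open>K\<^sub>0\<close>.\<close>

lemma K0_linear_diffop_linear:
  "klin L K\<^sub>0 (carrier L) Q \<Longrightarrow> dord L (carrier L) (carrier L) n Q \<Longrightarrow>
    b \<in> carrier L \<Longrightarrow> y \<in> carrier L \<Longrightarrow> Q (b \<otimes> y) = b \<otimes> Q y"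
proof (induction n arbitrary: Q b y)
  case (Suc n)
  note Q = Suc.prems(1) and b = Suc.prems(3) and y = Suc.prems(4)
  note Qc = klinD(1)[OF Q]
  let ?C = "\<lambda>j y. Q (v j \<otimes> y) \<ominus> v j \<otimes> Q y"
  define T where "T y = (\<Oplus>j\<in>{..<m}. u j \<otimes> ?C j y)" for y
  have Tc: "T y \<in> carrier L" if "y \<in> carrier L" for y
    unfolding T_def using that Qc by (intro finsum_closed) (auto simp: u_mem v_mem)
  have C: "?C j (b \<otimes> y) = b \<otimes> ?C j y" if "j < m" for j
    using that Suc.prems
    by (intro Suc.IH klin_commutator[OF Q K0_sub]) (auto simp: v_mem)
  have "T (b \<otimes> y) = (\<Oplus>j\<in>{..<m}. b \<otimes> (u j \<otimes> ?C j y))"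
    unfolding T_def
  proof (intro finsum_cong' refl)
    fix j assume j: "j \<in> {..<m}"
    then have "u j \<otimes> ?C j (b \<otimes> y) = u j \<otimes> (b \<otimes> ?C j y)"
      by (simp only: C lessThan_iff)
    also have "\<dots> = b \<otimes> (u j \<otimes> ?C j y)"
      using j b y Qc by (intro m_lcomm) (auto simp: u_mem v_mem)
    finally show "u j \<otimes> ?C j (b \<otimes> y) = b \<otimes> (u j \<otimes> ?C j y)" .
  qed (use b y Qc in \<open>auto simp: u_mem v_mem\<close>)
  also have "\<dots> = b \<otimes> T y"
    unfolding T_def using b y Qc by (intro finsum_rdistr[symmetric]) (auto simp: u_mem v_mem)
  finally have T: "T (b \<otimes> y) = b \<otimes> T y" .
  \<comment> \<open>The double sum of \<open>eps_commutator\<close> involves only commutators of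
    \<open>Q\<close> with elements of \<open>K\<^sub>0\<close>, and these are zero.\<close>
  have e: "eps Q (b \<otimes> y) \<ominus> b \<otimes> eps Q y = \<zero>"
    unfolding eps_commutator[OF Q b y]
    using Qc b y by (intro add.finprod_one_eqI) (auto simp: u_mem v_mem tr_mem klinD(3)[OF Q] minus_eq r_neg)
  \<comment> \<open>Since the u_j v_j add up to 1, \<open>Q y\<close> is the sum of the u_j v_j Q y,
    which restores the terms subtracted in the commutators.\<close>
  have QT: "eps Q y = T y \<oplus> Q y" if y: "y \<in> carrier L" for y
  proof -
    have "(\<Oplus>j\<in>{..<m}. u j \<otimes> v j) \<otimes> Q y = (\<Oplus>j\<in>{..<m}. u j \<otimes> v j \<otimes> Q y)"
      using Qc[OF y] by (intro finsum_ldistr) (auto simp: u_mem v_mem)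
    then have "T y \<oplus> Q y = T y \<oplus> (\<Oplus>j\<in>{..<m}. u j \<otimes> v j \<otimes> Q y)"
      using Qc[OF y] by (simp add: sum_uv)
    also have "\<dots> = (\<Oplus>j\<in>{..<m}. u j \<otimes> ?C j y \<oplus> u j \<otimes> v j \<otimes> Q y)"
      unfolding T_def using y Qc by (intro finsum_addf[symmetric]) (auto simp: u_mem v_mem)
    also have "\<dots> = eps Q y"
      unfolding eps_def
    proof (intro finsum_cong' refl)
      fix j assume "j \<in> {..<m}"
      then have "u j \<in> carrier L" "v j \<in> carrier L" "Q (v j \<otimes> y) \<in> carrier L" "Q y \<in> carrier L"
        using Qc y by (auto simp: u_mem v_mem)
      then show "u j \<otimes> ?C j y \<oplus> u j \<otimes> v j \<otimes> Q y = u j \<otimes> Q (v j \<otimes> y)" by algebra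
    qed (use Qc y in \<open>auto simp: u_mem v_mem\<close>)
    finally show ?thesis by simp
  qed
  have c: "Q y \<in> carrier L" "Q (b \<otimes> y) \<in> carrier L" "T y \<in> carrier L"
    using Qc Tc b y by auto
  then have "b \<otimes> T y \<oplus> Q (b \<otimes> y) \<ominus> b \<otimes> (T y \<oplus> Q y) = Q (b \<otimes> y) \<ominus> b \<otimes> Q y"
    using b by algebra
  moreover have "b \<otimes> T y \<oplus> Q (b \<otimes> y) \<ominus> b \<otimes> (T y \<oplus> Q y) = \<zero>"
    using e QT b y T by simp
  ultimately have "Q (b \<otimes> y) \<ominus> b \<otimes> Q y = \<zero>" by (rule trans[OF sym])
  then show ?case using b c by simp
qed auto

text \<open>For \<open>a\<close> in \<open>K\<^sub>0\<close> the commutator of \<open>Q\<close> with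
  \<open>a\<close> again vanishes on \<open>K\<^sub>0\<close> and has smaller order, so it is zero
  by induction. Thus \<open>Q\<close> is \<open>K\<^sub>0\<close>-linear, hence
  \<open>L\<close>-linear, and is determined by its value 0 at 1.\<close>

lemma diffop_zero_if_zero_on_K0:
  "klin L k (carrier L) Q \<Longrightarrow> dord L (carrier L) (carrier L) n Q \<Longrightarrow> (\<And>x. x \<in> K\<^sub>0 \<Longrightarrow> Q x = \<zero>) \<Longrightarrow>
    y \<in> carrier L \<Longrightarrow> Q y = \<zero>"
proof (induction n arbitrary: Q y)
  case (Suc n)
  note Qc = klinD(1)[OF Suc.prems(1)]
  have "Q (a \<otimes> y) = a \<otimes> Q y" if a: "a \<in> K\<^sub>0" and y: "y \<in> carrier L" for a y
  proof -
    have "Q (a \<otimes> y) \<ominus> a \<otimes> Q y = \<zero>"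
    proof (rule Suc.IH[OF klin_commutator[OF Suc.prems(1) k_carr] _ _ y])
      show "dord L (carrier L) (carrier L) n (\<lambda>y. Q (a \<otimes> y) \<ominus> a \<otimes> Q y)"
        using Suc.prems(2) a by simp
      show "Q (a \<otimes> x) \<ominus> a \<otimes> Q x = \<zero>" if "x \<in> K\<^sub>0" for x
        using Suc.prems(3)[OF K0_mult[OF a that]] Suc.prems(3)[OF that] a by simp
    qed (use a in simp)
    then show ?thesis using Qc a y by simp
  qed
  then have "klin L K\<^sub>0 (carrier L) Q"
    using klinD[OF Suc.prems(1)] by (intro klinI) auto
  then have "Q (y \<otimes> \<one>) = y \<otimes> Q \<one>"
    by (rule K0_linear_diffop_linear[OF _ Suc.prems(2,4) one_closed])
  then show ?case using Suc.prems(3)[OF K0_one] Suc.prems(4) by simp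
qed auto

end

section \<open>Galois extensions\<close>

text \<open>Module records extend ring records, so one predicate covers maps between rings, between
  modules, and from a ring to a module. Compatibility with scalars is stated separately where it is
  wanted.\<close>

definition additive_map :: "('a, 'm) ring_scheme \<Rightarrow> ('b, 'n) ring_scheme \<Rightarrow> ('a \<Rightarrow> 'b) \<Rightarrow> bool" where
  "additive_map A B f \<longleftrightarrow> f \<in> carrier A \<rightarrow> carrier B \<and>
     (\<forall>x\<in>carrier A. \<forall>y\<in>carrier A. f (x \<oplus>\<^bsub>A\<^esub> y) = f x \<oplus>\<^bsub>B\<^esub> f y)"

lemma additive_mapI:
  assumes "\<And>x. x \<in> carrier A \<Longrightarrow> f x \<in> carrier B"
    and "\<And>x y. x \<in> carrier A \<Longrightarrow> y \<in> carrier A \<Longrightarrow> f (x \<oplus>\<^bsub>A\<^esub> y) = f x \<oplus>\<^bsub>B\<^esub> f y"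
  shows "additive_map A B f"
  using assms unfolding additive_map_def by auto

lemma additive_mapD:
  assumes "additive_map A B f"
  shows "x \<in> carrier A \<Longrightarrow> f x \<in> carrier B"
    and "x \<in> carrier A \<Longrightarrow> y \<in> carrier A \<Longrightarrow> f (x \<oplus>\<^bsub>A\<^esub> y) = f x \<oplus>\<^bsub>B\<^esub> f y"
  using assms unfolding additive_map_def by auto

lemma additive_map_zero:
  assumes "abelian_group A" "abelian_group B" "additive_map A B f"
  shows "f \<zero>\<^bsub>A\<^esub> = \<zero>\<^bsub>B\<^esub>"
proof -
  interpret A: abelian_group A by fact
  interpret B: abelian_group B by fact
  have "f \<zero>\<^bsub>A\<^esub> \<in> carrier B" "f \<zero>\<^bsub>A\<^esub> = f \<zero>\<^bsub>A\<^esub> \<oplus>\<^bsub>B\<^esub> f \<zero>\<^bsub>A\<^esub>"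
    using additive_mapD[OF assms(3)] by (simp, metis A.l_zero A.zero_closed)
  then show ?thesis by (metis B.add.r_cancel_one')
qed

lemma additive_map_minus:
  assumes "abelian_group A" "abelian_group B" "additive_map A B f" "x \<in> carrier A"
  shows "f (\<ominus>\<^bsub>A\<^esub> x) = \<ominus>\<^bsub>B\<^esub> f x"
proof -
  interpret A: abelian_group A by fact
  interpret B: abelian_group B by fact
  have "f (\<ominus>\<^bsub>A\<^esub> x) \<oplus>\<^bsub>B\<^esub> f x = \<zero>\<^bsub>B\<^esub>"
    using additive_mapD[OF assms(3)] assms(4) additive_map_zero[OF assms(1-3)] by (metis A.a_inv_closed A.l_neg)
  then show ?thesis
    using additive_mapD(1)[OF assms(3)] assms(4) by (metis A.a_inv_closed B.minus_equality)
qed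

lemma additive_map_finsum:
  assumes "abelian_group A" "abelian_group B" "additive_map A B f" "finite I"
    "\<And>i. i \<in> I \<Longrightarrow> g i \<in> carrier A"
  shows "f (\<Oplus>\<^bsub>A\<^esub>i\<in>I. g i) = (\<Oplus>\<^bsub>B\<^esub>i\<in>I. f (g i))"
proof -
  interpret A: abelian_group A by fact
  interpret B: abelian_group B by fact
  show ?thesis
    using assms(4,5)
  proof (induction I)
    case empty
    then show ?case using additive_map_zero[OF assms(1-3)] by simp
  next
    case (insert x I)
    then show ?case
      using additive_mapD[OF assms(3)] by (simp add: Pi_def)
  qed
qed

text \<open>Lets two families be stored as a single one of length \<open>m + n\<close>, as in the
  doubling step for dual families.\<close>

lemma (in abelian_monoid) finsum_concat:
  fixes m n :: nat
  assumes "\<And>j. j < m \<Longrightarrow> f j \<in> carrier G" "\<And>j. j < n \<Longrightarrow> g j \<in> carrier G"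
  shows "(\<Oplus>j\<in>{..<m + n}. if j < m then f j else g (j - m)) = (\<Oplus>j\<in>{..<m}. f j) \<oplus> (\<Oplus>j\<in>{..<n}. g j)"
  using assms(2)
proof (induction n)
  case 0
  have "(\<Oplus>j\<in>{..<m}. if j < m then f j else g (j - m)) = (\<Oplus>j\<in>{..<m}. f j)"
    using assms(1) by (intro finsum_cong') auto
  then show ?case using assms(1) by (auto intro!: r_zero[symmetric] finsum_closed)
next
  case (Suc n)
  have "{..<m + Suc n} = insert (m + n) {..<m + n}" "{..<Suc n} = insert n {..<n}" by auto
  then show ?case
    using Suc assms(1) by (simp add: Pi_def a_lcomm)
qed

section \<open>Differential operators along an injective ring homomorphism\<close>

locale inj_ring_hom = K: cring K + L: cring L for K (structure) and L (structure) +
  fixes q k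
  assumes q_hom: "q \<in> ring_hom K L" and q_inj: "inj_on q (carrier K)" and k_sub: "k \<subseteq> carrier K"
begin

lemma q_mem [simp]: "x \<in> carrier K \<Longrightarrow> q x \<in> carrier L"
  using q_hom by (simp add: ring_hom_def Pi_iff)

lemma q_simps:
  "x \<in> carrier K \<Longrightarrow> y \<in> carrier K \<Longrightarrow> q (x \<oplus>\<^bsub>K\<^esub> y) = q x \<oplus>\<^bsub>L\<^esub> q y"
  "x \<in> carrier K \<Longrightarrow> y \<in> carrier K \<Longrightarrow> q (x \<otimes>\<^bsub>K\<^esub> y) = q x \<otimes>\<^bsub>L\<^esub> q y"
  "q \<one>\<^bsub>K\<^esub> = \<one>\<^bsub>L\<^esub>"
  using q_hom by (auto simp: ring_hom_def)

lemma q_additive: "additive_map K L q"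
  by (intro additive_mapI) (auto simp: q_simps)

lemma q_zero [simp]: "q \<zero>\<^bsub>K\<^esub> = \<zero>\<^bsub>L\<^esub>"
  by (rule additive_map_zero[OF K.is_abelian_group L.is_abelian_group q_additive])

lemma q_minus: "x \<in> carrier K \<Longrightarrow> y \<in> carrier K \<Longrightarrow> q (x \<ominus>\<^bsub>K\<^esub> y) = q x \<ominus>\<^bsub>L\<^esub> q y"
  by (simp add: a_minus_def q_simps additive_map_minus[OF K.is_abelian_group L.is_abelian_group q_additive])

lemma q_eq_iff: "x \<in> carrier K \<Longrightarrow> y \<in> carrier K \<Longrightarrow> q x = q y \<longleftrightarrow> x = y"
  using q_inj by (auto simp: inj_on_def)

lemma dord_transfer:
  "\<lbrakk>\<And>x. x \<in> carrier K \<Longrightarrow> P x \<in> carrier K; \<And>x. x \<in> carrier K \<Longrightarrow> R (q x) = q (P x)\<rbrakk> \<Longrightarrow>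
    dord L (q ` carrier K) (q ` carrier K) n R \<longleftrightarrow> dord K (carrier K) (carrier K) n P"
proof (induction n arbitrary: P R)
  case 0
  then show ?case
    by (simp, metis K.zero_closed q_eq_iff q_zero)
next
  case (Suc n)
  have "dord L (q ` carrier K) (q ` carrier K) n (\<lambda>x. R (q a \<otimes>\<^bsub>L\<^esub> x) \<ominus>\<^bsub>L\<^esub> q a \<otimes>\<^bsub>L\<^esub> R x) \<longleftrightarrow>
    dord K (carrier K) (carrier K) n (\<lambda>x. P (a \<otimes>\<^bsub>K\<^esub> x) \<ominus>\<^bsub>K\<^esub> a \<otimes>\<^bsub>K\<^esub> P x)"
    if a: "a \<in> carrier K" for a
  proof (rule Suc.IH)
    fix x assume x: "x \<in> carrier K"
    show "P (a \<otimes>\<^bsub>K\<^esub> x) \<ominus>\<^bsub>K\<^esub> a \<otimes>\<^bsub>K\<^esub> P x \<in> carrier K"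
      using Suc.prems(1) a x by simp
    have "R (q a \<otimes>\<^bsub>L\<^esub> q x) = q (P (a \<otimes>\<^bsub>K\<^esub> x))"
      using Suc.prems(2)[of "a \<otimes>\<^bsub>K\<^esub> x"] a x by (simp add: q_simps)
    then show "R (q a \<otimes>\<^bsub>L\<^esub> q x) \<ominus>\<^bsub>L\<^esub> q a \<otimes>\<^bsub>L\<^esub> R (q x) = q (P (a \<otimes>\<^bsub>K\<^esub> x) \<ominus>\<^bsub>K\<^esub> a \<otimes>\<^bsub>K\<^esub> P x)"
      using Suc.prems a x by (simp add: q_minus q_simps)
  qed
  then show ?case by auto
qed

text \<open>Order and linearity are known on the image of \<open>q\<close>, which \<open>R\<close>
  maps into itself; injectivity of \<open>q\<close> carries the identities back to
  \<open>K\<close>.\<close>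

lemma diffop_descend:
  assumes "klin L (q ` k) (q ` carrier K) R" "dord L (q ` carrier K) (q ` carrier K) n R"
    and P: "\<And>x. x \<in> carrier K \<Longrightarrow> P x \<in> carrier K" "\<And>x. x \<in> carrier K \<Longrightarrow> R (q x) = q (P x)"
  shows "(\<lambda>x\<in>carrier K. P x) \<in> carrier (diffop_ring k K)"
proof -
  have "dord K (carrier K) (carrier K) n P"
    using dord_transfer[of P R n] P assms(2) by simp
  moreover have "klin K k (carrier K) P"
  proof (rule klinI)
    fix x y assume xy: "x \<in> carrier K" "y \<in> carrier K"
    then have "q (P (x \<oplus>\<^bsub>K\<^esub> y)) = q (P x \<oplus>\<^bsub>K\<^esub> P y)"
      using klinD(2)[OF assms(1), of "q x" "q y"] P(1) by (simp add: q_simps flip: P(2))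
    then show "P (x \<oplus>\<^bsub>K\<^esub> y) = P x \<oplus>\<^bsub>K\<^esub> P y"
      using xy P by (simp add: q_eq_iff)
  next
    fix c x assume cx: "c \<in> k" "x \<in> carrier K"
    then have c: "c \<in> carrier K" using k_sub by auto
    have "q (P (c \<otimes>\<^bsub>K\<^esub> x)) = q (c \<otimes>\<^bsub>K\<^esub> P x)"
      using klinD(3)[OF assms(1), of "q c" "q x"] P(1) cx c by (simp add: q_simps flip: P(2))
    then show "P (c \<otimes>\<^bsub>K\<^esub> x) = c \<otimes>\<^bsub>K\<^esub> P x"
      using cx c P by (simp add: q_eq_iff)
  qed (use P in auto)
  ultimately show ?thesis
    by (intro K.diffop_ringI[OF k_sub])
qed

end

text \<open>\<open>G\<close> consists of functions that are undefined off the carrier of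
  \<open>L\<close>, so that equality means agreement on \<open>L\<close> and finiteness makes sense.
  The group is described by closure properties and by its fixed field, so the same locale serves a
  subgroup together with its own fixed field.\<close>

locale galois_setting = K: field K + L: field L for K (structure) and L (structure) +
  fixes q :: "'a \<Rightarrow> 'c" and k :: "'a set" and G :: "('c \<Rightarrow> 'c) set"
  assumes hom: "q \<in> ring_hom K L" and k_subset: "k \<subseteq> carrier K"
    and G_hom: "\<sigma> \<in> G \<Longrightarrow> \<sigma> \<in> ring_hom L L" and G_ext: "\<sigma> \<in> G \<Longrightarrow> \<sigma> \<in> extensional (carrier L)"
    and G_finite: "finite G" and G_id: "(\<lambda>x\<in>carrier L. x) \<in> G"
    and G_comp: "\<sigma> \<in> G \<Longrightarrow> \<tau> \<in> G \<Longrightarrow> compose (carrier L) \<sigma> \<tau> \<in> G"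
    and G_inv: "\<sigma> \<in> G \<Longrightarrow> \<exists>\<tau>\<in>G. \<forall>x\<in>carrier L. \<tau> (\<sigma> x) = x \<and> \<sigma> (\<tau> x) = x"
    and G_fixed: "{x \<in> carrier L. \<forall>\<sigma>\<in>G. \<sigma> x = x} = q ` carrier K"
begin

lemma inj_hom: "inj_ring_hom K L q k"
proof -
  have "inj_on q (carrier K)"
    using non_trivial_field_hom_is_inj[OF hom K.field_axioms L.field_axioms] .
  then show ?thesis
    using hom k_subset by unfold_locales
qed

lemma q_mem: "x \<in> carrier K \<Longrightarrow> q x \<in> carrier L"
  by (rule inj_ring_hom.q_mem[OF inj_hom])

lemmas q_simps = inj_ring_hom.q_simps[OF inj_hom]

lemma sigma_simps:
  assumes "\<sigma> \<in> G"
  shows "x \<in> carrier L \<Longrightarrow> \<sigma> x \<in> carrier L"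
    and "x \<in> carrier L \<Longrightarrow> y \<in> carrier L \<Longrightarrow> \<sigma> (x \<oplus>\<^bsub>L\<^esub> y) = \<sigma> x \<oplus>\<^bsub>L\<^esub> \<sigma> y"
    and "x \<in> carrier L \<Longrightarrow> y \<in> carrier L \<Longrightarrow> \<sigma> (x \<otimes>\<^bsub>L\<^esub> y) = \<sigma> x \<otimes>\<^bsub>L\<^esub> \<sigma> y"
    and "\<sigma> \<one>\<^bsub>L\<^esub> = \<one>\<^bsub>L\<^esub>"
  using G_hom[OF assms] by (auto simp: ring_hom_def)

lemma sigma_additive: "\<sigma> \<in> G \<Longrightarrow> additive_map L L \<sigma>"
  by (intro additive_mapI) (auto simp: sigma_simps)

lemma sigma_zero: "\<sigma> \<in> G \<Longrightarrow> \<sigma> \<zero>\<^bsub>L\<^esub> = \<zero>\<^bsub>L\<^esub>"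
  by (rule additive_map_zero[OF L.is_abelian_group L.is_abelian_group sigma_additive])

lemma sigma_minus: "\<sigma> \<in> G \<Longrightarrow> x \<in> carrier L \<Longrightarrow> y \<in> carrier L \<Longrightarrow> \<sigma> (x \<ominus>\<^bsub>L\<^esub> y) = \<sigma> x \<ominus>\<^bsub>L\<^esub> \<sigma> y"
  by (simp add: a_minus_def sigma_simps additive_map_minus[OF L.is_abelian_group L.is_abelian_group sigma_additive])

lemma sigma_finsum:
  assumes "\<sigma> \<in> G" "finite I" "\<And>i. i \<in> I \<Longrightarrow> g i \<in> carrier L"
  shows "\<sigma> (\<Oplus>\<^bsub>L\<^esub>i\<in>I. g i) = (\<Oplus>\<^bsub>L\<^esub>i\<in>I. \<sigma> (g i))"
  by (rule additive_map_finsum[OF L.is_abelian_group L.is_abelian_group sigma_additive]) (use assms in auto)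

lemma sigma_q: "\<sigma> \<in> G \<Longrightarrow> x \<in> carrier K \<Longrightarrow> \<sigma> (q x) = q x"
  using G_fixed by blast

lemma fixed_in_K: "x \<in> carrier L \<Longrightarrow> (\<And>\<sigma>. \<sigma> \<in> G \<Longrightarrow> \<sigma> x = x) \<Longrightarrow> x \<in> q ` carrier K"
  using G_fixed by blast

definition ginv :: "('c \<Rightarrow> 'c) \<Rightarrow> 'c \<Rightarrow> 'c" where
  "ginv \<sigma> = (SOME \<tau>. \<tau> \<in> G \<and> (\<forall>x\<in>carrier L. \<tau> (\<sigma> x) = x \<and> \<sigma> (\<tau> x) = x))"

lemma ginv:
  assumes "\<sigma> \<in> G"
  shows "ginv \<sigma> \<in> G" and "x \<in> carrier L \<Longrightarrow> ginv \<sigma> (\<sigma> x) = x" and "x \<in> carrier L \<Longrightarrow> \<sigma> (ginv \<sigma> x) = x"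
proof -
  have "\<exists>\<tau>. \<tau> \<in> G \<and> (\<forall>x\<in>carrier L. \<tau> (\<sigma> x) = x \<and> \<sigma> (\<tau> x) = x)"
    using G_inv[OF assms] by blast
  from someI_ex[OF this]
  have "ginv \<sigma> \<in> G \<and> (\<forall>x\<in>carrier L. ginv \<sigma> (\<sigma> x) = x \<and> \<sigma> (ginv \<sigma> x) = x)"
    unfolding ginv_def .
  then show "ginv \<sigma> \<in> G" and "x \<in> carrier L \<Longrightarrow> ginv \<sigma> (\<sigma> x) = x" and "x \<in> carrier L \<Longrightarrow> \<sigma> (ginv \<sigma> x) = x"
    by auto
qed

lemma G_eqI:
  assumes "\<sigma> \<in> G" "\<tau> \<in> G" "\<And>x. x \<in> carrier L \<Longrightarrow> \<sigma> x = \<tau> x"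
  shows "\<sigma> = \<tau>"
  using extensionalityI[OF G_ext[OF assms(1)] G_ext[OF assms(2)]] assms(3) by blast

lemma compose_left_bij:
  assumes "\<sigma> \<in> G"
  shows "inj_on (compose (carrier L) \<sigma>) G" and "compose (carrier L) \<sigma> ` G = G"
proof -
  show inj: "inj_on (compose (carrier L) \<sigma>) G"
  proof (rule inj_onI)
    fix \<tau> \<rho> assume *: "\<tau> \<in> G" "\<rho> \<in> G" "compose (carrier L) \<sigma> \<tau> = compose (carrier L) \<sigma> \<rho>"
    show "\<tau> = \<rho>"
    proof (rule G_eqI[OF *(1,2)])
      fix x assume x: "x \<in> carrier L"
      have "\<sigma> (\<tau> x) = \<sigma> (\<rho> x)"
        using fun_cong[OF *(3), of x] x by (simp add: compose_def)
      then show "\<tau> x = \<rho> x"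
        using ginv(2)[OF assms sigma_simps(1)[OF *(1) x]] ginv(2)[OF assms sigma_simps(1)[OF *(2) x]] by metis
    qed
  qed
  have "compose (carrier L) \<sigma> ` G \<subseteq> G"
    using G_comp[OF assms] by auto
  then show "compose (carrier L) \<sigma> ` G = G"
    by (rule endo_inj_surj[OF G_finite _ inj])
qed

text \<open>The separability idempotent of \<open>L \<otimes>\<^sub>K L\<close> as a pair of families: start from \<open>1 \<otimes> 1\<close> and multiply
  by \<open>(\<tau> x \<otimes> 1 - 1 \<otimes> x) / (\<tau> x - x)\<close> for each \<open>\<tau> \<noteq> 1\<close>, with \<open>x\<close> moved by \<open>\<tau>\<close>.\<close>

lemma dual_families_exist:
  "\<exists>(m::nat) u v. (\<forall>j<m. u j \<in> carrier L \<and> v j \<in> carrier L) \<and>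
     (\<forall>\<sigma>\<in>G. (\<Oplus>\<^bsub>L\<^esub>j\<in>{..<m}. u j \<otimes>\<^bsub>L\<^esub> \<sigma> (v j)) = (if \<sigma> = (\<lambda>x\<in>carrier L. x) then \<one>\<^bsub>L\<^esub> else \<zero>\<^bsub>L\<^esub>))"
proof -
  let ?id = "\<lambda>x\<in>carrier L. x"
  have "\<exists>(m::nat) u v. (\<forall>j<m. u j \<in> carrier L \<and> v j \<in> carrier L) \<and>
      (\<Oplus>\<^bsub>L\<^esub>j\<in>{..<m}. u j \<otimes>\<^bsub>L\<^esub> ?id (v j)) = \<one>\<^bsub>L\<^esub> \<and>
      (\<forall>\<sigma>\<in>S. (\<Oplus>\<^bsub>L\<^esub>j\<in>{..<m}. u j \<otimes>\<^bsub>L\<^esub> \<sigma> (v j)) = \<zero>\<^bsub>L\<^esub>)"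
    if "finite S" "S \<subseteq> G - {?id}" for S
    using that
  proof (induction S)
    case empty
    show ?case
      by (rule exI[of _ 1], rule exI[of _ "\<lambda>_. \<one>\<^bsub>L\<^esub>"], rule exI[of _ "\<lambda>_. \<one>\<^bsub>L\<^esub>"]) (simp add: lessThan_Suc)
  next
    case (insert \<tau> S)
    have \<tau>: "\<tau> \<in> G" "\<tau> \<noteq> ?id" using insert.prems by auto
    obtain m :: nat and u v where uv: "\<And>j. j < m \<Longrightarrow> u j \<in> carrier L" "\<And>j. j < m \<Longrightarrow> v j \<in> carrier L"
      and one: "(\<Oplus>\<^bsub>L\<^esub>j\<in>{..<m}. u j \<otimes>\<^bsub>L\<^esub> ?id (v j)) = \<one>\<^bsub>L\<^esub>"
      and zero: "\<And>\<sigma>. \<sigma> \<in> S \<Longrightarrow> (\<Oplus>\<^bsub>L\<^esub>j\<in>{..<m}. u j \<otimes>\<^bsub>L\<^esub> \<sigma> (v j)) = \<zero>\<^bsub>L\<^esub>"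
      using insert by blast
    obtain x where x: "x \<in> carrier L" "\<tau> x \<noteq> x"
      using G_eqI[OF \<tau>(1) G_id] \<tau>(2) by auto
    define d where "d = \<tau> x \<ominus>\<^bsub>L\<^esub> x"
    have tx: "\<tau> x \<in> carrier L" using x sigma_simps(1)[OF \<tau>(1)] by auto
    have d: "d \<in> carrier L" "d \<noteq> \<zero>\<^bsub>L\<^esub>" using x tx unfolding d_def by auto
    then have dU: "d \<in> Units L" by (simp add: L.field_Units)
    define a where "a = inv\<^bsub>L\<^esub> d"
    have a: "a \<in> carrier L" "a \<otimes>\<^bsub>L\<^esub> d = \<one>\<^bsub>L\<^esub>"
      unfolding a_def using dU by auto
    \<comment> \<open>Multiplying the sum of u_j \<otimes> v_j by (\<tau> x \<otimes> 1 - 1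
      \<otimes> x) / (\<tau> x - x) doubles the number of terms: the first half carries \<tau> x on
      the left, the second half carries x on the right and the sign on the left.\<close>
    define u' where "u' j = (if j < m then a \<otimes>\<^bsub>L\<^esub> \<tau> x \<otimes>\<^bsub>L\<^esub> u j else \<ominus>\<^bsub>L\<^esub> a \<otimes>\<^bsub>L\<^esub> u (j - m))" for j
    define v' where "v' j = (if j < m then v j else x \<otimes>\<^bsub>L\<^esub> v (j - m))" for j
    \<comment> \<open>Evaluated at \<sigma>, the new factor is (\<tau> x - \<sigma> x) / (\<tau> x -
      x). It is 1 at the identity and 0 at \<tau>, and it leaves the zeros already achieved on
      \<open>S\<close> untouched.\<close>
    have sum': "(\<Oplus>\<^bsub>L\<^esub>j\<in>{..<m + m}. u' j \<otimes>\<^bsub>L\<^esub> \<sigma> (v' j)) =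
        a \<otimes>\<^bsub>L\<^esub> (\<tau> x \<ominus>\<^bsub>L\<^esub> \<sigma> x) \<otimes>\<^bsub>L\<^esub> (\<Oplus>\<^bsub>L\<^esub>j\<in>{..<m}. u j \<otimes>\<^bsub>L\<^esub> \<sigma> (v j))" if \<sigma>: "\<sigma> \<in> G" for \<sigma>
    proof -
      have sx: "\<sigma> x \<in> carrier L" using \<sigma> x sigma_simps(1) by auto
      have sv: "\<sigma> (v j) \<in> carrier L" if "j < m" for j using that \<sigma> uv sigma_simps(1) by auto
      define A where "A = (\<Oplus>\<^bsub>L\<^esub>j\<in>{..<m}. u j \<otimes>\<^bsub>L\<^esub> \<sigma> (v j))"
      have A: "A \<in> carrier L" unfolding A_def using uv sv by (intro L.finsum_closed) auto
      have "(\<Oplus>\<^bsub>L\<^esub>j\<in>{..<m + m}. u' j \<otimes>\<^bsub>L\<^esub> \<sigma> (v' j)) =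
        (\<Oplus>\<^bsub>L\<^esub>j\<in>{..<m + m}. if j < m then (a \<otimes>\<^bsub>L\<^esub> \<tau> x) \<otimes>\<^bsub>L\<^esub> (u j \<otimes>\<^bsub>L\<^esub> \<sigma> (v j))
            else (\<ominus>\<^bsub>L\<^esub> a \<otimes>\<^bsub>L\<^esub> \<sigma> x) \<otimes>\<^bsub>L\<^esub> (u (j - m) \<otimes>\<^bsub>L\<^esub> \<sigma> (v (j - m))))"
      proof (intro L.finsum_cong' refl)
        fix j assume j: "j \<in> {..<m + m}"
        show "u' j \<otimes>\<^bsub>L\<^esub> \<sigma> (v' j) = (if j < m then (a \<otimes>\<^bsub>L\<^esub> \<tau> x) \<otimes>\<^bsub>L\<^esub> (u j \<otimes>\<^bsub>L\<^esub> \<sigma> (v j))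
            else (\<ominus>\<^bsub>L\<^esub> a \<otimes>\<^bsub>L\<^esub> \<sigma> x) \<otimes>\<^bsub>L\<^esub> (u (j - m) \<otimes>\<^bsub>L\<^esub> \<sigma> (v (j - m))))"
        proof (cases "j < m")
          case True
          then show ?thesis unfolding u'_def v'_def using uv sv a tx by (simp add: L.m_assoc)
        next
          case False
          then have jm: "j - m < m" using j by auto
          have "\<sigma> (x \<otimes>\<^bsub>L\<^esub> v (j - m)) = \<sigma> x \<otimes>\<^bsub>L\<^esub> \<sigma> (v (j - m))"
            using x uv jm by (intro sigma_simps(3)[OF \<sigma>]) auto
          moreover have "u (j - m) \<in> carrier L" "\<sigma> (v (j - m)) \<in> carrier L" using uv sv jm by auto
          then have "\<ominus>\<^bsub>L\<^esub> a \<otimes>\<^bsub>L\<^esub> u (j - m) \<otimes>\<^bsub>L\<^esub> (\<sigma> x \<otimes>\<^bsub>L\<^esub> \<sigma> (v (j - m))) =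
              \<ominus>\<^bsub>L\<^esub> a \<otimes>\<^bsub>L\<^esub> \<sigma> x \<otimes>\<^bsub>L\<^esub> (u (j - m) \<otimes>\<^bsub>L\<^esub> \<sigma> (v (j - m)))"
            using a sx by algebra
          ultimately show ?thesis unfolding u'_def v'_def using False by simp
        qed
      qed (use uv sv a sx tx in auto)
      also have "\<dots> = (\<Oplus>\<^bsub>L\<^esub>j\<in>{..<m}. (a \<otimes>\<^bsub>L\<^esub> \<tau> x) \<otimes>\<^bsub>L\<^esub> (u j \<otimes>\<^bsub>L\<^esub> \<sigma> (v j))) \<oplus>\<^bsub>L\<^esub>
          (\<Oplus>\<^bsub>L\<^esub>j\<in>{..<m}. (\<ominus>\<^bsub>L\<^esub> a \<otimes>\<^bsub>L\<^esub> \<sigma> x) \<otimes>\<^bsub>L\<^esub> (u j \<otimes>\<^bsub>L\<^esub> \<sigma> (v j)))"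
        using uv sv a sx tx by (intro L.finsum_concat) auto
      also have "\<dots> = (a \<otimes>\<^bsub>L\<^esub> \<tau> x) \<otimes>\<^bsub>L\<^esub> A \<oplus>\<^bsub>L\<^esub> (\<ominus>\<^bsub>L\<^esub> a \<otimes>\<^bsub>L\<^esub> \<sigma> x) \<otimes>\<^bsub>L\<^esub> A"
        unfolding A_def using uv sv a sx tx by (subst (1 2) L.finsum_rdistr) auto
      also have "\<dots> = a \<otimes>\<^bsub>L\<^esub> (\<tau> x \<ominus>\<^bsub>L\<^esub> \<sigma> x) \<otimes>\<^bsub>L\<^esub> A"
        using A a sx tx by algebra
      finally show ?thesis unfolding A_def .
    qed
    show ?case
    proof (rule exI[of _ "m + m"], rule exI[of _ u'], rule exI[of _ v'], intro conjI allI impI ballI)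
      fix j assume "j < m + m"
      then show "u' j \<in> carrier L" "v' j \<in> carrier L"
        unfolding u'_def v'_def using uv a tx x by auto
    next
      show "(\<Oplus>\<^bsub>L\<^esub>j\<in>{..<m + m}. u' j \<otimes>\<^bsub>L\<^esub> ?id (v' j)) = \<one>\<^bsub>L\<^esub>"
        unfolding sum'[OF G_id] one using a x by (simp add: d_def)
    next
      fix \<sigma> assume \<sigma>: "\<sigma> \<in> insert \<tau> S"
      then have \<sigma>G: "\<sigma> \<in> G" using insert.prems by auto
      have A: "(\<Oplus>\<^bsub>L\<^esub>j\<in>{..<m}. u j \<otimes>\<^bsub>L\<^esub> \<sigma> (v j)) \<in> carrier L"
        using uv sigma_simps(1)[OF \<sigma>G] by (intro L.finsum_closed) auto
      show "(\<Oplus>\<^bsub>L\<^esub>j\<in>{..<m + m}. u' j \<otimes>\<^bsub>L\<^esub> \<sigma> (v' j)) = \<zero>\<^bsub>L\<^esub>"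
      proof (cases "\<sigma> = \<tau>")
        case True
        then show ?thesis unfolding sum'[OF \<sigma>G] using A a tx by (simp add: L.minus_eq L.r_neg)
      next
        case False
        then show ?thesis
          unfolding sum'[OF \<sigma>G] using zero[of \<sigma>] \<sigma> a tx sigma_simps(1)[OF \<sigma>G x(1)] by simp
      qed
    qed
  qed
  from this[of "G - {?id}"] G_finite obtain m :: nat and u v where
    mem: "\<forall>j<m. u j \<in> carrier L \<and> v j \<in> carrier L"
    and one: "(\<Oplus>\<^bsub>L\<^esub>j\<in>{..<m}. u j \<otimes>\<^bsub>L\<^esub> ?id (v j)) = \<one>\<^bsub>L\<^esub>"
    and zero: "\<forall>\<sigma>\<in>G - {?id}. (\<Oplus>\<^bsub>L\<^esub>j\<in>{..<m}. u j \<otimes>\<^bsub>L\<^esub> \<sigma> (v j)) = \<zero>\<^bsub>L\<^esub>"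
    by auto
  have delta: "(\<Oplus>\<^bsub>L\<^esub>j\<in>{..<m}. u j \<otimes>\<^bsub>L\<^esub> \<sigma> (v j)) = (if \<sigma> = ?id then \<one>\<^bsub>L\<^esub> else \<zero>\<^bsub>L\<^esub>)" if "\<sigma> \<in> G" for \<sigma>
  proof (cases "\<sigma> = ?id")
    case True
    then show ?thesis by (simp only: one simp_thms if_True)
  next
    case False
    with that zero have "(\<Oplus>\<^bsub>L\<^esub>j\<in>{..<m}. u j \<otimes>\<^bsub>L\<^esub> \<sigma> (v j)) = \<zero>\<^bsub>L\<^esub>" by blast
    then show ?thesis by (simp only: False if_False)
  qed
  show ?thesis
    by (rule exI[of _ m], rule exI[of _ u], rule exI[of _ v], intro conjI ballI mem delta)
qed

definition dual_families :: "nat \<times> (nat \<Rightarrow> 'c) \<times> (nat \<Rightarrow> 'c)" where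
  "dual_families = (SOME (m, u, v). (\<forall>j<m. u j \<in> carrier L \<and> v j \<in> carrier L) \<and>
     (\<forall>\<sigma>\<in>G. (\<Oplus>\<^bsub>L\<^esub>j\<in>{..<m}. u j \<otimes>\<^bsub>L\<^esub> \<sigma> (v j)) = (if \<sigma> = (\<lambda>x\<in>carrier L. x) then \<one>\<^bsub>L\<^esub> else \<zero>\<^bsub>L\<^esub>)))"

definition "gdim = fst dual_families"
definition "du = fst (snd dual_families)"
definition "dv = snd (snd dual_families)"

lemma dual_families:
  shows du_mem: "j < gdim \<Longrightarrow> du j \<in> carrier L" and dv_mem: "j < gdim \<Longrightarrow> dv j \<in> carrier L"
    and dual: "\<sigma> \<in> G \<Longrightarrow> (\<Oplus>\<^bsub>L\<^esub>j\<in>{..<gdim}. du j \<otimes>\<^bsub>L\<^esub> \<sigma> (dv j)) = (if \<sigma> = (\<lambda>x\<in>carrier L. x) then \<one>\<^bsub>L\<^esub> else \<zero>\<^bsub>L\<^esub>)"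
proof -
  have "\<exists>w :: nat \<times> _. case w of (m, u, v) \<Rightarrow> (\<forall>j<m. u j \<in> carrier L \<and> v j \<in> carrier L) \<and>
     (\<forall>\<sigma>\<in>G. (\<Oplus>\<^bsub>L\<^esub>j\<in>{..<m}. u j \<otimes>\<^bsub>L\<^esub> \<sigma> (v j)) = (if \<sigma> = (\<lambda>x\<in>carrier L. x) then \<one>\<^bsub>L\<^esub> else \<zero>\<^bsub>L\<^esub>))"
    using dual_families_exist by (simp only: split_paired_Ex prod.case)
  from someI_ex[OF this]
  have "case dual_families of (m, u, v) \<Rightarrow> (\<forall>j<m. u j \<in> carrier L \<and> v j \<in> carrier L) \<and>
     (\<forall>\<sigma>\<in>G. (\<Oplus>\<^bsub>L\<^esub>j\<in>{..<m}. u j \<otimes>\<^bsub>L\<^esub> \<sigma> (v j)) = (if \<sigma> = (\<lambda>x\<in>carrier L. x) then \<one>\<^bsub>L\<^esub> else \<zero>\<^bsub>L\<^esub>))"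
    unfolding dual_families_def .
  then have *: "(\<forall>j<gdim. du j \<in> carrier L \<and> dv j \<in> carrier L) \<and>
     (\<forall>\<sigma>\<in>G. (\<Oplus>\<^bsub>L\<^esub>j\<in>{..<gdim}. du j \<otimes>\<^bsub>L\<^esub> \<sigma> (dv j)) = (if \<sigma> = (\<lambda>x\<in>carrier L. x) then \<one>\<^bsub>L\<^esub> else \<zero>\<^bsub>L\<^esub>))"
    by (simp only: split_beta gdim_def du_def dv_def)
  show "j < gdim \<Longrightarrow> du j \<in> carrier L" "j < gdim \<Longrightarrow> dv j \<in> carrier L"
    "\<sigma> \<in> G \<Longrightarrow> (\<Oplus>\<^bsub>L\<^esub>j\<in>{..<gdim}. du j \<otimes>\<^bsub>L\<^esub> \<sigma> (dv j)) = (if \<sigma> = (\<lambda>x\<in>carrier L. x) then \<one>\<^bsub>L\<^esub> else \<zero>\<^bsub>L\<^esub>)"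
    using * by auto
qed

text \<open>Apply \<sigma> to the duality relation for \<sigma>^-1 \<tau>, which is the identity
  exactly when \<sigma> = \<tau>.\<close>

lemma dual_twisted:
  assumes "\<sigma> \<in> G" "\<tau> \<in> G"
  shows "(\<Oplus>\<^bsub>L\<^esub>j\<in>{..<gdim}. \<sigma> (du j) \<otimes>\<^bsub>L\<^esub> \<tau> (dv j)) = (if \<sigma> = \<tau> then \<one>\<^bsub>L\<^esub> else \<zero>\<^bsub>L\<^esub>)"
proof -
  let ?\<rho> = "compose (carrier L) (ginv \<sigma>) \<tau>"
  have \<rho>: "?\<rho> \<in> G" using assms ginv(1) G_comp by auto
  have "(\<Oplus>\<^bsub>L\<^esub>j\<in>{..<gdim}. \<sigma> (du j) \<otimes>\<^bsub>L\<^esub> \<tau> (dv j)) = (\<Oplus>\<^bsub>L\<^esub>j\<in>{..<gdim}. \<sigma> (du j \<otimes>\<^bsub>L\<^esub> ?\<rho> (dv j)))"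
  proof (intro L.finsum_cong' refl)
    fix j assume "j \<in> {..<gdim}"
    then have j: "du j \<in> carrier L" "dv j \<in> carrier L" by (auto simp: du_mem dv_mem)
    have t: "\<tau> (dv j) \<in> carrier L" using j assms sigma_simps(1) by auto
    then have "ginv \<sigma> (\<tau> (dv j)) \<in> carrier L" using sigma_simps(1)[OF ginv(1)[OF assms(1)]] by auto
    then show "\<sigma> (du j) \<otimes>\<^bsub>L\<^esub> \<tau> (dv j) = \<sigma> (du j \<otimes>\<^bsub>L\<^esub> ?\<rho> (dv j))"
      using j t assms by (simp add: compose_def sigma_simps ginv)
  qed (use assms sigma_simps(1) \<rho> in \<open>auto simp: du_mem dv_mem\<close>)
  also have "\<dots> = \<sigma> (\<Oplus>\<^bsub>L\<^esub>j\<in>{..<gdim}. du j \<otimes>\<^bsub>L\<^esub> ?\<rho> (dv j))"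
    using assms \<rho> sigma_simps(1) by (intro sigma_finsum[symmetric]) (auto simp: du_mem dv_mem)
  also have "\<dots> = (if ?\<rho> = (\<lambda>x\<in>carrier L. x) then \<one>\<^bsub>L\<^esub> else \<zero>\<^bsub>L\<^esub>)"
    unfolding dual[OF \<rho>] using assms by (simp add: sigma_simps sigma_zero)
  also have "?\<rho> = (\<lambda>x\<in>carrier L. x) \<longleftrightarrow> \<sigma> = \<tau>"
  proof
    assume *: "?\<rho> = (\<lambda>x\<in>carrier L. x)"
    show "\<sigma> = \<tau>"
    proof (rule G_eqI[OF assms])
      fix x assume x: "x \<in> carrier L"
      then have "\<sigma> (ginv \<sigma> (\<tau> x)) = \<sigma> x"
        using fun_cong[OF *, of x] by (simp add: compose_def)
      then show "\<sigma> x = \<tau> x"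
        using ginv(3)[OF assms(1) sigma_simps(1)[OF assms(2) x]] by simp
    qed
  next
    assume "\<sigma> = \<tau>"
    then show "?\<rho> = (\<lambda>x\<in>carrier L. x)"
      using ginv(2)[OF assms(1)] by (auto simp: compose_def)
  qed
  finally show ?thesis .
qed

definition tr :: "'c \<Rightarrow> 'c" where
  "tr y = (\<Oplus>\<^bsub>L\<^esub>\<sigma>\<in>G. \<sigma> y)"

lemma tr_closed: "y \<in> carrier L \<Longrightarrow> tr y \<in> carrier L"
  unfolding tr_def using sigma_simps(1) by (intro L.finsum_closed) auto

text \<open>Left composition with \<tau> permutes \<open>G\<close>, so the trace is fixed by the
  whole group.\<close>

lemma tr_in_K:
  assumes y: "y \<in> carrier L" shows "tr y \<in> q ` carrier K"
proof (rule fixed_in_K[OF tr_closed[OF y]])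
  fix \<tau> assume \<tau>: "\<tau> \<in> G"
  have "\<tau> (tr y) = (\<Oplus>\<^bsub>L\<^esub>\<sigma>\<in>G. \<tau> (\<sigma> y))"
    unfolding tr_def using sigma_simps(1) y by (intro sigma_finsum[OF \<tau> G_finite]) auto
  also have "\<dots> = (\<Oplus>\<^bsub>L\<^esub>\<sigma>\<in>G. compose (carrier L) \<tau> \<sigma> y)"
    using y by (simp add: compose_def)
  also have "\<dots> = (\<Oplus>\<^bsub>L\<^esub>\<sigma>\<in>compose (carrier L) \<tau> ` G. \<sigma> y)"
    using compose_left_bij[OF \<tau>] sigma_simps(1) y
    by (intro L.finsum_reindex[symmetric]) auto
  finally show "\<tau> (tr y) = tr y"
    unfolding tr_def compose_left_bij(2)[OF \<tau>] .
qed

lemma tr_add: "x \<in> carrier L \<Longrightarrow> y \<in> carrier L \<Longrightarrow> tr (x \<oplus>\<^bsub>L\<^esub> y) = tr x \<oplus>\<^bsub>L\<^esub> tr y"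
proof -
  assume xy: "x \<in> carrier L" "y \<in> carrier L"
  have "tr (x \<oplus>\<^bsub>L\<^esub> y) = (\<Oplus>\<^bsub>L\<^esub>\<sigma>\<in>G. \<sigma> x \<oplus>\<^bsub>L\<^esub> \<sigma> y)"
    unfolding tr_def using xy by (intro L.finsum_cong' refl) (auto simp: sigma_simps)
  also have "\<dots> = tr x \<oplus>\<^bsub>L\<^esub> tr y"
    unfolding tr_def using xy by (intro L.finsum_addf) (auto simp: sigma_simps)
  finally show ?thesis .
qed

lemma tr_mult:
  assumes c: "c \<in> q ` carrier K" and x: "x \<in> carrier L"
  shows "tr (c \<otimes>\<^bsub>L\<^esub> x) = c \<otimes>\<^bsub>L\<^esub> tr x"
proof -
  have c': "c \<in> carrier L" using c q_mem by auto
  have "tr (c \<otimes>\<^bsub>L\<^esub> x) = (\<Oplus>\<^bsub>L\<^esub>\<sigma>\<in>G. c \<otimes>\<^bsub>L\<^esub> \<sigma> x)"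
    unfolding tr_def using x c c'
    by (intro L.finsum_cong' refl) (auto simp: sigma_simps sigma_q)
  also have "\<dots> = c \<otimes>\<^bsub>L\<^esub> tr x"
    unfolding tr_def using x c' by (intro L.finsum_rdistr[symmetric] G_finite) (auto simp: sigma_simps)
  finally show ?thesis .
qed

lemma finsum_sigma_delta:
  assumes "A \<subseteq> G" "\<sigma> \<in> G" "y \<in> carrier L"
  shows "(\<Oplus>\<^bsub>L\<^esub>\<tau>\<in>A. (if \<sigma> = \<tau> then \<one>\<^bsub>L\<^esub> else \<zero>\<^bsub>L\<^esub>) \<otimes>\<^bsub>L\<^esub> \<tau> y) = (if \<sigma> \<in> A then \<sigma> y else \<zero>\<^bsub>L\<^esub>)"
proof -
  have fA: "finite A" using assms(1) G_finite finite_subset by auto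
  have m: "\<tau> y \<in> carrier L" if "\<tau> \<in> A" for \<tau> using that assms sigma_simps(1) by auto
  have "(\<Oplus>\<^bsub>L\<^esub>\<tau>\<in>A. (if \<sigma> = \<tau> then \<one>\<^bsub>L\<^esub> else \<zero>\<^bsub>L\<^esub>) \<otimes>\<^bsub>L\<^esub> \<tau> y) = (\<Oplus>\<^bsub>L\<^esub>\<tau>\<in>A. if \<sigma> = \<tau> then \<tau> y else \<zero>\<^bsub>L\<^esub>)"
    using m by (intro L.finsum_cong' refl) auto
  also have "\<dots> = (if \<sigma> \<in> A then \<sigma> y else \<zero>\<^bsub>L\<^esub>)"
  proof (cases "\<sigma> \<in> A")
    case True
    then show ?thesis using L.finsum_singleton[OF True fA, of "\<lambda>\<tau>. \<tau> y"] m by auto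
  next
    case False
    then show ?thesis by (auto intro!: L.add.finprod_one_eqI)
  qed
  finally show ?thesis .
qed

text \<open>Orthogonality of the twisted dual families picks the single summand \<tau> = \<sigma>
  out of the partial trace over \<open>A\<close>. With \<open>A\<close> = \<open>G\<close> this
  gives the expansion in trace coordinates; with a subgroup it separates the elements of
  \<open>G\<close> inside \<open>A\<close> from those outside, which is the heart of
  \<open>full_if_iso\<close>.\<close>

lemma expand_sigma:
  assumes A: "A \<subseteq> G" and \<sigma>: "\<sigma> \<in> G" and y: "y \<in> carrier L"
  shows "(\<Oplus>\<^bsub>L\<^esub>j\<in>{..<gdim}. \<sigma> (du j) \<otimes>\<^bsub>L\<^esub> (\<Oplus>\<^bsub>L\<^esub>\<tau>\<in>A. \<tau> (dv j \<otimes>\<^bsub>L\<^esub> y))) = (if \<sigma> \<in> A then \<sigma> y else \<zero>\<^bsub>L\<^esub>)"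
proof -
  have fA: "finite A" using A G_finite finite_subset by auto
  have mem: "\<sigma> (du j) \<in> carrier L" "\<And>\<tau>. \<tau> \<in> A \<Longrightarrow> \<tau> (dv j) \<in> carrier L" "\<And>\<tau>. \<tau> \<in> A \<Longrightarrow> \<tau> (dv j \<otimes>\<^bsub>L\<^esub> y) \<in> carrier L"
    if "j < gdim" for j
    using that A \<sigma> y sigma_simps(1) by (auto simp: du_mem dv_mem)
  have memy: "\<tau> y \<in> carrier L" if "\<tau> \<in> A" for \<tau> using that A y sigma_simps(1) by auto
  have "(\<Oplus>\<^bsub>L\<^esub>j\<in>{..<gdim}. \<sigma> (du j) \<otimes>\<^bsub>L\<^esub> (\<Oplus>\<^bsub>L\<^esub>\<tau>\<in>A. \<tau> (dv j \<otimes>\<^bsub>L\<^esub> y))) =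
      (\<Oplus>\<^bsub>L\<^esub>j\<in>{..<gdim}. \<Oplus>\<^bsub>L\<^esub>\<tau>\<in>A. \<sigma> (du j) \<otimes>\<^bsub>L\<^esub> \<tau> (dv j) \<otimes>\<^bsub>L\<^esub> \<tau> y)"
  proof (intro L.finsum_cong' refl)
    fix j assume "j \<in> {..<gdim}"
    then have j: "j < gdim" by simp
    have "\<sigma> (du j) \<otimes>\<^bsub>L\<^esub> (\<Oplus>\<^bsub>L\<^esub>\<tau>\<in>A. \<tau> (dv j \<otimes>\<^bsub>L\<^esub> y)) = (\<Oplus>\<^bsub>L\<^esub>\<tau>\<in>A. \<sigma> (du j) \<otimes>\<^bsub>L\<^esub> \<tau> (dv j \<otimes>\<^bsub>L\<^esub> y))"
      using mem[OF j] by (intro L.finsum_rdistr fA) auto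
    also have "\<dots> = (\<Oplus>\<^bsub>L\<^esub>\<tau>\<in>A. \<sigma> (du j) \<otimes>\<^bsub>L\<^esub> \<tau> (dv j) \<otimes>\<^bsub>L\<^esub> \<tau> y)"
    proof (intro L.finsum_cong' refl)
      fix \<tau> assume \<tau>: "\<tau> \<in> A"
      then have "\<tau> (dv j \<otimes>\<^bsub>L\<^esub> y) = \<tau> (dv j) \<otimes>\<^bsub>L\<^esub> \<tau> y"
        using A y dv_mem[OF j] by (intro sigma_simps(3)) auto
      then show "\<sigma> (du j) \<otimes>\<^bsub>L\<^esub> \<tau> (dv j \<otimes>\<^bsub>L\<^esub> y) = \<sigma> (du j) \<otimes>\<^bsub>L\<^esub> \<tau> (dv j) \<otimes>\<^bsub>L\<^esub> \<tau> y"
        using mem[OF j] memy \<tau> by (simp add: L.m_assoc)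
    qed (use mem[OF j] memy in auto)
    finally show "\<sigma> (du j) \<otimes>\<^bsub>L\<^esub> (\<Oplus>\<^bsub>L\<^esub>\<tau>\<in>A. \<tau> (dv j \<otimes>\<^bsub>L\<^esub> y)) = (\<Oplus>\<^bsub>L\<^esub>\<tau>\<in>A. \<sigma> (du j) \<otimes>\<^bsub>L\<^esub> \<tau> (dv j) \<otimes>\<^bsub>L\<^esub> \<tau> y)" .
  qed (use mem memy in \<open>auto intro!: L.finsum_closed\<close>)
  also have "\<dots> = (\<Oplus>\<^bsub>L\<^esub>\<tau>\<in>A. \<Oplus>\<^bsub>L\<^esub>j\<in>{..<gdim}. \<sigma> (du j) \<otimes>\<^bsub>L\<^esub> \<tau> (dv j) \<otimes>\<^bsub>L\<^esub> \<tau> y)"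
    using mem memy by (intro L.finsum_swap fA) auto
  also have "\<dots> = (\<Oplus>\<^bsub>L\<^esub>\<tau>\<in>A. (if \<sigma> = \<tau> then \<one>\<^bsub>L\<^esub> else \<zero>\<^bsub>L\<^esub>) \<otimes>\<^bsub>L\<^esub> \<tau> y)"
  proof (intro L.finsum_cong' refl)
    fix \<tau> assume \<tau>: "\<tau> \<in> A"
    have "(\<Oplus>\<^bsub>L\<^esub>j\<in>{..<gdim}. \<sigma> (du j) \<otimes>\<^bsub>L\<^esub> \<tau> (dv j) \<otimes>\<^bsub>L\<^esub> \<tau> y) = (\<Oplus>\<^bsub>L\<^esub>j\<in>{..<gdim}. \<sigma> (du j) \<otimes>\<^bsub>L\<^esub> \<tau> (dv j)) \<otimes>\<^bsub>L\<^esub> \<tau> y"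
      using mem memy \<tau> by (intro L.finsum_ldistr[symmetric]) auto
    then show "(\<Oplus>\<^bsub>L\<^esub>j\<in>{..<gdim}. \<sigma> (du j) \<otimes>\<^bsub>L\<^esub> \<tau> (dv j) \<otimes>\<^bsub>L\<^esub> \<tau> y) = (if \<sigma> = \<tau> then \<one>\<^bsub>L\<^esub> else \<zero>\<^bsub>L\<^esub>) \<otimes>\<^bsub>L\<^esub> \<tau> y"
      using \<tau> A dual_twisted[OF \<sigma>, of \<tau>] by (simp add: subset_iff)
  qed (use memy in auto)
  also have "\<dots> = (if \<sigma> \<in> A then \<sigma> y else \<zero>\<^bsub>L\<^esub>)"
    by (rule finsum_sigma_delta[OF A \<sigma> y])
  finally show ?thesis .
qed

lemma expand_u: "y \<in> carrier L \<Longrightarrow> (\<Oplus>\<^bsub>L\<^esub>j\<in>{..<gdim}. du j \<otimes>\<^bsub>L\<^esub> tr (dv j \<otimes>\<^bsub>L\<^esub> y)) = y"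
proof -
  assume y: "y \<in> carrier L"
  have "(\<Oplus>\<^bsub>L\<^esub>j\<in>{..<gdim}. du j \<otimes>\<^bsub>L\<^esub> tr (dv j \<otimes>\<^bsub>L\<^esub> y)) =
      (\<Oplus>\<^bsub>L\<^esub>j\<in>{..<gdim}. (\<lambda>x\<in>carrier L. x) (du j) \<otimes>\<^bsub>L\<^esub> (\<Oplus>\<^bsub>L\<^esub>\<tau>\<in>G. \<tau> (dv j \<otimes>\<^bsub>L\<^esub> y)))"
    using y tr_closed by (intro L.finsum_cong' refl) (auto simp: tr_def du_mem dv_mem)
  also have "\<dots> = y" using expand_sigma[OF subset_refl G_id y] G_id y by simp
  finally show ?thesis .
qed

text \<open>Mirror image of \<open>expand_u\<close>: now the trace twists u_j while v_j stays put,
  which calls for the two-sided relation \<open>dual_twisted\<close>.\<close>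

lemma expand_v:
  assumes y: "y \<in> carrier L" shows "(\<Oplus>\<^bsub>L\<^esub>j\<in>{..<gdim}. tr (y \<otimes>\<^bsub>L\<^esub> du j) \<otimes>\<^bsub>L\<^esub> dv j) = y"
proof -
  let ?id = "\<lambda>x\<in>carrier L. x"
  have mem: "\<tau> (du j) \<in> carrier L" "\<tau> (dv j) \<in> carrier L" "\<tau> (y \<otimes>\<^bsub>L\<^esub> du j) \<in> carrier L" "\<tau> y \<in> carrier L" if "\<tau> \<in> G" "j < gdim" for j \<tau>
    using that y sigma_simps(1) by (auto simp: du_mem dv_mem)
  have memy: "\<tau> y \<in> carrier L" if "\<tau> \<in> G" for \<tau> using that y sigma_simps(1) by auto
  have "(\<Oplus>\<^bsub>L\<^esub>j\<in>{..<gdim}. tr (y \<otimes>\<^bsub>L\<^esub> du j) \<otimes>\<^bsub>L\<^esub> dv j) = (\<Oplus>\<^bsub>L\<^esub>j\<in>{..<gdim}. \<Oplus>\<^bsub>L\<^esub>\<tau>\<in>G. (\<tau> (du j) \<otimes>\<^bsub>L\<^esub> ?id (dv j)) \<otimes>\<^bsub>L\<^esub> \<tau> y)"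
  proof (intro L.finsum_cong' refl)
    fix j assume "j \<in> {..<gdim}"
    then have j: "j < gdim" by simp
    have "tr (y \<otimes>\<^bsub>L\<^esub> du j) \<otimes>\<^bsub>L\<^esub> dv j = (\<Oplus>\<^bsub>L\<^esub>\<tau>\<in>G. \<tau> (y \<otimes>\<^bsub>L\<^esub> du j) \<otimes>\<^bsub>L\<^esub> dv j)"
      unfolding tr_def using mem j dv_mem[OF j] by (intro L.finsum_ldistr G_finite) auto
    also have "\<dots> = (\<Oplus>\<^bsub>L\<^esub>\<tau>\<in>G. (\<tau> (du j) \<otimes>\<^bsub>L\<^esub> ?id (dv j)) \<otimes>\<^bsub>L\<^esub> \<tau> y)"
    proof (intro L.finsum_cong' refl)
      fix \<tau> assume \<tau>: "\<tau> \<in> G"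
      have "\<tau> (y \<otimes>\<^bsub>L\<^esub> du j) = \<tau> y \<otimes>\<^bsub>L\<^esub> \<tau> (du j)"
        using \<tau> y du_mem[OF j] by (intro sigma_simps(3)) auto
      then show "\<tau> (y \<otimes>\<^bsub>L\<^esub> du j) \<otimes>\<^bsub>L\<^esub> dv j = (\<tau> (du j) \<otimes>\<^bsub>L\<^esub> ?id (dv j)) \<otimes>\<^bsub>L\<^esub> \<tau> y"
        using mem[OF \<tau> j] dv_mem[OF j] by (simp add: L.m_ac)
    qed (use mem[OF _ j] dv_mem[OF j] in auto)
    finally show "tr (y \<otimes>\<^bsub>L\<^esub> du j) \<otimes>\<^bsub>L\<^esub> dv j = (\<Oplus>\<^bsub>L\<^esub>\<tau>\<in>G. (\<tau> (du j) \<otimes>\<^bsub>L\<^esub> ?id (dv j)) \<otimes>\<^bsub>L\<^esub> \<tau> y)" .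
  qed (use mem dv_mem in \<open>auto intro!: L.finsum_closed\<close>)
  also have "\<dots> = (\<Oplus>\<^bsub>L\<^esub>\<tau>\<in>G. \<Oplus>\<^bsub>L\<^esub>j\<in>{..<gdim}. (\<tau> (du j) \<otimes>\<^bsub>L\<^esub> ?id (dv j)) \<otimes>\<^bsub>L\<^esub> \<tau> y)"
    using mem dv_mem by (intro L.finsum_swap G_finite) auto
  also have "\<dots> = (\<Oplus>\<^bsub>L\<^esub>\<tau>\<in>G. (if ?id = \<tau> then \<one>\<^bsub>L\<^esub> else \<zero>\<^bsub>L\<^esub>) \<otimes>\<^bsub>L\<^esub> \<tau> y)"
  proof (intro L.finsum_cong' refl)
    fix \<tau> assume \<tau>: "\<tau> \<in> G"
    have "(\<Oplus>\<^bsub>L\<^esub>j\<in>{..<gdim}. (\<tau> (du j) \<otimes>\<^bsub>L\<^esub> ?id (dv j)) \<otimes>\<^bsub>L\<^esub> \<tau> y) = (\<Oplus>\<^bsub>L\<^esub>j\<in>{..<gdim}. \<tau> (du j) \<otimes>\<^bsub>L\<^esub> ?id (dv j)) \<otimes>\<^bsub>L\<^esub> \<tau> y"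
      using mem \<tau> dv_mem memy by (intro L.finsum_ldistr[symmetric]) auto
    then show "(\<Oplus>\<^bsub>L\<^esub>j\<in>{..<gdim}. (\<tau> (du j) \<otimes>\<^bsub>L\<^esub> ?id (dv j)) \<otimes>\<^bsub>L\<^esub> \<tau> y) = (if ?id = \<tau> then \<one>\<^bsub>L\<^esub> else \<zero>\<^bsub>L\<^esub>) \<otimes>\<^bsub>L\<^esub> \<tau> y"
      using dual_twisted[OF \<tau> G_id] by (simp add: eq_commute[of \<tau>])
  qed (use memy in auto)
  also have "\<dots> = y"
    using finsum_sigma_delta[OF subset_refl G_id y] G_id y by simp
  finally show ?thesis .
qed

lemma separable: "separable_trace L (q ` carrier K) (q ` k) tr gdim du dv"
proof (intro separable_trace.intro separable_trace_axioms.intro L.is_cring)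
  have "(\<Oplus>\<^bsub>L\<^esub>j\<in>{..<gdim}. du j \<otimes>\<^bsub>L\<^esub> dv j) = (\<Oplus>\<^bsub>L\<^esub>j\<in>{..<gdim}. du j \<otimes>\<^bsub>L\<^esub> (\<lambda>x\<in>carrier L. x) (dv j))"
    by (intro L.finsum_cong' refl) (auto simp: du_mem dv_mem)
  then show "(\<Oplus>\<^bsub>L\<^esub>j\<in>{..<gdim}. du j \<otimes>\<^bsub>L\<^esub> dv j) = \<one>\<^bsub>L\<^esub>"
    using dual[OF G_id] by simp
  show "\<one>\<^bsub>L\<^esub> \<in> q ` carrier K"
    using q_simps(3) K.one_closed by (metis imageI)
  show "a \<otimes>\<^bsub>L\<^esub> b \<in> q ` carrier K" if "a \<in> q ` carrier K" "b \<in> q ` carrier K" for a b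
    using that by (auto simp flip: q_simps)
qed (use k_subset q_mem in \<open>auto simp: tr_in_K tr_add tr_mult expand_u expand_v du_mem dv_mem\<close>)

end

section \<open>Extension, conjugation and trace of operators in a Galois extension\<close>

lemma (in cring) klin_diff:
  assumes "klin R k (carrier R) P" "klin R k (carrier R) Q" "k \<subseteq> carrier R"
  shows "klin R k (carrier R) (\<lambda>x. P x \<ominus> Q x)"
proof (rule klinI)
  fix x y assume xy: "x \<in> carrier R" "y \<in> carrier R"
  have "P x \<in> carrier R" "P y \<in> carrier R" "Q x \<in> carrier R" "Q y \<in> carrier R"
    using xy klinD(1)[OF assms(1)] klinD(1)[OF assms(2)] by auto
  then show "P (x \<oplus> y) \<ominus> Q (x \<oplus> y) = P x \<ominus> Q x \<oplus> (P y \<ominus> Q y)"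
    using xy by (simp add: klinD(2)[OF assms(1)] klinD(2)[OF assms(2)]) algebra
next
  fix c x assume cx: "c \<in> k" "x \<in> carrier R"
  have "P x \<in> carrier R" "Q x \<in> carrier R" "c \<in> carrier R"
    using cx klinD(1)[OF assms(1)] klinD(1)[OF assms(2)] assms(3) by auto
  then show "P (c \<otimes> x) \<ominus> Q (c \<otimes> x) = c \<otimes> (P x \<ominus> Q x)"
    using cx by (simp add: klinD(3)[OF assms(1)] klinD(3)[OF assms(2)]) algebra
qed (use klinD(1)[OF assms(1)] klinD(1)[OF assms(2)] in auto)

lemma (in cring) diffop_apply:
  assumes k: "k \<subseteq> carrier R" and P: "P \<in> carrier (diffop_ring k R)"
  shows "x \<in> carrier R \<Longrightarrow> P x \<in> carrier R"
    and "x \<in> carrier R \<Longrightarrow> y \<in> carrier R \<Longrightarrow> P (x \<oplus> y) = P x \<oplus> P y"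
    and "c \<in> k \<Longrightarrow> x \<in> carrier R \<Longrightarrow> P (c \<otimes> x) = c \<otimes> P x"
  using P unfolding carrier_diffop_ring[OF k] by (auto dest: klinD)

lemma (in cring) diffop_evaluation:
  assumes "k \<subseteq> carrier R" "x \<in> carrier R"
  shows "additive_map (diffop_ring k R) R (\<lambda>P. P x)"
  using assms by (intro additive_mapI) (auto simp: diffop_apply diffop_ring_simps)

lemma (in cring) diffop_finsum_apply:
  assumes k: "k \<subseteq> carrier R" and "finite I" "\<And>i. i \<in> I \<Longrightarrow> P i \<in> carrier (diffop_ring k R)" "x \<in> carrier R"
  shows "(\<Oplus>\<^bsub>diffop_ring k R\<^esub>i\<in>I. P i) x = (\<Oplus>i\<in>I. P i x)"
proof -
  interpret D: ring "diffop_ring k R" by (rule diffop_ring_ring[OF k])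
  show ?thesis
    using additive_map_finsum[OF D.is_abelian_group is_abelian_group diffop_evaluation[OF k assms(4)] assms(2), of P] assms(3)
    by simp
qed

context galois_setting
begin

lemma qk_sub: "q ` k \<subseteq> carrier L"
  using k_subset q_mem by auto

abbreviation "DK \<equiv> diffop_ring k K"
abbreviation "DL \<equiv> diffop_ring (q ` k) L"

lemma ring_DK: "ring DK" by (rule K.diffop_ring_ring[OF k_subset])
lemma ring_DL: "ring DL" by (rule L.diffop_ring_ring[OF qk_sub])

lemmas DK_iff = K.carrier_diffop_ring[OF k_subset]
lemmas DL_iff = L.carrier_diffop_ring[OF qk_sub]
lemmas DK_apply = K.diffop_apply[OF k_subset]
lemmas DL_apply = L.diffop_apply[OF qk_sub]
lemmas DL_mult = L.diffop_mult[OF qk_sub]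
lemmas DL_add = L.diffop_add[OF qk_sub]
lemmas DK_mult = K.diffop_mult[OF k_subset]
lemmas DK_add = K.diffop_add[OF k_subset]
lemmas DL_op = L.mult_op_diffop[OF qk_sub]
lemmas DK_op = K.mult_op_diffop[OF k_subset]
lemmas q_eq_iff = inj_ring_hom.q_eq_iff[OF inj_hom]

lemma mult_op_apply: "x \<in> carrier L \<Longrightarrow> mult_op L a x = a \<otimes>\<^bsub>L\<^esub> x"
  by (simp add: mult_op_def)

lemma DL_eqI:
  assumes "P \<in> carrier DL" "Q \<in> carrier DL" "\<And>x. x \<in> carrier L \<Longrightarrow> P x = Q x"
  shows "P = Q"
  using assms unfolding DL_iff by (intro extensionalityI[of P "carrier L"]) auto

lemma DK_eqI:
  assumes "P \<in> carrier DK" "Q \<in> carrier DK" "\<And>x. x \<in> carrier K \<Longrightarrow> P x = Q x"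
  shows "P = Q"
  using assms unfolding DK_iff by (intro extensionalityI[of P "carrier K"]) auto

text \<open>Both operators are brought to a common order bound; their difference vanishes on the
  image of \<open>K\<close>, hence everywhere.\<close>

lemma diffop_eqI:
  assumes P: "P \<in> carrier DL" and Q: "Q \<in> carrier DL" and eq: "\<And>x. x \<in> carrier K \<Longrightarrow> P (q x) = Q (q x)"
  shows "P = Q"
proof (rule DL_eqI[OF P Q])
  fix y assume y: "y \<in> carrier L"
  obtain m n where m: "dord L (carrier L) (carrier L) m P" and n: "dord L (carrier L) (carrier L) n Q"
    using P Q unfolding DL_iff by blast
  note oc = order_context_self[OF L.is_cring]
  have "dord L (carrier L) (carrier L) (max m n) P" "dord L (carrier L) (carrier L) (max m n) Q"
    using order_context.dord_mono[OF oc m] order_context.dord_mono[OF oc n] by auto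
  then have ord: "dord L (carrier L) (carrier L) (max m n) (\<lambda>x. P x \<ominus>\<^bsub>L\<^esub> Q x)"
    using DL_apply(1)[OF P] DL_apply(1)[OF Q] by (intro order_context.dord_minus[OF oc]) auto
  have lin: "klin L (q ` k) (carrier L) (\<lambda>x. P x \<ominus>\<^bsub>L\<^esub> Q x)"
    using P Q unfolding DL_iff by (intro L.klin_diff qk_sub) auto
  have "P x \<ominus>\<^bsub>L\<^esub> Q x = \<zero>\<^bsub>L\<^esub>" if "x \<in> q ` carrier K" for x
    using that eq DL_apply(1)[OF Q] q_mem by auto
  from separable_trace.diffop_zero_if_zero_on_K0[OF separable lin ord this y]
  have "P y \<ominus>\<^bsub>L\<^esub> Q y = \<zero>\<^bsub>L\<^esub>" .
  then show "P y = Q y"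
    using DL_apply(1)[OF P y] DL_apply(1)[OF Q y] by simp
qed

text \<open>Justifies the definite description in \<open>diffop_ext\<close>. Existence comes from
  \<open>diffop_extension_exists\<close>, applied to the copy of \<open>P\<close> on the image of
  \<open>q\<close>; uniqueness comes from \<open>diffop_eqI\<close>.\<close>

lemma diffop_ext_ex1:
  assumes P: "P \<in> carrier DK"
  shows "\<exists>!Q. Q \<in> carrier DL \<and> (\<forall>x\<in>carrier K. Q (q x) = q (P x))"
proof -
  obtain n where n: "dord K (carrier K) (carrier K) n P" using P unfolding DK_iff by blast
  define R where "R y = q (P (inv_into (carrier K) q y))" for y
  have inv: "inv_into (carrier K) q (q x) = x" if "x \<in> carrier K" for x
    using that inv_into_f_f inj_ring_hom.q_inj[OF inj_hom] by metis
  have R: "R (q x) = q (P x)" if "x \<in> carrier K" for x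
    using that by (simp add: R_def inv)
  have "klin L (q ` k) (q ` carrier K) R"
  proof (rule klinI)
    fix x y assume "x \<in> q ` carrier K" "y \<in> q ` carrier K"
    then obtain a b where ab: "x = q a" "y = q b" "a \<in> carrier K" "b \<in> carrier K" by auto
    then have "x \<oplus>\<^bsub>L\<^esub> y = q (a \<oplus>\<^bsub>K\<^esub> b)" by (simp add: q_simps)
    then have "R (x \<oplus>\<^bsub>L\<^esub> y) = q (P (a \<oplus>\<^bsub>K\<^esub> b))"
      using R[of "a \<oplus>\<^bsub>K\<^esub> b"] ab by (simp only: K.add.m_closed)
    then show "R (x \<oplus>\<^bsub>L\<^esub> y) = R x \<oplus>\<^bsub>L\<^esub> R y"
      using ab DK_apply[OF P] by (simp add: R q_simps)
  next
    fix c x assume "c \<in> q ` k" "x \<in> q ` carrier K"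
    then obtain a b where ab: "c = q a" "x = q b" "a \<in> k" "a \<in> carrier K" "b \<in> carrier K" using k_subset by auto
    then have "c \<otimes>\<^bsub>L\<^esub> x = q (a \<otimes>\<^bsub>K\<^esub> b)" by (simp add: q_simps)
    then have "R (c \<otimes>\<^bsub>L\<^esub> x) = q (P (a \<otimes>\<^bsub>K\<^esub> b))"
      using R[of "a \<otimes>\<^bsub>K\<^esub> b"] ab by (simp only: K.m_closed)
    then show "R (c \<otimes>\<^bsub>L\<^esub> x) = c \<otimes>\<^bsub>L\<^esub> R x"
      using ab DK_apply[OF P] by (simp add: R q_simps)
  qed (use R DK_apply(1)[OF P] q_mem in auto)
  moreover have "dord L (q ` carrier K) (q ` carrier K) n R"
    using inj_ring_hom.dord_transfer[OF inj_hom, of P R n] n R DK_apply(1)[OF P] by simp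
  ultimately obtain Q where Q: "klin L (q ` k) (carrier L) Q" "dord L (carrier L) (carrier L) n Q"
    "\<And>x. x \<in> q ` carrier K \<Longrightarrow> Q x = R x"
    using separable_trace.diffop_extension_exists[OF separable] by blast
  have QD: "(\<lambda>x\<in>carrier L. Q x) \<in> carrier DL"
    by (rule L.diffop_ringI[OF qk_sub Q(1,2)])
  moreover have "(\<lambda>x\<in>carrier L. Q x) (q x) = q (P x)" if "x \<in> carrier K" for x
    using that Q(3) R q_mem by simp
  ultimately show ?thesis
    using diffop_eqI by (intro ex1I[of _ "\<lambda>x\<in>carrier L. Q x"]) auto
qed

definition "ext = diffop_ext k K L q"

lemma ext:
  assumes "P \<in> carrier DK"
  shows "ext P \<in> carrier DL" and "x \<in> carrier K \<Longrightarrow> ext P (q x) = q (P x)"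
  using theI'[OF diffop_ext_ex1[OF assms]] unfolding ext_def diffop_ext_def by auto

lemma ext_eqI:
  assumes "P \<in> carrier DK" "Q \<in> carrier DL" "\<And>x. x \<in> carrier K \<Longrightarrow> Q (q x) = q (P x)"
  shows "ext P = Q"
  using assms by (intro diffop_eqI ext) (auto simp: ext)

lemma ext_mult:
  assumes "P \<in> carrier DK" "P' \<in> carrier DK"
  shows "ext (P \<otimes>\<^bsub>DK\<^esub> P') = ext P \<otimes>\<^bsub>DL\<^esub> ext P'"
proof (rule ext_eqI)
  fix x assume x: "x \<in> carrier K"
  then have "P' x \<in> carrier K" using DK_apply(1)[OF assms(2)] by auto
  then show "(ext P \<otimes>\<^bsub>DL\<^esub> ext P') (q x) = q ((P \<otimes>\<^bsub>DK\<^esub> P') x)"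
    using x assms ext by (simp add: L.diffop_ring_simps K.diffop_ring_simps q_mem)
qed (use assms ext in \<open>auto intro: DK_mult DL_mult\<close>)

lemma ext_add:
  assumes "P \<in> carrier DK" "P' \<in> carrier DK"
  shows "ext (P \<oplus>\<^bsub>DK\<^esub> P') = ext P \<oplus>\<^bsub>DL\<^esub> ext P'"
proof (rule ext_eqI)
  fix x assume x: "x \<in> carrier K"
  then have "P' x \<in> carrier K" "P x \<in> carrier K" using DK_apply(1)[OF assms(2)] DK_apply(1)[OF assms(1)] by auto
  then show "(ext P \<oplus>\<^bsub>DL\<^esub> ext P') (q x) = q ((P \<oplus>\<^bsub>DK\<^esub> P') x)"
    using x assms ext by (simp add: L.diffop_ring_simps K.diffop_ring_simps q_mem q_simps)
qed (use assms ext in \<open>auto intro: DK_add DL_add\<close>)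

lemma ext_one: "ext \<one>\<^bsub>DK\<^esub> = \<one>\<^bsub>DL\<^esub>"
proof (rule ext_eqI)
  show "\<one>\<^bsub>DL\<^esub> \<in> carrier DL" "\<one>\<^bsub>DK\<^esub> \<in> carrier DK"
    using ring.ring_simprules(6)[OF ring_DL] ring.ring_simprules(6)[OF ring_DK] by auto
qed (simp add: L.diffop_ring_simps K.diffop_ring_simps q_mem)

lemma ext_mult_op: "a \<in> carrier K \<Longrightarrow> ext (mult_op K a) = mult_op L (q a)"
  by (rule ext_eqI) (auto simp: DK_op DL_op q_mem, simp add: mult_op_def q_mem q_simps)

definition cj :: "('c \<Rightarrow> 'c) \<Rightarrow> ('c \<Rightarrow> 'c) \<Rightarrow> 'c \<Rightarrow> 'c" where
  "cj \<sigma> Q = (\<lambda>x\<in>carrier L. \<sigma> (Q (ginv \<sigma> x)))"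

text \<open>The commutator of the conjugate with \<open>a\<close> is the conjugate of the commutator
  with \<sigma>^-1 a, so the order is preserved.\<close>

lemma dord_cj:
  assumes \<sigma>: "\<sigma> \<in> G"
  shows "\<lbrakk>\<And>x. x \<in> carrier L \<Longrightarrow> Q x \<in> carrier L; dord L (carrier L) (carrier L) n Q\<rbrakk> \<Longrightarrow>
    dord L (carrier L) (carrier L) n (\<lambda>x. \<sigma> (Q (ginv \<sigma> x)))"
proof (induction n arbitrary: Q)
  case 0
  then show ?case
    using sigma_simps(1)[OF ginv(1)[OF \<sigma>]] by (simp add: sigma_zero[OF \<sigma>])
next
  case (Suc n)
  note gc = sigma_simps(1)[OF ginv(1)[OF \<sigma>]]
  have "dord L (carrier L) (carrier L) n (\<lambda>x. \<sigma> (Q (ginv \<sigma> (a \<otimes>\<^bsub>L\<^esub> x))) \<ominus>\<^bsub>L\<^esub> a \<otimes>\<^bsub>L\<^esub> \<sigma> (Q (ginv \<sigma> x)))"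
    if a: "a \<in> carrier L" for a
  proof -
    let ?b = "ginv \<sigma> a"
    have b: "?b \<in> carrier L" using gc[OF a] .
    have "dord L (carrier L) (carrier L) n (\<lambda>x. \<sigma> (Q (?b \<otimes>\<^bsub>L\<^esub> ginv \<sigma> x) \<ominus>\<^bsub>L\<^esub> ?b \<otimes>\<^bsub>L\<^esub> Q (ginv \<sigma> x)))"
      using Suc.prems b by (intro Suc.IH[of "\<lambda>x. Q (?b \<otimes>\<^bsub>L\<^esub> x) \<ominus>\<^bsub>L\<^esub> ?b \<otimes>\<^bsub>L\<^esub> Q x"]) auto
    moreover have "\<sigma> (Q (?b \<otimes>\<^bsub>L\<^esub> ginv \<sigma> x) \<ominus>\<^bsub>L\<^esub> ?b \<otimes>\<^bsub>L\<^esub> Q (ginv \<sigma> x)) =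
        \<sigma> (Q (ginv \<sigma> (a \<otimes>\<^bsub>L\<^esub> x))) \<ominus>\<^bsub>L\<^esub> a \<otimes>\<^bsub>L\<^esub> \<sigma> (Q (ginv \<sigma> x))" if x: "x \<in> carrier L" for x
    proof -
      have Qx: "Q (ginv \<sigma> x) \<in> carrier L" "Q (?b \<otimes>\<^bsub>L\<^esub> ginv \<sigma> x) \<in> carrier L"
        using gc[OF x] b Suc.prems(1) by auto
      have "ginv \<sigma> (a \<otimes>\<^bsub>L\<^esub> x) = ?b \<otimes>\<^bsub>L\<^esub> ginv \<sigma> x"
        by (rule sigma_simps(3)[OF ginv(1)[OF \<sigma>] a x])
      then show ?thesis
        using Qx b a by (simp add: sigma_minus[OF \<sigma>] sigma_simps[OF \<sigma>] ginv(3)[OF \<sigma>])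
    qed
    ultimately show ?thesis
      by (subst (asm) order_context.dord_cong[OF order_context_self[OF L.is_cring]]) auto
  qed
  then show ?case by simp
qed

lemma cj_closed:
  assumes \<sigma>: "\<sigma> \<in> G" and Q: "Q \<in> carrier DL"
  shows "cj \<sigma> Q \<in> carrier DL"
proof -
  obtain n where n: "dord L (carrier L) (carrier L) n Q" using Q unfolding DL_iff by blast
  note g = ginv(1)[OF \<sigma>]
  note gc = sigma_simps(1)[OF g]
  have "klin L (q ` k) (carrier L) (\<lambda>x. \<sigma> (Q (ginv \<sigma> x)))"
  proof (rule klinI)
    fix x y assume "x \<in> carrier L" "y \<in> carrier L"
    then show "\<sigma> (Q (ginv \<sigma> (x \<oplus>\<^bsub>L\<^esub> y))) = \<sigma> (Q (ginv \<sigma> x)) \<oplus>\<^bsub>L\<^esub> \<sigma> (Q (ginv \<sigma> y))"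
      using gc by (simp add: sigma_simps(2)[OF g] sigma_simps(2)[OF \<sigma>] DL_apply[OF Q])
  next
    fix c x assume "c \<in> q ` k" and x: "x \<in> carrier L"
    then obtain a where a: "c = q a" "a \<in> carrier K" "c \<in> q ` k" "c \<in> carrier L" using k_subset q_mem by auto
    have "ginv \<sigma> (c \<otimes>\<^bsub>L\<^esub> x) = c \<otimes>\<^bsub>L\<^esub> ginv \<sigma> x"
      using a x by (simp add: sigma_simps(3)[OF g] sigma_q[OF g])
    then show "\<sigma> (Q (ginv \<sigma> (c \<otimes>\<^bsub>L\<^esub> x))) = c \<otimes>\<^bsub>L\<^esub> \<sigma> (Q (ginv \<sigma> x))"
      using a gc[OF x] DL_apply(1)[OF Q gc[OF x]] by (simp add: DL_apply(3)[OF Q] sigma_simps(3)[OF \<sigma>] sigma_q[OF \<sigma>])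
  qed (use gc DL_apply(1)[OF Q] sigma_simps(1)[OF \<sigma>] in auto)
  moreover have "dord L (carrier L) (carrier L) n (\<lambda>x. \<sigma> (Q (ginv \<sigma> x)))"
    by (rule dord_cj[OF \<sigma> DL_apply(1)[OF Q] n])
  ultimately show ?thesis
    unfolding cj_def by (rule L.diffop_ringI[OF qk_sub])
qed

text \<open>Since \<sigma> fixes the image of \<open>K\<close>, the conjugate is again an operator
  of \<open>L\<close> that extends \<open>P\<close>, and extensions are unique.\<close>

lemma cj_ext:
  assumes \<sigma>: "\<sigma> \<in> G" and P: "P \<in> carrier DK"
  shows "cj \<sigma> (ext P) = ext P"
proof (rule ext_eqI[OF P, symmetric])
  show "cj \<sigma> (ext P) \<in> carrier DL" by (rule cj_closed[OF \<sigma> ext(1)[OF P]])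
  fix x assume x: "x \<in> carrier K"
  then show "cj \<sigma> (ext P) (q x) = q (P x)"
    using DK_apply(1)[OF P x] by (simp add: cj_def q_mem sigma_q[OF ginv(1)[OF \<sigma>]] sigma_q[OF \<sigma>] ext(2)[OF P])
qed

lemma ext_equivariant:
  assumes \<sigma>: "\<sigma> \<in> G" and P: "P \<in> carrier DK" and x: "x \<in> carrier L"
  shows "ext P (\<sigma> x) = \<sigma> (ext P x)"
  using fun_cong[OF cj_ext[OF \<sigma> P], of "\<sigma> x"] sigma_simps(1)[OF \<sigma> x] x
  by (simp add: cj_def ginv(2)[OF \<sigma>])

text \<open>An operator-valued trace from \<open>DL\<close> to \<open>DK\<close>. The inverse of
  \<open>q\<close> is taken at traces, which lie in its range by \<open>tr_in_K\<close>.\<close>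

definition tro :: "('c \<Rightarrow> 'c) \<Rightarrow> 'a \<Rightarrow> 'a" where
  "tro Q = (\<lambda>x\<in>carrier K. inv_into (carrier K) q (tr (Q (q x))))"

lemma tro_q:
  assumes "Q \<in> carrier DL" "x \<in> carrier K"
  shows "q (tro Q x) = tr (Q (q x))" and "tro Q x \<in> carrier K"
proof -
  have "tr (Q (q x)) \<in> q ` carrier K"
    using assms DL_apply(1) q_mem by (intro tr_in_K) auto
  then show "q (tro Q x) = tr (Q (q x))" "tro Q x \<in> carrier K"
    using assms(2) by (auto simp: tro_def f_inv_into_f inv_into_into)
qed

lemma tr_zero: "tr \<zero>\<^bsub>L\<^esub> = \<zero>\<^bsub>L\<^esub>"
  using tr_mult[of "\<zero>\<^bsub>L\<^esub>" "\<zero>\<^bsub>L\<^esub>"] tr_closed[of "\<zero>\<^bsub>L\<^esub>"] K.zero_closed inj_ring_hom.q_zero[OF inj_hom]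
  by (metis L.l_null L.zero_closed imageI)

lemma tr_additive: "additive_map L L tr"
  by (intro additive_mapI) (auto simp: tr_closed tr_add)

lemma tr_minus: "x \<in> carrier L \<Longrightarrow> y \<in> carrier L \<Longrightarrow> tr (x \<ominus>\<^bsub>L\<^esub> y) = tr x \<ominus>\<^bsub>L\<^esub> tr y"
  by (simp add: a_minus_def tr_add additive_map_minus[OF L.is_abelian_group L.is_abelian_group tr_additive])

lemma tr_finsum:
  assumes "finite I" "\<And>i. i \<in> I \<Longrightarrow> g i \<in> carrier L"
  shows "tr (\<Oplus>\<^bsub>L\<^esub>i\<in>I. g i) = (\<Oplus>\<^bsub>L\<^esub>i\<in>I. tr (g i))"
  by (rule additive_map_finsum[OF L.is_abelian_group L.is_abelian_group tr_additive]) (use assms in auto)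

text \<open>The trace is linear over the image of \<open>K\<close>, so it passes through commutators
  with elements of that image.\<close>

lemma dord_tr:
  "\<lbrakk>\<And>x. x \<in> carrier L \<Longrightarrow> Q x \<in> carrier L; dord L (carrier L) (carrier L) n Q\<rbrakk> \<Longrightarrow>
    dord L (q ` carrier K) (q ` carrier K) n (\<lambda>x. tr (Q x))"
proof (induction n arbitrary: Q)
  case 0
  then show ?case using q_mem by (auto simp: tr_zero)
next
  case (Suc n)
  have "dord L (q ` carrier K) (q ` carrier K) n (\<lambda>x. tr (Q (a \<otimes>\<^bsub>L\<^esub> x)) \<ominus>\<^bsub>L\<^esub> a \<otimes>\<^bsub>L\<^esub> tr (Q x))"
    if a: "a \<in> q ` carrier K" for a
  proof -
    have a': "a \<in> carrier L" using a q_mem by auto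
    have "dord L (q ` carrier K) (q ` carrier K) n (\<lambda>x. tr (Q (a \<otimes>\<^bsub>L\<^esub> x) \<ominus>\<^bsub>L\<^esub> a \<otimes>\<^bsub>L\<^esub> Q x))"
      using Suc.prems a' by (intro Suc.IH) auto
    moreover have "tr (Q (a \<otimes>\<^bsub>L\<^esub> x) \<ominus>\<^bsub>L\<^esub> a \<otimes>\<^bsub>L\<^esub> Q x) = tr (Q (a \<otimes>\<^bsub>L\<^esub> x)) \<ominus>\<^bsub>L\<^esub> a \<otimes>\<^bsub>L\<^esub> tr (Q x)"
      if "x \<in> q ` carrier K" for x
    proof -
      have "x \<in> carrier L" using that q_mem by auto
      then have "Q x \<in> carrier L" "Q (a \<otimes>\<^bsub>L\<^esub> x) \<in> carrier L" using a' Suc.prems(1) by auto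
      then show ?thesis using a a' by (simp add: tr_minus tr_mult)
    qed
    ultimately show ?thesis
      by (subst (asm) order_context.dord_cong[OF separable_trace.KK[OF separable]]) auto
  qed
  then show ?case by simp
qed

lemma tro_closed:
  assumes Q: "Q \<in> carrier DL" shows "tro Q \<in> carrier DK"
proof -
  obtain n where n: "dord L (carrier L) (carrier L) n Q" using Q unfolding DL_iff by blast
  have sub: "q ` carrier K \<subseteq> carrier L" using q_mem by auto
  have "klin L (q ` k) (q ` carrier K) (\<lambda>x. tr (Q x))"
  proof (rule klinI)
    fix c x assume c: "c \<in> q ` k" and "x \<in> q ` carrier K"
    then have x: "x \<in> carrier L" and cK: "c \<in> q ` carrier K" using sub k_subset by auto
    show "tr (Q (c \<otimes>\<^bsub>L\<^esub> x)) = c \<otimes>\<^bsub>L\<^esub> tr (Q x)"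
      using tr_mult[OF cK DL_apply(1)[OF Q x]] by (simp add: DL_apply(3)[OF Q c x])
  next
    fix x y assume "x \<in> q ` carrier K" "y \<in> q ` carrier K"
    then have xy: "x \<in> carrier L" "y \<in> carrier L" using sub by auto
    then show "tr (Q (x \<oplus>\<^bsub>L\<^esub> y)) = tr (Q x) \<oplus>\<^bsub>L\<^esub> tr (Q y)"
      by (simp add: DL_apply[OF Q] tr_add)
  qed (use sub DL_apply(1)[OF Q] tr_closed in auto)
  moreover have "dord L (q ` carrier K) (q ` carrier K) n (\<lambda>x. tr (Q x))"
    by (rule dord_tr[OF DL_apply(1)[OF Q] n])
  ultimately have "(\<lambda>x\<in>carrier K. tro Q x) \<in> carrier DK"
    using tro_q[OF Q] by (intro inj_ring_hom.diffop_descend[OF inj_hom]) auto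
  moreover have "(\<lambda>x\<in>carrier K. tro Q x) = tro Q" by (auto simp: tro_def)
  ultimately show ?thesis by simp
qed

lemma tro_eqI:
  assumes "Q \<in> carrier DL" "P \<in> carrier DK" "\<And>x. x \<in> carrier K \<Longrightarrow> tr (Q (q x)) = q (P x)"
  shows "tro Q = P"
proof (rule DK_eqI[OF tro_closed[OF assms(1)] assms(2)])
  fix x assume x: "x \<in> carrier K"
  then have "q (tro Q x) = q (P x)" using tro_q[OF assms(1)] assms(3) by simp
  then show "tro Q x = P x"
    using q_eq_iff[OF tro_q(2)[OF assms(1) x] DK_apply(1)[OF assms(2) x]] by (rule iffD1[rotated])
qed

lemma tro_add:
  assumes "Q \<in> carrier DL" "R \<in> carrier DL"
  shows "tro (Q \<oplus>\<^bsub>DL\<^esub> R) = tro Q \<oplus>\<^bsub>DK\<^esub> tro R"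
proof (rule tro_eqI)
  fix x assume x: "x \<in> carrier K"
  then show "tr ((Q \<oplus>\<^bsub>DL\<^esub> R) (q x)) = q ((tro Q \<oplus>\<^bsub>DK\<^esub> tro R) x)"
    using assms tro_q[OF assms(1) x] tro_q[OF assms(2) x] DL_apply(1)
    by (simp add: L.diffop_ring_simps K.diffop_ring_simps q_mem q_simps tr_add)
qed (use assms in \<open>auto intro: DL_add DK_add tro_closed\<close>)

lemma tro_mult_ext:
  assumes "Q \<in> carrier DL" "P \<in> carrier DK"
  shows "tro (Q \<otimes>\<^bsub>DL\<^esub> ext P) = tro Q \<otimes>\<^bsub>DK\<^esub> P"
proof (rule tro_eqI)
  fix x assume x: "x \<in> carrier K"
  then show "tr ((Q \<otimes>\<^bsub>DL\<^esub> ext P) (q x)) = q ((tro Q \<otimes>\<^bsub>DK\<^esub> P) x)"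
    using assms tro_q(1)[OF assms(1) DK_apply(1)[OF assms(2) x]]
    by (simp add: L.diffop_ring_simps K.diffop_ring_simps q_mem ext)
qed (use assms in \<open>auto intro: DL_mult DK_mult tro_closed ext\<close>)

text \<open>The identity y = sum of u_i tr(v_i y), inserted between \<open>A\<close> and
  \<open>B\<close>. It makes the operators tro(v_i Q u_j) multiply like matrices, which is why
  \<open>act\<close> will be multiplicative.\<close>

lemma tro_compose:
  assumes A: "A \<in> carrier DL" and B: "B \<in> carrier DL"
  shows "(\<Oplus>\<^bsub>DK\<^esub>i\<in>{..<gdim}. tro (A \<otimes>\<^bsub>DL\<^esub> mult_op L (du i)) \<otimes>\<^bsub>DK\<^esub> tro (mult_op L (dv i) \<otimes>\<^bsub>DL\<^esub> B)) = tro (A \<otimes>\<^bsub>DL\<^esub> B)"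
proof (rule tro_eqI[symmetric])
  interpret D: ring DK by (rule ring_DK)
  have mem: "tro (A \<otimes>\<^bsub>DL\<^esub> mult_op L (du i)) \<in> carrier DK" "tro (mult_op L (dv i) \<otimes>\<^bsub>DL\<^esub> B) \<in> carrier DK"
    "A \<otimes>\<^bsub>DL\<^esub> mult_op L (du i) \<in> carrier DL" "mult_op L (dv i) \<otimes>\<^bsub>DL\<^esub> B \<in> carrier DL" if "i < gdim" for i
    using that A B by (auto intro!: tro_closed DL_mult DL_op simp: du_mem dv_mem)
  show "A \<otimes>\<^bsub>DL\<^esub> B \<in> carrier DL" using A B by (rule DL_mult)
  show "(\<Oplus>\<^bsub>DK\<^esub>i\<in>{..<gdim}. tro (A \<otimes>\<^bsub>DL\<^esub> mult_op L (du i)) \<otimes>\<^bsub>DK\<^esub> tro (mult_op L (dv i) \<otimes>\<^bsub>DL\<^esub> B)) \<in> carrier DK"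
    using mem by (intro D.finsum_closed) auto
  fix x assume x: "x \<in> carrier K"
  have memK: "(tro (A \<otimes>\<^bsub>DL\<^esub> mult_op L (du i)) \<otimes>\<^bsub>DK\<^esub> tro (mult_op L (dv i) \<otimes>\<^bsub>DL\<^esub> B)) x \<in> carrier K"
    if "i < gdim" for i
    by (rule DK_apply(1)[OF DK_mult[OF mem(1,2)[OF that]] x])
  have Bx: "B (q x) \<in> carrier L" using B x DL_apply(1) q_mem by auto
  have tm: "tr (dv i \<otimes>\<^bsub>L\<^esub> B (q x)) \<in> carrier L" if "i < gdim" for i
    using that Bx dv_mem tr_closed by auto
  have am: "A y \<in> carrier L" if "y \<in> carrier L" for y using that DL_apply(1)[OF A] by auto
  have "A (B (q x)) = A (\<Oplus>\<^bsub>L\<^esub>i\<in>{..<gdim}. du i \<otimes>\<^bsub>L\<^esub> tr (dv i \<otimes>\<^bsub>L\<^esub> B (q x)))"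
    using expand_u[OF Bx] by simp
  also have "\<dots> = (\<Oplus>\<^bsub>L\<^esub>i\<in>{..<gdim}. A (du i \<otimes>\<^bsub>L\<^esub> tr (dv i \<otimes>\<^bsub>L\<^esub> B (q x))))"
    using A tm unfolding DL_iff
    by (intro separable_trace.klin_finsum[OF separable]) (auto simp: du_mem)
  finally have "tr (A (B (q x))) = (\<Oplus>\<^bsub>L\<^esub>i\<in>{..<gdim}. tr (A (du i \<otimes>\<^bsub>L\<^esub> tr (dv i \<otimes>\<^bsub>L\<^esub> B (q x)))))"
    using tm am by (simp, intro tr_finsum) (auto simp: du_mem)
  also have "\<dots> = (\<Oplus>\<^bsub>L\<^esub>i\<in>{..<gdim}. q ((tro (A \<otimes>\<^bsub>DL\<^esub> mult_op L (du i)) \<otimes>\<^bsub>DK\<^esub> tro (mult_op L (dv i) \<otimes>\<^bsub>DL\<^esub> B)) x))"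
  proof (intro L.finsum_cong' refl)
    fix i assume "i \<in> {..<gdim}"
    then have i: "i < gdim" by simp
    let ?y = "tro (mult_op L (dv i) \<otimes>\<^bsub>DL\<^esub> B) x"
    have y: "?y \<in> carrier K" "q ?y = tr (dv i \<otimes>\<^bsub>L\<^esub> B (q x))"
      using tro_q[OF mem(4)[OF i] x] Bx x by (auto simp: L.diffop_ring_simps mult_op_apply q_mem)
    show "tr (A (du i \<otimes>\<^bsub>L\<^esub> tr (dv i \<otimes>\<^bsub>L\<^esub> B (q x)))) = q ((tro (A \<otimes>\<^bsub>DL\<^esub> mult_op L (du i)) \<otimes>\<^bsub>DK\<^esub> tro (mult_op L (dv i) \<otimes>\<^bsub>DL\<^esub> B)) x)"
      using tro_q(1)[OF mem(3)[OF i] y(1)] x y q_mem tm[OF i]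
      by (simp add: L.diffop_ring_simps K.diffop_ring_simps mult_op_apply)
  next
    show "(\<lambda>i. q ((tro (A \<otimes>\<^bsub>DL\<^esub> mult_op L (du i)) \<otimes>\<^bsub>DK\<^esub> tro (mult_op L (dv i) \<otimes>\<^bsub>DL\<^esub> B)) x)) \<in> {..<gdim} \<rightarrow> carrier L"
      using memK by (auto intro!: q_mem)
  qed
  also have "\<dots> = q (\<Oplus>\<^bsub>K\<^esub>i\<in>{..<gdim}. (tro (A \<otimes>\<^bsub>DL\<^esub> mult_op L (du i)) \<otimes>\<^bsub>DK\<^esub> tro (mult_op L (dv i) \<otimes>\<^bsub>DL\<^esub> B)) x)"
    using memK by (intro additive_map_finsum[OF K.is_abelian_group L.is_abelian_group inj_ring_hom.q_additive[OF inj_hom], symmetric])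
      auto
  also have "(\<Oplus>\<^bsub>K\<^esub>i\<in>{..<gdim}. (tro (A \<otimes>\<^bsub>DL\<^esub> mult_op L (du i)) \<otimes>\<^bsub>DK\<^esub> tro (mult_op L (dv i) \<otimes>\<^bsub>DL\<^esub> B)) x)
      = (\<Oplus>\<^bsub>DK\<^esub>i\<in>{..<gdim}. tro (A \<otimes>\<^bsub>DL\<^esub> mult_op L (du i)) \<otimes>\<^bsub>DK\<^esub> tro (mult_op L (dv i) \<otimes>\<^bsub>DL\<^esub> B)) x"
    using mem x by (intro K.diffop_finsum_apply[OF k_subset, symmetric]) (auto intro!: DK_mult)
  finally show "tr ((A \<otimes>\<^bsub>DL\<^esub> B) (q x)) =
      q ((\<Oplus>\<^bsub>DK\<^esub>i\<in>{..<gdim}. tro (A \<otimes>\<^bsub>DL\<^esub> mult_op L (du i)) \<otimes>\<^bsub>DK\<^esub> tro (mult_op L (dv i) \<otimes>\<^bsub>DL\<^esub> B)) x)"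
    using x by (simp add: L.diffop_ring_simps q_mem)
qed

text \<open>Explicit form of D_L = L \<otimes> D_K over \<open>K\<close>. By
  \<open>diffop_eqI\<close> the two sides need comparing only on the image of \<open>K\<close>,
  where the claim is \<open>expand_u\<close> for \<open>Q (q x)\<close>.\<close>

lemma diffop_decomposition:
  assumes Q: "Q \<in> carrier DL"
  shows "Q = (\<Oplus>\<^bsub>DL\<^esub>i\<in>{..<gdim}. mult_op L (du i) \<otimes>\<^bsub>DL\<^esub> ext (tro (mult_op L (dv i) \<otimes>\<^bsub>DL\<^esub> Q)))"
proof (rule diffop_eqI[OF Q])
  interpret D: ring DL by (rule ring_DL)
  have mem: "tro (mult_op L (dv i) \<otimes>\<^bsub>DL\<^esub> Q) \<in> carrier DK" "mult_op L (dv i) \<otimes>\<^bsub>DL\<^esub> Q \<in> carrier DL"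
    "mult_op L (du i) \<in> carrier DL" if "i < gdim" for i
    using that Q by (auto intro!: tro_closed DL_mult DL_op simp: du_mem dv_mem)
  have mem': "mult_op L (du i) \<otimes>\<^bsub>DL\<^esub> ext (tro (mult_op L (dv i) \<otimes>\<^bsub>DL\<^esub> Q)) \<in> carrier DL" if "i < gdim" for i
    using mem[OF that] by (intro DL_mult ext(1))
  then show "(\<Oplus>\<^bsub>DL\<^esub>i\<in>{..<gdim}. mult_op L (du i) \<otimes>\<^bsub>DL\<^esub> ext (tro (mult_op L (dv i) \<otimes>\<^bsub>DL\<^esub> Q))) \<in> carrier DL"
    by (intro D.finsum_closed) auto
  fix x assume x: "x \<in> carrier K"
  have Qx: "Q (q x) \<in> carrier L" using Q x DL_apply(1) q_mem by auto
  have "(\<Oplus>\<^bsub>DL\<^esub>i\<in>{..<gdim}. mult_op L (du i) \<otimes>\<^bsub>DL\<^esub> ext (tro (mult_op L (dv i) \<otimes>\<^bsub>DL\<^esub> Q))) (q x)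
    = (\<Oplus>\<^bsub>L\<^esub>i\<in>{..<gdim}. (mult_op L (du i) \<otimes>\<^bsub>DL\<^esub> ext (tro (mult_op L (dv i) \<otimes>\<^bsub>DL\<^esub> Q))) (q x))"
    using mem' x q_mem by (intro L.diffop_finsum_apply[OF qk_sub]) auto
  also have "\<dots> = (\<Oplus>\<^bsub>L\<^esub>i\<in>{..<gdim}. du i \<otimes>\<^bsub>L\<^esub> tr (dv i \<otimes>\<^bsub>L\<^esub> Q (q x)))"
  proof (intro L.finsum_cong' refl)
    fix i assume "i \<in> {..<gdim}"
    then have i: "i < gdim" by simp
    have "ext (tro (mult_op L (dv i) \<otimes>\<^bsub>DL\<^esub> Q)) (q x) = tr (dv i \<otimes>\<^bsub>L\<^esub> Q (q x))"
      using ext(2)[OF mem(1)[OF i] x] tro_q[OF mem(2)[OF i] x] Qx x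
      by (simp add: L.diffop_ring_simps mult_op_apply q_mem)
    then show "(mult_op L (du i) \<otimes>\<^bsub>DL\<^esub> ext (tro (mult_op L (dv i) \<otimes>\<^bsub>DL\<^esub> Q))) (q x) = du i \<otimes>\<^bsub>L\<^esub> tr (dv i \<otimes>\<^bsub>L\<^esub> Q (q x))"
      using x Qx i by (simp add: L.diffop_ring_simps mult_op_apply q_mem tr_closed dv_mem)
  qed (use Qx in \<open>auto simp: du_mem dv_mem tr_closed\<close>)
  also have "\<dots> = Q (q x)" by (rule expand_u[OF Qx])
  finally show "Q (q x) = (\<Oplus>\<^bsub>DL\<^esub>i\<in>{..<gdim}. mult_op L (du i) \<otimes>\<^bsub>DL\<^esub> ext (tro (mult_op L (dv i) \<otimes>\<^bsub>DL\<^esub> Q))) (q x)"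
    by simp
qed

end

section \<open>Tensor products and the inverse image\<close>

locale tensor_setting = L: abelian_group L + N: abelian_group N
  for K :: "('a, 'c) ring_scheme" and L :: "('b, 'd) ring_scheme" (structure) and q :: "'a \<Rightarrow> 'b"
    and N :: "('a, 'm) module" +
  assumes mult_closed: "l \<in> carrier L \<Longrightarrow> a \<in> carrier K \<Longrightarrow> l \<otimes> q a \<in> carrier L"
    and smult_closed: "a \<in> carrier K \<Longrightarrow> n \<in> carrier N \<Longrightarrow> a \<odot>\<^bsub>N\<^esub> n \<in> carrier N"
begin

abbreviation "F \<equiv> free_Abelian_group (carrier L \<times> carrier N)"
abbreviation "T s \<equiv> tensor_module K L q N s"
abbreviation "t \<equiv> pure_tensor K L q N"
abbreviation "rel \<equiv> tensor_relations K L q N"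
abbreviation "ker \<equiv> tensor_kernel K L q N"

lemma rel_sub: "rel \<subseteq> carrier F"
proof -
  have "frag_of a - frag_of b - frag_of c \<in> carrier F" if "a \<in> carrier L \<times> carrier N" "b \<in> carrier L \<times> carrier N"
    "c \<in> carrier L \<times> carrier N" for a b c
    using that keys_diff[of "frag_of a - frag_of b" "frag_of c"] keys_diff[of "frag_of a" "frag_of b"] by auto
  moreover have "frag_of a - frag_of b \<in> carrier F" if "a \<in> carrier L \<times> carrier N" "b \<in> carrier L \<times> carrier N" for a b
    using that keys_diff[of "frag_of a" "frag_of b"] by auto
  ultimately show ?thesis
    unfolding tensor_relations_def using mult_closed smult_closed
    by (intro Un_least subsetI; elim CollectE exE conjE; hypsubst; simp del: carrier_free_Abelian_group_iff)
qed

lemma ker_subgroup: "subgroup ker F"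
  unfolding tensor_kernel_def by (rule group.generate_is_subgroup[OF group_free_Abelian_group rel_sub])

lemma ker_normal: "ker \<lhd> F"
  using ker_subgroup by (simp add: comm_group.normal_iff_subgroup[OF abelian_free_Abelian_group])

lemma T_group:
  "carrier (T s) = carrier (F Mod ker)" "\<zero>\<^bsub>T s\<^esub> = \<one>\<^bsub>F Mod ker\<^esub>"
  "x \<oplus>\<^bsub>T s\<^esub> y = x \<otimes>\<^bsub>F Mod ker\<^esub> y"
  by (simp_all add: tensor_module_def tensor_group_def)

lemma abelian_group_T: "abelian_group (T s)"
proof -
  interpret Q: comm_group "F Mod ker"
    by (rule comm_group.abelian_FactGroup[OF abelian_free_Abelian_group ker_subgroup])
  show ?thesis
    by (rule abelian_groupI; unfold T_group)
      (rule Q.m_closed Q.one_closed Q.m_assoc Q.m_comm Q.l_one Q.l_inv_ex; assumption)+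
qed

lemma T_simps:
  "carrier (T s) = (\<lambda>x. ker #>\<^bsub>F\<^esub> x) ` carrier F"
  "x \<oplus>\<^bsub>T s\<^esub> y = x <#>\<^bsub>F\<^esub> y"
  by (simp_all add: tensor_module_def tensor_group_def carrier_FactGroup)

lemma coset_add:
  "x \<in> carrier F \<Longrightarrow> y \<in> carrier F \<Longrightarrow> (ker #>\<^bsub>F\<^esub> x) \<oplus>\<^bsub>T s\<^esub> (ker #>\<^bsub>F\<^esub> y) = ker #>\<^bsub>F\<^esub> (x + y)"
  unfolding T_simps using normal.rcos_sum[OF ker_normal, of x y] by simp

lemma coset_eqI:
  assumes "x - y \<in> ker" "x \<in> carrier F" "y \<in> carrier F"
  shows "ker #>\<^bsub>F\<^esub> x = ker #>\<^bsub>F\<^esub> y"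
proof -
  have "x = (x - y) \<otimes>\<^bsub>F\<^esub> y" by simp
  then have "x \<in> ker #>\<^bsub>F\<^esub> y"
    unfolding r_coset_def using assms(1) by blast
  then show ?thesis
    using group.repr_independence[OF group_free_Abelian_group _ assms(3) ker_subgroup] by simp
qed

lemma rel_ker: "x \<in> rel \<Longrightarrow> x \<in> ker"
  unfolding tensor_kernel_def by (rule generate.incl)

lemma frag_mem: "l \<in> carrier L \<Longrightarrow> n \<in> carrier N \<Longrightarrow> frag_of (l, n) \<in> carrier F"
  by simp

lemma F_add: "x \<in> carrier F \<Longrightarrow> y \<in> carrier F \<Longrightarrow> x + y \<in> carrier F"
  using group.is_monoid[OF group_free_Abelian_group, THEN monoid.m_closed, of x _ y] by simp

lemma F_diff: "x \<in> carrier F \<Longrightarrow> y \<in> carrier F \<Longrightarrow> x - y \<in> carrier F"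
  using keys_diff[of x y] by (simp, meson Un_least order.trans)

lemma t_mem: "l \<in> carrier L \<Longrightarrow> n \<in> carrier N \<Longrightarrow> t l n \<in> carrier (T s)"
  unfolding T_simps pure_tensor_def by (intro imageI) simp

lemma t_add_left:
  assumes "l \<in> carrier L" "l' \<in> carrier L" "n \<in> carrier N"
  shows "t (l \<oplus> l') n = t l n \<oplus>\<^bsub>T s\<^esub> t l' n"
proof -
  have "frag_of (l \<oplus> l', n) - frag_of (l, n) - frag_of (l', n) \<in> rel"
    unfolding tensor_relations_def using assms by blast
  then have "frag_of (l \<oplus> l', n) - (frag_of (l, n) + frag_of (l', n)) \<in> ker"
    by (intro rel_ker) (simp add: diff_diff_eq)
  then show ?thesis
    unfolding pure_tensor_def using assms by (subst coset_add) (rule coset_eqI frag_mem F_add L.a_closed N.a_closed | assumption)+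
qed

lemma t_add_right:
  assumes "l \<in> carrier L" "n' \<in> carrier N" "n \<in> carrier N"
  shows "t l (n \<oplus>\<^bsub>N\<^esub> n') = t l n \<oplus>\<^bsub>T s\<^esub> t l n'"
proof -
  have "frag_of (l, n \<oplus>\<^bsub>N\<^esub> n') - frag_of (l, n) - frag_of (l, n') \<in> rel"
    unfolding tensor_relations_def using assms by blast
  then have "frag_of (l, n \<oplus>\<^bsub>N\<^esub> n') - (frag_of (l, n) + frag_of (l, n')) \<in> ker"
    by (intro rel_ker) (simp add: diff_diff_eq)
  then show ?thesis
    unfolding pure_tensor_def using assms by (subst coset_add) (rule coset_eqI frag_mem F_add L.a_closed N.a_closed | assumption)+
qed

lemma t_balanced:
  assumes "l \<in> carrier L" "a \<in> carrier K" "n \<in> carrier N"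
  shows "t (l \<otimes> q a) n = t l (a \<odot>\<^bsub>N\<^esub> n)"
proof -
  have "frag_of (l \<otimes> q a, n) - frag_of (l, a \<odot>\<^bsub>N\<^esub> n) \<in> rel"
    unfolding tensor_relations_def using assms by blast
  then show ?thesis
    unfolding pure_tensor_def using assms mult_closed smult_closed
    by (intro coset_eqI rel_ker) auto
qed

text \<open>Closure under differences mirrors the induction principle of the free abelian group,
  whose elements are reached from the generators by subtraction.\<close>

lemma tensor_induct [consumes 1, case_names diff pure]:
  assumes x: "x \<in> carrier (T s)"
    and diff: "\<And>x y. \<lbrakk>x \<in> carrier (T s); y \<in> carrier (T s); P x; P y\<rbrakk> \<Longrightarrow> P (x \<ominus>\<^bsub>T s\<^esub> y)"
    and pure: "\<And>l n. l \<in> carrier L \<Longrightarrow> n \<in> carrier N \<Longrightarrow> P (t l n)"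
  shows "P x"
proof -
  interpret T: abelian_group "T s" by (rule abelian_group_T)
  obtain c where c: "c \<in> carrier F" "x = ker #>\<^bsub>F\<^esub> c" using x unfolding T_simps by auto
  have ker_zero: "ker #>\<^bsub>F\<^esub> 0 = \<zero>\<^bsub>T s\<^esub>"
  proof -
    have "ker #>\<^bsub>F\<^esub> 0 \<in> carrier (T s)" unfolding T_simps by (intro imageI) simp
    moreover have "(ker #>\<^bsub>F\<^esub> 0) \<oplus>\<^bsub>T s\<^esub> (ker #>\<^bsub>F\<^esub> 0) = ker #>\<^bsub>F\<^esub> 0" by (subst coset_add) simp_all
    ultimately show ?thesis by (metis T.add.r_cancel_one')
  qed
  have "Poly_Mapping.keys c \<subseteq> carrier L \<times> carrier N" using c(1) by simp
  then have "P (ker #>\<^bsub>F\<^esub> c)"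
  proof (induction c rule: free_Abelian_group_induct[consumes 1, case_names zero diff frag])
    \<comment> \<open>Zero is a difference of two equal pure tensors, so it needs no case of its
      own.\<close>
    case zero
    have "carrier L \<noteq> {}" "carrier N \<noteq> {}" by auto
    have z: "t \<zero> \<zero>\<^bsub>N\<^esub> \<ominus>\<^bsub>T s\<^esub> t \<zero> \<zero>\<^bsub>N\<^esub> = \<zero>\<^bsub>T s\<^esub>"
      using t_mem[of \<zero> "\<zero>\<^bsub>N\<^esub>" s] by (simp add: T.minus_eq T.r_neg)
    have "P (t \<zero> \<zero>\<^bsub>N\<^esub> \<ominus>\<^bsub>T s\<^esub> t \<zero> \<zero>\<^bsub>N\<^esub>)"
      by (intro assms(2) t_mem pure) auto
    then show ?case unfolding z ker_zero .
  next
    case (diff x y)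
    have m: "ker #>\<^bsub>F\<^esub> x \<in> carrier (T s)" "ker #>\<^bsub>F\<^esub> y \<in> carrier (T s)" "ker #>\<^bsub>F\<^esub> (x - y) \<in> carrier (T s)"
      unfolding T_simps using diff.hyps F_diff[of x y] by (simp_all add: image_eqI)
    have "(ker #>\<^bsub>F\<^esub> (x - y)) \<oplus>\<^bsub>T s\<^esub> (ker #>\<^bsub>F\<^esub> y) = ker #>\<^bsub>F\<^esub> x"
      using diff.hyps F_diff[of x y] by (subst coset_add) simp_all
    then have "ker #>\<^bsub>F\<^esub> (x - y) = (ker #>\<^bsub>F\<^esub> x) \<ominus>\<^bsub>T s\<^esub> (ker #>\<^bsub>F\<^esub> y)"
      using m by (intro T.eq_minusI) auto
    then show ?case using assms(2)[OF m(1,2)] diff.IH by simp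
  next
    case (frag a)
    then show ?case using pure unfolding pure_tensor_def by (cases a) auto
  qed
  then show ?thesis using c by simp
qed

lemma tensor_map_eqI:
  assumes A: "abelian_group A" and f: "additive_map (T s) A f" and g: "additive_map (T s) A g"
    and eq: "\<And>l n. l \<in> carrier L \<Longrightarrow> n \<in> carrier N \<Longrightarrow> f (t l n) = g (t l n)"
    and x: "x \<in> carrier (T s)"
  shows "f x = g x"
  using x
proof (induction rule: tensor_induct)
  case (diff x y)
  interpret T: abelian_group "T s" by (rule abelian_group_T)
  show ?case
    using diff additive_mapD[OF f] additive_mapD[OF g]
      additive_map_minus[OF abelian_group_T A f] additive_map_minus[OF abelian_group_T A g]
    by (simp add: T.minus_eq)
qed (rule eq)

text \<open>The map induced on the free group kills the three families of relations, hence the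
  subgroup they generate, and so factors through the quotient.\<close>

lemma tensor_universal:
  assumes A: "abelian_group A"
    and f: "\<And>l n. l \<in> carrier L \<Longrightarrow> n \<in> carrier N \<Longrightarrow> f l n \<in> carrier A"
    and add_left: "\<And>l l' n. \<lbrakk>l \<in> carrier L; l' \<in> carrier L; n \<in> carrier N\<rbrakk> \<Longrightarrow> f (l \<oplus> l') n = f l n \<oplus>\<^bsub>A\<^esub> f l' n"
    and add_right: "\<And>l n n'. \<lbrakk>l \<in> carrier L; n \<in> carrier N; n' \<in> carrier N\<rbrakk> \<Longrightarrow> f l (n \<oplus>\<^bsub>N\<^esub> n') = f l n \<oplus>\<^bsub>A\<^esub> f l n'"
    and balanced: "\<And>l a n. \<lbrakk>l \<in> carrier L; a \<in> carrier K; n \<in> carrier N\<rbrakk> \<Longrightarrow> f (l \<otimes> q a) n = f l (a \<odot>\<^bsub>N\<^esub> n)"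
  shows "\<exists>h. additive_map (T s) A h \<and> (\<forall>l\<in>carrier L. \<forall>n\<in>carrier N. h (t l n) = f l n)"
proof -
  interpret A: abelian_group A by fact
  have AG: "comm_group (add_monoid A)" by (rule A.a_comm_group)
  have img: "case_prod f ` (carrier L \<times> carrier N) \<subseteq> carrier (add_monoid A)" using f by auto
  obtain h where h: "h \<in> hom F (add_monoid A)"
    and hf: "\<And>x. x \<in> carrier L \<times> carrier N \<Longrightarrow> h (frag_of x) = case_prod f x"
    using comm_group.free_Abelian_group_universal[OF AG img] by blast
  interpret H: group_hom F "add_monoid A" h
    using h AG by (simp add: group_hom_def group_hom_axioms_def comm_group.axioms)
  have h_add: "h (x + y) = h x \<oplus>\<^bsub>A\<^esub> h y" if "x \<in> carrier F" "y \<in> carrier F" for x y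
    using H.hom_mult[OF that] by simp
  have hc: "h x \<in> carrier A" if "x \<in> carrier F" for x using H.hom_closed[OF that] by simp
  have h_diff: "h (x - y) = h x \<ominus>\<^bsub>A\<^esub> h y" if x: "x \<in> carrier F" and y: "y \<in> carrier F" for x y
  proof -
    have d: "x - y \<in> carrier F" by (rule F_diff[OF x y])
    have "h x = h (x - y) \<oplus>\<^bsub>A\<^esub> h y" using h_add[OF d y] by simp
    then show ?thesis using hc[OF d] hc[OF y] by (rule A.eq_minusI)
  qed
  have hf': "h (frag_of (l, n)) = f l n" if "l \<in> carrier L" "n \<in> carrier N" for l n using hf that by simp
  \<comment> \<open>Both biadditivity relations have this three-term shape; the balancing relation
    has the two-term shape treated next.\<close>
  have zero3: "h (frag_of a - frag_of b - frag_of c) = \<zero>\<^bsub>A\<^esub>"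
    if "frag_of a \<in> carrier F" "frag_of b \<in> carrier F" "frag_of c \<in> carrier F"
      "h (frag_of a) = h (frag_of b) \<oplus>\<^bsub>A\<^esub> h (frag_of c)" for a b c
  proof -
    have "h (frag_of a - frag_of b - frag_of c) = h (frag_of a) \<ominus>\<^bsub>A\<^esub> h (frag_of b) \<ominus>\<^bsub>A\<^esub> h (frag_of c)"
      using that by (subst h_diff) (auto intro!: F_diff simp del: carrier_free_Abelian_group_iff simp: h_diff)
    also have "\<dots> = \<zero>\<^bsub>A\<^esub>"
    proof -
      have "h (frag_of c) = h (frag_of a) \<ominus>\<^bsub>A\<^esub> h (frag_of b)"
        using hc[OF that(2)] hc[OF that(3)] that(4) by (intro A.eq_minusI) (auto simp: A.a_comm)
      then show ?thesis using hc[OF that(3)] by (simp add: A.minus_eq A.r_neg flip: that(4))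
    qed
    finally show ?thesis .
  qed
  have zero2: "h (frag_of a - frag_of b) = \<zero>\<^bsub>A\<^esub>"
    if "frag_of a \<in> carrier F" "frag_of b \<in> carrier F" "h (frag_of a) = h (frag_of b)" for a b
    using hc[OF that(2)] that(3) by (simp add: h_diff[OF that(1,2)] A.minus_eq A.r_neg)
  have "rel \<subseteq> kernel F (add_monoid A) h"
  proof
    fix x assume x: "x \<in> rel"
    then have "h x = \<zero>\<^bsub>A\<^esub>"
      unfolding tensor_relations_def
    proof (elim UnE CollectE exE conjE)
      fix l l' n assume "x = frag_of (l \<oplus> l', n) - frag_of (l, n) - frag_of (l', n)"
        "l \<in> carrier L" "l' \<in> carrier L" "n \<in> carrier N"
      then show ?thesis by (simp only:) (rule zero3, auto simp: hf' add_left)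
    next
      fix l n n' assume "x = frag_of (l, n \<oplus>\<^bsub>N\<^esub> n') - frag_of (l, n) - frag_of (l, n')"
        "l \<in> carrier L" "n \<in> carrier N" "n' \<in> carrier N"
      then show ?thesis by (simp only:) (rule zero3, auto simp: hf' add_right)
    next
      fix l a n assume "x = frag_of (l \<otimes> q a, n) - frag_of (l, a \<odot>\<^bsub>N\<^esub> n)"
        "l \<in> carrier L" "a \<in> carrier K" "n \<in> carrier N"
      then show ?thesis by (simp only:) (rule zero2, auto simp: hf' balanced mult_closed smult_closed)
    qed
    then show "x \<in> kernel F (add_monoid A) h"
      using x rel_sub unfolding kernel_def by (simp only: mem_Collect_eq subsetD) simp
  qed
  then have ker_h: "ker \<subseteq> kernel F (add_monoid A) h"
    unfolding tensor_kernel_def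
    by (rule group.generate_subgroup_incl[OF group_free_Abelian_group _ H.subgroup_kernel])
  have "h x = h y" if xy: "x \<in> carrier F" "y \<in> carrier F" "ker #>\<^bsub>F\<^esub> x = ker #>\<^bsub>F\<^esub> y" for x y
  proof -
    have "x \<in> ker #>\<^bsub>F\<^esub> y"
      using group.rcos_self[OF group_free_Abelian_group xy(1) ker_subgroup] xy(3) by simp
    then obtain z where z: "z \<in> ker" "x = z + y" unfolding r_coset_def by auto
    then have "h z = \<zero>\<^bsub>A\<^esub>" "z \<in> carrier F" using ker_h by (auto simp: kernel_def)
    then show ?thesis using h_add[of z y] z(2) xy(2) hc[OF xy(2)] by simp
  qed
  then obtain g where g: "g \<in> hom (F Mod ker) (add_monoid A)" "\<And>x. x \<in> carrier F \<Longrightarrow> g (ker #>\<^bsub>F\<^esub> x) = h x"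
    using FactGroup_universal[OF h ker_normal] by blast
  have "additive_map (T s) A g"
    by (rule additive_mapI; unfold T_group) (use g(1) in \<open>auto simp: hom_def simp del: mult_FactGroup\<close>)
  moreover have "g (t l n) = f l n" if "l \<in> carrier L" "n \<in> carrier N" for l n
    unfolding pure_tensor_def using g(2)[OF frag_mem[OF that]] hf'[OF that] by simp
  ultimately show ?thesis by blast
qed

end

context galois_setting
begin

lemma one_DL: "\<one>\<^bsub>DL\<^esub> = mult_op L \<one>\<^bsub>L\<^esub>"
  by (auto simp: L.diffop_ring_simps mult_op_def)

lemma mult_op_mult: "a \<in> carrier L \<Longrightarrow> b \<in> carrier L \<Longrightarrow> mult_op L (a \<otimes>\<^bsub>L\<^esub> b) = mult_op L a \<otimes>\<^bsub>DL\<^esub> mult_op L b"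
  by (auto simp: L.diffop_ring_simps mult_op_def L.m_assoc)

lemma mult_op_add: "a \<in> carrier L \<Longrightarrow> b \<in> carrier L \<Longrightarrow> mult_op L (a \<oplus>\<^bsub>L\<^esub> b) = mult_op L a \<oplus>\<^bsub>DL\<^esub> mult_op L b"
  by (auto simp: L.diffop_ring_simps mult_op_def L.l_distr)

lemma tro_mult_op:
  assumes y: "y \<in> carrier L" and a: "a \<in> carrier K" "q a = tr y"
  shows "tro (mult_op L y) = mult_op K a"
proof (rule tro_eqI)
  fix x assume x: "x \<in> carrier K"
  have "tr (y \<otimes>\<^bsub>L\<^esub> q x) = q x \<otimes>\<^bsub>L\<^esub> tr y"
    using x y tr_mult[of "q x" y] by (simp add: L.m_comm q_mem)
  then show "tr (mult_op L y (q x)) = q (mult_op K a x)"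
    using x a y tr_closed[OF y] by (simp add: mult_op_def q_mem q_simps L.m_comm)
qed (use y a in \<open>auto intro: DL_op DK_op\<close>)

text \<open>If the trace vanished on every v_j, the expansion of 1 in the u_j would be 0. A nonzero
  trace value comes from the field \<open>K\<close> and can be scaled to 1.\<close>

lemma trace_one_exists: "\<exists>c\<in>carrier L. tr c = \<one>\<^bsub>L\<^esub>"
proof -
  have "\<exists>j<gdim. tr (dv j) \<noteq> \<zero>\<^bsub>L\<^esub>"
  proof (rule ccontr)
    assume "\<not> (\<exists>j<gdim. tr (dv j) \<noteq> \<zero>\<^bsub>L\<^esub>)"
    then have "(\<Oplus>\<^bsub>L\<^esub>j\<in>{..<gdim}. du j \<otimes>\<^bsub>L\<^esub> tr (dv j \<otimes>\<^bsub>L\<^esub> \<one>\<^bsub>L\<^esub>)) = \<zero>\<^bsub>L\<^esub>"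
      by (intro L.add.finprod_one_eqI) (auto simp: du_mem dv_mem)
    then show False using expand_u[of "\<one>\<^bsub>L\<^esub>"] by simp
  qed
  then obtain y where y: "y \<in> carrier L" "tr y \<noteq> \<zero>\<^bsub>L\<^esub>" using dv_mem by blast
  obtain a where a: "a \<in> carrier K" "tr y = q a" using tr_in_K[OF y(1)] by auto
  have "a \<noteq> \<zero>\<^bsub>K\<^esub>" using a y inj_ring_hom.q_zero[OF inj_hom] by auto
  then have aU: "a \<in> Units K" using a by (simp add: K.field_Units)
  let ?b = "inv\<^bsub>K\<^esub> a"
  have b: "?b \<in> carrier K" "?b \<otimes>\<^bsub>K\<^esub> a = \<one>\<^bsub>K\<^esub>" using aU by auto
  have "tr (q ?b \<otimes>\<^bsub>L\<^esub> y) = q ?b \<otimes>\<^bsub>L\<^esub> q a"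
    using tr_mult[of "q ?b" y] b y a by simp
  also have "\<dots> = \<one>\<^bsub>L\<^esub>" using q_simps(2)[OF b(1) a(1)] b(2) q_simps(3) by simp
  finally show ?thesis using b y q_mem by (intro bexI[of _ "q ?b \<otimes>\<^bsub>L\<^esub> y"]) auto
qed

lemma cj_apply: "x \<in> carrier L \<Longrightarrow> cj \<sigma> Q x = \<sigma> (Q (ginv \<sigma> x))"
  by (simp add: cj_def)

lemma cj_add:
  assumes "\<sigma> \<in> G" "Q \<in> carrier DL" "R \<in> carrier DL"
  shows "cj \<sigma> (Q \<oplus>\<^bsub>DL\<^esub> R) = cj \<sigma> Q \<oplus>\<^bsub>DL\<^esub> cj \<sigma> R"
  using assms sigma_simps(1)[OF ginv(1)[OF assms(1)]] DL_apply(1)[OF assms(2)] DL_apply(1)[OF assms(3)]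
  by (intro DL_eqI cj_closed DL_add) (auto simp: L.diffop_ring_simps cj_apply sigma_simps)

lemma cj_mult:
  assumes "\<sigma> \<in> G" "Q \<in> carrier DL" "R \<in> carrier DL"
  shows "cj \<sigma> (Q \<otimes>\<^bsub>DL\<^esub> R) = cj \<sigma> Q \<otimes>\<^bsub>DL\<^esub> cj \<sigma> R"
proof (rule DL_eqI)
  fix x assume x: "x \<in> carrier L"
  have "ginv \<sigma> x \<in> carrier L" "R (ginv \<sigma> x) \<in> carrier L"
    using sigma_simps(1)[OF ginv(1)[OF assms(1)] x] DL_apply(1)[OF assms(3)] by auto
  then show "cj \<sigma> (Q \<otimes>\<^bsub>DL\<^esub> R) x = (cj \<sigma> Q \<otimes>\<^bsub>DL\<^esub> cj \<sigma> R) x"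
    using x assms by (simp add: L.diffop_ring_simps cj_apply sigma_simps(1)[OF assms(1)] ginv(2)[OF assms(1)])
qed (use assms in \<open>auto intro: cj_closed DL_mult\<close>)

lemma cj_mult_op:
  assumes "\<sigma> \<in> G" "l \<in> carrier L"
  shows "cj \<sigma> (mult_op L l) = mult_op L (\<sigma> l)"
proof (rule DL_eqI)
  fix x assume x: "x \<in> carrier L"
  have "ginv \<sigma> x \<in> carrier L" using sigma_simps(1)[OF ginv(1)[OF assms(1)] x] by auto
  then show "cj \<sigma> (mult_op L l) x = mult_op L (\<sigma> l) x"
    using x assms by (simp add: cj_apply mult_op_apply sigma_simps(3)[OF assms(1)] ginv(3)[OF assms(1)])
qed (use assms sigma_simps(1) in \<open>auto intro: cj_closed DL_op\<close>)

end

lemma restrict_scalars_simps: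
  "carrier (restrict_scalars \<phi> M) = carrier M" "\<zero>\<^bsub>restrict_scalars \<phi> M\<^esub> = \<zero>\<^bsub>M\<^esub>"
  "x \<oplus>\<^bsub>restrict_scalars \<phi> M\<^esub> y = x \<oplus>\<^bsub>M\<^esub> y" "a \<odot>\<^bsub>restrict_scalars \<phi> M\<^esub> x = \<phi> a \<odot>\<^bsub>M\<^esub> x"
  by (simp_all add: restrict_scalars_def)

lemma restrict_scalars_abelian_group:
  assumes "abelian_group M" shows "abelian_group (restrict_scalars \<phi> M)"
proof -
  interpret M: abelian_group M by fact
  show ?thesis
    by (rule abelian_groupI; unfold restrict_scalars_simps)
      (rule M.a_closed M.zero_closed M.a_assoc M.a_comm M.l_zero M.add.l_inv_ex[simplified]; assumption)+
qed

section \<open>Construction of the operator action on the tensor product\<close>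

locale galois_module = galois_setting K L q k G
  for K :: "('a, 'b) ring_scheme" (structure) and L :: "('c, 'd) ring_scheme" (structure)
    and q :: "'a \<Rightarrow> 'c" and k :: "'a set" and G :: "('c \<Rightarrow> 'c) set" +
  fixes N :: "('a \<Rightarrow> 'a, 'm) module"
  assumes N_module: "left_module (diffop_ring k K) N"
begin

abbreviation "N' \<equiv> restrict_scalars (mult_op K) N"

lemma N'_simps: "carrier N' = carrier N" "\<zero>\<^bsub>N'\<^esub> = \<zero>\<^bsub>N\<^esub>" "x \<oplus>\<^bsub>N'\<^esub> y = x \<oplus>\<^bsub>N\<^esub> y" "a \<odot>\<^bsub>N'\<^esub> x = mult_op K a \<odot>\<^bsub>N\<^esub> x"
  by (rule restrict_scalars_simps)+

lemma abelian_N: "abelian_group N"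
  using N_module by (simp add: left_module_def)

lemma abelian_N': "abelian_group N'"
  by (rule restrict_scalars_abelian_group[OF abelian_N])

lemmas N_smult = left_module.smult_closed[OF N_module]
lemmas N_ldistr = left_module.smult_l_distr[OF N_module]
lemmas N_rdistr = left_module.smult_r_distr[OF N_module]
lemmas N_assoc = left_module.smult_assoc[OF N_module]
lemmas N_one = left_module.smult_one[OF N_module]

lemma tensor: "tensor_setting K L q N'"
  by (intro tensor_setting.intro tensor_setting_axioms.intro L.is_abelian_group abelian_N')
    (auto simp: N'_simps q_mem intro: N_smult DK_op)

abbreviation "V (s :: ('c \<Rightarrow> 'c) \<Rightarrow> ('c \<times> 'm \<Rightarrow>\<^sub>0 int) set \<Rightarrow> ('c \<times> 'm \<Rightarrow>\<^sub>0 int) set) \<equiv> tensor_module K L q N' s"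
abbreviation "t \<equiv> pure_tensor K L q N'"

lemmas abelian_V = tensor_setting.abelian_group_T[OF tensor]
lemmas t_mem = tensor_setting.t_mem[OF tensor, unfolded N'_simps]
lemmas t_add_left = tensor_setting.t_add_left[OF tensor, unfolded N'_simps]
lemmas t_add_right = tensor_setting.t_add_right[OF tensor, unfolded N'_simps]
lemmas t_balanced = tensor_setting.t_balanced[OF tensor, unfolded N'_simps]
lemmas V_induct = tensor_setting.tensor_induct[OF tensor, unfolded N'_simps, consumes 1, case_names diff pure]
lemmas V_map_eqI = tensor_setting.tensor_map_eqI[OF tensor, unfolded N'_simps]
lemmas V_universal = tensor_setting.tensor_universal[OF tensor, unfolded N'_simps]

lemma V_simps:
  "carrier (V s) = carrier (V s')" "\<zero>\<^bsub>V s\<^esub> = \<zero>\<^bsub>V s'\<^esub>" "x \<oplus>\<^bsub>V s\<^esub> y = x \<oplus>\<^bsub>V s'\<^esub> y" "Q \<odot>\<^bsub>V s\<^esub> x = s Q x"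
  by (simp_all add: tensor_module_def)

lemma t_left_map: "n \<in> carrier N \<Longrightarrow> additive_map L (V s) (\<lambda>l. t l n)"
  by (intro additive_mapI t_mem t_add_left)

lemma t_right_map: "l \<in> carrier L \<Longrightarrow> additive_map N (V s) (t l)"
  by (intro additive_mapI t_mem t_add_right)

lemma N_left_map: "n \<in> carrier N \<Longrightarrow> additive_map DK N (\<lambda>P. P \<odot>\<^bsub>N\<^esub> n)"
  by (intro additive_mapI N_smult N_ldistr)

text \<open>The i-th coefficient of the operator Q l, that is of \<open>Q\<close> after
  multiplication by l, in the decomposition of \<open>diffop_decomposition\<close>.\<close>

definition coeff_op :: "('c \<Rightarrow> 'c) \<Rightarrow> nat \<Rightarrow> 'c \<Rightarrow> 'a \<Rightarrow> 'a" where
  "coeff_op Q i l = tro (mult_op L (dv i) \<otimes>\<^bsub>DL\<^esub> (Q \<otimes>\<^bsub>DL\<^esub> mult_op L l))"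

lemma coeff_op_mem:
  "\<lbrakk>Q \<in> carrier DL; i < gdim; l \<in> carrier L\<rbrakk> \<Longrightarrow> mult_op L (dv i) \<otimes>\<^bsub>DL\<^esub> (Q \<otimes>\<^bsub>DL\<^esub> mult_op L l) \<in> carrier DL"
  by (intro DL_mult DL_op dv_mem)

lemma coeff_op_closed:
  "\<lbrakk>Q \<in> carrier DL; i < gdim; l \<in> carrier L\<rbrakk> \<Longrightarrow> coeff_op Q i l \<in> carrier DK"
  unfolding coeff_op_def by (intro tro_closed coeff_op_mem)

text \<open>The formula is forced: Q acts on l \<otimes> n as Q l acts on 1 \<otimes> n, and
  decomposing Q l moves coefficients from \<open>DK\<close> onto n. Only the additive structure of
  \<open>V\<close> enters, so its action slot is filled with \<open>undefined\<close>.\<close>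

definition act :: "('c \<Rightarrow> 'c) \<Rightarrow> ('c \<times> 'm \<Rightarrow>\<^sub>0 int) set \<Rightarrow> ('c \<times> 'm \<Rightarrow>\<^sub>0 int) set" where
  "act Q = (SOME h. additive_map (V undefined) (V undefined) h \<and> (\<forall>l\<in>carrier L. \<forall>n\<in>carrier N.
     h (t l n) = (\<Oplus>\<^bsub>V undefined\<^esub>i\<in>{..<gdim}. t (du i) (coeff_op Q i l \<odot>\<^bsub>N\<^esub> n))))"

lemma act_term_closed:
  assumes "Q \<in> carrier DL" "l \<in> carrier L" "n \<in> carrier N" "i < gdim"
  shows "t (du i) (coeff_op Q i l \<odot>\<^bsub>N\<^esub> n) \<in> carrier (V s)" and "coeff_op Q i l \<odot>\<^bsub>N\<^esub> n \<in> carrier N"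
  using assms by (auto intro!: t_mem du_mem N_smult coeff_op_closed)

text \<open>Well-definedness on the tensor product. Balancing holds because multiplication by q a is
  the extension of an operator of \<open>K\<close>, so it leaves \<open>tro\<close> as a right
  factor and then acts on n.\<close>

lemma act:
  assumes Q: "Q \<in> carrier DL"
  shows act_additive: "additive_map (V undefined) (V undefined) (act Q)"
    and act_pure: "l \<in> carrier L \<Longrightarrow> n \<in> carrier N \<Longrightarrow>
      act Q (t l n) = (\<Oplus>\<^bsub>V undefined\<^esub>i\<in>{..<gdim}. t (du i) (coeff_op Q i l \<odot>\<^bsub>N\<^esub> n))"
proof -
  let ?V = "V undefined"
  interpret V: abelian_group ?V by (rule abelian_V)
  interpret D: ring DL by (rule ring_DL)
  let ?f = "\<lambda>l n. \<Oplus>\<^bsub>?V\<^esub>i\<in>{..<gdim}. t (du i) (coeff_op Q i l \<odot>\<^bsub>N\<^esub> n)"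
  have "\<exists>h. additive_map ?V ?V h \<and> (\<forall>l\<in>carrier L. \<forall>n\<in>carrier N. h (t l n) = ?f l n)"
  proof (rule V_universal[OF abelian_V])
    fix l n assume l: "l \<in> carrier L" and n: "n \<in> carrier N"
    show "?f l n \<in> carrier ?V"
      using act_term_closed(1)[OF Q l n] by (intro V.finsum_closed) auto
    fix l' assume l': "l' \<in> carrier L"
    have "?f (l \<oplus>\<^bsub>L\<^esub> l') n = (\<Oplus>\<^bsub>?V\<^esub>i\<in>{..<gdim}. t (du i) (coeff_op Q i l \<odot>\<^bsub>N\<^esub> n) \<oplus>\<^bsub>?V\<^esub> t (du i) (coeff_op Q i l' \<odot>\<^bsub>N\<^esub> n))"
    proof (intro V.finsum_cong' refl)
      fix i assume "i \<in> {..<gdim}"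
      then have i: "i < gdim" by simp
      have "mult_op L (dv i) \<otimes>\<^bsub>DL\<^esub> (Q \<otimes>\<^bsub>DL\<^esub> mult_op L (l \<oplus>\<^bsub>L\<^esub> l')) =
          mult_op L (dv i) \<otimes>\<^bsub>DL\<^esub> (Q \<otimes>\<^bsub>DL\<^esub> mult_op L l) \<oplus>\<^bsub>DL\<^esub> mult_op L (dv i) \<otimes>\<^bsub>DL\<^esub> (Q \<otimes>\<^bsub>DL\<^esub> mult_op L l')"
        using Q DL_op[OF l] DL_op[OF l'] DL_op[OF dv_mem[OF i]] by (simp add: mult_op_add[OF l l'] D.r_distr)
      then have "coeff_op Q i (l \<oplus>\<^bsub>L\<^esub> l') = coeff_op Q i l \<oplus>\<^bsub>DK\<^esub> coeff_op Q i l'"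
        unfolding coeff_op_def using tro_add[OF coeff_op_mem[OF Q i l] coeff_op_mem[OF Q i l']] by simp
      then show "t (du i) (coeff_op Q i (l \<oplus>\<^bsub>L\<^esub> l') \<odot>\<^bsub>N\<^esub> n) = t (du i) (coeff_op Q i l \<odot>\<^bsub>N\<^esub> n) \<oplus>\<^bsub>?V\<^esub> t (du i) (coeff_op Q i l' \<odot>\<^bsub>N\<^esub> n)"
        using act_term_closed(2)[OF Q l n i] act_term_closed(2)[OF Q l' n i] du_mem[OF i]
        by (simp add: N_ldistr[OF coeff_op_closed[OF Q i l] coeff_op_closed[OF Q i l'] n] t_add_right[of _ _ _ undefined])
    qed (use act_term_closed(1)[OF Q l n] act_term_closed(1)[OF Q l' n] in auto)
    also have "\<dots> = ?f l n \<oplus>\<^bsub>?V\<^esub> ?f l' n"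
      using act_term_closed(1)[OF Q l n] act_term_closed(1)[OF Q l' n] by (intro V.finsum_addf) auto
    finally show "?f (l \<oplus>\<^bsub>L\<^esub> l') n = ?f l n \<oplus>\<^bsub>?V\<^esub> ?f l' n" .
  next
    fix l n n' assume l: "l \<in> carrier L" and n: "n \<in> carrier N" and n': "n' \<in> carrier N"
    have "?f l (n \<oplus>\<^bsub>N\<^esub> n') = (\<Oplus>\<^bsub>?V\<^esub>i\<in>{..<gdim}. t (du i) (coeff_op Q i l \<odot>\<^bsub>N\<^esub> n) \<oplus>\<^bsub>?V\<^esub> t (du i) (coeff_op Q i l \<odot>\<^bsub>N\<^esub> n'))"
    proof (intro V.finsum_cong' refl)
      fix i assume "i \<in> {..<gdim}"
      then have i: "i < gdim" by simp
      show "t (du i) (coeff_op Q i l \<odot>\<^bsub>N\<^esub> (n \<oplus>\<^bsub>N\<^esub> n')) = t (du i) (coeff_op Q i l \<odot>\<^bsub>N\<^esub> n) \<oplus>\<^bsub>?V\<^esub> t (du i) (coeff_op Q i l \<odot>\<^bsub>N\<^esub> n')"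
        using act_term_closed(2)[OF Q l n i] act_term_closed(2)[OF Q l n' i] du_mem[OF i]
        by (simp add: N_rdistr[OF coeff_op_closed[OF Q i l] n n'] t_add_right[of _ _ _ undefined])
    qed (use act_term_closed(1)[OF Q l n] act_term_closed(1)[OF Q l n'] in auto)
    also have "\<dots> = ?f l n \<oplus>\<^bsub>?V\<^esub> ?f l n'"
      using act_term_closed(1)[OF Q l n] act_term_closed(1)[OF Q l n'] by (intro V.finsum_addf) auto
    finally show "?f l (n \<oplus>\<^bsub>N\<^esub> n') = ?f l n \<oplus>\<^bsub>?V\<^esub> ?f l n'" .
  next
    fix l a n assume l: "l \<in> carrier L" and a: "a \<in> carrier K" and n: "n \<in> carrier N"
    show "?f (l \<otimes>\<^bsub>L\<^esub> q a) n = ?f l (mult_op K a \<odot>\<^bsub>N\<^esub> n)"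
    proof (intro V.finsum_cong' refl)
      fix i assume "i \<in> {..<gdim}"
      then have i: "i < gdim" by simp
      have "mult_op L (dv i) \<otimes>\<^bsub>DL\<^esub> (Q \<otimes>\<^bsub>DL\<^esub> mult_op L (l \<otimes>\<^bsub>L\<^esub> q a)) =
          mult_op L (dv i) \<otimes>\<^bsub>DL\<^esub> (Q \<otimes>\<^bsub>DL\<^esub> mult_op L l) \<otimes>\<^bsub>DL\<^esub> ext (mult_op K a)"
        using Q DL_op[OF l] DL_op[OF q_mem[OF a]] DL_op[OF dv_mem[OF i]]
        by (simp add: mult_op_mult[OF l q_mem[OF a]] ext_mult_op[OF a] D.m_assoc)
      then have "coeff_op Q i (l \<otimes>\<^bsub>L\<^esub> q a) = coeff_op Q i l \<otimes>\<^bsub>DK\<^esub> mult_op K a"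
        unfolding coeff_op_def using tro_mult_ext[OF coeff_op_mem[OF Q i l] DK_op[OF a]] by simp
      then show "t (du i) (coeff_op Q i (l \<otimes>\<^bsub>L\<^esub> q a) \<odot>\<^bsub>N\<^esub> n) = t (du i) (coeff_op Q i l \<odot>\<^bsub>N\<^esub> (mult_op K a \<odot>\<^bsub>N\<^esub> n))"
        by (simp add: N_assoc[OF coeff_op_closed[OF Q i l] DK_op[OF a] n])
    qed (use act_term_closed(1)[OF Q l N_smult[OF DK_op[OF a] n]] in auto)
  qed
  from someI_ex[OF this] show "additive_map ?V ?V (act Q)"
    "l \<in> carrier L \<Longrightarrow> n \<in> carrier N \<Longrightarrow> act Q (t l n) = ?f l n"
    unfolding act_def by auto
qed

lemma act_add:
  assumes Q: "Q \<in> carrier DL" and R: "R \<in> carrier DL" and x: "x \<in> carrier (V undefined)"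
  shows "act (Q \<oplus>\<^bsub>DL\<^esub> R) x = act Q x \<oplus>\<^bsub>V undefined\<^esub> act R x"
proof (rule V_map_eqI[OF abelian_V _ _ _ x])
  let ?V = "V undefined"
  interpret V: abelian_group ?V by (rule abelian_V)
  interpret D: ring DL by (rule ring_DL)
  show "additive_map ?V ?V (act (Q \<oplus>\<^bsub>DL\<^esub> R))" by (rule act_additive[OF DL_add[OF Q R]])
  show "additive_map ?V ?V (\<lambda>x. act Q x \<oplus>\<^bsub>?V\<^esub> act R x)"
    using additive_mapD[OF act_additive[OF Q]] additive_mapD[OF act_additive[OF R]]
    by (intro additive_mapI) (auto simp: V.a_ac)
  fix l n assume l: "l \<in> carrier L" and n: "n \<in> carrier N"
  have "act (Q \<oplus>\<^bsub>DL\<^esub> R) (t l n) = (\<Oplus>\<^bsub>?V\<^esub>i\<in>{..<gdim}. t (du i) (coeff_op Q i l \<odot>\<^bsub>N\<^esub> n) \<oplus>\<^bsub>?V\<^esub> t (du i) (coeff_op R i l \<odot>\<^bsub>N\<^esub> n))"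
    unfolding act_pure[OF DL_add[OF Q R] l n]
  proof (intro V.finsum_cong' refl)
    fix i assume "i \<in> {..<gdim}"
    then have i: "i < gdim" by simp
    have "mult_op L (dv i) \<otimes>\<^bsub>DL\<^esub> ((Q \<oplus>\<^bsub>DL\<^esub> R) \<otimes>\<^bsub>DL\<^esub> mult_op L l) =
        mult_op L (dv i) \<otimes>\<^bsub>DL\<^esub> (Q \<otimes>\<^bsub>DL\<^esub> mult_op L l) \<oplus>\<^bsub>DL\<^esub> mult_op L (dv i) \<otimes>\<^bsub>DL\<^esub> (R \<otimes>\<^bsub>DL\<^esub> mult_op L l)"
      using Q R DL_op[OF l] DL_op[OF dv_mem[OF i]] by (simp add: D.r_distr D.l_distr)
    then have "coeff_op (Q \<oplus>\<^bsub>DL\<^esub> R) i l = coeff_op Q i l \<oplus>\<^bsub>DK\<^esub> coeff_op R i l"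
      unfolding coeff_op_def using tro_add[OF coeff_op_mem[OF Q i l] coeff_op_mem[OF R i l]] by simp
    then show "t (du i) (coeff_op (Q \<oplus>\<^bsub>DL\<^esub> R) i l \<odot>\<^bsub>N\<^esub> n) = t (du i) (coeff_op Q i l \<odot>\<^bsub>N\<^esub> n) \<oplus>\<^bsub>?V\<^esub> t (du i) (coeff_op R i l \<odot>\<^bsub>N\<^esub> n)"
      using act_term_closed(2)[OF Q l n i] act_term_closed(2)[OF R l n i] du_mem[OF i]
      by (simp add: N_ldistr[OF coeff_op_closed[OF Q i l] coeff_op_closed[OF R i l] n] t_add_right[of _ _ _ undefined])
  qed (use act_term_closed(1)[OF Q l n] act_term_closed(1)[OF R l n] in auto)
  also have "\<dots> = act Q (t l n) \<oplus>\<^bsub>?V\<^esub> act R (t l n)"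
    unfolding act_pure[OF Q l n] act_pure[OF R l n]
    using act_term_closed(1)[OF Q l n] act_term_closed(1)[OF R l n] by (intro V.finsum_addf) auto
  finally show "act (Q \<oplus>\<^bsub>DL\<^esub> R) (t l n) = act Q (t l n) \<oplus>\<^bsub>?V\<^esub> act R (t l n)" .
qed

text \<open>On a pure tensor the iterated action is a double sum over matrix coefficients;
  \<open>tro_compose\<close> with A = v_i Q and B = R l is the matrix product rule that contracts
  it.\<close>

lemma act_mult:
  assumes Q: "Q \<in> carrier DL" and R: "R \<in> carrier DL" and x: "x \<in> carrier (V undefined)"
  shows "act (Q \<otimes>\<^bsub>DL\<^esub> R) x = act Q (act R x)"
proof (rule V_map_eqI[OF abelian_V _ _ _ x])
  let ?V = "V undefined"
  interpret V: abelian_group ?V by (rule abelian_V)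
  interpret D: ring DL by (rule ring_DL)
  interpret DK: ring DK by (rule ring_DK)
  note QR = DL_mult[OF Q R]
  show "additive_map ?V ?V (act (Q \<otimes>\<^bsub>DL\<^esub> R))" by (rule act_additive[OF QR])
  show "additive_map ?V ?V (\<lambda>x. act Q (act R x))"
    using additive_mapD[OF act_additive[OF Q]] additive_mapD[OF act_additive[OF R]]
    by (intro additive_mapI) auto
  fix l n assume l: "l \<in> carrier L" and n: "n \<in> carrier N"
  let ?c = "\<lambda>i j. coeff_op Q i (du j)" and ?d = "\<lambda>j. coeff_op R j l"
  have cm: "?c i j \<in> carrier DK" if "i < gdim" "j < gdim" for i j using that Q du_mem coeff_op_closed by auto
  have dm: "?d j \<in> carrier DK" if "j < gdim" for j using that R l coeff_op_closed by auto
  have tm: "t (du i) (?c i j \<odot>\<^bsub>N\<^esub> (?d j \<odot>\<^bsub>N\<^esub> n)) \<in> carrier ?V" if "i < gdim" "j < gdim" for i j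
    using that n by (intro t_mem N_smult cm dm du_mem)
  have "act Q (act R (t l n)) = act Q (\<Oplus>\<^bsub>?V\<^esub>j\<in>{..<gdim}. t (du j) (?d j \<odot>\<^bsub>N\<^esub> n))"
    by (simp only: act_pure[OF R l n])
  also have "\<dots> = (\<Oplus>\<^bsub>?V\<^esub>j\<in>{..<gdim}. act Q (t (du j) (?d j \<odot>\<^bsub>N\<^esub> n)))"
    using act_term_closed(1)[OF R l n] by (intro additive_map_finsum[OF abelian_V abelian_V act_additive[OF Q]]) auto
  also have "\<dots> = (\<Oplus>\<^bsub>?V\<^esub>j\<in>{..<gdim}. \<Oplus>\<^bsub>?V\<^esub>i\<in>{..<gdim}. t (du i) (?c i j \<odot>\<^bsub>N\<^esub> (?d j \<odot>\<^bsub>N\<^esub> n)))"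
  proof (intro V.finsum_cong' refl)
    fix j assume "j \<in> {..<gdim}"
    then show "act Q (t (du j) (?d j \<odot>\<^bsub>N\<^esub> n)) = (\<Oplus>\<^bsub>?V\<^esub>i\<in>{..<gdim}. t (du i) (?c i j \<odot>\<^bsub>N\<^esub> (?d j \<odot>\<^bsub>N\<^esub> n)))"
      using act_term_closed(2)[OF R l n] by (intro act_pure[OF Q] du_mem) auto
  qed (use tm in \<open>auto intro!: V.finsum_closed\<close>)
  also have "\<dots> = (\<Oplus>\<^bsub>?V\<^esub>i\<in>{..<gdim}. \<Oplus>\<^bsub>?V\<^esub>j\<in>{..<gdim}. t (du i) (?c i j \<odot>\<^bsub>N\<^esub> (?d j \<odot>\<^bsub>N\<^esub> n)))"
    using tm by (intro V.finsum_swap) auto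
  also have "\<dots> = (\<Oplus>\<^bsub>?V\<^esub>i\<in>{..<gdim}. t (du i) (coeff_op (Q \<otimes>\<^bsub>DL\<^esub> R) i l \<odot>\<^bsub>N\<^esub> n))"
  proof (intro V.finsum_cong' refl)
    fix i assume "i \<in> {..<gdim}"
    then have i: "i < gdim" by simp
    let ?A = "mult_op L (dv i) \<otimes>\<^bsub>DL\<^esub> Q" and ?B = "R \<otimes>\<^bsub>DL\<^esub> mult_op L l"
    have AB: "?A \<in> carrier DL" "?B \<in> carrier DL" using i Q R l by (auto intro!: DL_mult DL_op dv_mem)
    have "coeff_op (Q \<otimes>\<^bsub>DL\<^esub> R) i l = tro (?A \<otimes>\<^bsub>DL\<^esub> ?B)"
      unfolding coeff_op_def using Q R DL_op[OF l] DL_op[OF dv_mem[OF i]] by (simp add: D.m_assoc)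
    also have "\<dots> = (\<Oplus>\<^bsub>DK\<^esub>j\<in>{..<gdim}. tro (?A \<otimes>\<^bsub>DL\<^esub> mult_op L (du j)) \<otimes>\<^bsub>DK\<^esub> tro (mult_op L (dv j) \<otimes>\<^bsub>DL\<^esub> ?B))"
      by (rule tro_compose[OF AB, symmetric])
    also have "\<dots> = (\<Oplus>\<^bsub>DK\<^esub>j\<in>{..<gdim}. ?c i j \<otimes>\<^bsub>DK\<^esub> ?d j)"
    proof (intro DK.finsum_cong' refl)
      fix j assume "j \<in> {..<gdim}"
      then have j: "j < gdim" by simp
      show "tro (?A \<otimes>\<^bsub>DL\<^esub> mult_op L (du j)) \<otimes>\<^bsub>DK\<^esub> tro (mult_op L (dv j) \<otimes>\<^bsub>DL\<^esub> ?B) = ?c i j \<otimes>\<^bsub>DK\<^esub> ?d j"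
        unfolding coeff_op_def using Q DL_op[OF dv_mem[OF i]] DL_op[OF du_mem[OF j]] by (simp add: D.m_assoc)
    qed (use cm dm i in auto)
    finally have "coeff_op (Q \<otimes>\<^bsub>DL\<^esub> R) i l \<odot>\<^bsub>N\<^esub> n = (\<Oplus>\<^bsub>DK\<^esub>j\<in>{..<gdim}. ?c i j \<otimes>\<^bsub>DK\<^esub> ?d j) \<odot>\<^bsub>N\<^esub> n" by simp
    also have "\<dots> = (\<Oplus>\<^bsub>N\<^esub>j\<in>{..<gdim}. (?c i j \<otimes>\<^bsub>DK\<^esub> ?d j) \<odot>\<^bsub>N\<^esub> n)"
      using cm dm i by (intro additive_map_finsum[OF DK.is_abelian_group abelian_N N_left_map[OF n]]) auto
    finally have "t (du i) (coeff_op (Q \<otimes>\<^bsub>DL\<^esub> R) i l \<odot>\<^bsub>N\<^esub> n) = t (du i) (\<Oplus>\<^bsub>N\<^esub>j\<in>{..<gdim}. (?c i j \<otimes>\<^bsub>DK\<^esub> ?d j) \<odot>\<^bsub>N\<^esub> n)"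
      by simp
    also have "\<dots> = (\<Oplus>\<^bsub>?V\<^esub>j\<in>{..<gdim}. t (du i) ((?c i j \<otimes>\<^bsub>DK\<^esub> ?d j) \<odot>\<^bsub>N\<^esub> n))"
      using cm dm i n by (intro additive_map_finsum[OF abelian_N abelian_V t_right_map[OF du_mem[OF i]]]) (auto intro!: N_smult)
    also have "\<dots> = (\<Oplus>\<^bsub>?V\<^esub>j\<in>{..<gdim}. t (du i) (?c i j \<odot>\<^bsub>N\<^esub> (?d j \<odot>\<^bsub>N\<^esub> n)))"
      using cm dm i n tm by (intro V.finsum_cong' refl) (auto simp: N_assoc)
    finally show "(\<Oplus>\<^bsub>?V\<^esub>j\<in>{..<gdim}. t (du i) (?c i j \<odot>\<^bsub>N\<^esub> (?d j \<odot>\<^bsub>N\<^esub> n))) = t (du i) (coeff_op (Q \<otimes>\<^bsub>DL\<^esub> R) i l \<odot>\<^bsub>N\<^esub> n)"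
      by simp
  qed (use act_term_closed(1)[OF QR l n] in auto)
  also have "\<dots> = act (Q \<otimes>\<^bsub>DL\<^esub> R) (t l n)" by (rule act_pure[OF QR l n, symmetric])
  finally show "act (Q \<otimes>\<^bsub>DL\<^esub> R) (t l n) = act Q (act R (t l n))" by simp
qed

text \<open>For a multiplication, \<open>tro\<close> is multiplication by the trace, an element of
  \<open>K\<close>; it is moved across the tensor sign, and \<open>expand_u\<close> collects the
  left factors into l.\<close>

lemma trace_expansion:
  assumes l: "l \<in> carrier L" and n: "n \<in> carrier N"
  shows "(\<Oplus>\<^bsub>V s\<^esub>i\<in>{..<gdim}. t (du i) (tro (mult_op L (dv i \<otimes>\<^bsub>L\<^esub> l)) \<odot>\<^bsub>N\<^esub> n)) = t l n"
proof -
  interpret V: abelian_group "V s" by (rule abelian_V)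
  have "(\<Oplus>\<^bsub>V s\<^esub>i\<in>{..<gdim}. t (du i) (tro (mult_op L (dv i \<otimes>\<^bsub>L\<^esub> l)) \<odot>\<^bsub>N\<^esub> n)) =
      (\<Oplus>\<^bsub>V s\<^esub>i\<in>{..<gdim}. t (du i \<otimes>\<^bsub>L\<^esub> tr (dv i \<otimes>\<^bsub>L\<^esub> l)) n)"
  proof (intro V.finsum_cong' refl)
    fix i assume "i \<in> {..<gdim}"
    then have i: "i < gdim" by simp
    have y: "dv i \<otimes>\<^bsub>L\<^esub> l \<in> carrier L" using l dv_mem[OF i] by simp
    obtain a where a: "a \<in> carrier K" "q a = tr (dv i \<otimes>\<^bsub>L\<^esub> l)" using tr_in_K[OF y] by auto
    show "t (du i) (tro (mult_op L (dv i \<otimes>\<^bsub>L\<^esub> l)) \<odot>\<^bsub>N\<^esub> n) = t (du i \<otimes>\<^bsub>L\<^esub> tr (dv i \<otimes>\<^bsub>L\<^esub> l)) n"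
      unfolding tro_mult_op[OF y a] using t_balanced[OF du_mem[OF i] a(1) n] a(2) by simp
  qed (use l n in \<open>auto intro!: t_mem simp: du_mem dv_mem tr_closed\<close>)
  also have "\<dots> = t (\<Oplus>\<^bsub>L\<^esub>i\<in>{..<gdim}. du i \<otimes>\<^bsub>L\<^esub> tr (dv i \<otimes>\<^bsub>L\<^esub> l)) n"
    using l by (intro additive_map_finsum[OF L.is_abelian_group abelian_V t_left_map[OF n], symmetric])
      (auto simp: du_mem dv_mem tr_closed)
  also have "\<dots> = t l n" by (simp only: expand_u[OF l])
  finally show ?thesis .
qed

lemma act_mult_op:
  assumes f: "f \<in> carrier L" and l: "l \<in> carrier L" and n: "n \<in> carrier N"
  shows "act (mult_op L f) (t l n) = t (f \<otimes>\<^bsub>L\<^esub> l) n"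
proof -
  interpret V: abelian_group "V undefined" by (rule abelian_V)
  have "act (mult_op L f) (t l n) = (\<Oplus>\<^bsub>V undefined\<^esub>i\<in>{..<gdim}. t (du i) (tro (mult_op L (dv i \<otimes>\<^bsub>L\<^esub> (f \<otimes>\<^bsub>L\<^esub> l))) \<odot>\<^bsub>N\<^esub> n))"
    unfolding act_pure[OF DL_op[OF f] l n] coeff_op_def
    using f l n by (intro V.finsum_cong' refl) (auto simp: mult_op_mult dv_mem du_mem intro!: t_mem N_smult tro_closed DL_mult DL_op)
  also have "\<dots> = t (f \<otimes>\<^bsub>L\<^esub> l) n" using f l n by (intro trace_expansion) auto
  finally show ?thesis .
qed

text \<open>\<open>ext P\<close> leaves \<open>tro\<close> as a right factor P, which acts on n
  before the coefficients do; what remains is the trace expansion with l = 1.\<close>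

lemma act_ext:
  assumes P: "P \<in> carrier DK" and n: "n \<in> carrier N"
  shows "act (ext P) (t \<one>\<^bsub>L\<^esub> n) = t \<one>\<^bsub>L\<^esub> (P \<odot>\<^bsub>N\<^esub> n)"
proof -
  interpret V: abelian_group "V undefined" by (rule abelian_V)
  interpret D: ring DL by (rule ring_DL)
  have "act (ext P) (t \<one>\<^bsub>L\<^esub> n) = (\<Oplus>\<^bsub>V undefined\<^esub>i\<in>{..<gdim}. t (du i) (tro (mult_op L (dv i \<otimes>\<^bsub>L\<^esub> \<one>\<^bsub>L\<^esub>)) \<odot>\<^bsub>N\<^esub> (P \<odot>\<^bsub>N\<^esub> n)))"
    unfolding act_pure[OF ext(1)[OF P] L.one_closed n]
  proof (intro V.finsum_cong' refl)
    fix i assume "i \<in> {..<gdim}"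
    then have i: "i < gdim" by simp
    have "coeff_op (ext P) i \<one>\<^bsub>L\<^esub> = tro (mult_op L (dv i)) \<otimes>\<^bsub>DK\<^esub> P"
      unfolding coeff_op_def using tro_mult_ext[OF DL_op[OF dv_mem[OF i]] P] ext(1)[OF P]
      by (simp flip: one_DL)
    then show "t (du i) (coeff_op (ext P) i \<one>\<^bsub>L\<^esub> \<odot>\<^bsub>N\<^esub> n) = t (du i) (tro (mult_op L (dv i \<otimes>\<^bsub>L\<^esub> \<one>\<^bsub>L\<^esub>)) \<odot>\<^bsub>N\<^esub> (P \<odot>\<^bsub>N\<^esub> n))"
      using dv_mem[OF i] by (simp add: N_assoc[OF tro_closed[OF DL_op[OF dv_mem[OF i]]] P n])
  qed (use n P in \<open>auto intro!: t_mem N_smult tro_closed DL_op simp: du_mem dv_mem\<close>)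
  also have "\<dots> = t \<one>\<^bsub>L\<^esub> (P \<odot>\<^bsub>N\<^esub> n)" using P n by (intro trace_expansion N_smult) auto
  finally show ?thesis .
qed

text \<open>Guarantees that the choice in \<open>inverse_image\<close> is made among existing
  actions. Afterwards an arbitrary action with the characterizing property is studied.\<close>

lemma inverse_image_action_act: "inverse_image_action k K L q N act"
proof -
  have mod: "left_module DL (V act)"
  proof (intro left_module.intro left_module_axioms.intro ring_DL abelian_V; unfold V_simps(4) V_simps(1)[of act undefined] V_simps(3)[of act _ _ undefined])
    fix x assume x: "x \<in> carrier (V undefined)"
    have one: "\<one>\<^bsub>DL\<^esub> \<in> carrier DL" using ring.ring_simprules(6)[OF ring_DL] .
    show "act \<one>\<^bsub>DL\<^esub> x = x"
    proof (rule V_map_eqI[OF abelian_V act_additive[OF one] _ _ x])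
      show "additive_map (V undefined) (V undefined) (\<lambda>x. x)" by (rule additive_mapI) auto
      show "act \<one>\<^bsub>DL\<^esub> (t l n) = t l n" if "l \<in> carrier L" "n \<in> carrier N" for l n
        using act_mult_op[OF L.one_closed that] that by (simp add: one_DL)
    qed
  qed (rule act_add act_mult additive_mapD[OF act_additive]; assumption)+
  then show ?thesis
    unfolding inverse_image_action_def Let_def
    by (auto simp: act_mult_op act_ext[unfolded ext_def])
qed

end

section \<open>Isotypic decomposition under a semilinear group action\<close>

lemma image_cancel:
  assumes "\<And>x. x \<in> C \<Longrightarrow> h (f x) = x" "Y \<subseteq> C"
  shows "h ` f ` Y = Y"
proof -
  have "(\<lambda>x. h (f x)) ` Y = (\<lambda>x. x) ` Y"
    using assms by (intro image_cong) auto
  then show ?thesis by (simp add: image_image)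
qed

context left_module
begin

lemma smult_left_map: "x \<in> carrier M \<Longrightarrow> additive_map R M (\<lambda>a. a \<odot>\<^bsub>M\<^esub> x)"
  by (intro additive_mapI smult_closed smult_l_distr)

lemma smult_right_map: "a \<in> carrier R \<Longrightarrow> additive_map M M (\<lambda>x. a \<odot>\<^bsub>M\<^esub> x)"
  by (intro additive_mapI smult_closed smult_r_distr)

lemma smult_minus_one: "x \<in> carrier M \<Longrightarrow> (\<ominus>\<^bsub>R\<^esub> \<one>\<^bsub>R\<^esub>) \<odot>\<^bsub>M\<^esub> x = \<ominus>\<^bsub>M\<^esub> x"
  using additive_map_minus[OF R.is_abelian_group M.abelian_group_axioms smult_left_map R.one_closed, of x] smult_one[of x] by simp

lemma smult_zero: "a \<in> carrier R \<Longrightarrow> a \<odot>\<^bsub>M\<^esub> \<zero>\<^bsub>M\<^esub> = \<zero>\<^bsub>M\<^esub>"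
  by (rule additive_map_zero[OF M.abelian_group_axioms M.abelian_group_axioms smult_right_map])

lemma smult_finsum:
  assumes "a \<in> carrier R" "finite I" "\<And>i. i \<in> I \<Longrightarrow> f i \<in> carrier M"
  shows "a \<odot>\<^bsub>M\<^esub> (\<Oplus>\<^bsub>M\<^esub>i\<in>I. f i) = (\<Oplus>\<^bsub>M\<^esub>i\<in>I. a \<odot>\<^bsub>M\<^esub> f i)"
  by (rule additive_map_finsum[OF M.abelian_group_axioms M.abelian_group_axioms smult_right_map]) (use assms in auto)

text \<open>Negatives are multiples by -1, so the subgroup condition reduces to zero and
  sums.\<close>

lemma submodule_iff:
  "submodule W R M \<longleftrightarrow> W \<subseteq> carrier M \<and> \<zero>\<^bsub>M\<^esub> \<in> W \<and> (\<forall>x\<in>W. \<forall>y\<in>W. x \<oplus>\<^bsub>M\<^esub> y \<in> W) \<and>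
     (\<forall>a\<in>carrier R. \<forall>x\<in>W. a \<odot>\<^bsub>M\<^esub> x \<in> W)"
proof
  assume "submodule W R M"
  then interpret W: submodule W R M .
  show "W \<subseteq> carrier M \<and> \<zero>\<^bsub>M\<^esub> \<in> W \<and> (\<forall>x\<in>W. \<forall>y\<in>W. x \<oplus>\<^bsub>M\<^esub> y \<in> W) \<and> (\<forall>a\<in>carrier R. \<forall>x\<in>W. a \<odot>\<^bsub>M\<^esub> x \<in> W)"
    using W.subset W.one_closed W.m_closed W.smult_closed by auto
next
  assume W: "W \<subseteq> carrier M \<and> \<zero>\<^bsub>M\<^esub> \<in> W \<and> (\<forall>x\<in>W. \<forall>y\<in>W. x \<oplus>\<^bsub>M\<^esub> y \<in> W) \<and> (\<forall>a\<in>carrier R. \<forall>x\<in>W. a \<odot>\<^bsub>M\<^esub> x \<in> W)"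
  have "\<ominus>\<^bsub>M\<^esub> x \<in> W" if "x \<in> W" for x
  proof -
    have "(\<ominus>\<^bsub>R\<^esub> \<one>\<^bsub>R\<^esub>) \<odot>\<^bsub>M\<^esub> x \<in> W" using W that by blast
    then show ?thesis using smult_minus_one[of x] W that by (metis subsetD)
  qed
  then show "submodule W R M"
    using W by (intro submodule.intro subgroup.intro submodule_axioms.intro) (auto simp: a_inv_def)
qed

lemma submoduleD:
  assumes "submodule W R M"
  shows "x \<in> W \<Longrightarrow> x \<in> carrier M" and "\<zero>\<^bsub>M\<^esub> \<in> W" and "x \<in> W \<Longrightarrow> y \<in> W \<Longrightarrow> x \<oplus>\<^bsub>M\<^esub> y \<in> W"
    and "a \<in> carrier R \<Longrightarrow> x \<in> W \<Longrightarrow> a \<odot>\<^bsub>M\<^esub> x \<in> W" and "x \<in> W \<Longrightarrow> \<ominus>\<^bsub>M\<^esub> x \<in> W"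
proof -
  note W = assms[unfolded submodule_iff]
  show "x \<in> W \<Longrightarrow> x \<in> carrier M" and "\<zero>\<^bsub>M\<^esub> \<in> W" and "x \<in> W \<Longrightarrow> y \<in> W \<Longrightarrow> x \<oplus>\<^bsub>M\<^esub> y \<in> W"
    "a \<in> carrier R \<Longrightarrow> x \<in> W \<Longrightarrow> a \<odot>\<^bsub>M\<^esub> x \<in> W" using W by auto
  assume x: "x \<in> W"
  then have "(\<ominus>\<^bsub>R\<^esub> \<one>\<^bsub>R\<^esub>) \<odot>\<^bsub>M\<^esub> x \<in> W" using W by blast
  then show "\<ominus>\<^bsub>M\<^esub> x \<in> W" using smult_minus_one[of x] W x by (metis subsetD)
qed

lemma submoduleI:
  assumes "\<And>x. x \<in> W \<Longrightarrow> x \<in> carrier M" "\<zero>\<^bsub>M\<^esub> \<in> W" "\<And>x y. x \<in> W \<Longrightarrow> y \<in> W \<Longrightarrow> x \<oplus>\<^bsub>M\<^esub> y \<in> W"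
    "\<And>a x. a \<in> carrier R \<Longrightarrow> x \<in> W \<Longrightarrow> a \<odot>\<^bsub>M\<^esub> x \<in> W"
  shows "submodule W R M"
  using assms unfolding submodule_iff by blast

lemma submodule_finsum:
  assumes W: "submodule W R M" and "finite I" "\<And>i. i \<in> I \<Longrightarrow> f i \<in> W"
  shows "(\<Oplus>\<^bsub>M\<^esub>i\<in>I. f i) \<in> W"
  using assms(2,3)
proof (induction I)
  case (insert x F)
  then show ?case
    using submoduleD[OF W] by (subst M.finsum_insert) auto
qed (simp add: submoduleD[OF W])

lemma submodule_inter: "submodule W R M \<Longrightarrow> submodule W' R M \<Longrightarrow> submodule (W \<inter> W') R M"
  unfolding submodule_iff by blast

lemma submodule_left_module:
  assumes W: "submodule W R M"
  shows "left_module R (M\<lparr>carrier := W\<rparr>)"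
proof -
  note D = submoduleD[OF W]
  have "abelian_group (M\<lparr>carrier := W\<rparr>)"
  proof (rule abelian_groupI)
    fix x assume "x \<in> carrier (M\<lparr>carrier := W\<rparr>)"
    then have "\<ominus>\<^bsub>M\<^esub> x \<in> W" "x \<in> carrier M" using D by auto
    then show "\<exists>y\<in>carrier (M\<lparr>carrier := W\<rparr>). y \<oplus>\<^bsub>M\<lparr>carrier := W\<rparr>\<^esub> x = \<zero>\<^bsub>M\<lparr>carrier := W\<rparr>\<^esub>"
      by (intro bexI[of _ "\<ominus>\<^bsub>M\<^esub> x"]) (auto simp: M.l_neg)
  qed (use D in \<open>auto intro: M.a_assoc M.a_comm\<close>)
  then show ?thesis
    using D by (intro left_module.intro left_module_axioms.intro R.ring_axioms)
      (auto simp: smult_l_distr smult_r_distr smult_assoc smult_one)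
qed

text \<open>All modules to be compared are submodules of the one module \<open>M\<close>, so
  linearity is expressed for maps between subsets of it.\<close>

definition lin_on :: "'m set \<Rightarrow> 'm set \<Rightarrow> ('m \<Rightarrow> 'm) \<Rightarrow> bool" where
  "lin_on A B f \<longleftrightarrow> f \<in> A \<rightarrow> B \<and> (\<forall>x\<in>A. \<forall>y\<in>A. f (x \<oplus>\<^bsub>M\<^esub> y) = f x \<oplus>\<^bsub>M\<^esub> f y) \<and>
     (\<forall>a\<in>carrier R. \<forall>x\<in>A. f (a \<odot>\<^bsub>M\<^esub> x) = a \<odot>\<^bsub>M\<^esub> f x)"

lemma lin_onI:
  assumes "\<And>x. x \<in> A \<Longrightarrow> f x \<in> B" "\<And>x y. x \<in> A \<Longrightarrow> y \<in> A \<Longrightarrow> f (x \<oplus>\<^bsub>M\<^esub> y) = f x \<oplus>\<^bsub>M\<^esub> f y"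
    "\<And>a x. a \<in> carrier R \<Longrightarrow> x \<in> A \<Longrightarrow> f (a \<odot>\<^bsub>M\<^esub> x) = a \<odot>\<^bsub>M\<^esub> f x"
  shows "lin_on A B f"
  using assms unfolding lin_on_def by auto

lemma lin_onD:
  assumes "lin_on A B f"
  shows "x \<in> A \<Longrightarrow> f x \<in> B" "x \<in> A \<Longrightarrow> y \<in> A \<Longrightarrow> f (x \<oplus>\<^bsub>M\<^esub> y) = f x \<oplus>\<^bsub>M\<^esub> f y"
    "a \<in> carrier R \<Longrightarrow> x \<in> A \<Longrightarrow> f (a \<odot>\<^bsub>M\<^esub> x) = a \<odot>\<^bsub>M\<^esub> f x"
  using assms unfolding lin_on_def by auto

definition iso_sub :: "'m set \<Rightarrow> 'm set \<Rightarrow> bool" where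
  "iso_sub A B \<longleftrightarrow> (\<exists>f. lin_on A B f \<and> bij_betw f A B)"

definition minimal :: "'m set \<Rightarrow> bool" where
  "minimal W \<longleftrightarrow> submodule W R M \<and> W \<noteq> {\<zero>\<^bsub>M\<^esub>} \<and>
     (\<forall>H. submodule H R M \<and> H \<subseteq> W \<longrightarrow> H = {\<zero>\<^bsub>M\<^esub>} \<or> H = W)"

lemma minimalD:
  assumes "minimal W"
  shows "submodule W R M" "W \<noteq> {\<zero>\<^bsub>M\<^esub>}" "submodule H R M \<Longrightarrow> H \<subseteq> W \<Longrightarrow> H = {\<zero>\<^bsub>M\<^esub>} \<or> H = W"
  using assms unfolding minimal_def by auto

lemma iso_sub_trans: "iso_sub A B \<Longrightarrow> iso_sub B C \<Longrightarrow> iso_sub A C"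
proof -
  assume "iso_sub A B" "iso_sub B C"
  then obtain f g where f: "lin_on A B f" "bij_betw f A B" and g: "lin_on B C g" "bij_betw g B C"
    unfolding iso_sub_def by auto
  have "lin_on A C (g \<circ> f)"
    using lin_onD[OF f(1)] lin_onD[OF g(1)] by (intro lin_onI) auto
  then show ?thesis
    unfolding iso_sub_def using bij_betw_trans[OF f(2) g(2)] by blast
qed

lemma iso_sub_sym:
  assumes "iso_sub A B" "submodule A R M"
  shows "iso_sub B A"
proof -
  obtain f where f: "lin_on A B f" "bij_betw f A B" using assms(1) unfolding iso_sub_def by auto
  let ?g = "inv_into A f"
  have g: "?g y \<in> A" "f (?g y) = y" if "y \<in> B" for y
    using f(2) that by (auto simp: bij_betw_def inv_into_into f_inv_into_f)
  have gI: "?g y = x" if "x \<in> A" "f x = y" for x y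
    using f(2) that by (auto simp: bij_betw_def inv_into_f_f)
  have "lin_on B A ?g"
  proof (rule lin_onI)
    fix x y assume xy: "x \<in> B" "y \<in> B"
    then show "?g (x \<oplus>\<^bsub>M\<^esub> y) = ?g x \<oplus>\<^bsub>M\<^esub> ?g y"
      using g submoduleD(3)[OF assms(2)] lin_onD(2)[OF f(1)] by (intro gI) auto
  next
    fix a x assume "a \<in> carrier R" "x \<in> B"
    then show "?g (a \<odot>\<^bsub>M\<^esub> x) = a \<odot>\<^bsub>M\<^esub> ?g x"
      using g submoduleD(4)[OF assms(2)] lin_onD(3)[OF f(1)] by (intro gI) auto
  qed (use g in auto)
  then show ?thesis
    unfolding iso_sub_def using bij_betw_inv_into[OF f(2)] by blast
qed

text \<open>Kernel and image of \<open>f\<close> are submodules of minimal submodules; the point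
  \<open>x\<close> rules out a full kernel and a zero image.\<close>

lemma schur:
  assumes A: "minimal A" and B: "minimal B" and f: "lin_on A B f" and x: "x \<in> A" "f x \<noteq> \<zero>\<^bsub>M\<^esub>"
  shows "bij_betw f A B"
proof -
  note DA = submoduleD[OF minimalD(1)[OF A]] and DB = submoduleD[OF minimalD(1)[OF B]]
  have f0: "f \<zero>\<^bsub>M\<^esub> = \<zero>\<^bsub>M\<^esub>"
  proof -
    have z: "\<zero>\<^bsub>R\<^esub> \<odot>\<^bsub>M\<^esub> y = \<zero>\<^bsub>M\<^esub>" if "y \<in> carrier M" for y
      by (rule additive_map_zero[OF R.is_abelian_group M.abelian_group_axioms smult_left_map[OF that]])
    have "f (\<zero>\<^bsub>R\<^esub> \<odot>\<^bsub>M\<^esub> \<zero>\<^bsub>M\<^esub>) = \<zero>\<^bsub>R\<^esub> \<odot>\<^bsub>M\<^esub> f \<zero>\<^bsub>M\<^esub>" using lin_onD(3)[OF f] DA(2) by auto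
    then show ?thesis using z DB(1) lin_onD(1)[OF f DA(2)] by simp
  qed
  let ?K = "{y \<in> A. f y = \<zero>\<^bsub>M\<^esub>}"
  have "submodule ?K R M"
    using DA f0 by (intro submoduleI) (auto simp: lin_onD[OF f] smult_zero)
  then have "?K = {\<zero>\<^bsub>M\<^esub>}"
    using minimalD(3)[OF A, of ?K] x by blast
  moreover have "inj_on f A"
  proof (rule inj_onI)
    fix y z assume yz: "y \<in> A" "z \<in> A" "f y = f z"
    have nz: "\<ominus>\<^bsub>M\<^esub> z \<in> A" using DA(5) yz by auto
    have "f (\<ominus>\<^bsub>M\<^esub> z) = \<ominus>\<^bsub>M\<^esub> f z"
    proof -
      have m1: "\<ominus>\<^bsub>R\<^esub> \<one>\<^bsub>R\<^esub> \<in> carrier R" by simp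
      show ?thesis
        using lin_onD(3)[OF f m1 yz(2)] smult_minus_one[OF DA(1)[OF yz(2)]] smult_minus_one[OF DB(1)[OF lin_onD(1)[OF f yz(2)]]] by simp
    qed
    then have "f (y \<oplus>\<^bsub>M\<^esub> \<ominus>\<^bsub>M\<^esub> z) = \<zero>\<^bsub>M\<^esub>"
      using yz nz lin_onD(1,2)[OF f] DB(1) by (simp add: M.r_neg)
    then have "y \<oplus>\<^bsub>M\<^esub> \<ominus>\<^bsub>M\<^esub> z = \<zero>\<^bsub>M\<^esub>"
      using calculation yz nz DA(3) by blast
    then have "\<ominus>\<^bsub>M\<^esub> z = \<ominus>\<^bsub>M\<^esub> y"
      using yz DA(1) nz by (metis M.a_comm M.minus_equality M.a_inv_closed)
    then show "y = z"
      using yz DA(1) by (metis M.minus_minus)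
  qed
  moreover have "submodule (f ` A) R M"
  proof (rule submoduleI)
    show "\<zero>\<^bsub>M\<^esub> \<in> f ` A" using f0 DA(2) by force
    fix y assume "y \<in> f ` A"
    then obtain y' where y: "y' \<in> A" "y = f y'" by auto
    show "y \<in> carrier M" using y lin_onD(1)[OF f] DB(1) by auto
    show "a \<odot>\<^bsub>M\<^esub> y \<in> f ` A" if "a \<in> carrier R" for a
      using y(2) lin_onD(3)[OF f that y(1)] DA(4)[OF that y(1)] by (metis imageI)
    fix z assume "z \<in> f ` A"
    then obtain z' where z: "z' \<in> A" "z = f z'" by auto
    show "y \<oplus>\<^bsub>M\<^esub> z \<in> f ` A"
      using y z lin_onD(2)[OF f y(1) z(1)] DA(3) by (metis imageI)
  qed
  then have "f ` A = B"
    using minimalD(3)[OF B, of "f ` A"] x lin_onD(1)[OF f] by blast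
  ultimately show ?thesis unfolding bij_betw_def by simp
qed

text \<open>Simplicity is written out because \<open>simple_module\<close> is typed for plain module
  records, while \<open>M\<close> may carry further fields here.\<close>

lemma minimal_simple: "minimal W \<Longrightarrow> M' = M\<lparr>carrier := W\<rparr> \<Longrightarrow> left_module R M' \<and> carrier M' \<noteq> {\<zero>\<^bsub>M'\<^esub>} \<and>
     (\<forall>H. submodule H R M' \<longrightarrow> H = {\<zero>\<^bsub>M'\<^esub>} \<or> H = carrier M')"
proof -
  assume W: "minimal W" and M': "M' = M\<lparr>carrier := W\<rparr>"
  have lm: "left_module R M'" unfolding M' by (rule submodule_left_module[OF minimalD(1)[OF W]])
  have "H = {\<zero>\<^bsub>M'\<^esub>} \<or> H = carrier M'" if H: "submodule H R M'" for H
  proof -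
    note HD = left_module.submoduleD[OF lm H]
    have "submodule H R M" "H \<subseteq> W"
      using HD submoduleD(1)[OF minimalD(1)[OF W]] by (auto intro!: submoduleI simp: M')
    then show ?thesis using minimalD(3)[OF W, of H] by (simp add: M')
  qed
  then show ?thesis using lm minimalD(2)[OF W] by (simp add: M')
qed

end

text \<open>All translates of the minimal submodule \<open>W\<close> are minimal, and they span the module. The isotypic
  component of \<open>W\<close> is encoded by the projection onto it.\<close>

locale semilinear_action = left_module D V for D :: "('d, 'e) ring_scheme" and V :: "('d, 'v, 'w) module_scheme" +
  fixes G :: "'g set" and mul :: "'g \<Rightarrow> 'g \<Rightarrow> 'g" and e :: 'g and g :: "'g \<Rightarrow> 'v \<Rightarrow> 'v" and c :: "'g \<Rightarrow> 'd \<Rightarrow> 'd"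
    and W :: "'v set"
  assumes fin: "finite G" and e_mem: "e \<in> G" and mul_mem: "\<alpha> \<in> G \<Longrightarrow> \<beta> \<in> G \<Longrightarrow> mul \<alpha> \<beta> \<in> G"
    and inv_ex: "\<alpha> \<in> G \<Longrightarrow> \<exists>\<beta>\<in>G. \<forall>x\<in>carrier V. g \<beta> (g \<alpha> x) = x \<and> g \<alpha> (g \<beta> x) = x"
    and g_one: "x \<in> carrier V \<Longrightarrow> g e x = x"
    and g_mul: "\<alpha> \<in> G \<Longrightarrow> \<beta> \<in> G \<Longrightarrow> x \<in> carrier V \<Longrightarrow> g (mul \<alpha> \<beta>) x = g \<alpha> (g \<beta> x)"
    and g_additive: "\<alpha> \<in> G \<Longrightarrow> additive_map V V (g \<alpha>)"
    and c_mem: "\<alpha> \<in> G \<Longrightarrow> a \<in> carrier D \<Longrightarrow> c \<alpha> a \<in> carrier D"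
    and g_smult: "\<alpha> \<in> G \<Longrightarrow> a \<in> carrier D \<Longrightarrow> x \<in> carrier V \<Longrightarrow> g \<alpha> (a \<odot>\<^bsub>V\<^esub> x) = c \<alpha> a \<odot>\<^bsub>V\<^esub> g \<alpha> x"
    and irreducible: "submodule U D V \<Longrightarrow> (\<And>\<alpha> x. \<alpha> \<in> G \<Longrightarrow> x \<in> U \<Longrightarrow> g \<alpha> x \<in> U) \<Longrightarrow> U = {\<zero>\<^bsub>V\<^esub>} \<or> U = carrier V"
    and W_minimal: "minimal W"
begin

lemma g_mem: "\<alpha> \<in> G \<Longrightarrow> x \<in> carrier V \<Longrightarrow> g \<alpha> x \<in> carrier V"
  using additive_mapD(1)[OF g_additive] .

lemma g_add: "\<alpha> \<in> G \<Longrightarrow> x \<in> carrier V \<Longrightarrow> y \<in> carrier V \<Longrightarrow> g \<alpha> (x \<oplus>\<^bsub>V\<^esub> y) = g \<alpha> x \<oplus>\<^bsub>V\<^esub> g \<alpha> y"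
  using additive_mapD(2)[OF g_additive] .

lemma g_zero: "\<alpha> \<in> G \<Longrightarrow> g \<alpha> \<zero>\<^bsub>V\<^esub> = \<zero>\<^bsub>V\<^esub>"
  by (rule additive_map_zero[OF M.abelian_group_axioms M.abelian_group_axioms g_additive])

lemma g_finsum:
  assumes "\<alpha> \<in> G" "finite I" "\<And>i. i \<in> I \<Longrightarrow> f i \<in> carrier V"
  shows "g \<alpha> (\<Oplus>\<^bsub>V\<^esub>i\<in>I. f i) = (\<Oplus>\<^bsub>V\<^esub>i\<in>I. g \<alpha> (f i))"
  by (rule additive_map_finsum[OF M.abelian_group_axioms M.abelian_group_axioms g_additive]) (use assms in auto)

text \<open>The last property expresses a scalar acting on a translate through a scalar acting
  before translation. It follows from semilinearity of the inverse and stands in for invertibility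
  of \<open>c \<alpha>\<close>.\<close>

lemma inverse:
  assumes "\<alpha> \<in> G"
  obtains \<beta> where "\<beta> \<in> G" "\<And>x. x \<in> carrier V \<Longrightarrow> g \<beta> (g \<alpha> x) = x" "\<And>x. x \<in> carrier V \<Longrightarrow> g \<alpha> (g \<beta> x) = x"
    "\<And>a x. a \<in> carrier D \<Longrightarrow> x \<in> carrier V \<Longrightarrow> g \<alpha> (c \<beta> a \<odot>\<^bsub>V\<^esub> x) = a \<odot>\<^bsub>V\<^esub> g \<alpha> x"
proof -
  obtain \<beta> where \<beta>: "\<beta> \<in> G" "\<And>x. x \<in> carrier V \<Longrightarrow> g \<beta> (g \<alpha> x) = x" "\<And>x. x \<in> carrier V \<Longrightarrow> g \<alpha> (g \<beta> x) = x"
    using inv_ex[OF assms] by blast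
  have "g \<alpha> (c \<beta> a \<odot>\<^bsub>V\<^esub> x) = a \<odot>\<^bsub>V\<^esub> g \<alpha> x" if "a \<in> carrier D" "x \<in> carrier V" for a x
  proof -
    have "g \<beta> (a \<odot>\<^bsub>V\<^esub> g \<alpha> x) = c \<beta> a \<odot>\<^bsub>V\<^esub> x"
      using g_smult[OF \<beta>(1) that(1) g_mem[OF assms that(2)]] \<beta>(2)[OF that(2)] by simp
    then show ?thesis using \<beta>(3)[of "a \<odot>\<^bsub>V\<^esub> g \<alpha> x"] that g_mem[OF assms] smult_closed by simp
  qed
  with \<beta> show ?thesis using that by blast
qed

lemma translate_submodule:
  assumes \<alpha>: "\<alpha> \<in> G" and U: "submodule U D V"
  shows "submodule (g \<alpha> ` U) D V"
proof -
  obtain \<beta> where \<beta>: "\<beta> \<in> G" "\<And>a x. a \<in> carrier D \<Longrightarrow> x \<in> carrier V \<Longrightarrow> g \<alpha> (c \<beta> a \<odot>\<^bsub>V\<^esub> x) = a \<odot>\<^bsub>V\<^esub> g \<alpha> x"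
    using inverse[OF \<alpha>] by metis
  note U' = submoduleD[OF U]
  show ?thesis
  proof (rule submoduleI)
    show "\<zero>\<^bsub>V\<^esub> \<in> g \<alpha> ` U" using g_zero[OF \<alpha>] U'(2) by force
    fix x assume "x \<in> g \<alpha> ` U"
    then obtain x' where x: "x' \<in> U" "x = g \<alpha> x'" by auto
    show "x \<in> carrier V" using x U' g_mem[OF \<alpha>] by auto
    show "a \<odot>\<^bsub>V\<^esub> x \<in> g \<alpha> ` U" if a: "a \<in> carrier D" for a
    proof -
      have "a \<odot>\<^bsub>V\<^esub> x = g \<alpha> (c \<beta> a \<odot>\<^bsub>V\<^esub> x')" using \<beta>(2)[OF a] x U'(1) by simp
      then show ?thesis using U'(4)[OF c_mem[OF \<beta>(1) a] x(1)] by blast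
    qed
    fix y assume "y \<in> g \<alpha> ` U"
    then obtain y' where y: "y' \<in> U" "y = g \<alpha> y'" by auto
    show "x \<oplus>\<^bsub>V\<^esub> y \<in> g \<alpha> ` U"
      using x y U' by (auto simp flip: g_add[OF \<alpha>])
  qed
qed

lemma translate_image:
  assumes "\<alpha> \<in> G" "\<beta> \<in> G" "U \<subseteq> carrier V"
  shows "g (mul \<alpha> \<beta>) ` U = g \<alpha> ` g \<beta> ` U"
  unfolding image_image by (intro image_cong refl g_mul assms(1,2)) (use assms(3) in blast)

text \<open>The inverse group element carries submodules of the translate back to submodules of
  \<open>U\<close>.\<close>

lemma translate_minimal:
  assumes \<alpha>: "\<alpha> \<in> G" and U: "minimal U"
  shows "minimal (g \<alpha> ` U)"
proof -
  obtain \<beta> where \<beta>: "\<beta> \<in> G" "\<And>x. x \<in> carrier V \<Longrightarrow> g \<beta> (g \<alpha> x) = x" "\<And>x. x \<in> carrier V \<Longrightarrow> g \<alpha> (g \<beta> x) = x"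
    using inverse[OF \<alpha>] by metis
  note sub = minimalD(1)[OF U]
  note U' = submoduleD[OF sub]
  have retract: "g \<beta> ` g \<alpha> ` Y = Y" if "Y \<subseteq> carrier V" for Y
    using \<beta>(2) that by (rule image_cancel)
  have section_eq: "g \<alpha> ` g \<beta> ` Y = Y" if "Y \<subseteq> carrier V" for Y
    using \<beta>(3) that by (rule image_cancel)
  have UV: "U \<subseteq> carrier V" using U' by auto
  show ?thesis
    unfolding minimal_def
  proof (intro conjI allI impI)
    show "submodule (g \<alpha> ` U) D V" by (rule translate_submodule[OF \<alpha> sub])
    show "g \<alpha> ` U \<noteq> {\<zero>\<^bsub>V\<^esub>}"
    proof
      assume "g \<alpha> ` U = {\<zero>\<^bsub>V\<^esub>}"
      then have "U = {g \<beta> \<zero>\<^bsub>V\<^esub>}" using retract[OF UV] by simp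
      then show False using g_zero[OF \<beta>(1)] minimalD(2)[OF U] by simp
    qed
    fix H assume H: "submodule H D V \<and> H \<subseteq> g \<alpha> ` U"
    then have HV: "H \<subseteq> carrier V" using submoduleD(1) by blast
    have "submodule (g \<beta> ` H) D V" "g \<beta> ` H \<subseteq> U"
      using translate_submodule[OF \<beta>(1)] H retract[OF UV] by blast+
    then have "g \<beta> ` H = {\<zero>\<^bsub>V\<^esub>} \<or> g \<beta> ` H = U" using minimalD(3)[OF U] by blast
    then show "H = {\<zero>\<^bsub>V\<^esub>} \<or> H = g \<alpha> ` U"
      using section_eq[OF HV] g_zero[OF \<alpha>] by auto
  qed
qed

text \<open>Conjugating an isomorphism by the semilinear map \<open>g \<alpha>\<close> gives a
  linear one, as the two twists of the scalars cancel.\<close>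

lemma translate_iso:
  assumes \<alpha>: "\<alpha> \<in> G" and A: "submodule A D V" and B: "submodule B D V" and iso: "iso_sub A B"
  shows "iso_sub (g \<alpha> ` A) (g \<alpha> ` B)"
proof -
  obtain \<beta> where \<beta>: "\<beta> \<in> G" "\<And>x. x \<in> carrier V \<Longrightarrow> g \<beta> (g \<alpha> x) = x" "\<And>x. x \<in> carrier V \<Longrightarrow> g \<alpha> (g \<beta> x) = x"
    "\<And>a x. a \<in> carrier D \<Longrightarrow> x \<in> carrier V \<Longrightarrow> g \<alpha> (c \<beta> a \<odot>\<^bsub>V\<^esub> x) = a \<odot>\<^bsub>V\<^esub> g \<alpha> x"
    using inverse[OF \<alpha>] by metis
  obtain f where f: "lin_on A B f" "bij_betw f A B" using iso unfolding iso_sub_def by auto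
  note A' = submoduleD[OF A] and B' = submoduleD[OF B] and f' = lin_onD[OF f(1)]
  let ?f = "\<lambda>x. g \<alpha> (f (g \<beta> x))"
  have fx: "?f (g \<alpha> x) = g \<alpha> (f x)" if "x \<in> A" for x using \<beta>(2) A'(1)[OF that] by simp
  have "lin_on (g \<alpha> ` A) (g \<alpha> ` B) ?f"
  proof (rule lin_onI)
    fix x assume "x \<in> g \<alpha> ` A"
    then obtain x' where x: "x' \<in> A" "x = g \<alpha> x'" by auto
    show "?f x \<in> g \<alpha> ` B" unfolding x(2) fx[OF x(1)] using f'(1)[OF x(1)] by auto
    show "?f (a \<odot>\<^bsub>V\<^esub> x) = a \<odot>\<^bsub>V\<^esub> ?f x" if a: "a \<in> carrier D" for a
    proof -
      have "a \<odot>\<^bsub>V\<^esub> x = g \<alpha> (c \<beta> a \<odot>\<^bsub>V\<^esub> x')" using \<beta>(4)[OF a A'(1)[OF x(1)]] x by simp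
      then have "?f (a \<odot>\<^bsub>V\<^esub> x) = g \<alpha> (c \<beta> a \<odot>\<^bsub>V\<^esub> f x')"
        using fx[OF A'(4)[OF c_mem[OF \<beta>(1) a] x(1)]] f'(3)[OF c_mem[OF \<beta>(1) a] x(1)] by simp
      also have "\<dots> = a \<odot>\<^bsub>V\<^esub> g \<alpha> (f x')" by (rule \<beta>(4)[OF a B'(1)[OF f'(1)[OF x(1)]]])
      finally show ?thesis unfolding x(2) fx[OF x(1)] .
    qed
    fix y assume "y \<in> g \<alpha> ` A"
    then obtain y' where y: "y' \<in> A" "y = g \<alpha> y'" by auto
    have "x \<oplus>\<^bsub>V\<^esub> y = g \<alpha> (x' \<oplus>\<^bsub>V\<^esub> y')" using x y A'(1) g_add[OF \<alpha>] by simp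
    then have "?f (x \<oplus>\<^bsub>V\<^esub> y) = g \<alpha> (f x' \<oplus>\<^bsub>V\<^esub> f y')" using fx[OF A'(3)[OF x(1) y(1)]] f'(2)[OF x(1) y(1)] by simp
    also have "\<dots> = g \<alpha> (f x') \<oplus>\<^bsub>V\<^esub> g \<alpha> (f y')" using B'(1) f'(1) x y by (intro g_add[OF \<alpha>]) auto
    finally show "?f (x \<oplus>\<^bsub>V\<^esub> y) = ?f x \<oplus>\<^bsub>V\<^esub> ?f y" unfolding x(2) y(2) fx[OF x(1)] fx[OF y(1)] .
  qed
  moreover have "bij_betw ?f (g \<alpha> ` A) (g \<alpha> ` B)"
  proof (rule bij_betwI)
    let ?h = "\<lambda>x. g \<alpha> (inv_into A f (g \<beta> x))"
    have h: "?h (g \<alpha> y) = g \<alpha> (inv_into A f y)" if "y \<in> B" for y using \<beta>(2) B'(1)[OF that] by simp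
    have inv: "inv_into A f y \<in> A" "f (inv_into A f y) = y" if "y \<in> B" for y
      using f(2) that by (auto simp: bij_betw_def inv_into_into f_inv_into_f)
    have inv': "inv_into A f (f x) = x" if "x \<in> A" for x
      using f(2) that by (auto simp: bij_betw_def)
    show "?f \<in> g \<alpha> ` A \<rightarrow> g \<alpha> ` B" using fx f'(1) by force
    show "?h \<in> g \<alpha> ` B \<rightarrow> g \<alpha> ` A" using h inv by force
    show "?h (?f x) = x" if "x \<in> g \<alpha> ` A" for x using that fx h f'(1) inv' by force
    show "?f (?h y) = y" if "y \<in> g \<alpha> ` B" for y using that fx h inv by force
  qed
  ultimately show ?thesis unfolding iso_sub_def by blast
qed

section \<open>Direct decomposition into translates and the isotypic projection\<close>

abbreviation "tw \<alpha> \<equiv> g \<alpha> ` W"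

lemma tw_minimal: "\<alpha> \<in> G \<Longrightarrow> minimal (tw \<alpha>)" by (rule translate_minimal[OF _ W_minimal])
lemma tw_submodule: "\<alpha> \<in> G \<Longrightarrow> submodule (tw \<alpha>) D V" using tw_minimal minimalD(1) by auto
lemma tw_carrier: "\<alpha> \<in> G \<Longrightarrow> x \<in> tw \<alpha> \<Longrightarrow> x \<in> carrier V" using submoduleD(1)[OF tw_submodule] .
lemma W_carrier: "W \<subseteq> carrier V" using submoduleD(1)[OF minimalD(1)[OF W_minimal]] by auto
lemma tw_mul: "\<alpha> \<in> G \<Longrightarrow> \<beta> \<in> G \<Longrightarrow> x \<in> tw \<beta> \<Longrightarrow> g \<alpha> x \<in> tw (mul \<alpha> \<beta>)"
  using translate_image[OF _ _ W_carrier] by blast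

definition sumset :: "'g set \<Rightarrow> 'v set" where
  "sumset S = {(\<Oplus>\<^bsub>V\<^esub>\<alpha>\<in>S. w \<alpha>) | w. \<forall>\<alpha>\<in>S. w \<alpha> \<in> tw \<alpha>}"

lemma sumset_submodule:
  assumes S: "S \<subseteq> G" shows "submodule (sumset S) D V"
proof (rule submoduleI)
  have fS: "finite S" using S fin finite_subset by auto
  have m: "x \<in> carrier V" if "\<alpha> \<in> S" "x \<in> tw \<alpha>" for x \<alpha> using that S tw_carrier by blast
  have sub: "submodule (tw \<alpha>) D V" if "\<alpha> \<in> S" for \<alpha> using that S tw_submodule by blast
  have "(\<Oplus>\<^bsub>V\<^esub>\<alpha>\<in>S. \<zero>\<^bsub>V\<^esub>) \<in> sumset S"
    unfolding sumset_def using submoduleD(2)[OF sub] by blast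
  then show "\<zero>\<^bsub>V\<^esub> \<in> sumset S" by simp
  fix x assume "x \<in> sumset S"
  then obtain w where w: "x = (\<Oplus>\<^bsub>V\<^esub>\<alpha>\<in>S. w \<alpha>)" "\<And>\<alpha>. \<alpha> \<in> S \<Longrightarrow> w \<alpha> \<in> tw \<alpha>" unfolding sumset_def by auto
  have wm: "w \<alpha> \<in> carrier V" if "\<alpha> \<in> S" for \<alpha> using m w(2) that by blast
  show "x \<in> carrier V" unfolding w(1) using wm by (intro M.finsum_closed) auto
  show "a \<odot>\<^bsub>V\<^esub> x \<in> sumset S" if a: "a \<in> carrier D" for a
  proof -
    have "a \<odot>\<^bsub>V\<^esub> x = (\<Oplus>\<^bsub>V\<^esub>\<alpha>\<in>S. a \<odot>\<^bsub>V\<^esub> w \<alpha>)" unfolding w(1) by (rule smult_finsum[OF a fS wm])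
    moreover have "a \<odot>\<^bsub>V\<^esub> w \<alpha> \<in> tw \<alpha>" if "\<alpha> \<in> S" for \<alpha> using submoduleD(4)[OF sub[OF that] a w(2)[OF that]] .
    ultimately show ?thesis unfolding sumset_def by blast
  qed
  fix y assume "y \<in> sumset S"
  then obtain w' where w': "y = (\<Oplus>\<^bsub>V\<^esub>\<alpha>\<in>S. w' \<alpha>)" "\<And>\<alpha>. \<alpha> \<in> S \<Longrightarrow> w' \<alpha> \<in> tw \<alpha>" unfolding sumset_def by auto
  have wm': "w' \<alpha> \<in> carrier V" if "\<alpha> \<in> S" for \<alpha> using m w'(2) that by blast
  have "x \<oplus>\<^bsub>V\<^esub> y = (\<Oplus>\<^bsub>V\<^esub>\<alpha>\<in>S. w \<alpha> \<oplus>\<^bsub>V\<^esub> w' \<alpha>)" unfolding w(1) w'(1) using wm wm' by (intro M.finsum_addf[symmetric]) auto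
  moreover have "w \<alpha> \<oplus>\<^bsub>V\<^esub> w' \<alpha> \<in> tw \<alpha>" if "\<alpha> \<in> S" for \<alpha> using submoduleD(3)[OF sub[OF that] w(2)[OF that] w'(2)[OF that]] .
  ultimately show "x \<oplus>\<^bsub>V\<^esub> y \<in> sumset S" unfolding sumset_def by blast
qed

lemma tw_sumset:
  assumes S: "S \<subseteq> G" and \<alpha>: "\<alpha> \<in> S" and x: "x \<in> tw \<alpha>"
  shows "x \<in> sumset S"
proof -
  have fS: "finite S" using S fin finite_subset by auto
  have xc: "x \<in> carrier V" using S \<alpha> x tw_carrier by blast
  have "(\<Oplus>\<^bsub>V\<^esub>\<beta>\<in>S. if \<alpha> = \<beta> then x else \<zero>\<^bsub>V\<^esub>) = x"
    using M.finsum_singleton[OF \<alpha> fS, of "\<lambda>_. x"] xc by auto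
  moreover have "\<forall>\<beta>\<in>S. (if \<alpha> = \<beta> then x else \<zero>\<^bsub>V\<^esub>) \<in> tw \<beta>"
    using x submoduleD(2)[OF tw_submodule] S by (auto simp: subset_iff)
  ultimately show ?thesis unfolding sumset_def by force
qed

lemma sumset_least:
  assumes S: "S \<subseteq> G" and U: "submodule U D V" and sub: "\<And>\<alpha>. \<alpha> \<in> S \<Longrightarrow> tw \<alpha> \<subseteq> U"
  shows "sumset S \<subseteq> U"
proof
  have fS: "finite S" using S fin finite_subset by auto
  fix x assume "x \<in> sumset S"
  then obtain w where w: "x = (\<Oplus>\<^bsub>V\<^esub>\<alpha>\<in>S. w \<alpha>)" "\<And>\<alpha>. \<alpha> \<in> S \<Longrightarrow> w \<alpha> \<in> tw \<alpha>" unfolding sumset_def by auto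
  show "x \<in> U" unfolding w(1) using w(2) sub by (intro submodule_finsum[OF U fS]) blast
qed

text \<open>The sum of all translates is stable under \<open>G\<close> and contains the nonzero
  \<open>W\<close>, so irreducibility makes it everything.\<close>

lemma sumset_G: "sumset G = carrier V"
proof -
  have "sumset G = {\<zero>\<^bsub>V\<^esub>} \<or> sumset G = carrier V"
  proof (rule irreducible[OF sumset_submodule[OF subset_refl]])
    fix \<alpha> x assume \<alpha>: "\<alpha> \<in> G" and "x \<in> sumset G"
    then obtain w where w: "x = (\<Oplus>\<^bsub>V\<^esub>\<beta>\<in>G. w \<beta>)" "\<And>\<beta>. \<beta> \<in> G \<Longrightarrow> w \<beta> \<in> tw \<beta>" unfolding sumset_def by auto
    have "g \<alpha> x = (\<Oplus>\<^bsub>V\<^esub>\<beta>\<in>G. g \<alpha> (w \<beta>))" unfolding w(1) using w(2) tw_carrier by (intro g_finsum[OF \<alpha> fin]) blast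
    moreover have "(\<Oplus>\<^bsub>V\<^esub>\<beta>\<in>G. g \<alpha> (w \<beta>)) \<in> sumset G"
      using tw_sumset[OF subset_refl mul_mem[OF \<alpha>] tw_mul[OF \<alpha> _ w(2)]]
      by (intro submodule_finsum[OF sumset_submodule[OF subset_refl] fin]) auto
    ultimately show "g \<alpha> x \<in> sumset G" by simp
  qed
  moreover have "sumset G \<noteq> {\<zero>\<^bsub>V\<^esub>}"
    using tw_sumset[OF subset_refl e_mem] minimalD(2)[OF tw_minimal[OF e_mem]] submoduleD(2)[OF tw_submodule[OF e_mem]] by blast
  ultimately show ?thesis by simp
qed

text \<open>An inclusion-minimal set of group elements whose translates of \<open>W\<close> span. It
  exists because \<open>G\<close> is finite, and its minimality makes the sum direct.\<close>

definition basis :: "'g set" where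
  "basis = (SOME S. S \<subseteq> G \<and> sumset S = carrier V \<and> (\<forall>S'. S' \<subset> S \<longrightarrow> sumset S' \<noteq> carrier V))"

lemma basis: "basis \<subseteq> G" "sumset basis = carrier V" "S' \<subset> basis \<Longrightarrow> sumset S' \<noteq> carrier V"
proof -
  define A where "A = {S. S \<subseteq> G \<and> sumset S = carrier V}"
  have fA: "finite A" unfolding A_def by (rule finite_subset[of _ "Pow G"]) (auto simp: fin)
  have GA: "G \<in> A" by (simp add: A_def sumset_G)
  obtain S where S: "S \<in> A" "\<forall>S'\<in>A. S' \<subseteq> S \<longrightarrow> S = S'"
    using finite_has_minimal2[OF fA GA] by metis
  have "sumset S' \<noteq> carrier V" if "S' \<subset> S" for S'
  proof
    assume "sumset S' = carrier V"
    then have "S' \<in> A" using that S(1) unfolding A_def by auto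
    then show False using S(2) that by blast
  qed
  moreover have "S \<subseteq> G" "sumset S = carrier V" using S(1) unfolding A_def by auto
  ultimately have "\<exists>S. S \<subseteq> G \<and> sumset S = carrier V \<and> (\<forall>S'. S' \<subset> S \<longrightarrow> sumset S' \<noteq> carrier V)" by blast
  from someI_ex[OF this]
  have "basis \<subseteq> G \<and> sumset basis = carrier V \<and> (\<forall>S'. S' \<subset> basis \<longrightarrow> sumset S' \<noteq> carrier V)"
    unfolding basis_def .
  then show "basis \<subseteq> G" "sumset basis = carrier V" "S' \<subset> basis \<Longrightarrow> sumset S' \<noteq> carrier V"
    by auto
qed

lemma fin_basis: "finite basis" using basis(1) fin finite_subset by auto

text \<open>Were the \<gamma>-summand nonzero, it would lie in the sum of the other translates; as
  its translate is a minimal submodule, all of that translate would, and \<gamma> could be dropped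
  from the spanning set.\<close>

lemma basis_independent:
  assumes w: "\<And>\<alpha>. \<alpha> \<in> basis \<Longrightarrow> w \<alpha> \<in> tw \<alpha>" and zero: "(\<Oplus>\<^bsub>V\<^esub>\<alpha>\<in>basis. w \<alpha>) = \<zero>\<^bsub>V\<^esub>" and \<gamma>: "\<gamma> \<in> basis"
  shows "w \<gamma> = \<zero>\<^bsub>V\<^esub>"
proof (rule ccontr)
  assume nz: "w \<gamma> \<noteq> \<zero>\<^bsub>V\<^esub>"
  let ?S = "basis - {\<gamma>}"
  have SG: "?S \<subseteq> G" and \<gamma>G: "\<gamma> \<in> G" using basis(1) \<gamma> by auto
  have wm: "w \<alpha> \<in> carrier V" if "\<alpha> \<in> basis" for \<alpha> using w[OF that] tw_carrier basis(1) that by blast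
  let ?x = "\<Oplus>\<^bsub>V\<^esub>\<alpha>\<in>?S. w \<alpha>"
  have xS: "?x \<in> sumset ?S" unfolding sumset_def using w by blast
  have xV: "?x \<in> carrier V" using wm by (intro M.finsum_closed) auto
  have "basis = insert \<gamma> ?S" using \<gamma> by auto
  then have "w \<gamma> \<oplus>\<^bsub>V\<^esub> ?x = \<zero>\<^bsub>V\<^esub>"
    using zero wm \<gamma> fin_basis M.finsum_insert[of ?S \<gamma> w] by auto
  then have "w \<gamma> = \<ominus>\<^bsub>V\<^esub> ?x" using wm[OF \<gamma>] xV by (metis M.minus_equality)
  then have wS: "w \<gamma> \<in> sumset ?S" using submoduleD(5)[OF sumset_submodule[OF SG] xS] by simp
  have "tw \<gamma> \<inter> sumset ?S = {\<zero>\<^bsub>V\<^esub>} \<or> tw \<gamma> \<inter> sumset ?S = tw \<gamma>"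
    by (rule minimalD(3)[OF tw_minimal[OF \<gamma>G] submodule_inter[OF tw_submodule[OF \<gamma>G] sumset_submodule[OF SG]]]) auto
  then have "tw \<gamma> \<subseteq> sumset ?S" using nz wS w[OF \<gamma>] by blast
  then have "sumset basis \<subseteq> sumset ?S"
    using tw_sumset[OF SG] by (intro sumset_least[OF basis(1) sumset_submodule[OF SG]]) blast
  then have "sumset ?S = carrier V"
    using basis(2) submoduleD(1)[OF sumset_submodule[OF SG]] by auto
  then show False using basis(3)[of ?S] \<gamma> by blast
qed

definition comp :: "'v \<Rightarrow> 'g \<Rightarrow> 'v" where
  "comp x = (SOME w. (\<forall>\<alpha>\<in>basis. w \<alpha> \<in> tw \<alpha>) \<and> x = (\<Oplus>\<^bsub>V\<^esub>\<alpha>\<in>basis. w \<alpha>))"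

lemma comp:
  assumes "x \<in> carrier V"
  shows comp_mem: "\<alpha> \<in> basis \<Longrightarrow> comp x \<alpha> \<in> tw \<alpha>" and comp_sum: "(\<Oplus>\<^bsub>V\<^esub>\<alpha>\<in>basis. comp x \<alpha>) = x"
proof -
  have "\<exists>w. (\<forall>\<alpha>\<in>basis. w \<alpha> \<in> tw \<alpha>) \<and> x = (\<Oplus>\<^bsub>V\<^esub>\<alpha>\<in>basis. w \<alpha>)"
    using assms basis(2) unfolding sumset_def by blast
  from someI_ex[OF this]
  have "(\<forall>\<alpha>\<in>basis. comp x \<alpha> \<in> tw \<alpha>) \<and> x = (\<Oplus>\<^bsub>V\<^esub>\<alpha>\<in>basis. comp x \<alpha>)"
    unfolding comp_def .
  then show "\<alpha> \<in> basis \<Longrightarrow> comp x \<alpha> \<in> tw \<alpha>" "(\<Oplus>\<^bsub>V\<^esub>\<alpha>\<in>basis. comp x \<alpha>) = x"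
    by auto
qed

lemma comp_carrier: "x \<in> carrier V \<Longrightarrow> \<alpha> \<in> basis \<Longrightarrow> comp x \<alpha> \<in> carrier V"
  using comp_mem tw_carrier basis(1) by blast

lemma comp_eqI:
  assumes w: "\<And>\<alpha>. \<alpha> \<in> basis \<Longrightarrow> w \<alpha> \<in> tw \<alpha>" and x: "x = (\<Oplus>\<^bsub>V\<^esub>\<alpha>\<in>basis. w \<alpha>)" and \<gamma>: "\<gamma> \<in> basis"
  shows "comp x \<gamma> = w \<gamma>"
proof -
  have wm: "w \<alpha> \<in> carrier V" if "\<alpha> \<in> basis" for \<alpha> using w[OF that] tw_carrier basis(1) that by blast
  have xV: "x \<in> carrier V" unfolding x using wm by (intro M.finsum_closed) auto
  let ?d = "\<lambda>\<alpha>. comp x \<alpha> \<oplus>\<^bsub>V\<^esub> \<ominus>\<^bsub>V\<^esub> w \<alpha>"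
  have neg: "\<ominus>\<^bsub>V\<^esub> w \<alpha> \<in> tw \<alpha>" if "\<alpha> \<in> basis" for \<alpha>
    using submoduleD(5)[OF tw_submodule w[OF that]] basis(1) that by blast
  have d: "?d \<alpha> \<in> tw \<alpha>" if "\<alpha> \<in> basis" for \<alpha>
    using submoduleD(3)[OF tw_submodule comp_mem[OF xV that] neg[OF that]] basis(1) that by blast
  have "x = (\<Oplus>\<^bsub>V\<^esub>\<alpha>\<in>basis. comp x \<alpha>)" by (rule comp_sum[OF xV, symmetric])
  also have "\<dots> = (\<Oplus>\<^bsub>V\<^esub>\<alpha>\<in>basis. ?d \<alpha> \<oplus>\<^bsub>V\<^esub> w \<alpha>)"
    using wm comp_carrier[OF xV] by (intro M.finsum_cong' refl) (auto simp: M.a_assoc M.l_neg)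
  also have "\<dots> = (\<Oplus>\<^bsub>V\<^esub>\<alpha>\<in>basis. ?d \<alpha>) \<oplus>\<^bsub>V\<^esub> (\<Oplus>\<^bsub>V\<^esub>\<alpha>\<in>basis. w \<alpha>)"
    using wm comp_carrier[OF xV] by (intro M.finsum_addf) auto
  finally have "x = (\<Oplus>\<^bsub>V\<^esub>\<alpha>\<in>basis. ?d \<alpha>) \<oplus>\<^bsub>V\<^esub> x" by (simp only: x[symmetric])
  then have "(\<Oplus>\<^bsub>V\<^esub>\<alpha>\<in>basis. ?d \<alpha>) \<oplus>\<^bsub>V\<^esub> x = x" by (rule sym)
  moreover have "(\<Oplus>\<^bsub>V\<^esub>\<alpha>\<in>basis. ?d \<alpha>) \<in> carrier V" using wm comp_carrier[OF xV] by (intro M.finsum_closed) auto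
  ultimately have "(\<Oplus>\<^bsub>V\<^esub>\<alpha>\<in>basis. ?d \<alpha>) = \<zero>\<^bsub>V\<^esub>" using xV by simp
  then have "?d \<gamma> = \<zero>\<^bsub>V\<^esub>" using basis_independent[of ?d, OF d _ \<gamma>] by simp
  then show ?thesis
    using wm[OF \<gamma>] comp_carrier[OF xV \<gamma>] by (metis M.a_inv_closed M.minus_equality M.minus_minus)
qed

lemma comp_add:
  assumes x: "x \<in> carrier V" and y: "y \<in> carrier V" and \<alpha>: "\<alpha> \<in> basis"
  shows "comp (x \<oplus>\<^bsub>V\<^esub> y) \<alpha> = comp x \<alpha> \<oplus>\<^bsub>V\<^esub> comp y \<alpha>"
proof (rule comp_eqI[OF _ _ \<alpha>])
  show "comp x \<gamma> \<oplus>\<^bsub>V\<^esub> comp y \<gamma> \<in> tw \<gamma>" if "\<gamma> \<in> basis" for \<gamma>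
    using submoduleD(3)[OF tw_submodule comp_mem[OF x that] comp_mem[OF y that]] basis(1) that by blast
  have "(\<Oplus>\<^bsub>V\<^esub>\<alpha>\<in>basis. comp x \<alpha> \<oplus>\<^bsub>V\<^esub> comp y \<alpha>) = (\<Oplus>\<^bsub>V\<^esub>\<alpha>\<in>basis. comp x \<alpha>) \<oplus>\<^bsub>V\<^esub> (\<Oplus>\<^bsub>V\<^esub>\<alpha>\<in>basis. comp y \<alpha>)"
    using comp_carrier[OF x] comp_carrier[OF y] by (intro M.finsum_addf) auto
  then show "x \<oplus>\<^bsub>V\<^esub> y = (\<Oplus>\<^bsub>V\<^esub>\<alpha>\<in>basis. comp x \<alpha> \<oplus>\<^bsub>V\<^esub> comp y \<alpha>)"
    by (simp add: comp_sum[OF x] comp_sum[OF y])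
qed

lemma comp_smult:
  assumes a: "a \<in> carrier D" and x: "x \<in> carrier V" and \<alpha>: "\<alpha> \<in> basis"
  shows "comp (a \<odot>\<^bsub>V\<^esub> x) \<alpha> = a \<odot>\<^bsub>V\<^esub> comp x \<alpha>"
proof (rule comp_eqI[OF _ _ \<alpha>])
  show "a \<odot>\<^bsub>V\<^esub> comp x \<gamma> \<in> tw \<gamma>" if "\<gamma> \<in> basis" for \<gamma>
    using submoduleD(4)[OF tw_submodule a comp_mem[OF x that]] basis(1) that by blast
  show "a \<odot>\<^bsub>V\<^esub> x = (\<Oplus>\<^bsub>V\<^esub>\<alpha>\<in>basis. a \<odot>\<^bsub>V\<^esub> comp x \<alpha>)"
    using smult_finsum[OF a fin_basis, of "comp x"] comp_carrier[OF x] by (simp add: comp_sum[OF x])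
qed

text \<open>A coordinate map restricted to a translate is linear between minimal submodules, so
  Schur's lemma makes it an isomorphism once it is nonzero somewhere.\<close>

lemma comp_iso:
  assumes \<alpha>: "\<alpha> \<in> G" and x: "x \<in> tw \<alpha>" and \<gamma>: "\<gamma> \<in> basis" and nz: "comp x \<gamma> \<noteq> \<zero>\<^bsub>V\<^esub>"
  shows "iso_sub (tw \<alpha>) (tw \<gamma>)"
proof -
  have \<gamma>G: "\<gamma> \<in> G" using \<gamma> basis(1) by auto
  have "lin_on (tw \<alpha>) (tw \<gamma>) (\<lambda>y. comp y \<gamma>)"
    using tw_carrier[OF \<alpha>] by (intro lin_onI comp_mem comp_add comp_smult \<gamma>) auto
  moreover from schur[OF tw_minimal[OF \<alpha>] tw_minimal[OF \<gamma>G] this x nz]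
  have "bij_betw (\<lambda>y. comp y \<gamma>) (tw \<alpha>) (tw \<gamma>)" .
  ultimately show ?thesis unfolding iso_sub_def by blast
qed

text \<open>The stabilizer of the isomorphism class of \<open>W\<close>, equivalently of its
  isotypic component. The fixed field of this group will be the intermediate field
  \<open>Z\<close>.\<close>

definition inertia :: "'g set" where
  "inertia = {\<alpha> \<in> G. iso_sub W (tw \<alpha>)}"

lemma inertia_sub: "inertia \<subseteq> G" by (auto simp: inertia_def)

lemma tw_e: "tw e = W"
  using image_cancel[of "carrier V" "\<lambda>x. x" "g e" W] g_one W_carrier by simp

lemma inertia_e: "e \<in> inertia"
proof -
  have "lin_on W W (\<lambda>x. x)" by (intro lin_onI) auto
  then have "iso_sub W W" unfolding iso_sub_def by (intro exI[of _ "\<lambda>x. x"]) (auto simp: bij_betw_def)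
  then show ?thesis by (simp add: inertia_def e_mem tw_e)
qed

text \<open>Translating by \<beta> turns an isomorphism of \<open>W\<close> with the
  \<alpha>-translate into one of the \<beta>-translate with the \<beta>\<alpha>-translate, and
  conversely. Transitivity then gives both cancellation rules, from which the subgroup properties
  are read off later.\<close>

lemma inertia_mul_iff:
  assumes \<beta>: "\<beta> \<in> G" and \<alpha>: "\<alpha> \<in> G"
  shows "\<beta> \<in> inertia \<Longrightarrow> mul \<beta> \<alpha> \<in> inertia \<longleftrightarrow> \<alpha> \<in> inertia"
    and "\<alpha> \<in> inertia \<Longrightarrow> mul \<beta> \<alpha> \<in> inertia \<longleftrightarrow> \<beta> \<in> inertia"
proof -
  note WS = minimalD(1)[OF W_minimal]
  have img: "tw (mul \<beta> \<alpha>) = g \<beta> ` tw \<alpha>" by (rule translate_image[OF \<beta> \<alpha> W_carrier])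
  have m: "mul \<beta> \<alpha> \<in> G" by (rule mul_mem[OF \<beta> \<alpha>])
  have up: "iso_sub (tw \<beta>) (tw (mul \<beta> \<alpha>)) \<longleftrightarrow> iso_sub W (tw \<alpha>)"
  proof
    assume "iso_sub W (tw \<alpha>)"
    then show "iso_sub (tw \<beta>) (tw (mul \<beta> \<alpha>))"
      unfolding img by (rule translate_iso[OF \<beta> WS tw_submodule[OF \<alpha>]])
  next
    assume i: "iso_sub (tw \<beta>) (tw (mul \<beta> \<alpha>))"
    obtain \<gamma> where \<gamma>: "\<gamma> \<in> G" "\<And>x. x \<in> carrier V \<Longrightarrow> g \<gamma> (g \<beta> x) = x" using inverse[OF \<beta>] by metis
    have retract: "g \<gamma> ` g \<beta> ` Y = Y" if "Y \<subseteq> carrier V" for Y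
      using \<gamma>(2) that by (rule image_cancel)
    have "iso_sub (g \<gamma> ` tw \<beta>) (g \<gamma> ` tw (mul \<beta> \<alpha>))"
      by (rule translate_iso[OF \<gamma>(1) tw_submodule[OF \<beta>] tw_submodule[OF m] i])
    then show "iso_sub W (tw \<alpha>)"
      unfolding img using retract[OF W_carrier] retract[of "tw \<alpha>"] subsetI[OF tw_carrier[OF \<alpha>]] by simp
  qed
  show "\<beta> \<in> inertia \<Longrightarrow> mul \<beta> \<alpha> \<in> inertia \<longleftrightarrow> \<alpha> \<in> inertia"
    using up m \<alpha> \<beta> iso_sub_trans iso_sub_sym[OF _ WS] unfolding inertia_def by blast
  show "\<alpha> \<in> inertia \<Longrightarrow> mul \<beta> \<alpha> \<in> inertia \<longleftrightarrow> \<beta> \<in> inertia"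
    using up m \<alpha> \<beta> iso_sub_trans iso_sub_sym[OF _ tw_submodule[OF \<beta>]] unfolding inertia_def by blast
qed

text \<open>Projection onto the isotypic component of \<open>W\<close> along the other isotypic
  components. Its independence of \<open>basis\<close> is hidden in the formula;
  \<open>proj_inertia\<close> and \<open>proj_not_inertia\<close> show it by computing the map on
  every translate.\<close>

definition proj :: "'v \<Rightarrow> 'v" where
  "proj x = (\<Oplus>\<^bsub>V\<^esub>\<alpha>\<in>basis \<inter> inertia. comp x \<alpha>)"

lemma proj_mem: "x \<in> carrier V \<Longrightarrow> proj x \<in> carrier V"
  unfolding proj_def using comp_carrier by (intro M.finsum_closed) auto

lemma proj_add: "x \<in> carrier V \<Longrightarrow> y \<in> carrier V \<Longrightarrow> proj (x \<oplus>\<^bsub>V\<^esub> y) = proj x \<oplus>\<^bsub>V\<^esub> proj y"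
proof -
  assume x: "x \<in> carrier V" and y: "y \<in> carrier V"
  have "proj (x \<oplus>\<^bsub>V\<^esub> y) = (\<Oplus>\<^bsub>V\<^esub>\<alpha>\<in>basis \<inter> inertia. comp x \<alpha> \<oplus>\<^bsub>V\<^esub> comp y \<alpha>)"
    unfolding proj_def using x y comp_carrier by (intro M.finsum_cong' refl) (auto simp: comp_add)
  also have "\<dots> = proj x \<oplus>\<^bsub>V\<^esub> proj y"
    unfolding proj_def using x y comp_carrier by (intro M.finsum_addf) auto
  finally show ?thesis .
qed

lemma proj_smult: "a \<in> carrier D \<Longrightarrow> x \<in> carrier V \<Longrightarrow> proj (a \<odot>\<^bsub>V\<^esub> x) = a \<odot>\<^bsub>V\<^esub> proj x"
proof -
  assume a: "a \<in> carrier D" and x: "x \<in> carrier V"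
  have "proj (a \<odot>\<^bsub>V\<^esub> x) = (\<Oplus>\<^bsub>V\<^esub>\<alpha>\<in>basis \<inter> inertia. a \<odot>\<^bsub>V\<^esub> comp x \<alpha>)"
    unfolding proj_def using a x comp_carrier by (intro M.finsum_cong' refl) (auto simp: comp_smult smult_closed)
  also have "\<dots> = a \<odot>\<^bsub>V\<^esub> proj x"
    unfolding proj_def using a x comp_carrier fin_basis by (intro smult_finsum[symmetric]) auto
  finally show ?thesis .
qed

lemma proj_additive: "additive_map V V proj"
  by (intro additive_mapI proj_mem proj_add)

text \<open>By \<open>comp_iso\<close>, a nonzero coordinate at a translate outside the inertia
  group would make that translate isomorphic to \<open>W\<close>. So all coordinates that the
  projection omits are zero.\<close>

lemma proj_inertia:
  assumes \<alpha>: "\<alpha> \<in> inertia" and x: "x \<in> tw \<alpha>"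
  shows "proj x = x"
proof -
  have \<alpha>G: "\<alpha> \<in> G" using \<alpha> inertia_sub by auto
  have xV: "x \<in> carrier V" by (rule tw_carrier[OF \<alpha>G x])
  have "comp x \<gamma> = \<zero>\<^bsub>V\<^esub>" if \<gamma>: "\<gamma> \<in> basis - inertia" for \<gamma>
  proof (rule ccontr)
    assume "comp x \<gamma> \<noteq> \<zero>\<^bsub>V\<^esub>"
    then have "iso_sub (tw \<alpha>) (tw \<gamma>)" using comp_iso[OF \<alpha>G x] \<gamma> by blast
    then have "iso_sub W (tw \<gamma>)" using \<alpha> iso_sub_trans unfolding inertia_def by blast
    then show False using \<gamma> basis(1) unfolding inertia_def by blast
  qed
  then have "proj x = (\<Oplus>\<^bsub>V\<^esub>\<alpha>\<in>basis. comp x \<alpha>)"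
    unfolding proj_def using comp_carrier[OF xV] fin_basis
    by (intro M.add.finprod_mono_neutral_cong_left) auto
  then show ?thesis by (simp add: comp_sum[OF xV])
qed

lemma proj_not_inertia:
  assumes \<alpha>: "\<alpha> \<in> G" "\<alpha> \<notin> inertia" and x: "x \<in> tw \<alpha>"
  shows "proj x = \<zero>\<^bsub>V\<^esub>"
proof -
  have "comp x \<gamma> = \<zero>\<^bsub>V\<^esub>" if \<gamma>: "\<gamma> \<in> basis \<inter> inertia" for \<gamma>
  proof (rule ccontr)
    assume "comp x \<gamma> \<noteq> \<zero>\<^bsub>V\<^esub>"
    then have "iso_sub (tw \<alpha>) (tw \<gamma>)" using comp_iso[OF \<alpha>(1) x] \<gamma> by blast
    then have "iso_sub W (tw \<alpha>)"
      using \<gamma> iso_sub_trans iso_sub_sym[OF _ tw_submodule[OF \<alpha>(1)]] unfolding inertia_def by blast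
    then show False using \<alpha> unfolding inertia_def by blast
  qed
  then show ?thesis unfolding proj_def by (intro M.add.finprod_one_eqI) auto
qed

lemma proj_finsum:
  assumes "finite I" "\<And>i. i \<in> I \<Longrightarrow> f i \<in> carrier V"
  shows "proj (\<Oplus>\<^bsub>V\<^esub>i\<in>I. f i) = (\<Oplus>\<^bsub>V\<^esub>i\<in>I. proj (f i))"
  by (rule additive_map_finsum[OF M.abelian_group_axioms M.abelian_group_axioms proj_additive]) (use assms in auto)

text \<open>Checked on the coordinates of \<open>x\<close>: an element of the inertia group keeps
  translates isomorphic to \<open>W\<close> so, and keeps the others non-isomorphic to
  \<open>W\<close>.\<close>

lemma proj_equivariant:
  assumes \<beta>: "\<beta> \<in> inertia" and x: "x \<in> carrier V"
  shows "proj (g \<beta> x) = g \<beta> (proj x)"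
proof -
  have \<beta>G: "\<beta> \<in> G" using \<beta> inertia_sub by auto
  have *: "proj (g \<beta> (comp x \<alpha>)) = g \<beta> (proj (comp x \<alpha>))" if \<alpha>: "\<alpha> \<in> basis" for \<alpha>
  proof -
    have \<alpha>G: "\<alpha> \<in> G" using \<alpha> basis(1) by auto
    have mem: "g \<beta> (comp x \<alpha>) \<in> tw (mul \<beta> \<alpha>)" by (rule tw_mul[OF \<beta>G \<alpha>G comp_mem[OF x \<alpha>]])
    show ?thesis
    proof (cases "\<alpha> \<in> inertia")
      case True
      then show ?thesis
        using proj_inertia[OF _ mem] proj_inertia[OF True comp_mem[OF x \<alpha>]] inertia_mul_iff(1)[OF \<beta>G \<alpha>G \<beta>] by simp
    next
      case False
      then show ?thesis
        using proj_not_inertia[OF mul_mem[OF \<beta>G \<alpha>G] _ mem] proj_not_inertia[OF \<alpha>G False comp_mem[OF x \<alpha>]]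
          inertia_mul_iff(1)[OF \<beta>G \<alpha>G \<beta>] g_zero[OF \<beta>G] by simp
    qed
  qed
  note cm = comp_carrier[OF x]
  have "proj (g \<beta> x) = proj (g \<beta> (\<Oplus>\<^bsub>V\<^esub>\<alpha>\<in>basis. comp x \<alpha>))" by (simp only: comp_sum[OF x])
  also have "\<dots> = proj (\<Oplus>\<^bsub>V\<^esub>\<alpha>\<in>basis. g \<beta> (comp x \<alpha>))" by (subst g_finsum[OF \<beta>G fin_basis]) (use cm in auto)
  also have "\<dots> = (\<Oplus>\<^bsub>V\<^esub>\<alpha>\<in>basis. proj (g \<beta> (comp x \<alpha>)))" using cm g_mem[OF \<beta>G] by (intro proj_finsum[OF fin_basis]) auto
  also have "\<dots> = (\<Oplus>\<^bsub>V\<^esub>\<alpha>\<in>basis. g \<beta> (proj (comp x \<alpha>)))"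
    using * cm proj_mem g_mem[OF \<beta>G] by (intro M.finsum_cong' refl) auto
  also have "\<dots> = g \<beta> (\<Oplus>\<^bsub>V\<^esub>\<alpha>\<in>basis. proj (comp x \<alpha>))" using cm proj_mem by (intro g_finsum[OF \<beta>G fin_basis, symmetric]) auto
  also have "(\<Oplus>\<^bsub>V\<^esub>\<alpha>\<in>basis. proj (comp x \<alpha>)) = proj x" using proj_finsum[OF fin_basis, of "comp x"] cm by (simp add: comp_sum[OF x])
  finally show ?thesis .
qed

text \<open>If \<alpha> is in the inertia group and \<beta> is not, then \<beta>\<alpha> is not; so
  \<beta> carries the whole component of \<open>W\<close> into the part that the projection
  kills.\<close>

lemma proj_translate_zero:
  assumes \<beta>: "\<beta> \<in> G" "\<beta> \<notin> inertia" and x: "x \<in> carrier V"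
  shows "proj (g \<beta> (proj x)) = \<zero>\<^bsub>V\<^esub>"
proof -
  have fI: "finite (basis \<inter> inertia)" using fin_basis by auto
  have cm: "comp x \<alpha> \<in> carrier V" if "\<alpha> \<in> basis \<inter> inertia" for \<alpha> using comp_carrier[OF x] that by auto
  have "proj (g \<beta> (proj x)) = (\<Oplus>\<^bsub>V\<^esub>\<alpha>\<in>basis \<inter> inertia. proj (g \<beta> (comp x \<alpha>)))"
  proof -
    have "g \<beta> (\<Oplus>\<^bsub>V\<^esub>\<alpha>\<in>basis \<inter> inertia. comp x \<alpha>) = (\<Oplus>\<^bsub>V\<^esub>\<alpha>\<in>basis \<inter> inertia. g \<beta> (comp x \<alpha>))"
      using cm by (intro g_finsum[OF \<beta>(1) fI]) auto
    moreover have "proj (\<Oplus>\<^bsub>V\<^esub>\<alpha>\<in>basis \<inter> inertia. g \<beta> (comp x \<alpha>)) = (\<Oplus>\<^bsub>V\<^esub>\<alpha>\<in>basis \<inter> inertia. proj (g \<beta> (comp x \<alpha>)))"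
      using cm g_mem[OF \<beta>(1)] by (intro proj_finsum[OF fI]) auto
    ultimately show ?thesis unfolding proj_def[of x] by simp
  qed
  also have "\<dots> = \<zero>\<^bsub>V\<^esub>"
  proof (rule M.add.finprod_one_eqI)
    fix \<alpha> assume \<alpha>: "\<alpha> \<in> basis \<inter> inertia"
    then have \<alpha>G: "\<alpha> \<in> G" using basis(1) by auto
    show "proj (g \<beta> (comp x \<alpha>)) = \<zero>\<^bsub>V\<^esub>"
      using proj_not_inertia[OF mul_mem[OF \<beta>(1) \<alpha>G] _ tw_mul[OF \<beta>(1) \<alpha>G comp_mem[OF x]]]
        inertia_mul_iff(2)[OF \<beta>(1) \<alpha>G] \<alpha> \<beta>(2) by simp
  qed
  finally show ?thesis .
qed

lemma proj_idem: "x \<in> carrier V \<Longrightarrow> proj (proj x) = proj x"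
proof -
  assume x: "x \<in> carrier V"
  have fI: "finite (basis \<inter> inertia)" using fin_basis by auto
  have cm: "comp x \<alpha> \<in> carrier V" if "\<alpha> \<in> basis \<inter> inertia" for \<alpha> using comp_carrier[OF x] that by auto
  have "proj (proj x) = (\<Oplus>\<^bsub>V\<^esub>\<alpha>\<in>basis \<inter> inertia. proj (comp x \<alpha>))"
    unfolding proj_def[of x] using cm by (intro proj_finsum[OF fI]) auto
  also have "\<dots> = proj x"
    unfolding proj_def[of x] using cm comp_mem[OF x] by (intro M.finsum_cong' refl) (auto simp: proj_inertia)
  finally show ?thesis .
qed

lemma proj_nonzero: "\<exists>x\<in>carrier V. proj x \<noteq> \<zero>\<^bsub>V\<^esub>"
proof -
  obtain x where x: "x \<in> W" "x \<noteq> \<zero>\<^bsub>V\<^esub>"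
    using minimalD(2)[OF W_minimal] submoduleD(2)[OF minimalD(1)[OF W_minimal]] by blast
  then have "proj x = x" "x \<in> carrier V" using proj_inertia[OF inertia_e, of x] W_carrier by (auto simp: tw_e)
  then show ?thesis using x(2) by (intro bexI[of _ x]) auto
qed

text \<open>Each summand of the direct sum over \<open>basis\<close> is then isomorphic to
  \<open>W\<close>; choosing such isomorphisms turns coordinates into a tuple in \<open>W\<close>.
  The exponent is the number of summands.\<close>

lemma isotypic_if_inertia_full:
  assumes full: "inertia = G"
  shows "\<exists>(f :: 'v \<Rightarrow> nat \<Rightarrow> 'v) n. bij_betw f (carrier V) ({..<n} \<rightarrow>\<^sub>E W) \<and>
    (\<forall>x\<in>carrier V. \<forall>y\<in>carrier V. f (x \<oplus>\<^bsub>V\<^esub> y) = (\<lambda>i\<in>{..<n}. f x i \<oplus>\<^bsub>V\<^esub> f y i)) \<and>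
    (\<forall>a\<in>carrier D. \<forall>x\<in>carrier V. f (a \<odot>\<^bsub>V\<^esub> x) = (\<lambda>i\<in>{..<n}. a \<odot>\<^bsub>V\<^esub> f x i))"
proof -
  let ?n = "card basis"
  obtain b where b: "bij_betw b {..<?n} basis" using ex_bij_betw_nat_finite[OF fin_basis] by (auto simp: atLeast0LessThan)
  have "iso_sub (tw \<alpha>) W" if "\<alpha> \<in> basis" for \<alpha>
    using iso_sub_sym[OF _ minimalD(1)[OF W_minimal]] basis(1) full that unfolding inertia_def by blast
  then have "\<exists>\<phi>. lin_on (tw \<alpha>) W \<phi> \<and> bij_betw \<phi> (tw \<alpha>) W" if "\<alpha> \<in> basis" for \<alpha>
    using that unfolding iso_sub_def by blast
  then obtain \<phi> where \<phi>: "\<And>\<alpha>. \<alpha> \<in> basis \<Longrightarrow> lin_on (tw \<alpha>) W (\<phi> \<alpha>)" "\<And>\<alpha>. \<alpha> \<in> basis \<Longrightarrow> bij_betw (\<phi> \<alpha>) (tw \<alpha>) W"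
    by metis
  have bm: "b i \<in> basis" if "i < ?n" for i using b that by (auto simp: bij_betw_def)
  let ?f = "\<lambda>x. \<lambda>i\<in>{..<?n}. \<phi> (b i) (comp x (b i))"
  let ?h = "\<lambda>w. \<Oplus>\<^bsub>V\<^esub>\<alpha>\<in>basis. inv_into (tw \<alpha>) (\<phi> \<alpha>) (w (inv_into {..<?n} b \<alpha>))"
  have bi: "inv_into {..<?n} b (b i) = i" if "i < ?n" for i using b that by (auto simp: bij_betw_def)
  have bi': "inv_into {..<?n} b \<alpha> < ?n" "b (inv_into {..<?n} b \<alpha>) = \<alpha>" if "\<alpha> \<in> basis" for \<alpha>
    using b that inv_into_into[of \<alpha> b "{..<?n}"] by (auto simp: bij_betw_def f_inv_into_f)
  have inv: "inv_into (tw \<alpha>) (\<phi> \<alpha>) y \<in> tw \<alpha>" "\<phi> \<alpha> (inv_into (tw \<alpha>) (\<phi> \<alpha>) y) = y" if "\<alpha> \<in> basis" "y \<in> W" for \<alpha> y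
    using \<phi>(2)[OF that(1)] that(2) inv_into_into[of y "\<phi> \<alpha>" "tw \<alpha>"] f_inv_into_f[of y "\<phi> \<alpha>" "tw \<alpha>"]
    unfolding bij_betw_def by simp_all
  have inv': "inv_into (tw \<alpha>) (\<phi> \<alpha>) (\<phi> \<alpha> y) = y" if "\<alpha> \<in> basis" "y \<in> tw \<alpha>" for \<alpha> y
    using \<phi>(2)[OF that(1)] that(2) unfolding bij_betw_def by simp
  have "bij_betw ?f (carrier V) ({..<?n} \<rightarrow>\<^sub>E W)"
  proof (rule bij_betwI)
    show "?f \<in> carrier V \<rightarrow> ({..<?n} \<rightarrow>\<^sub>E W)"
      using lin_onD(1)[OF \<phi>(1)[OF bm] comp_mem[OF _ bm]] by auto
    have wm: "inv_into (tw \<alpha>) (\<phi> \<alpha>) (w (inv_into {..<?n} b \<alpha>)) \<in> tw \<alpha>" if "w \<in> {..<?n} \<rightarrow>\<^sub>E W" "\<alpha> \<in> basis" for w \<alpha>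
      using inv(1)[OF that(2)] bi'(1)[OF that(2)] that(1) by blast
    show "?h \<in> ({..<?n} \<rightarrow>\<^sub>E W) \<rightarrow> carrier V"
    proof (intro Pi_I M.finsum_closed)
      fix w \<alpha> assume "w \<in> {..<?n} \<rightarrow>\<^sub>E W" "\<alpha> \<in> basis"
      then show "inv_into (tw \<alpha>) (\<phi> \<alpha>) (w (inv_into {..<?n} b \<alpha>)) \<in> carrier V"
        using wm tw_carrier basis(1) by blast
    qed
    fix x assume x: "x \<in> carrier V"
    have "?h (?f x) = (\<Oplus>\<^bsub>V\<^esub>\<alpha>\<in>basis. comp x \<alpha>)"
      using comp_carrier[OF x] by (intro M.finsum_cong' refl) (auto simp: bi' inv' comp_mem[OF x])
    then show "?h (?f x) = x" by (simp only: comp_sum[OF x])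
  next
    fix w assume w: "w \<in> {..<?n} \<rightarrow>\<^sub>E W"
    have wm: "inv_into (tw \<alpha>) (\<phi> \<alpha>) (w (inv_into {..<?n} b \<alpha>)) \<in> tw \<alpha>" if "\<alpha> \<in> basis" for \<alpha>
      using inv(1)[OF that] bi'(1)[OF that] w by blast
    show "?f (?h w) = w"
    proof (rule extensionalityI[of _ "{..<?n}"])
      fix i assume "i \<in> {..<?n}"
      then have i: "i < ?n" by simp
      have "comp (?h w) (b i) = inv_into (tw (b i)) (\<phi> (b i)) (w (inv_into {..<?n} b (b i)))"
        by (rule comp_eqI[OF wm refl bm[OF i]])
      moreover have "w i \<in> W" using w i by blast
      ultimately show "?f (?h w) i = w i" using i inv(2)[OF bm[OF i]] by (simp add: bi)
    qed (use w in \<open>auto simp: PiE_def\<close>)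
  qed
  moreover have "?f (x \<oplus>\<^bsub>V\<^esub> y) = (\<lambda>i\<in>{..<?n}. ?f x i \<oplus>\<^bsub>V\<^esub> ?f y i)" if "x \<in> carrier V" "y \<in> carrier V" for x y
    using that bm by (intro restrict_ext) (simp add: comp_add lin_onD(2)[OF \<phi>(1)] comp_mem)
  moreover have "?f (a \<odot>\<^bsub>V\<^esub> x) = (\<lambda>i\<in>{..<?n}. a \<odot>\<^bsub>V\<^esub> ?f x i)" if "a \<in> carrier D" "x \<in> carrier V" for a x
    using that bm by (intro restrict_ext) (simp add: comp_smult lin_onD(3)[OF \<phi>(1)] comp_mem)
  ultimately show ?thesis by (intro exI[of _ ?f] exI[of _ ?n]) blast
qed

end

section \<open>The Galois action on the inverse image\<close>

lemma additive_map_finsum_fun: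
  assumes A: "abelian_group A" and B: "abelian_group B" and I: "finite I"
    and f: "\<And>i. i \<in> I \<Longrightarrow> additive_map A B (f i)"
  shows "additive_map A B (\<lambda>x. \<Oplus>\<^bsub>B\<^esub>i\<in>I. f i x)"
proof -
  interpret A: abelian_group A by fact
  interpret B: abelian_group B by fact
  note m = additive_mapD[OF f]
  show ?thesis
  proof (rule additive_mapI)
    fix x assume x: "x \<in> carrier A"
    show "(\<Oplus>\<^bsub>B\<^esub>i\<in>I. f i x) \<in> carrier B" using m(1) x by (intro B.finsum_closed) auto
    fix y assume y: "y \<in> carrier A"
    have "(\<Oplus>\<^bsub>B\<^esub>i\<in>I. f i (x \<oplus>\<^bsub>A\<^esub> y)) = (\<Oplus>\<^bsub>B\<^esub>i\<in>I. f i x \<oplus>\<^bsub>B\<^esub> f i y)"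
      using m x y by (intro B.finsum_cong' refl) auto
    also have "\<dots> = (\<Oplus>\<^bsub>B\<^esub>i\<in>I. f i x) \<oplus>\<^bsub>B\<^esub> (\<Oplus>\<^bsub>B\<^esub>i\<in>I. f i y)"
      using m(1) x y by (intro B.finsum_addf) auto
    finally show "(\<Oplus>\<^bsub>B\<^esub>i\<in>I. f i (x \<oplus>\<^bsub>A\<^esub> y)) = (\<Oplus>\<^bsub>B\<^esub>i\<in>I. f i x) \<oplus>\<^bsub>B\<^esub> (\<Oplus>\<^bsub>B\<^esub>i\<in>I. f i y)" .
  qed
qed

lemma additive_map_compose: "additive_map A B f \<Longrightarrow> additive_map B C h \<Longrightarrow> additive_map A C (\<lambda>x. h (f x))"
  by (intro additive_mapI) (auto simp: additive_mapD)

text \<open>Counting the pivots of a subspace replaces its dimension.\<close>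

lemma subspace_measure_exists:
  fixes M :: "('r, 'm, 'x) module_scheme" and b :: "nat \<Rightarrow> 'm"
  assumes L: "field L" and M: "left_module L M" and b: "\<And>i. i < r \<Longrightarrow> b i \<in> carrier M"
    and span: "\<And>x. x \<in> carrier M \<Longrightarrow> \<exists>c\<in>{..<r} \<rightarrow> carrier L. x = (\<Oplus>\<^bsub>M\<^esub>i\<in>{..<r}. c i \<odot>\<^bsub>M\<^esub> b i)"
  shows "\<exists>\<mu> :: 'm set \<Rightarrow> nat. \<forall>U U'. submodule U L M \<longrightarrow> submodule U' L M \<longrightarrow> U \<subset> U' \<longrightarrow> \<mu> U < \<mu> U'"
proof -
  interpret L: field L by fact
  interpret M: left_module L M by fact
  \<comment> \<open>Positions i such that \<open>U\<close> contains a combination of b_0, ..., b_i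
    with coefficient 1 at b_i. The b_i may be linearly dependent, so these are pivots of expressions
    rather than of vectors.\<close>
  define piv where "piv U = {i. i < r \<and> (\<exists>c\<in>{..<Suc i} \<rightarrow> carrier L. c i = \<one>\<^bsub>L\<^esub> \<and> (\<Oplus>\<^bsub>M\<^esub>j\<in>{..<Suc i}. c j \<odot>\<^bsub>M\<^esub> b j) \<in> U)}" for U
  have pivI: "i \<in> piv U" if "i < r" "\<And>j. j < Suc i \<Longrightarrow> c j \<in> carrier L" "c i = \<one>\<^bsub>L\<^esub>" "(\<Oplus>\<^bsub>M\<^esub>j\<in>{..<Suc i}. c j \<odot>\<^bsub>M\<^esub> b j) \<in> U" for i U c
    using that unfolding piv_def by (intro CollectI conjI bexI[of _ c]) auto
  have sum_Suc: "(\<Oplus>\<^bsub>M\<^esub>j\<in>{..<Suc i}. c j \<odot>\<^bsub>M\<^esub> b j) = c i \<odot>\<^bsub>M\<^esub> b i \<oplus>\<^bsub>M\<^esub> (\<Oplus>\<^bsub>M\<^esub>j\<in>{..<i}. c j \<odot>\<^bsub>M\<^esub> b j)"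
    if "i < r" "\<And>j. j < Suc i \<Longrightarrow> c j \<in> carrier L" for i c
    using that b by (simp add: lessThan_Suc M.smult_closed Pi_def)
  \<comment> \<open>Gaussian elimination from the top: if \<open>U'\<close> has no pivots beyond
    those of \<open>U\<close>, an element of \<open>U'\<close> is reduced by elements of
    \<open>U\<close> until nothing is left.\<close>
  have key: "(\<Oplus>\<^bsub>M\<^esub>j\<in>{..<i}. c j \<odot>\<^bsub>M\<^esub> b j) \<in> U"
    if U: "submodule U L M" and U': "submodule U' L M" and sub: "U \<subseteq> U'" and eq: "piv U' \<subseteq> piv U"
      and "i \<le> r" and "\<And>j. j < i \<Longrightarrow> c j \<in> carrier L" and "(\<Oplus>\<^bsub>M\<^esub>j\<in>{..<i}. c j \<odot>\<^bsub>M\<^esub> b j) \<in> U'" for U U' i c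
    using that(5-7)
  proof (induction i arbitrary: c)
    case 0
    then show ?case using M.submoduleD(2)[OF U] by simp
  next
    case (Suc i)
    note UD = M.submoduleD[OF U] and UD' = M.submoduleD[OF U']
    have i: "i < r" using Suc.prems(1) by simp
    have c: "c j \<in> carrier L" if "j < Suc i" for j using Suc.prems(2) that by auto
    have bj: "b j \<in> carrier M" if "j < Suc i" for j using b i that by auto
    have ci: "c i \<in> carrier L" using c by simp
    let ?x = "\<Oplus>\<^bsub>M\<^esub>j\<in>{..<Suc i}. c j \<odot>\<^bsub>M\<^esub> b j"
    show ?case
    proof (cases "c i = \<zero>\<^bsub>L\<^esub>")
      case True
      have "\<zero>\<^bsub>L\<^esub> \<odot>\<^bsub>M\<^esub> b i = \<zero>\<^bsub>M\<^esub>"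
        by (rule additive_map_zero[OF L.is_abelian_group M.M.abelian_group_axioms M.smult_left_map]) (use bj in auto)
      moreover have "(\<Oplus>\<^bsub>M\<^esub>j\<in>{..<i}. c j \<odot>\<^bsub>M\<^esub> b j) \<in> carrier M"
        using c bj by (intro M.M.finsum_closed) (auto intro!: M.smult_closed)
      ultimately have x: "?x = (\<Oplus>\<^bsub>M\<^esub>j\<in>{..<i}. c j \<odot>\<^bsub>M\<^esub> b j)"
        using sum_Suc[OF i c] True by simp
      show ?thesis unfolding x using Suc.prems(3) c i unfolding x by (intro Suc.IH) auto
    next
      case False
      then have "c i \<in> Units L" using ci by (simp add: L.field_Units)
      then obtain d where d: "d \<in> carrier L" "d \<otimes>\<^bsub>L\<^esub> c i = \<one>\<^bsub>L\<^esub>"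
        using L.Units_inv_closed L.Units_l_inv by metis
      have "d \<odot>\<^bsub>M\<^esub> ?x = (\<Oplus>\<^bsub>M\<^esub>j\<in>{..<Suc i}. d \<odot>\<^bsub>M\<^esub> (c j \<odot>\<^bsub>M\<^esub> b j))"
        using d c bj by (intro M.smult_finsum) (auto intro!: M.smult_closed)
      also have "\<dots> = (\<Oplus>\<^bsub>M\<^esub>j\<in>{..<Suc i}. (d \<otimes>\<^bsub>L\<^esub> c j) \<odot>\<^bsub>M\<^esub> b j)"
        using d c bj by (intro M.M.finsum_cong' refl) (auto simp: M.smult_assoc intro!: M.smult_closed)
      finally have "(\<Oplus>\<^bsub>M\<^esub>j\<in>{..<Suc i}. (d \<otimes>\<^bsub>L\<^esub> c j) \<odot>\<^bsub>M\<^esub> b j) \<in> U'"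
        using UD'(4)[OF d(1) Suc.prems(3)] by simp
      then have "i \<in> piv U'" using d c by (intro pivI[OF i, of "\<lambda>j. d \<otimes>\<^bsub>L\<^esub> c j"]) auto
      then have "i \<in> piv U" using eq by auto
      then obtain c' where c': "\<And>j. j < Suc i \<Longrightarrow> c' j \<in> carrier L" "c' i = \<one>\<^bsub>L\<^esub>" "(\<Oplus>\<^bsub>M\<^esub>j\<in>{..<Suc i}. c' j \<odot>\<^bsub>M\<^esub> b j) \<in> U"
        unfolding piv_def by auto
      let ?y = "\<Oplus>\<^bsub>M\<^esub>j\<in>{..<Suc i}. c' j \<odot>\<^bsub>M\<^esub> b j"
      \<comment> \<open>Subtracting c_i times the pivot element of \<open>U\<close> cancels the
        coefficient at b_i and leaves a shorter combination, still in \<open>U'\<close>.\<close>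
      let ?z = "\<Oplus>\<^bsub>M\<^esub>j\<in>{..<i}. (c j \<ominus>\<^bsub>L\<^esub> c i \<otimes>\<^bsub>L\<^esub> c' j) \<odot>\<^bsub>M\<^esub> b j"
      have yi: "c i \<odot>\<^bsub>M\<^esub> ?y \<in> U" using UD(4)[OF ci c'(3)] .
      have zc: "?z \<in> carrier M" using c c' ci bj by (intro M.M.finsum_closed) (auto intro!: M.smult_closed)
      let ?cc = "\<lambda>j. c j \<ominus>\<^bsub>L\<^esub> c i \<otimes>\<^bsub>L\<^esub> c' j"
      have ccm: "?cc j \<in> carrier L" if "j < Suc i" for j using c c' ci that by auto
      have "?z = (\<Oplus>\<^bsub>M\<^esub>j\<in>{..<Suc i}. ?cc j \<odot>\<^bsub>M\<^esub> b j)"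
      proof -
        have "?cc i = \<zero>\<^bsub>L\<^esub>" using ci c'(2) by (simp add: L.minus_eq L.r_neg)
        moreover have "\<zero>\<^bsub>L\<^esub> \<odot>\<^bsub>M\<^esub> b i = \<zero>\<^bsub>M\<^esub>"
          by (rule additive_map_zero[OF L.is_abelian_group M.M.abelian_group_axioms M.smult_left_map]) (use bj in auto)
        ultimately show ?thesis using sum_Suc[OF i ccm] zc by simp
      qed
      moreover have "c i \<odot>\<^bsub>M\<^esub> ?y = (\<Oplus>\<^bsub>M\<^esub>j\<in>{..<Suc i}. (c i \<otimes>\<^bsub>L\<^esub> c' j) \<odot>\<^bsub>M\<^esub> b j)"
      proof -
        have "c i \<odot>\<^bsub>M\<^esub> ?y = (\<Oplus>\<^bsub>M\<^esub>j\<in>{..<Suc i}. c i \<odot>\<^bsub>M\<^esub> (c' j \<odot>\<^bsub>M\<^esub> b j))"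
          using ci c' bj by (intro M.smult_finsum) (auto intro!: M.smult_closed)
        also have "\<dots> = (\<Oplus>\<^bsub>M\<^esub>j\<in>{..<Suc i}. (c i \<otimes>\<^bsub>L\<^esub> c' j) \<odot>\<^bsub>M\<^esub> b j)"
          using ci c' bj by (intro M.M.finsum_cong' refl) (auto simp: M.smult_assoc intro!: M.smult_closed)
        finally show ?thesis .
      qed
      moreover have "(\<Oplus>\<^bsub>M\<^esub>j\<in>{..<Suc i}. ?cc j \<odot>\<^bsub>M\<^esub> b j) \<oplus>\<^bsub>M\<^esub> (\<Oplus>\<^bsub>M\<^esub>j\<in>{..<Suc i}. (c i \<otimes>\<^bsub>L\<^esub> c' j) \<odot>\<^bsub>M\<^esub> b j) = ?x"
      proof -
        have "(\<Oplus>\<^bsub>M\<^esub>j\<in>{..<Suc i}. ?cc j \<odot>\<^bsub>M\<^esub> b j) \<oplus>\<^bsub>M\<^esub> (\<Oplus>\<^bsub>M\<^esub>j\<in>{..<Suc i}. (c i \<otimes>\<^bsub>L\<^esub> c' j) \<odot>\<^bsub>M\<^esub> b j) =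
            (\<Oplus>\<^bsub>M\<^esub>j\<in>{..<Suc i}. ?cc j \<odot>\<^bsub>M\<^esub> b j \<oplus>\<^bsub>M\<^esub> (c i \<otimes>\<^bsub>L\<^esub> c' j) \<odot>\<^bsub>M\<^esub> b j)"
          using ccm ci c' bj by (intro M.M.finsum_addf[symmetric]) (auto intro!: M.smult_closed)
        also have "\<dots> = ?x"
        proof (intro M.M.finsum_cong' refl)
          fix j assume "j \<in> {..<Suc i}"
          then have j: "j < Suc i" by simp
          have "?cc j \<oplus>\<^bsub>L\<^esub> c i \<otimes>\<^bsub>L\<^esub> c' j = c j"
            using c[OF j] c'(1)[OF j] ci by (simp add: L.minus_eq L.a_assoc L.l_neg)
          then show "?cc j \<odot>\<^bsub>M\<^esub> b j \<oplus>\<^bsub>M\<^esub> (c i \<otimes>\<^bsub>L\<^esub> c' j) \<odot>\<^bsub>M\<^esub> b j = c j \<odot>\<^bsub>M\<^esub> b j"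
            using M.smult_l_distr[OF ccm[OF j] _ bj[OF j], of "c i \<otimes>\<^bsub>L\<^esub> c' j"] ci c'(1)[OF j] by simp
        qed (use c bj in \<open>auto intro!: M.smult_closed\<close>)
        finally show ?thesis .
      qed
      ultimately have x: "?x = ?z \<oplus>\<^bsub>M\<^esub> c i \<odot>\<^bsub>M\<^esub> ?y" by simp
      have "?z = ?x \<ominus>\<^bsub>M\<^esub> c i \<odot>\<^bsub>M\<^esub> ?y" using x zc UD(1)[OF yi] by (rule M.M.eq_minusI)
      then have "?z \<in> U'"
        using UD'(3)[OF Suc.prems(3) UD'(5)[OF subsetD[OF sub yi]]] by (simp add: M.M.minus_eq)
      then have "?z \<in> U" using i c c' ci by (intro Suc.IH) auto
      then show ?thesis unfolding x using UD(3) yi by blast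
    qed
  qed
  have "card (piv U) < card (piv U')" if U: "submodule U L M" and U': "submodule U' L M" and sub: "U \<subset> U'" for U U'
  proof (rule psubset_card_mono)
    show "finite (piv U')" by (rule finite_subset[of _ "{..<r}"]) (auto simp: piv_def)
    have "piv U \<subseteq> piv U'" using sub unfolding piv_def by blast
    moreover have "piv U \<noteq> piv U'"
    proof
      assume eq: "piv U = piv U'"
      have "U' \<subseteq> U"
      proof
        fix x assume x: "x \<in> U'"
        then have "x \<in> carrier M" using M.submoduleD(1)[OF U'] by auto
        then obtain c where c: "c \<in> {..<r} \<rightarrow> carrier L" "x = (\<Oplus>\<^bsub>M\<^esub>i\<in>{..<r}. c i \<odot>\<^bsub>M\<^esub> b i)" using span by blast
        show "x \<in> U" using key[OF U U', of r c] sub eq c x by auto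
      qed
      then show False using sub by auto
    qed
    ultimately show "piv U \<subset> piv U'" by auto
  qed
  then show ?thesis by (intro exI[of _ "\<lambda>U. card (piv U)"]) blast
qed

section \<open>Galois descent on the inverse image\<close>

locale inverse_image_setting = galois_module K L q k G N
  for K :: "('a, 'b) ring_scheme" (structure) and L :: "('c, 'd) ring_scheme" (structure)
    and q :: "'a \<Rightarrow> 'c" and k :: "'a set" and G :: "('c \<Rightarrow> 'c) set" and N :: "('a \<Rightarrow> 'a, 'm) module" +
  fixes s
  assumes action: "inverse_image_action k K L q N s"
begin

abbreviation "Vs \<equiv> V s"

lemma Vs_module: "left_module DL Vs"
  and s_mult_op: "f \<in> carrier L \<Longrightarrow> l \<in> carrier L \<Longrightarrow> n \<in> carrier N \<Longrightarrow> s (mult_op L f) (t l n) = t (f \<otimes>\<^bsub>L\<^esub> l) n"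
  and s_ext: "P \<in> carrier DK \<Longrightarrow> n \<in> carrier N \<Longrightarrow> s (ext P) (t \<one>\<^bsub>L\<^esub> n) = t \<one>\<^bsub>L\<^esub> (P \<odot>\<^bsub>N\<^esub> n)"
  using action unfolding inverse_image_action_def Let_def ext_def by auto

lemmas s_closed = left_module.smult_closed[OF Vs_module, unfolded V_simps(4)]
lemmas s_ldistr = left_module.smult_l_distr[OF Vs_module, unfolded V_simps(4)]
lemmas s_rdistr = left_module.smult_r_distr[OF Vs_module, unfolded V_simps(4)]
lemmas s_assoc = left_module.smult_assoc[OF Vs_module, unfolded V_simps(4)]
lemmas s_one = left_module.smult_one[OF Vs_module, unfolded V_simps(4)]
lemmas s_left_map = left_module.smult_left_map[OF Vs_module, unfolded V_simps(4)]
lemmas s_right_map = left_module.smult_right_map[OF Vs_module, unfolded V_simps(4)]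

lemma s_mult_op_one: "l \<in> carrier L \<Longrightarrow> n \<in> carrier N \<Longrightarrow> s (mult_op L l) (t \<one>\<^bsub>L\<^esub> n) = t l n"
  by (simp add: s_mult_op)

definition gact :: "('c \<Rightarrow> 'c) \<Rightarrow> ('c \<times> 'm \<Rightarrow>\<^sub>0 int) set \<Rightarrow> ('c \<times> 'm \<Rightarrow>\<^sub>0 int) set" where
  "gact \<sigma> = (SOME h. additive_map Vs Vs h \<and> (\<forall>l\<in>carrier L. \<forall>n\<in>carrier N. h (t l n) = t (\<sigma> l) n))"

lemma gact:
  assumes \<sigma>: "\<sigma> \<in> G"
  shows gact_additive: "additive_map Vs Vs (gact \<sigma>)"
    and gact_pure: "l \<in> carrier L \<Longrightarrow> n \<in> carrier N \<Longrightarrow> gact \<sigma> (t l n) = t (\<sigma> l) n"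
proof -
  have "\<exists>h. additive_map Vs Vs h \<and> (\<forall>l\<in>carrier L. \<forall>n\<in>carrier N. h (t l n) = t (\<sigma> l) n)"
  proof (rule V_universal[OF abelian_V])
    fix l n assume l: "l \<in> carrier L" and n: "n \<in> carrier N"
    show "t (\<sigma> l) n \<in> carrier Vs" using l n sigma_simps(1)[OF \<sigma>] by (intro t_mem) auto
    show "t (\<sigma> (l \<oplus>\<^bsub>L\<^esub> l')) n = t (\<sigma> l) n \<oplus>\<^bsub>Vs\<^esub> t (\<sigma> l') n" if "l' \<in> carrier L" for l'
      using l n that sigma_simps(1,2)[OF \<sigma>] by (simp add: t_add_left[of _ _ _ s])
    show "t (\<sigma> l) (n \<oplus>\<^bsub>N\<^esub> n') = t (\<sigma> l) n \<oplus>\<^bsub>Vs\<^esub> t (\<sigma> l) n'" if "n' \<in> carrier N" for n'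
      using l n that sigma_simps(1)[OF \<sigma>] by (intro t_add_right) auto
    show "t (\<sigma> (l \<otimes>\<^bsub>L\<^esub> q a)) n = t (\<sigma> l) (mult_op K a \<odot>\<^bsub>N\<^esub> n)" if "a \<in> carrier K" for a
      using l n that sigma_simps(1,3)[OF \<sigma>] t_balanced[of "\<sigma> l" a n] by (simp add: q_mem sigma_q[OF \<sigma>])
  qed
  from someI_ex[OF this]
  have "additive_map Vs Vs (gact \<sigma>) \<and> (\<forall>l\<in>carrier L. \<forall>n\<in>carrier N. gact \<sigma> (t l n) = t (\<sigma> l) n)"
    unfolding gact_def .
  then show "additive_map Vs Vs (gact \<sigma>)" "l \<in> carrier L \<Longrightarrow> n \<in> carrier N \<Longrightarrow> gact \<sigma> (t l n) = t (\<sigma> l) n"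
    by auto
qed

lemmas gact_closed = additive_mapD(1)[OF gact_additive]

lemma gact_id:
  assumes x: "x \<in> carrier Vs" shows "gact (\<lambda>x\<in>carrier L. x) x = x"
proof (rule V_map_eqI[OF abelian_V gact_additive[OF G_id] _ _ x])
  show "additive_map Vs Vs (\<lambda>x. x)" by (rule additive_mapI) auto
qed (simp add: gact_pure[OF G_id])

lemma gact_compose:
  assumes \<sigma>: "\<sigma> \<in> G" and \<tau>: "\<tau> \<in> G" and x: "x \<in> carrier Vs"
  shows "gact (compose (carrier L) \<sigma> \<tau>) x = gact \<sigma> (gact \<tau> x)"
proof (rule V_map_eqI[OF abelian_V gact_additive[OF G_comp[OF \<sigma> \<tau>]] additive_map_compose[OF gact_additive[OF \<tau>] gact_additive[OF \<sigma>]] _ x])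
  fix l n assume "l \<in> carrier L" "n \<in> carrier N"
  then show "gact (compose (carrier L) \<sigma> \<tau>) (t l n) = gact \<sigma> (gact \<tau> (t l n))"
    using sigma_simps(1)[OF \<tau>] by (simp add: gact_pure[OF G_comp[OF \<sigma> \<tau>]] gact_pure[OF \<sigma>] gact_pure[OF \<tau>])
      (simp add: compose_def)
qed

text \<open>Both parts apply \<open>s\<close> to an explicit sum: the decomposition of
  \<open>R\<close>, and its conjugate, in which only the left factors u_i move because operators
  extended from \<open>K\<close> commute with the Galois group.\<close>

lemma s_decomposition:
  assumes R: "R \<in> carrier DL" and n: "n \<in> carrier N"
  shows "s R (t \<one>\<^bsub>L\<^esub> n) = (\<Oplus>\<^bsub>Vs\<^esub>i\<in>{..<gdim}. t (du i) (tro (mult_op L (dv i) \<otimes>\<^bsub>DL\<^esub> R) \<odot>\<^bsub>N\<^esub> n))"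
    and "\<sigma> \<in> G \<Longrightarrow> s (cj \<sigma> R) (t \<one>\<^bsub>L\<^esub> n) = (\<Oplus>\<^bsub>Vs\<^esub>i\<in>{..<gdim}. t (\<sigma> (du i)) (tro (mult_op L (dv i) \<otimes>\<^bsub>DL\<^esub> R) \<odot>\<^bsub>N\<^esub> n))"
proof -
  interpret V: abelian_group Vs by (rule abelian_V)
  interpret D: ring DL by (rule ring_DL)
  let ?P = "\<lambda>i. tro (mult_op L (dv i) \<otimes>\<^bsub>DL\<^esub> R)"
  have P: "?P i \<in> carrier DK" if "i < gdim" for i
    using that R by (intro tro_closed DL_mult DL_op dv_mem)
  have t1: "t \<one>\<^bsub>L\<^esub> n \<in> carrier Vs" using n by (intro t_mem) auto
  have main: "s (\<Oplus>\<^bsub>DL\<^esub>i\<in>{..<gdim}. mult_op L (w i) \<otimes>\<^bsub>DL\<^esub> ext (?P i)) (t \<one>\<^bsub>L\<^esub> n) = (\<Oplus>\<^bsub>Vs\<^esub>i\<in>{..<gdim}. t (w i) (?P i \<odot>\<^bsub>N\<^esub> n))"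
    if w: "\<And>i. i < gdim \<Longrightarrow> w i \<in> carrier L" for w
  proof -
    have m: "mult_op L (w i) \<otimes>\<^bsub>DL\<^esub> ext (?P i) \<in> carrier DL" if "i < gdim" for i
      using that w P by (intro DL_mult DL_op ext(1))
    have "s (\<Oplus>\<^bsub>DL\<^esub>i\<in>{..<gdim}. mult_op L (w i) \<otimes>\<^bsub>DL\<^esub> ext (?P i)) (t \<one>\<^bsub>L\<^esub> n) =
        (\<Oplus>\<^bsub>Vs\<^esub>i\<in>{..<gdim}. s (mult_op L (w i) \<otimes>\<^bsub>DL\<^esub> ext (?P i)) (t \<one>\<^bsub>L\<^esub> n))"
      using m by (intro additive_map_finsum[OF D.is_abelian_group abelian_V s_left_map[OF t1]]) auto
    also have "\<dots> = (\<Oplus>\<^bsub>Vs\<^esub>i\<in>{..<gdim}. t (w i) (?P i \<odot>\<^bsub>N\<^esub> n))"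
    proof (intro V.finsum_cong' refl)
      fix i assume "i \<in> {..<gdim}"
      then have i: "i < gdim" by simp
      show "s (mult_op L (w i) \<otimes>\<^bsub>DL\<^esub> ext (?P i)) (t \<one>\<^bsub>L\<^esub> n) = t (w i) (?P i \<odot>\<^bsub>N\<^esub> n)"
        using s_assoc[OF DL_op[OF w[OF i]] ext(1)[OF P[OF i]] t1] s_ext[OF P[OF i] n] s_mult_op_one[OF w[OF i] N_smult[OF P[OF i] n]]
        by simp
    next
      show "(\<lambda>i. t (w i) (?P i \<odot>\<^bsub>N\<^esub> n)) \<in> {..<gdim} \<rightarrow> carrier Vs"
        using w N_smult[OF P n] by (intro Pi_I t_mem) auto
    qed
    finally show ?thesis .
  qed
  show "s R (t \<one>\<^bsub>L\<^esub> n) = (\<Oplus>\<^bsub>Vs\<^esub>i\<in>{..<gdim}. t (du i) (?P i \<odot>\<^bsub>N\<^esub> n))"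
    using main[of du, OF du_mem] diffop_decomposition[OF R] by simp
  assume \<sigma>: "\<sigma> \<in> G"
  have m: "mult_op L (du i) \<otimes>\<^bsub>DL\<^esub> ext (?P i) \<in> carrier DL" if "i < gdim" for i
    using that P du_mem by (intro DL_mult DL_op ext(1))
  have add: "additive_map DL DL (cj \<sigma>)" using cj_closed[OF \<sigma>] cj_add[OF \<sigma>] by (intro additive_mapI)
  have "cj \<sigma> R = cj \<sigma> (\<Oplus>\<^bsub>DL\<^esub>i\<in>{..<gdim}. mult_op L (du i) \<otimes>\<^bsub>DL\<^esub> ext (?P i))"
    using diffop_decomposition[OF R] by simp
  also have "\<dots> = (\<Oplus>\<^bsub>DL\<^esub>i\<in>{..<gdim}. cj \<sigma> (mult_op L (du i) \<otimes>\<^bsub>DL\<^esub> ext (?P i)))"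
    using m by (intro additive_map_finsum[OF D.is_abelian_group D.is_abelian_group add]) auto
  also have "\<dots> = (\<Oplus>\<^bsub>DL\<^esub>i\<in>{..<gdim}. mult_op L (\<sigma> (du i)) \<otimes>\<^bsub>DL\<^esub> ext (?P i))"
  proof (intro D.finsum_cong' refl)
    fix i assume "i \<in> {..<gdim}"
    then have i: "i < gdim" by simp
    show "cj \<sigma> (mult_op L (du i) \<otimes>\<^bsub>DL\<^esub> ext (?P i)) = mult_op L (\<sigma> (du i)) \<otimes>\<^bsub>DL\<^esub> ext (?P i)"
      using cj_mult[OF \<sigma> DL_op[OF du_mem[OF i]] ext(1)[OF P[OF i]]] cj_mult_op[OF \<sigma> du_mem[OF i]] cj_ext[OF \<sigma> P[OF i]] by simp
  next
    show "(\<lambda>i. mult_op L (\<sigma> (du i)) \<otimes>\<^bsub>DL\<^esub> ext (?P i)) \<in> {..<gdim} \<rightarrow> carrier DL"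
      using sigma_simps(1)[OF \<sigma> du_mem] ext(1)[OF P] by (intro Pi_I DL_mult DL_op) auto
  qed
  finally show "s (cj \<sigma> R) (t \<one>\<^bsub>L\<^esub> n) = (\<Oplus>\<^bsub>Vs\<^esub>i\<in>{..<gdim}. t (\<sigma> (du i)) (?P i \<odot>\<^bsub>N\<^esub> n))"
    using main[of "\<lambda>i. \<sigma> (du i)"] sigma_simps(1)[OF \<sigma> du_mem] by simp
qed

text \<open>Replacing Q by R = Q l reduces the claim to tensors 1 \<otimes> n. There the two halves
  of \<open>s_decomposition\<close> differ exactly by \<sigma> on the left factors, which is the
  effect of \<open>gact\<close>.\<close>

lemma gact_semilinear:
  assumes \<sigma>: "\<sigma> \<in> G" and Q: "Q \<in> carrier DL" and x: "x \<in> carrier Vs"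
  shows "gact \<sigma> (s Q x) = s (cj \<sigma> Q) (gact \<sigma> x)"
proof (rule V_map_eqI[OF abelian_V additive_map_compose[OF s_right_map[OF Q] gact_additive[OF \<sigma>]]
    additive_map_compose[OF gact_additive[OF \<sigma>] s_right_map[OF cj_closed[OF \<sigma> Q]]] _ x])
  fix l n assume l: "l \<in> carrier L" and n: "n \<in> carrier N"
  interpret V: abelian_group Vs by (rule abelian_V)
  have t1: "t \<one>\<^bsub>L\<^esub> n \<in> carrier Vs" using n by (intro t_mem) auto
  have sl: "\<sigma> l \<in> carrier L" by (rule sigma_simps(1)[OF \<sigma> l])
  let ?R = "Q \<otimes>\<^bsub>DL\<^esub> mult_op L l"
  have R: "?R \<in> carrier DL" by (rule DL_mult[OF Q DL_op[OF l]])
  have P: "tro (mult_op L (dv i) \<otimes>\<^bsub>DL\<^esub> ?R) \<odot>\<^bsub>N\<^esub> n \<in> carrier N" if "i < gdim" for i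
    by (rule N_smult[OF tro_closed[OF DL_mult[OF DL_op[OF dv_mem[OF that]] R]] n])
  have "gact \<sigma> (s Q (t l n)) = gact \<sigma> (s ?R (t \<one>\<^bsub>L\<^esub> n))"
    using s_assoc[OF Q DL_op[OF l] t1] s_mult_op_one[OF l n] by simp
  also have "\<dots> = (\<Oplus>\<^bsub>Vs\<^esub>i\<in>{..<gdim}. gact \<sigma> (t (du i) (tro (mult_op L (dv i) \<otimes>\<^bsub>DL\<^esub> ?R) \<odot>\<^bsub>N\<^esub> n)))"
    unfolding s_decomposition(1)[OF R n] using P du_mem
    by (intro additive_map_finsum[OF abelian_V abelian_V gact_additive[OF \<sigma>]]) (auto intro!: t_mem)
  also have "\<dots> = (\<Oplus>\<^bsub>Vs\<^esub>i\<in>{..<gdim}. t (\<sigma> (du i)) (tro (mult_op L (dv i) \<otimes>\<^bsub>DL\<^esub> ?R) \<odot>\<^bsub>N\<^esub> n))"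
    using P du_mem sigma_simps(1)[OF \<sigma> du_mem] by (intro V.finsum_cong' refl) (auto intro!: t_mem simp: gact_pure[OF \<sigma>])
  also have "\<dots> = s (cj \<sigma> ?R) (t \<one>\<^bsub>L\<^esub> n)" by (rule s_decomposition(2)[OF R n \<sigma>, symmetric])
  also have "cj \<sigma> ?R = cj \<sigma> Q \<otimes>\<^bsub>DL\<^esub> mult_op L (\<sigma> l)"
    using cj_mult[OF \<sigma> Q DL_op[OF l]] cj_mult_op[OF \<sigma> l] by simp
  also have "s \<dots> (t \<one>\<^bsub>L\<^esub> n) = s (cj \<sigma> Q) (t (\<sigma> l) n)"
    using s_assoc[OF cj_closed[OF \<sigma> Q] DL_op[OF sl] t1] s_mult_op_one[OF sl n] by simp
  finally show "gact \<sigma> (s Q (t l n)) = s (cj \<sigma> Q) (gact \<sigma> (t l n))" by (simp add: gact_pure[OF \<sigma> l n])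
qed

definition trV :: "('c \<times> 'm \<Rightarrow>\<^sub>0 int) set \<Rightarrow> ('c \<times> 'm \<Rightarrow>\<^sub>0 int) set" where
  "trV x = (\<Oplus>\<^bsub>Vs\<^esub>\<sigma>\<in>G. gact \<sigma> x)"

lemma trV_additive: "additive_map Vs Vs trV"
  unfolding trV_def by (rule additive_map_finsum_fun[OF abelian_V abelian_V G_finite gact_additive])

lemma trV_pure:
  assumes l: "l \<in> carrier L" and n: "n \<in> carrier N"
  shows "trV (t l n) = t (tr l) n"
proof -
  interpret V: abelian_group Vs by (rule abelian_V)
  have "trV (t l n) = (\<Oplus>\<^bsub>Vs\<^esub>\<sigma>\<in>G. t (\<sigma> l) n)"
    unfolding trV_def using l n sigma_simps(1) by (intro V.finsum_cong' refl) (auto simp: gact_pure intro!: t_mem)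
  also have "\<dots> = t (tr l) n"
    unfolding tr_def using l sigma_simps(1)
    by (intro additive_map_finsum[OF L.is_abelian_group abelian_V t_left_map[OF n] G_finite, symmetric]) auto
  finally show ?thesis .
qed

text \<open>On l \<otimes> n the trace is tr(l) \<otimes> n, and tr(l) comes from \<open>K\<close>,
  so it moves to the right factor. The set of all 1 \<otimes> n is closed under differences, which
  covers the rest.\<close>

lemma trV_in_N:
  assumes x: "x \<in> carrier Vs" shows "trV x \<in> t \<one>\<^bsub>L\<^esub> ` carrier N"
  using x
proof (induction rule: V_induct)
  case (diff x y)
  interpret V: abelian_group Vs by (rule abelian_V)
  interpret N: abelian_group N by (rule abelian_N)
  obtain m n where mn: "m \<in> carrier N" "trV x = t \<one>\<^bsub>L\<^esub> m" "n \<in> carrier N" "trV y = t \<one>\<^bsub>L\<^esub> n" using diff by auto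
  have "trV (x \<ominus>\<^bsub>Vs\<^esub> y) = trV x \<oplus>\<^bsub>Vs\<^esub> \<ominus>\<^bsub>Vs\<^esub> trV y"
    using diff(1,2) additive_mapD(2)[OF trV_additive] additive_map_minus[OF abelian_V abelian_V trV_additive]
    by (simp add: V.minus_eq)
  also have "\<dots> = t \<one>\<^bsub>L\<^esub> (m \<oplus>\<^bsub>N\<^esub> \<ominus>\<^bsub>N\<^esub> n)"
    using mn additive_mapD(2)[OF t_right_map[OF L.one_closed]] additive_map_minus[OF abelian_N abelian_V t_right_map[OF L.one_closed]]
    by simp
  finally show ?case using mn by auto
next
  case (pure l n)
  obtain a where a: "a \<in> carrier K" "tr l = q a" using tr_in_K[OF pure(1)] by auto
  have "trV (t l n) = t \<one>\<^bsub>L\<^esub> (mult_op K a \<odot>\<^bsub>N\<^esub> n)"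
    unfolding trV_pure[OF pure] a(2) using t_balanced[OF L.one_closed a(1) pure(2)] a(1) by (simp add: q_mem)
  then show ?case using N_smult[OF DK_op[OF a(1)] pure(2)] by blast
qed

text \<open>Both sides are additive in \<open>x\<close>, and on pure tensors the identity is
  \<open>expand_u\<close> in the left factor.\<close>

lemma expand_V:
  assumes x: "x \<in> carrier Vs"
  shows "(\<Oplus>\<^bsub>Vs\<^esub>j\<in>{..<gdim}. s (mult_op L (du j)) (trV (s (mult_op L (dv j)) x))) = x"
proof (rule V_map_eqI[OF abelian_V _ _ _ x])
  interpret V: abelian_group Vs by (rule abelian_V)
  show "additive_map Vs Vs (\<lambda>x. \<Oplus>\<^bsub>Vs\<^esub>j\<in>{..<gdim}. s (mult_op L (du j)) (trV (s (mult_op L (dv j)) x)))"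
  proof (rule additive_map_finsum_fun[OF abelian_V abelian_V])
    fix j assume "j \<in> {..<gdim}"
    then have j: "j < gdim" by simp
    show "additive_map Vs Vs (\<lambda>x. s (mult_op L (du j)) (trV (s (mult_op L (dv j)) x)))"
      by (rule additive_map_compose[OF additive_map_compose[OF s_right_map[OF DL_op[OF dv_mem[OF j]]] trV_additive] s_right_map[OF DL_op[OF du_mem[OF j]]]])
  qed simp
  show "additive_map Vs Vs (\<lambda>x. x)" by (rule additive_mapI) auto
  fix l n assume l: "l \<in> carrier L" and n: "n \<in> carrier N"
  have "(\<Oplus>\<^bsub>Vs\<^esub>j\<in>{..<gdim}. s (mult_op L (du j)) (trV (s (mult_op L (dv j)) (t l n)))) =
      (\<Oplus>\<^bsub>Vs\<^esub>j\<in>{..<gdim}. t (du j \<otimes>\<^bsub>L\<^esub> tr (dv j \<otimes>\<^bsub>L\<^esub> l)) n)"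
    using l n by (intro V.finsum_cong' refl) (auto simp: s_mult_op trV_pure du_mem dv_mem tr_closed intro!: t_mem)
  also have "\<dots> = t (\<Oplus>\<^bsub>L\<^esub>j\<in>{..<gdim}. du j \<otimes>\<^bsub>L\<^esub> tr (dv j \<otimes>\<^bsub>L\<^esub> l)) n"
    using l by (intro additive_map_finsum[OF L.is_abelian_group abelian_V t_left_map[OF n], symmetric])
      (auto simp: du_mem dv_mem tr_closed)
  also have "\<dots> = t l n" by (simp only: expand_u[OF l])
  finally show "(\<Oplus>\<^bsub>Vs\<^esub>j\<in>{..<gdim}. s (mult_op L (du j)) (trV (s (mult_op L (dv j)) (t l n)))) = t l n" .
qed

text \<open>With tr c = 1, the assignment of tr(c l) n to l \<otimes> n is a well-defined additive
  map to \<open>N\<close> that recovers n from 1 \<otimes> n.\<close>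

lemma t_one_eq_zero:
  assumes n: "n \<in> carrier N" and zero: "t \<one>\<^bsub>L\<^esub> n = \<zero>\<^bsub>Vs\<^esub>"
  shows "n = \<zero>\<^bsub>N\<^esub>"
proof -
  obtain c where c: "c \<in> carrier L" "tr c = \<one>\<^bsub>L\<^esub>" using trace_one_exists by blast
  interpret D: ring DL by (rule ring_DL)
  have tm: "tro (mult_op L (c \<otimes>\<^bsub>L\<^esub> l)) \<in> carrier DK" if "l \<in> carrier L" for l
    using that c by (intro tro_closed DL_op) auto
  have "\<exists>h. additive_map Vs N h \<and> (\<forall>l\<in>carrier L. \<forall>n\<in>carrier N. h (t l n) = tro (mult_op L (c \<otimes>\<^bsub>L\<^esub> l)) \<odot>\<^bsub>N\<^esub> n)"
  proof (rule V_universal[OF abelian_N])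
    fix l n assume l: "l \<in> carrier L" and n: "n \<in> carrier N"
    show "tro (mult_op L (c \<otimes>\<^bsub>L\<^esub> l)) \<odot>\<^bsub>N\<^esub> n \<in> carrier N" by (rule N_smult[OF tm[OF l] n])
    show "tro (mult_op L (c \<otimes>\<^bsub>L\<^esub> l)) \<odot>\<^bsub>N\<^esub> (n \<oplus>\<^bsub>N\<^esub> n') = tro (mult_op L (c \<otimes>\<^bsub>L\<^esub> l)) \<odot>\<^bsub>N\<^esub> n \<oplus>\<^bsub>N\<^esub> tro (mult_op L (c \<otimes>\<^bsub>L\<^esub> l)) \<odot>\<^bsub>N\<^esub> n'"
      if "n' \<in> carrier N" for n' by (rule N_rdistr[OF tm[OF l] n that])
    show "tro (mult_op L (c \<otimes>\<^bsub>L\<^esub> (l \<oplus>\<^bsub>L\<^esub> l'))) \<odot>\<^bsub>N\<^esub> n = tro (mult_op L (c \<otimes>\<^bsub>L\<^esub> l)) \<odot>\<^bsub>N\<^esub> n \<oplus>\<^bsub>N\<^esub> tro (mult_op L (c \<otimes>\<^bsub>L\<^esub> l')) \<odot>\<^bsub>N\<^esub> n"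
      if l': "l' \<in> carrier L" for l'
    proof -
      have "mult_op L (c \<otimes>\<^bsub>L\<^esub> (l \<oplus>\<^bsub>L\<^esub> l')) = mult_op L (c \<otimes>\<^bsub>L\<^esub> l) \<oplus>\<^bsub>DL\<^esub> mult_op L (c \<otimes>\<^bsub>L\<^esub> l')"
        using c l l' by (simp add: L.r_distr mult_op_add)
      then have "tro (mult_op L (c \<otimes>\<^bsub>L\<^esub> (l \<oplus>\<^bsub>L\<^esub> l'))) = tro (mult_op L (c \<otimes>\<^bsub>L\<^esub> l)) \<oplus>\<^bsub>DK\<^esub> tro (mult_op L (c \<otimes>\<^bsub>L\<^esub> l'))"
        using c l l' by (simp add: tro_add DL_op)
      then show ?thesis by (simp add: N_ldistr[OF tm[OF l] tm[OF l'] n])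
    qed
    show "tro (mult_op L (c \<otimes>\<^bsub>L\<^esub> (l \<otimes>\<^bsub>L\<^esub> q a))) \<odot>\<^bsub>N\<^esub> n = tro (mult_op L (c \<otimes>\<^bsub>L\<^esub> l)) \<odot>\<^bsub>N\<^esub> (mult_op K a \<odot>\<^bsub>N\<^esub> n)"
      if a: "a \<in> carrier K" for a
    proof -
      have "mult_op L (c \<otimes>\<^bsub>L\<^esub> (l \<otimes>\<^bsub>L\<^esub> q a)) = mult_op L (c \<otimes>\<^bsub>L\<^esub> l) \<otimes>\<^bsub>DL\<^esub> ext (mult_op K a)"
        using c l a q_mem[OF a] by (simp add: ext_mult_op L.m_assoc flip: mult_op_mult)
      then have "tro (mult_op L (c \<otimes>\<^bsub>L\<^esub> (l \<otimes>\<^bsub>L\<^esub> q a))) = tro (mult_op L (c \<otimes>\<^bsub>L\<^esub> l)) \<otimes>\<^bsub>DK\<^esub> mult_op K a"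
        using c l a by (simp add: tro_mult_ext DL_op DK_op)
      then show ?thesis by (simp add: N_assoc[OF tm[OF l] DK_op[OF a] n])
    qed
  qed
  then obtain h where h: "additive_map Vs N h" "h (t \<one>\<^bsub>L\<^esub> n) = tro (mult_op L (c \<otimes>\<^bsub>L\<^esub> \<one>\<^bsub>L\<^esub>)) \<odot>\<^bsub>N\<^esub> n" using n by blast
  have "tro (mult_op L c) = \<one>\<^bsub>DK\<^esub>"
    using tro_mult_op[OF c(1) K.one_closed] c(2) q_simps(3) by (auto simp: mult_op_def K.diffop_ring_simps)
  then have "h (t \<one>\<^bsub>L\<^esub> n) = n" using h(2) c(1) N_one[OF n] by simp
  then show ?thesis using zero additive_map_zero[OF abelian_V abelian_N h(1)] by simp
qed

text \<open>The n with 1 \<otimes> n in \<open>U\<close> form a submodule of the simple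
  \<open>N\<close>. If it is everything, \<open>U\<close> contains all pure tensors. If it is zero,
  stability makes all traces of elements of \<open>U\<close> vanish, and \<open>expand_V\<close>
  rebuilds each element from such traces.\<close>

lemma irreducible:
  assumes simple: "simple_module DK N" and U: "submodule U DL Vs"
    and stable: "\<And>\<sigma> x. \<sigma> \<in> G \<Longrightarrow> x \<in> U \<Longrightarrow> gact \<sigma> x \<in> U"
  shows "U = {\<zero>\<^bsub>Vs\<^esub>} \<or> U = carrier Vs"
proof -
  interpret V: left_module DL Vs by (rule Vs_module)
  interpret N: abelian_group N by (rule abelian_N)
  note UD = V.submoduleD[OF U]
  have Us: "s Q x \<in> U" if "Q \<in> carrier DL" "x \<in> U" for Q x
    using UD(4)[OF that] by (simp only: V_simps(4))
  let ?H = "{n \<in> carrier N. t \<one>\<^bsub>L\<^esub> n \<in> U}"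
  have t1: "additive_map N Vs (t \<one>\<^bsub>L\<^esub>)" by (rule t_right_map[OF L.one_closed])
  have "submodule ?H DK N"
  proof (rule left_module.submoduleI[OF N_module])
    show "\<zero>\<^bsub>N\<^esub> \<in> ?H" using additive_map_zero[OF abelian_N abelian_V t1] UD(2) by simp
    fix x assume x: "x \<in> ?H"
    show "x \<in> carrier N" using x by simp
    show "x \<oplus>\<^bsub>N\<^esub> y \<in> ?H" if "y \<in> ?H" for y
      using x that UD(3) additive_mapD(2)[OF t1] by simp
    show "P \<odot>\<^bsub>N\<^esub> x \<in> ?H" if P: "P \<in> carrier DK" for P
      using x Us[OF ext(1)[OF P], of "t \<one>\<^bsub>L\<^esub> x"] s_ext[OF P, of x] N_smult[OF P, of x] by simp
  qed
  then have "?H = {\<zero>\<^bsub>N\<^esub>} \<or> ?H = carrier N" using simple unfolding simple_module_def by blast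
  then show ?thesis
  proof
    assume H: "?H = {\<zero>\<^bsub>N\<^esub>}"
    have "x = \<zero>\<^bsub>Vs\<^esub>" if x: "x \<in> U" for x
    proof -
      have xV: "x \<in> carrier Vs" using UD(1) x by auto
      have zero: "trV y = \<zero>\<^bsub>Vs\<^esub>" if y: "y \<in> U" for y
      proof -
        obtain n where n: "n \<in> carrier N" "trV y = t \<one>\<^bsub>L\<^esub> n" using trV_in_N UD(1) y by blast
        have "trV y \<in> U" unfolding trV_def by (rule V.submodule_finsum[OF U G_finite stable[OF _ y]])
        then have "n \<in> ?H" using n by simp
        then have "n = \<zero>\<^bsub>N\<^esub>" using H by blast
        then show ?thesis using n additive_map_zero[OF abelian_N abelian_V t1] by simp
      qed
      have "(\<Oplus>\<^bsub>Vs\<^esub>j\<in>{..<gdim}. s (mult_op L (du j)) (trV (s (mult_op L (dv j)) x))) = \<zero>\<^bsub>Vs\<^esub>"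
      proof (rule V.M.add.finprod_one_eqI)
        fix j assume "j \<in> {..<gdim}"
        then have j: "j < gdim" by simp
        show "s (mult_op L (du j)) (trV (s (mult_op L (dv j)) x)) = \<zero>\<^bsub>Vs\<^esub>"
          using zero[OF Us[OF DL_op[OF dv_mem[OF j]] x]] V.smult_zero[OF DL_op[OF du_mem[OF j]]]
          by (simp only: V_simps(4))
      qed
      then show ?thesis using expand_V[OF xV] by simp
    qed
    then show ?thesis using UD(2) by blast
  next
    assume H: "?H = carrier N"
    have "x \<in> U" if "x \<in> carrier Vs" for x
      using that
    proof (induction rule: V_induct)
      case (diff x y)
      then show ?case using UD(3)[OF _ UD(5)] by (simp add: V.M.minus_eq)
    next
      case (pure l n)
      then have "t \<one>\<^bsub>L\<^esub> n \<in> U" using H by blast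
      then show ?case using Us[OF DL_op[OF pure(1)]] s_mult_op_one[OF pure] by metis
    qed
    then show ?thesis using UD(1) by blast
  qed
qed

lemma V_nontrivial:
  assumes "simple_module DK N"
  shows "carrier Vs \<noteq> {\<zero>\<^bsub>Vs\<^esub>}"
proof
  assume *: "carrier Vs = {\<zero>\<^bsub>Vs\<^esub>}"
  interpret N: abelian_group N by (rule abelian_N)
  have "n = \<zero>\<^bsub>N\<^esub>" if "n \<in> carrier N" for n
    using t_one_eq_zero[OF that] t_mem[OF L.one_closed that, of s] * by blast
  then have "carrier N = {\<zero>\<^bsub>N\<^esub>}" by auto
  then show False using assms by (simp add: simple_module_def)
qed

text \<open>Generators of \<open>N\<close> over \<open>K\<close> also generate over
  \<open>L\<close>: the coefficients from \<open>K\<close> move to the left factor.\<close>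

lemma V_spanned:
  assumes "finitely_generated_module K N'"
  obtains r :: nat and b where "\<And>i. i < r \<Longrightarrow> b i \<in> carrier N"
    "\<And>x. x \<in> carrier Vs \<Longrightarrow> \<exists>c\<in>{..<r} \<rightarrow> carrier L. x = (\<Oplus>\<^bsub>Vs\<^esub>i\<in>{..<r}. t (c i) (b i))"
proof -
  interpret V: abelian_group Vs by (rule abelian_V)
  interpret N': abelian_group N' by (rule abelian_N')
  obtain B where B: "finite B" "B \<subseteq> carrier N" and
    span: "\<And>x. x \<in> carrier N \<Longrightarrow> \<exists>c\<in>B \<rightarrow> carrier K. x = (\<Oplus>\<^bsub>N'\<^esub>b\<in>B. c b \<odot>\<^bsub>N'\<^esub> b)"
    using assms unfolding finitely_generated_module_def N'_simps(1) by auto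
  let ?r = "card B"
  obtain b where b: "bij_betw b {..<?r} B" using ex_bij_betw_nat_finite[OF B(1)] by (auto simp: atLeast0LessThan)
  have bm: "b i \<in> carrier N" if "i < ?r" for i using b B(2) that by (auto simp: bij_betw_def)
  have binj: "inj_on b {..<?r}" and bimg: "b ` {..<?r} = B" using b by (auto simp: bij_betw_def)
  have "\<exists>c\<in>{..<?r} \<rightarrow> carrier L. x = (\<Oplus>\<^bsub>Vs\<^esub>i\<in>{..<?r}. t (c i) (b i))" if "x \<in> carrier Vs" for x
    using that
  proof (induction rule: V_induct)
    case (diff x y)
    obtain c d where c: "c \<in> {..<?r} \<rightarrow> carrier L" "x = (\<Oplus>\<^bsub>Vs\<^esub>i\<in>{..<?r}. t (c i) (b i))"
      and d: "d \<in> {..<?r} \<rightarrow> carrier L" "y = (\<Oplus>\<^bsub>Vs\<^esub>i\<in>{..<?r}. t (d i) (b i))"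
      using diff by blast
    have cm: "c i \<in> carrier L" and dm: "d i \<in> carrier L" if "i < ?r" for i using c d that by auto
    have "(\<Oplus>\<^bsub>Vs\<^esub>i\<in>{..<?r}. t (c i \<ominus>\<^bsub>L\<^esub> d i) (b i)) \<oplus>\<^bsub>Vs\<^esub> y = (\<Oplus>\<^bsub>Vs\<^esub>i\<in>{..<?r}. t (c i \<ominus>\<^bsub>L\<^esub> d i) (b i) \<oplus>\<^bsub>Vs\<^esub> t (d i) (b i))"
      unfolding d(2) using cm dm bm by (intro V.finsum_addf[symmetric]) (auto intro!: t_mem)
    also have "\<dots> = x"
      unfolding c(2)
    proof (intro V.finsum_cong' refl)
      fix i assume "i \<in> {..<?r}"
      then have i: "i < ?r" by simp
      have "c i \<ominus>\<^bsub>L\<^esub> d i \<oplus>\<^bsub>L\<^esub> d i = c i" using cm[OF i] dm[OF i] by (simp add: L.minus_eq L.a_assoc L.l_neg)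
      then show "t (c i \<ominus>\<^bsub>L\<^esub> d i) (b i) \<oplus>\<^bsub>Vs\<^esub> t (d i) (b i) = t (c i) (b i)"
        using t_add_left[of "c i \<ominus>\<^bsub>L\<^esub> d i" "d i" "b i" s] cm[OF i] dm[OF i] bm[OF i] by simp
    qed (use cm bm in \<open>auto intro!: t_mem\<close>)
    finally have "(\<Oplus>\<^bsub>Vs\<^esub>i\<in>{..<?r}. t (c i \<ominus>\<^bsub>L\<^esub> d i) (b i)) = x \<ominus>\<^bsub>Vs\<^esub> y"
      using diff(2) cm dm bm by (intro V.eq_minusI[OF sym]) (auto intro!: t_mem V.finsum_closed)
    then show ?case using cm dm by (intro bexI[of _ "\<lambda>i. c i \<ominus>\<^bsub>L\<^esub> d i"]) auto
  next
    case (pure l n)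
    obtain c where c: "c \<in> B \<rightarrow> carrier K" "n = (\<Oplus>\<^bsub>N'\<^esub>b\<in>B. c b \<odot>\<^bsub>N'\<^esub> b)" using span[OF pure(2)] by blast
    have cm: "c y \<in> carrier K" if "y \<in> B" for y using c that by auto
    have cmult: "c y \<odot>\<^bsub>N'\<^esub> y \<in> carrier N'" if "y \<in> B" for y
      unfolding N'_simps using N_smult[OF DK_op[OF cm[OF that]]] B(2) that by blast
    have map: "additive_map N' Vs (t l)"
      using additive_mapD[OF t_right_map[OF pure(1), of s]] by (intro additive_mapI) (simp_all add: N'_simps)
    have "t l n = (\<Oplus>\<^bsub>Vs\<^esub>y\<in>B. t l (c y \<odot>\<^bsub>N'\<^esub> y))"
      unfolding c(2) using cmult by (intro additive_map_finsum[OF abelian_N' abelian_V map B(1)]) auto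
    also have "\<dots> = (\<Oplus>\<^bsub>Vs\<^esub>y\<in>b ` {..<?r}. t (l \<otimes>\<^bsub>L\<^esub> q (c y)) y)"
      unfolding bimg
    proof (intro V.finsum_cong' refl)
      fix y assume y: "y \<in> B"
      then show "t l (c y \<odot>\<^bsub>N'\<^esub> y) = t (l \<otimes>\<^bsub>L\<^esub> q (c y)) y"
        using t_balanced[OF pure(1) cm[OF y]] B(2) by (auto simp: N'_simps)
    qed (use pure(1) cm B(2) q_mem in \<open>auto intro!: t_mem\<close>)
    also have "\<dots> = (\<Oplus>\<^bsub>Vs\<^esub>i\<in>{..<?r}. t (l \<otimes>\<^bsub>L\<^esub> q (c (b i))) (b i))"
      using pure(1) cm B(2) q_mem bimg by (intro V.finsum_reindex[OF _ binj]) (auto intro!: t_mem)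
    finally have e: "t l n = (\<Oplus>\<^bsub>Vs\<^esub>i\<in>{..<?r}. t (l \<otimes>\<^bsub>L\<^esub> q (c (b i))) (b i))" .
    have "l \<otimes>\<^bsub>L\<^esub> q (c (b i)) \<in> carrier L" if "i < ?r" for i
      using pure(1) q_mem[OF cm] bimg that by blast
    with e show ?case by (intro bexI[of _ "\<lambda>i. l \<otimes>\<^bsub>L\<^esub> q (c (b i))"]) auto
  qed
  then show ?thesis using that[of ?r b] bm by blast
qed

text \<open>Over \<open>L\<close> the inverse image is spanned by finitely many 1 \<otimes> b_i, and
  \<open>DL\<close>-submodules are \<open>L\<close>-subspaces. A nonzero submodule of least measure
  is then minimal, as the measure is strictly monotone.\<close>

lemma minimal_submodule_exists:
  assumes simple: "simple_module DK N" and fg: "finitely_generated_module K N'"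
  shows "\<exists>W. left_module.minimal DL Vs W"
proof -
  interpret V: left_module DL Vs by (rule Vs_module)
  let ?VL = "restrict_scalars (mult_op L) Vs"
  note VL = restrict_scalars_simps[of "mult_op L" Vs, unfolded V_simps(4)]
  have mod: "left_module L ?VL"
    by (intro left_module.intro left_module_axioms.intro L.ring_axioms restrict_scalars_abelian_group[OF abelian_V]; unfold VL)
      (auto simp: mult_op_add mult_op_mult s_ldistr s_rdistr s_assoc DL_op s_one simp flip: one_DL intro: s_closed)
  obtain r :: nat and b where b: "\<And>i. i < r \<Longrightarrow> b i \<in> carrier N"
    and span: "\<And>x. x \<in> carrier Vs \<Longrightarrow> \<exists>c\<in>{..<r} \<rightarrow> carrier L. x = (\<Oplus>\<^bsub>Vs\<^esub>i\<in>{..<r}. t (c i) (b i))"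
    using V_spanned[OF fg] by blast
  have "\<exists>\<mu> :: _ set \<Rightarrow> nat. \<forall>U U'. submodule U L ?VL \<longrightarrow> submodule U' L ?VL \<longrightarrow> U \<subset> U' \<longrightarrow> \<mu> U < \<mu> U'"
  proof (rule subspace_measure_exists[OF L.field_axioms mod])
    show "t \<one>\<^bsub>L\<^esub> (b i) \<in> carrier ?VL" if "i < r" for i
      unfolding VL using b[OF that] by (intro t_mem) auto
    fix x assume "x \<in> carrier ?VL"
    then obtain c where c: "c \<in> {..<r} \<rightarrow> carrier L" "x = (\<Oplus>\<^bsub>Vs\<^esub>i\<in>{..<r}. t (c i) (b i))"
      using span unfolding VL by blast
    have "(\<Oplus>\<^bsub>Vs\<^esub>i\<in>{..<r}. t (c i) (b i)) = (\<Oplus>\<^bsub>Vs\<^esub>i\<in>{..<r}. c i \<odot>\<^bsub>?VL\<^esub> t \<one>\<^bsub>L\<^esub> (b i))"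
    proof (intro V.M.finsum_cong' refl)
      fix i assume "i \<in> {..<r}"
      then have "c i \<in> carrier L" "b i \<in> carrier N" using c(1) b by auto
      then show "t (c i) (b i) = c i \<odot>\<^bsub>?VL\<^esub> t \<one>\<^bsub>L\<^esub> (b i)"
        by (simp add: VL s_mult_op_one)
    next
      show "(\<lambda>i. c i \<odot>\<^bsub>?VL\<^esub> t \<one>\<^bsub>L\<^esub> (b i)) \<in> {..<r} \<rightarrow> carrier Vs"
        unfolding VL using c(1) b by (intro Pi_I s_closed DL_op t_mem) auto
    qed
    also have "\<dots> = (\<Oplus>\<^bsub>?VL\<^esub>i\<in>{..<r}. c i \<odot>\<^bsub>?VL\<^esub> t \<one>\<^bsub>L\<^esub> (b i))"
    proof (rule additive_map_finsum[OF abelian_V restrict_scalars_abelian_group[OF abelian_V], where f = "\<lambda>x. x"])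
      show "additive_map Vs ?VL (\<lambda>x. x)" by (rule additive_mapI) (simp_all add: VL)
      show "c i \<odot>\<^bsub>?VL\<^esub> t \<one>\<^bsub>L\<^esub> (b i) \<in> carrier Vs" if "i \<in> {..<r}" for i
        unfolding VL using that c(1) b by (intro s_closed DL_op t_mem) auto
    qed simp
    finally show "\<exists>c\<in>{..<r} \<rightarrow> carrier L. x = (\<Oplus>\<^bsub>?VL\<^esub>i\<in>{..<r}. c i \<odot>\<^bsub>?VL\<^esub> t \<one>\<^bsub>L\<^esub> (b i))"
      using c by blast
  qed
  then obtain \<mu> :: "_ set \<Rightarrow> nat" where \<mu>: "\<And>U U'. submodule U L ?VL \<Longrightarrow> submodule U' L ?VL \<Longrightarrow> U \<subset> U' \<Longrightarrow> \<mu> U < \<mu> U'" by blast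
  have DL_L: "submodule U L ?VL" if U: "submodule U DL Vs" for U
    using V.submoduleD[OF U] by (intro left_module.submoduleI[OF mod]; unfold VL) (auto simp: V_simps(4) DL_op)
  let ?P = "\<lambda>U. submodule U DL Vs \<and> U \<noteq> {\<zero>\<^bsub>Vs\<^esub>}"
  have "?P (carrier Vs)"
    using V_nontrivial[OF simple] by (auto intro!: V.submoduleI V.smult_closed)
  then obtain W where W: "?P W" "\<And>U. ?P U \<Longrightarrow> \<mu> W \<le> \<mu> U"
    using ex_has_least_nat[of ?P "carrier Vs" \<mu>] by blast
  have "U = W" if U: "?P U" "U \<subseteq> W" for U
  proof (rule ccontr)
    assume "U \<noteq> W"
    then have "\<mu> U < \<mu> W" using \<mu>[OF DL_L DL_L] U W(1) by blast
    then show False using W(2)[OF U(1)] by simp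
  qed
  then have "V.minimal W" unfolding V.minimal_def using W(1) by blast
  then show ?thesis by blast
qed

lemma semilinear:
  assumes simple: "simple_module DK N" and W: "left_module.minimal DL Vs W"
  shows "semilinear_action DL Vs G (compose (carrier L)) (\<lambda>x\<in>carrier L. x) gact cj W"
proof (intro semilinear_action.intro semilinear_action_axioms.intro Vs_module)
  show "\<exists>\<tau>\<in>G. \<forall>x\<in>carrier Vs. gact \<tau> (gact \<sigma> x) = x \<and> gact \<sigma> (gact \<tau> x) = x" if \<sigma>: "\<sigma> \<in> G" for \<sigma>
  proof (intro bexI[of _ "ginv \<sigma>"] ballI conjI)
    show g: "ginv \<sigma> \<in> G" by (rule ginv(1)[OF \<sigma>])
    fix x assume x: "x \<in> carrier Vs"
    have "compose (carrier L) (ginv \<sigma>) \<sigma> = (\<lambda>x\<in>carrier L. x)" "compose (carrier L) \<sigma> (ginv \<sigma>) = (\<lambda>x\<in>carrier L. x)"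
      using ginv(2,3)[OF \<sigma>] by (auto simp: compose_def)
    then show "gact (ginv \<sigma>) (gact \<sigma> x) = x" "gact \<sigma> (gact (ginv \<sigma>) x) = x"
      using gact_compose[OF g \<sigma> x] gact_compose[OF \<sigma> g x] gact_id[OF x] by simp_all
  qed
  show "gact \<sigma> (a \<odot>\<^bsub>Vs\<^esub> x) = cj \<sigma> a \<odot>\<^bsub>Vs\<^esub> gact \<sigma> x" if "\<sigma> \<in> G" "a \<in> carrier DL" "x \<in> carrier Vs" for \<sigma> a x
    unfolding V_simps(4) by (rule gact_semilinear[OF that])
  show "U = {\<zero>\<^bsub>Vs\<^esub>} \<or> U = carrier Vs" if "submodule U DL Vs" "\<And>\<sigma> x. \<sigma> \<in> G \<Longrightarrow> x \<in> U \<Longrightarrow> gact \<sigma> x \<in> U" for U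
    by (rule irreducible[OF simple that])
qed (use W G_finite G_id G_comp gact_id gact_compose gact_additive cj_closed in auto)

end

section \<open>Restricted automorphisms and embeddings into the base field\<close>

text \<open>The multiples of 1 are pairwise distinct, since a coincidence would make a positive
  multiple vanish.\<close>

lemma infinite_carrier_char_zero:
  assumes "ring K" "\<forall>n::nat. n > 0 \<longrightarrow> add_pow K (n::nat) \<one>\<^bsub>K\<^esub> \<noteq> \<zero>\<^bsub>K\<^esub>"
  shows "infinite (carrier K)"
proof -
  interpret K: ring K by fact
  have less: "add_pow K (m::nat) \<one>\<^bsub>K\<^esub> \<noteq> add_pow K (n::nat) \<one>\<^bsub>K\<^esub>" if "m < n" for m n :: nat
  proof
    assume eq: "add_pow K (m::nat) \<one>\<^bsub>K\<^esub> = add_pow K (n::nat) \<one>\<^bsub>K\<^esub>"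
    have "add_pow K (n::nat) \<one>\<^bsub>K\<^esub> = add_pow K (n - m::nat) \<one>\<^bsub>K\<^esub> \<oplus>\<^bsub>K\<^esub> add_pow K (m::nat) \<one>\<^bsub>K\<^esub>"
      using K.add.nat_pow_mult[of "\<one>\<^bsub>K\<^esub>" "n - m" m] that by simp
    then have "add_pow K (n - m::nat) \<one>\<^bsub>K\<^esub> = \<zero>\<^bsub>K\<^esub>"
      using eq by (metis K.add.nat_pow_closed K.add.r_cancel_one' K.one_closed)
    then show False using assms(2) that by simp
  qed
  have "inj (\<lambda>n::nat. add_pow K (n::nat) \<one>\<^bsub>K\<^esub>)"
    by (rule linorder_injI) (use less in blast)
  then have "infinite (range (\<lambda>n::nat. add_pow K (n::nat) \<one>\<^bsub>K\<^esub>))" by (rule range_inj_infinite)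
  moreover have "range (\<lambda>n::nat. add_pow K (n::nat) \<one>\<^bsub>K\<^esub>) \<subseteq> carrier K" by auto
  ultimately show ?thesis using finite_subset by blast
qed

text \<open>Induction on the length, using that an infinite set has as many pairs as
  elements.\<close>

lemma tuples_inject:
  assumes "infinite A"
  shows "\<exists>f. inj_on f ({..<m::nat} \<rightarrow>\<^sub>E A) \<and> f ` ({..<m} \<rightarrow>\<^sub>E A) \<subseteq> A"
proof (induction m)
  case 0
  obtain a where "a \<in> A" using assms by fastforce
  then show ?case by (intro exI[of _ "\<lambda>_. a"]) auto
next
  case (Suc m)
  then obtain f where f: "inj_on f ({..<m} \<rightarrow>\<^sub>E A)" "f ` ({..<m} \<rightarrow>\<^sub>E A) \<subseteq> A" by blast
  have "|A \<times> A| \<le>o |A|" using card_of_Times_same_infinite[OF assms] by (rule ordIso_imp_ordLeq)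
  then obtain p where p: "inj_on p (A \<times> A)" "p ` (A \<times> A) \<subseteq> A" unfolding card_of_ordLeq[symmetric] by blast
  let ?f = "\<lambda>w. p (f (restrict w {..<m}), w m)"
  have mem: "restrict w {..<m} \<in> {..<m} \<rightarrow>\<^sub>E A" "f (restrict w {..<m}) \<in> A" "w m \<in> A" if "w \<in> {..<Suc m} \<rightarrow>\<^sub>E A" for w
  proof -
    have "w i \<in> A" if "i < Suc m" for i using PiE_mem[OF \<open>w \<in> _\<close>, of i] that by (simp add: lessThan_def)
    then show r: "restrict w {..<m} \<in> {..<m} \<rightarrow>\<^sub>E A" and "w m \<in> A" by (simp_all add: restrict_PiE_iff)
    then show "f (restrict w {..<m}) \<in> A" using f(2) by blast
  qed
  have "inj_on ?f ({..<Suc m} \<rightarrow>\<^sub>E A)"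
  proof (rule inj_onI)
    fix w w' assume w: "w \<in> {..<Suc m} \<rightarrow>\<^sub>E A" and w': "w' \<in> {..<Suc m} \<rightarrow>\<^sub>E A" and eq: "?f w = ?f w'"
    have "(f (restrict w {..<m}), w m) = (f (restrict w' {..<m}), w' m)"
      using eq mem[OF w] mem[OF w'] by (intro inj_onD[OF p(1)]) auto
    then have e: "restrict w {..<m} = restrict w' {..<m}" "w m = w' m"
      using inj_onD[OF f(1) _ mem(1)[OF w] mem(1)[OF w']] by auto
    show "w = w'"
    proof (rule PiE_ext[OF w w'])
      fix i assume i: "i \<in> {..<Suc m}"
      show "w i = w' i"
      proof (cases "i = m")
        case False
        then show ?thesis using i fun_cong[OF e(1), of i] by (simp add: lessThan_def)
      qed (simp add: e(2))
    qed
  qed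
  moreover have "?f ` ({..<Suc m} \<rightarrow>\<^sub>E A) \<subseteq> A" using mem p(2) by blast
  ultimately show ?case by blast
qed

text \<open>The trace coordinates tr(v_j y) determine y by \<open>expand_u\<close>, so
  \<open>L\<close> injects into finite tuples over \<open>K\<close>, hence into the type of
  \<open>K\<close>. This serves \<open>primitive_module\<close>, which tests only fields living in
  that type; the injection is one of sets and carries no algebra.\<close>

lemma (in galois_setting) embeds_in_base:
  assumes "infinite (carrier K)"
  shows "\<exists>\<beta> :: 'c \<Rightarrow> 'a. inj_on \<beta> (carrier L)"
proof -
  obtain f :: "(nat \<Rightarrow> 'a) \<Rightarrow> 'a" where f: "inj_on f ({..<gdim} \<rightarrow>\<^sub>E carrier K)" using tuples_inject[OF assms] by blast
  let ?w = "\<lambda>y. \<lambda>j\<in>{..<gdim}. inv_into (carrier K) q (tr (dv j \<otimes>\<^bsub>L\<^esub> y))"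
  have w: "?w y \<in> {..<gdim} \<rightarrow>\<^sub>E carrier K" "j < gdim \<Longrightarrow> q (?w y j) = tr (dv j \<otimes>\<^bsub>L\<^esub> y)" if y: "y \<in> carrier L" for y j
  proof -
    have *: "tr (dv j \<otimes>\<^bsub>L\<^esub> y) \<in> q ` carrier K" if "j < gdim" for j
      using y dv_mem[OF that] by (intro tr_in_K) auto
    show "?w y \<in> {..<gdim} \<rightarrow>\<^sub>E carrier K" using inv_into_into[OF *] by auto
    show "j < gdim \<Longrightarrow> q (?w y j) = tr (dv j \<otimes>\<^bsub>L\<^esub> y)" using f_inv_into_f[OF *] by simp
  qed
  have "inj_on (\<lambda>y. f (?w y)) (carrier L)"
  proof (rule inj_onI)
    fix y z assume y: "y \<in> carrier L" and z: "z \<in> carrier L" and "f (?w y) = f (?w z)"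
    then have eq: "?w y = ?w z" using inj_onD[OF f _ w(1)[OF y] w(1)[OF z]] by blast
    have "tr (dv j \<otimes>\<^bsub>L\<^esub> y) = tr (dv j \<otimes>\<^bsub>L\<^esub> z)" if "j < gdim" for j
      using w(2)[OF y that] w(2)[OF z that] fun_cong[OF eq, of j] by metis
    then have "(\<Oplus>\<^bsub>L\<^esub>j\<in>{..<gdim}. du j \<otimes>\<^bsub>L\<^esub> tr (dv j \<otimes>\<^bsub>L\<^esub> y)) = (\<Oplus>\<^bsub>L\<^esub>j\<in>{..<gdim}. du j \<otimes>\<^bsub>L\<^esub> tr (dv j \<otimes>\<^bsub>L\<^esub> z))"
      using z by (intro L.finsum_cong' refl) (auto simp: du_mem dv_mem tr_closed)
    then show "y = z" by (simp only: expand_u[OF y] expand_u[OF z])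
  qed
  then show ?thesis by blast
qed

text \<open>On the carrier an automorphism is determined by its values on a finite spanning set, and
  each value is a root of a fixed nonzero polynomial over \<open>K\<close>. Restriction removes the
  arbitrary values off the carrier, which could spoil finiteness.\<close>

lemma finite_restricted_automorphisms:
  assumes L: "field L" and K: "subfield K L" and fd: "ring.finite_dimension L K (carrier L)"
  shows "finite ((\<lambda>\<sigma>. restrict \<sigma> (carrier L)) ` field_automorphisms L K)"
proof -
  interpret L: field L by fact
  obtain n where n: "L.dimension n K (carrier L)" using fd unfolding L.finite_dimension_def by blast
  obtain Us where Us: "set Us \<subseteq> carrier L" "L.Span K Us = carrier L" using L.exists_base[OF K n] by blast
  note sub = subfieldE(1)[OF K] and KL = subfieldE(3)[OF K]
  have hom: "\<sigma> x \<in> carrier L" "\<sigma> (x \<oplus>\<^bsub>L\<^esub> y) = \<sigma> x \<oplus>\<^bsub>L\<^esub> \<sigma> y" "\<sigma> (x \<otimes>\<^bsub>L\<^esub> y) = \<sigma> x \<otimes>\<^bsub>L\<^esub> \<sigma> y" "\<sigma> \<one>\<^bsub>L\<^esub> = \<one>\<^bsub>L\<^esub>" "z \<in> K \<Longrightarrow> \<sigma> z = z"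
    if "\<sigma> \<in> field_automorphisms L K" "x \<in> carrier L" "y \<in> carrier L" for \<sigma> x y z
    using that by (auto simp: field_automorphisms_def ring_iso_def ring_hom_def)
  have hom0: "\<sigma> \<zero>\<^bsub>L\<^esub> = \<zero>\<^bsub>L\<^esub>" if "\<sigma> \<in> field_automorphisms L K" for \<sigma>
    using hom(5)[OF that L.zero_closed L.zero_closed] subringE(2)[OF sub] by simp
  define Rt where "Rt u = {\<sigma> u | \<sigma>. \<sigma> \<in> field_automorphisms L K}" for u
  have fin: "finite (Rt u)" if u: "u \<in> carrier L" for u
  proof -
    have "(L.algebraic over K) u" by (rule L.finite_dimension_imp_algebraic[OF K L.carrier_is_subring fd u])
    then obtain p where p: "p \<in> carrier (K[X]\<^bsub>L\<^esub>)" "p \<noteq> []" "L.eval p u = \<zero>\<^bsub>L\<^esub>" using L.algebraicE[OF sub u] by blast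
    have pK: "set p \<subseteq> K" using p(1) unfolding sym[OF univ_poly_carrier] polynomial_def by auto
    have ev: "L.eval p' (\<sigma> u) = \<sigma> (L.eval p' u)" if \<sigma>: "\<sigma> \<in> field_automorphisms L K" and "set p' \<subseteq> K" for p' \<sigma>
      using that(2)
    proof (induction p')
      case Nil
      then show ?case using hom0[OF \<sigma>] by simp
    next
      case (Cons a p')
      have a: "a \<in> K" "a \<in> carrier L" "set p' \<subseteq> carrier L" using Cons.prems KL by auto
      have pow: "\<sigma> (u [^]\<^bsub>L\<^esub> i) = \<sigma> u [^]\<^bsub>L\<^esub> i" for i :: nat
        using hom[OF \<sigma> _ u] hom(4)[OF \<sigma> u u] u by (induction i) auto
      have e: "L.eval p' u \<in> carrier L" by (rule L.eval_in_carrier[OF a(3) u])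
      have "\<sigma> (a \<otimes>\<^bsub>L\<^esub> u [^]\<^bsub>L\<^esub> length p' \<oplus>\<^bsub>L\<^esub> L.eval p' u) = \<sigma> a \<otimes>\<^bsub>L\<^esub> \<sigma> (u [^]\<^bsub>L\<^esub> length p') \<oplus>\<^bsub>L\<^esub> \<sigma> (L.eval p' u)"
        using a u e by (simp add: hom(2,3)[OF \<sigma>])
      then show ?case
        using Cons hom(5)[OF \<sigma> u u a(1)] pow by simp
    qed
    have "Rt u \<subseteq> {x. L.is_root p x}"
      using ev[OF _ pK] p hom0 hom(1)[OF _ u u] unfolding Rt_def L.is_root_def by auto
    moreover have "p \<in> carrier (poly_ring L)"
      using p(1) L.carrier_polynomial[OF sub] unfolding sym[OF univ_poly_carrier] by auto
    ultimately show ?thesis using L.finite_number_of_roots finite_subset by blast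
  qed
  let ?r = "\<lambda>\<sigma>. restrict \<sigma> (set Us)"
  let ?G = "(\<lambda>\<sigma>. restrict \<sigma> (carrier L)) ` field_automorphisms L K"
  have "inj_on ?r ?G"
  proof (rule inj_onI, elim imageE, hypsubst)
    fix \<sigma> \<tau> assume \<sigma>: "\<sigma> \<in> field_automorphisms L K" and \<tau>: "\<tau> \<in> field_automorphisms L K"
      and eq: "restrict (restrict \<sigma> (carrier L)) (set Us) = restrict (restrict \<tau> (carrier L)) (set Us)"
    have agree: "\<sigma> u = \<tau> u" if "u \<in> set Us" for u using fun_cong[OF eq, of u] that Us(1) by auto
    have "\<sigma> x = \<tau> x \<and> x \<in> carrier L" if "x \<in> L.Span K Us'" "set Us' \<subseteq> set Us" for x Us'
      using that
    proof (induction Us' arbitrary: x)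
      case Nil
      then show ?case using hom0[OF \<sigma>] hom0[OF \<tau>] by simp
    next
      case (Cons u Us')
      then obtain c v where cv: "c \<in> K" "v \<in> L.Span K Us'" "x = c \<otimes>\<^bsub>L\<^esub> u \<oplus>\<^bsub>L\<^esub> v"
        using L.line_extension_mem_iff by auto
      have v: "\<sigma> v = \<tau> v" "v \<in> carrier L" using Cons cv by auto
      have u: "u \<in> carrier L" "\<sigma> u = \<tau> u" using Cons.prems(2) Us(1) agree by auto
      have c: "c \<in> carrier L" using cv KL by auto
      show ?case unfolding cv(3) using u v c hom(5)[OF \<sigma> u(1) u(1) cv(1)] hom(5)[OF \<tau> u(1) u(1) cv(1)]
        by (simp add: hom(2,3)[OF \<sigma>] hom(2,3)[OF \<tau>])
    qed
    then have "\<sigma> x = \<tau> x" if "x \<in> carrier L" for x using Us(2) that by blast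
    then show "restrict \<sigma> (carrier L) = restrict \<tau> (carrier L)" by (intro restrict_ext) auto
  qed
  moreover have "?r ` ?G \<subseteq> (\<Pi>\<^sub>E u\<in>set Us. Rt u)"
    using Us(1) unfolding Rt_def by (auto simp: subset_iff)
  moreover have "finite (\<Pi>\<^sub>E u\<in>set Us. Rt u)" using fin Us(1) by (intro finite_PiE) auto
  ultimately show ?thesis using finite_imageD finite_subset by metis
qed

lemma galois_setting_of_finite_galois:
  fixes K :: "('a, 'c) ring_scheme" and L :: "('b, 'd) ring_scheme"
  assumes K: "field K" and L: "field L" and hom: "\<pi> \<in> ring_hom K L" and k: "k \<subseteq> carrier K"
    and gal: "finite_galois_extension L (\<pi> ` carrier K)"
  shows "galois_setting K L \<pi> k ((\<lambda>\<sigma>. restrict \<sigma> (carrier L)) ` field_automorphisms L (\<pi> ` carrier K))"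
proof -
  interpret K: field K by fact
  interpret L: field L by fact
  let ?A = "field_automorphisms L (\<pi> ` carrier K)"
  have sub: "subfield (\<pi> ` carrier K) L"
  proof -
    interpret h: ring_hom_ring K L \<pi> using hom by unfold_locales
    show ?thesis using h.img_is_subfield(2)[OF K.carrier_is_subfield] by simp
  qed
  have A: "\<sigma> \<in> ring_iso L L" "x \<in> \<pi> ` carrier K \<Longrightarrow> \<sigma> x = x" if "\<sigma> \<in> ?A" for \<sigma> x
    using that by (auto simp: field_automorphisms_def)
  have A_mem: "\<sigma> x \<in> carrier L" if "\<sigma> \<in> ?A" "x \<in> carrier L" for \<sigma> x
    using A(1)[OF that(1)] that(2) by (auto simp: ring_iso_def ring_hom_def)
  show ?thesis
  proof (intro galois_setting.intro galois_setting_axioms.intro K.field_axioms L.field_axioms hom k)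
    show "finite ((\<lambda>\<sigma>. restrict \<sigma> (carrier L)) ` ?A)"
      by (rule finite_restricted_automorphisms[OF L sub]) (use gal in \<open>simp add: finite_galois_extension_def\<close>)
    show "\<sigma> \<in> ring_hom L L" if "\<sigma> \<in> (\<lambda>\<sigma>. restrict \<sigma> (carrier L)) ` ?A" for \<sigma>
      using that A(1) by (auto simp: ring_iso_def ring_hom_def)
    show "\<sigma> \<in> extensional (carrier L)" if "\<sigma> \<in> (\<lambda>\<sigma>. restrict \<sigma> (carrier L)) ` ?A" for \<sigma>
      using that by auto
    have "(\<lambda>x. x) \<in> ?A" using hom by (auto simp: field_automorphisms_def ring_iso_def ring_hom_def bij_betw_def)
    then show "(\<lambda>x\<in>carrier L. x) \<in> (\<lambda>\<sigma>. restrict \<sigma> (carrier L)) ` ?A" by blast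
    show "compose (carrier L) \<sigma> \<tau> \<in> (\<lambda>\<sigma>. restrict \<sigma> (carrier L)) ` ?A"
      if in_A: "\<sigma> \<in> (\<lambda>\<sigma>. restrict \<sigma> (carrier L)) ` ?A" "\<tau> \<in> (\<lambda>\<sigma>. restrict \<sigma> (carrier L)) ` ?A" for \<sigma> \<tau>
    proof -
      obtain \<sigma>' \<tau>' where *: "\<sigma>' \<in> ?A" "\<sigma> = restrict \<sigma>' (carrier L)" "\<tau>' \<in> ?A" "\<tau> = restrict \<tau>' (carrier L)" using in_A by blast
      have "\<sigma>' \<circ> \<tau>' \<in> ?A"
        using A[OF *(1)] A[OF *(3)] ring_iso_set_trans[of \<tau>' L L \<sigma>' L] by (auto simp: field_automorphisms_def)
      moreover have "compose (carrier L) \<sigma> \<tau> = restrict (\<sigma>' \<circ> \<tau>') (carrier L)"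
        unfolding *(2,4) compose_def using A_mem[OF *(3)] by (intro restrict_ext) simp
      ultimately show ?thesis by blast
    qed
    show "\<exists>\<tau>\<in>(\<lambda>\<sigma>. restrict \<sigma> (carrier L)) ` ?A. \<forall>x\<in>carrier L. \<tau> (\<sigma> x) = x \<and> \<sigma> (\<tau> x) = x"
      if in_A: "\<sigma> \<in> (\<lambda>\<sigma>. restrict \<sigma> (carrier L)) ` ?A" for \<sigma>
    proof -
      obtain \<sigma>' where *: "\<sigma>' \<in> ?A" "\<sigma> = restrict \<sigma>' (carrier L)" using in_A by blast
      let ?\<tau> = "inv_into (carrier L) \<sigma>'"
      have bij: "bij_betw \<sigma>' (carrier L) (carrier L)" using A(1)[OF *(1)] by (simp add: ring_iso_def)
      have c1: "?\<tau> (\<sigma>' x) = x" if "x \<in> carrier L" for x using bij that by (auto simp: bij_betw_def)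
      have c2: "\<sigma>' (?\<tau> x) = x" if "x \<in> carrier L" for x
        using bij that f_inv_into_f[of x \<sigma>' "carrier L"] by (auto simp: bij_betw_def)
      have iso: "?\<tau> \<in> ring_iso L L" by (rule ring_iso_set_sym[OF L.ring_axioms A(1)[OF *(1)]])
      have "?\<tau> x = x" if "x \<in> \<pi> ` carrier K" for x
        using c1[of x] A(2)[OF *(1) that] that subfieldE(3)[OF sub] by (metis subsetD)
      then have \<tau>A: "?\<tau> \<in> ?A" using iso by (simp add: field_automorphisms_def)
      show ?thesis
        using \<tau>A c1 c2 A_mem[OF *(1)] A_mem[OF \<tau>A] *(2) by (intro bexI[of _ "restrict ?\<tau> (carrier L)"]) auto
    qed
    show "{x \<in> carrier L. \<forall>\<sigma>\<in>(\<lambda>\<sigma>. restrict \<sigma> (carrier L)) ` ?A. \<sigma> x = x} = \<pi> ` carrier K"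
      using gal unfolding finite_galois_extension_def by auto
  qed
qed

section \<open>Descent to an intermediate field\<close>

locale intermediate_field = galois_setting K L q k G
  for K :: "('a, 'b) ring_scheme" (structure) and L :: "('c, 'd) ring_scheme" (structure)
    and q :: "'a \<Rightarrow> 'c" and k :: "'a set" and G :: "('c \<Rightarrow> 'c) set" +
  fixes H :: "('c \<Rightarrow> 'c) set" and \<beta> :: "'c \<Rightarrow> 'e"
  assumes H_sub: "H \<subseteq> G" and H_id: "(\<lambda>x\<in>carrier L. x) \<in> H"
    and H_comp: "\<sigma> \<in> H \<Longrightarrow> \<tau> \<in> H \<Longrightarrow> compose (carrier L) \<sigma> \<tau> \<in> H"
    and H_inv: "\<sigma> \<in> H \<Longrightarrow> ginv \<sigma> \<in> H"
    and \<beta>_inj: "inj_on \<beta> (carrier L)"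
begin

definition "fixed = {x \<in> carrier L. \<forall>\<sigma>\<in>H. \<sigma> x = x}"
text \<open>The fixed field of \<open>H\<close> is copied along \<beta> into another type, in the
  end that of \<open>K\<close>. Next come \<open>\<iota>\<close>, the inclusion of the copy into
  \<open>L\<close>, and \<open>r\<close>, the inclusion of \<open>K\<close> into the copy.\<close>

definition "Z = image_ring \<beta> (L\<lparr>carrier := fixed\<rparr>)"
definition "\<iota> = inv_into fixed \<beta>"
definition "r = (\<lambda>x. \<beta> (q x))"

lemma fixed_carrier: "fixed \<subseteq> carrier L"
  by (auto simp: fixed_def)

lemma fixedD: "x \<in> fixed \<Longrightarrow> \<sigma> \<in> H \<Longrightarrow> \<sigma> x = x"
  by (simp add: fixed_def)

lemma q_fixed: "x \<in> carrier K \<Longrightarrow> q x \<in> fixed"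
  using H_sub by (auto simp: fixed_def q_mem sigma_q)

lemma fixed_subfield: "subfield fixed L"
proof (rule L.subfieldI')
  have H: "\<sigma> \<in> G" if "\<sigma> \<in> H" for \<sigma> using that H_sub by auto
  show "subring fixed L"
  proof (rule L.subringI)
    show "fixed \<subseteq> carrier L" by (rule fixed_carrier)
    show "\<one>\<^bsub>L\<^esub> \<in> fixed" using sigma_simps(4) H by (auto simp: fixed_def)
    fix x assume x: "x \<in> fixed"
    show "\<ominus>\<^bsub>L\<^esub> x \<in> fixed"
    proof -
      have xL: "x \<in> carrier L" using x by (simp add: fixed_def)
      have "\<sigma> (\<ominus>\<^bsub>L\<^esub> x) = \<ominus>\<^bsub>L\<^esub> x" if "\<sigma> \<in> H" for \<sigma>
        using additive_map_minus[OF L.is_abelian_group L.is_abelian_group sigma_additive[OF H[OF that]] xL] fixedD[OF x that] by simp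
      then show ?thesis using xL by (simp add: fixed_def)
    qed
    fix y assume y: "y \<in> fixed"
    show "x \<otimes>\<^bsub>L\<^esub> y \<in> fixed" "x \<oplus>\<^bsub>L\<^esub> y \<in> fixed"
    proof -
      have xy: "x \<in> carrier L" "y \<in> carrier L" using x y by (auto simp: fixed_def)
      have "\<sigma> (x \<otimes>\<^bsub>L\<^esub> y) = x \<otimes>\<^bsub>L\<^esub> y" "\<sigma> (x \<oplus>\<^bsub>L\<^esub> y) = x \<oplus>\<^bsub>L\<^esub> y" if "\<sigma> \<in> H" for \<sigma>
        using sigma_simps(2,3)[OF H[OF that] xy] fixedD[OF x that] fixedD[OF y that] by simp_all
      then show "x \<otimes>\<^bsub>L\<^esub> y \<in> fixed" "x \<oplus>\<^bsub>L\<^esub> y \<in> fixed" using xy by (simp_all add: fixed_def)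
    qed
  qed
  fix x assume x: "x \<in> fixed - {\<zero>\<^bsub>L\<^esub>}"
  then have xL: "x \<in> carrier L" "x \<in> Units L" using fixed_carrier by (auto simp: L.field_Units)
  have "\<sigma> (inv\<^bsub>L\<^esub> x) = inv\<^bsub>L\<^esub> x" if "\<sigma> \<in> H" for \<sigma>
  proof -
    have "\<sigma> (inv\<^bsub>L\<^esub> x) \<otimes>\<^bsub>L\<^esub> x = \<sigma> (inv\<^bsub>L\<^esub> x \<otimes>\<^bsub>L\<^esub> x)"
      using xL sigma_simps(3)[OF H[OF that] L.Units_inv_closed[OF xL(2)] xL(1)] fixedD[OF _ that, of x] x by simp
    then have "\<sigma> (inv\<^bsub>L\<^esub> x) \<otimes>\<^bsub>L\<^esub> x = \<one>\<^bsub>L\<^esub>"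
      using xL sigma_simps(4)[OF H[OF that]] by simp
    then show ?thesis
      using L.inv_unique'[OF xL(1) sigma_simps(1)[OF H[OF that] L.Units_inv_closed[OF xL(2)]]]
        L.m_comm[OF xL(1) sigma_simps(1)[OF H[OF that] L.Units_inv_closed[OF xL(2)]]] by simp
  qed
  then show "inv\<^bsub>L\<^esub> x \<in> fixed" using xL by (simp add: fixed_def)
qed

lemma \<beta>_inj_fixed: "inj_on \<beta> fixed"
  using \<beta>_inj fixed_carrier inj_on_subset by blast

lemma Z_field: "field Z"
  unfolding Z_def by (rule field.inj_imp_image_ring_is_field[OF L.subfield_iff(2)[OF fixed_subfield]]) (simp add: \<beta>_inj_fixed)

lemma Z_carrier: "carrier Z = \<beta> ` fixed"
  by (simp add: Z_def image_ring_carrier)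

lemma \<beta>_iso: "\<beta> \<in> ring_iso (L\<lparr>carrier := fixed\<rparr>) Z"
  unfolding Z_def by (rule inj_imp_image_ring_iso) (simp add: \<beta>_inj_fixed)

lemma \<iota>_\<beta>: "x \<in> fixed \<Longrightarrow> \<iota> (\<beta> x) = x"
  unfolding \<iota>_def using \<beta>_inj_fixed by simp

lemma \<beta>_\<iota>: "z \<in> carrier Z \<Longrightarrow> \<beta> (\<iota> z) = z"
  unfolding \<iota>_def Z_carrier by (rule f_inv_into_f)

lemma \<iota>_mem: "z \<in> carrier Z \<Longrightarrow> \<iota> z \<in> fixed"
  unfolding \<iota>_def Z_carrier by (rule inv_into_into)

lemma \<iota>_image: "\<iota> ` carrier Z = fixed"
  using \<iota>_\<beta> unfolding Z_carrier by (force simp: image_image)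

lemma \<iota>_hom: "\<iota> \<in> ring_hom Z L"
proof -
  have "inv_into (carrier (L\<lparr>carrier := fixed\<rparr>)) \<beta> \<in> ring_iso Z (L\<lparr>carrier := fixed\<rparr>)"
    by (rule ring_iso_set_sym[OF field.is_ring[OF L.subfield_iff(2)[OF fixed_subfield]] \<beta>_iso])
  then show ?thesis
    using fixed_carrier unfolding ring_iso_def ring_hom_def \<iota>_def by auto
qed

lemma r_hom: "r \<in> ring_hom K Z"
proof -
  have "q \<in> ring_hom K (L\<lparr>carrier := fixed\<rparr>)"
    using q_fixed hom unfolding ring_hom_def by auto
  moreover have "\<beta> \<in> ring_hom (L\<lparr>carrier := fixed\<rparr>) Z" using \<beta>_iso by (simp add: ring_iso_def)
  ultimately show ?thesis using ring_hom_trans unfolding r_def comp_def by blast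
qed

lemma \<iota>_r: "x \<in> carrier K \<Longrightarrow> \<iota> (r x) = q x"
  using \<iota>_\<beta> q_fixed by (simp add: r_def)

lemma \<iota>_r_image: "A \<subseteq> carrier K \<Longrightarrow> \<iota> ` r ` A = q ` A"
  using \<iota>_r by (force simp: image_image intro!: image_cong)

lemma r_k: "r ` k \<subseteq> carrier Z"
  using k_subset q_fixed by (auto simp: r_def Z_carrier)

text \<open>Makes extension of operators, traces and dual families available for \<open>L\<close>
  over \<open>Z\<close>, with \<open>H\<close> in place of \<open>G\<close>.\<close>

lemma galois_Z: "galois_setting Z L \<iota> (r ` k) H"
proof (intro galois_setting.intro galois_setting_axioms.intro Z_field L.field_axioms \<iota>_hom r_k)
  show "{x \<in> carrier L. \<forall>\<sigma>\<in>H. \<sigma> x = x} = \<iota> ` carrier Z"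
    by (simp add: \<iota>_image fixed_def)
  show "\<exists>\<tau>\<in>H. \<forall>x\<in>carrier L. \<tau> (\<sigma> x) = x \<and> \<sigma> (\<tau> x) = x" if "\<sigma> \<in> H" for \<sigma>
    using that H_sub ginv(2,3)[of \<sigma>] H_inv[OF that] by (intro bexI[of _ "ginv \<sigma>"]) auto
  show "finite H" using H_sub G_finite finite_subset by blast
qed (use H_sub G_hom G_ext H_id H_comp in auto)

abbreviation "DZ \<equiv> diffop_ring (r ` k) Z"
abbreviation "extZ \<equiv> diffop_ext (r ` k) Z L \<iota>"

text \<open>Infinite dimension would persist under the injection of \<open>Z\<close> into
  \<open>L\<close>, whereas the image is a subalgebra of an algebra of finite dimension over the
  image of \<open>K\<close>.\<close>

lemma finite_dimension_Z:
  assumes "ring.finite_dimension L (q ` carrier K) (carrier L)"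
  shows "ring.finite_dimension Z (r ` carrier K) (carrier Z)"
proof (rule ccontr)
  assume inf: "\<not> ?thesis"
  interpret Z: field Z by (rule Z_field)
  interpret i: ring_hom_ring Z L \<iota> using \<iota>_hom by unfold_locales
  interpret rh: ring_hom_ring K Z r using r_hom by unfold_locales
  interpret qh: ring_hom_ring K L q using hom by unfold_locales
  have rK: "r ` carrier K \<subseteq> carrier Z" using r_hom by (auto simp: ring_hom_def)
  have subZ: "subalgebra (r ` carrier K) (carrier Z) Z" by (rule Z.carrier_is_subalgebra[OF rK])
  have "\<not> L.finite_dimension (\<iota> ` r ` carrier K) (\<iota> ` carrier Z)"
  proof (rule i.infinite_dimension_hom[OF _ _ _ subZ inf])
    show "subfield (r ` carrier K) Z" by (rule rh.img_is_subfield(2)[OF K.carrier_is_subfield Z.one_not_zero])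
    show "inj_on \<iota> (carrier Z)" using \<beta>_\<iota> by (rule inj_on_inverseI)
  qed simp
  moreover have "subalgebra (\<iota> ` r ` carrier K) (\<iota> ` carrier Z) L"
    by (rule i.img_is_subalgebra[OF rK subZ])
  moreover have "subfield (q ` carrier K) L"
    by (rule qh.img_is_subfield(2)[OF K.carrier_is_subfield L.one_not_zero])
  ultimately show False
    using L.subalbegra_incl_imp_finite_dimension[OF _ assms] fixed_carrier unfolding \<iota>_image \<iota>_r_image[OF subset_refl] by blast
qed

text \<open>If the fixed field of \<open>H\<close> is the image of \<open>K\<close>, the
  \<open>H\<close>-traces of the v_j are fixed by every \<sigma> in \<open>G\<close>. Summing u_j
  times these traces gives 1, but twisting the u_j by some \<sigma> outside \<open>H\<close> gives
  0, although \<sigma> maps the first sum to the second.\<close>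

lemma full_if_iso:
  assumes iso: "r \<in> ring_iso K Z"
  shows "H = G"
proof (rule ccontr)
  interpret H: galois_setting Z L \<iota> "r ` k" H by (rule galois_Z)
  assume "H \<noteq> G"
  then obtain \<sigma> where \<sigma>: "\<sigma> \<in> G" "\<sigma> \<notin> H" using H_sub by auto
  have "r ` carrier K = carrier Z" using iso by (auto simp: ring_iso_def bij_betw_def)
  then have qK: "q ` carrier K = \<iota> ` carrier Z" using \<iota>_r_image[OF subset_refl] by simp
  let ?c = "\<lambda>j. \<Oplus>\<^bsub>L\<^esub>\<tau>\<in>H. \<tau> (dv j \<otimes>\<^bsub>L\<^esub> \<one>\<^bsub>L\<^esub>)"
  have c: "?c j \<in> q ` carrier K" if "j < gdim" for j
    using H.tr_in_K[of "dv j \<otimes>\<^bsub>L\<^esub> \<one>\<^bsub>L\<^esub>"] dv_mem[OF that] unfolding H.tr_def qK by simp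
  have cc: "?c j \<in> carrier L" "\<sigma> (?c j) = ?c j" if "j < gdim" for j
    using c[OF that] q_mem sigma_q[OF \<sigma>(1)] by auto
  have "(\<Oplus>\<^bsub>L\<^esub>j\<in>{..<gdim}. \<sigma> (du j) \<otimes>\<^bsub>L\<^esub> ?c j) = \<zero>\<^bsub>L\<^esub>"
    using expand_sigma[OF H_sub \<sigma>(1) L.one_closed] \<sigma>(2) by simp
  moreover have "(\<Oplus>\<^bsub>L\<^esub>j\<in>{..<gdim}. \<sigma> (du j) \<otimes>\<^bsub>L\<^esub> ?c j) = (\<Oplus>\<^bsub>L\<^esub>j\<in>{..<gdim}. \<sigma> (du j \<otimes>\<^bsub>L\<^esub> ?c j))"
    using cc by (intro L.finsum_cong' refl) (auto simp: sigma_simps[OF \<sigma>(1)] du_mem)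
  moreover have "\<dots> = \<sigma> (\<Oplus>\<^bsub>L\<^esub>j\<in>{..<gdim}. du j \<otimes>\<^bsub>L\<^esub> ?c j)"
    using cc by (intro sigma_finsum[symmetric] \<sigma>(1)) (auto simp: du_mem)
  moreover have "(\<Oplus>\<^bsub>L\<^esub>j\<in>{..<gdim}. du j \<otimes>\<^bsub>L\<^esub> ?c j) = \<one>\<^bsub>L\<^esub>"
  proof -
    have "(\<Oplus>\<^bsub>L\<^esub>j\<in>{..<gdim}. du j \<otimes>\<^bsub>L\<^esub> ?c j) = (\<Oplus>\<^bsub>L\<^esub>j\<in>{..<gdim}. (\<lambda>x\<in>carrier L. x) (du j) \<otimes>\<^bsub>L\<^esub> ?c j)"
      using cc by (intro L.finsum_cong' refl) (auto simp: du_mem)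
    then show ?thesis
      using expand_sigma[OF H_sub G_id L.one_closed] H_id by simp
  qed
  ultimately have "\<zero>\<^bsub>L\<^esub> = \<one>\<^bsub>L\<^esub>" using sigma_simps(4)[OF \<sigma>(1)] by simp
  then show False by simp
qed

lemma ext_fixed:
  assumes P: "P \<in> carrier DK" and x: "x \<in> fixed"
  shows "ext P x \<in> fixed"
proof -
  have "\<sigma> (ext P x) = ext P x" if "\<sigma> \<in> H" for \<sigma>
  proof -
    have "ext P (\<sigma> x) = \<sigma> (ext P x)" using that H_sub x by (intro ext_equivariant P) (auto simp: fixed_def)
    then show ?thesis using fixedD[OF x that] by simp
  qed
  then show ?thesis using DL_apply(1)[OF ext(1)[OF P]] x by (auto simp: fixed_def)
qed

text \<open>The candidate on \<open>Z\<close> is the restriction of \<open>ext P\<close> to the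
  fixed field, which it preserves by equivariance. As \<open>Z\<close> over \<open>K\<close> need
  not be Galois, \<open>diffop_ext_ex1\<close> does not give uniqueness on \<open>Z\<close>; it is
  obtained by extending further to \<open>L\<close>, where any two candidates agree.\<close>

lemma ext_through_Z:
  assumes P: "P \<in> carrier DK"
  shows "diffop_ext k K Z r P \<in> carrier DZ" and "extZ (diffop_ext k K Z r P) = ext P"
proof -
  interpret H: galois_setting Z L \<iota> "r ` k" H by (rule galois_Z)
  have rk: "\<iota> ` r ` k = q ` k" by (rule \<iota>_r_image[OF k_subset])
  have DL: "DL = H.DL" by (simp only: rk)
  define Q where "Q = (\<lambda>z\<in>carrier Z. \<beta> (ext P (\<iota> z)))"
  have Q_mem: "\<beta> (ext P (\<iota> z)) \<in> carrier Z" and Q_\<iota>: "\<iota> (\<beta> (ext P (\<iota> z))) = ext P (\<iota> z)" if "z \<in> carrier Z" for z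
    using ext_fixed[OF P \<iota>_mem[OF that]] \<iota>_\<beta> by (auto simp: Z_carrier)
  obtain n where n: "dord L (carrier L) (carrier L) n (ext P)" and lin: "klin L (q ` k) (carrier L) (ext P)"
    using ext(1)[OF P] unfolding DL_iff by blast
  have sub: "\<iota> ` carrier Z \<subseteq> carrier L" using \<iota>_image fixed_carrier by simp
  have "dord L (\<iota> ` carrier Z) (\<iota> ` carrier Z) n (ext P)"
  proof (rule order_context.dord_subset[OF order_context_self[OF L.is_cring] sub sub _ n])
    show "a \<otimes>\<^bsub>L\<^esub> x \<in> \<iota> ` carrier Z" if "a \<in> \<iota> ` carrier Z" "x \<in> \<iota> ` carrier Z" for a x
      using that unfolding \<iota>_image by (rule subringE(6)[OF subfieldE(1)[OF fixed_subfield]])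
  qed
  moreover have "klin L (\<iota> ` r ` k) (\<iota> ` carrier Z) (ext P)"
    unfolding rk
  proof (rule klinI)
    fix c x y assume x: "x \<in> \<iota> ` carrier Z"
    show "ext P x \<in> carrier L" using klinD(1)[OF lin] x sub by blast
    show "ext P (x \<oplus>\<^bsub>L\<^esub> y) = ext P x \<oplus>\<^bsub>L\<^esub> ext P y" if "y \<in> \<iota> ` carrier Z"
      using that x sub by (intro klinD(2)[OF lin]) auto
    show "ext P (c \<otimes>\<^bsub>L\<^esub> x) = c \<otimes>\<^bsub>L\<^esub> ext P x" if "c \<in> q ` k"
      using that x sub by (intro klinD(3)[OF lin]) auto
  qed
  ultimately have QD: "Q \<in> carrier DZ"
    unfolding Q_def using Q_mem Q_\<iota> by (intro inj_ring_hom.diffop_descend[OF H.inj_hom]) auto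
  have Qr: "Q (r x) = r (P x)" if x: "x \<in> carrier K" for x
    using x ext(2)[OF P x] \<iota>_r[OF x] q_fixed[OF x] by (simp add: Q_def r_def Z_carrier)
  have ext_eq: "H.ext Q' = ext P" if Q': "Q' \<in> carrier DZ" "\<And>x. x \<in> carrier K \<Longrightarrow> Q' (r x) = r (P x)" for Q'
  proof (rule diffop_eqI)
    show "H.ext Q' \<in> carrier DL" using H.ext(1)[OF Q'(1)] by (simp only: DL)
    show "ext P \<in> carrier DL" by (rule ext(1)[OF P])
    fix x assume x: "x \<in> carrier K"
    have "r x \<in> carrier Z" using q_fixed[OF x] by (auto simp: r_def Z_carrier)
    then show "H.ext Q' (q x) = ext P (q x)"
      using H.ext(2)[OF Q'(1), of "r x"] Q'(2)[OF x] \<iota>_r[OF x] \<iota>_r[OF DK_apply(1)[OF P x]] ext(2)[OF P x] by simp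
  qed
  have uniq: "Q' = Q" if Q': "Q' \<in> carrier DZ" "\<forall>x\<in>carrier K. Q' (r x) = r (P x)" for Q'
  proof (rule H.DK_eqI[OF Q'(1) QD])
    fix z assume z: "z \<in> carrier Z"
    have "H.ext Q' = H.ext Q" using ext_eq[of Q'] ext_eq[OF QD Qr] Q' by simp
    then have "\<iota> (Q' z) = \<iota> (Q z)"
      using H.ext(2)[OF Q'(1) z] H.ext(2)[OF QD z] by simp
    then show "Q' z = Q z" using H.q_eq_iff H.DK_apply(1)[OF Q'(1) z] H.DK_apply(1)[OF QD z] by simp
  qed
  have "diffop_ext k K Z r P = Q"
    unfolding diffop_ext_def
  proof (rule the_equality)
    show "Q \<in> carrier DZ \<and> (\<forall>x\<in>carrier K. Q (r x) = r (P x))" using QD Qr by blast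
    show "Q' = Q" if "Q' \<in> carrier DZ \<and> (\<forall>x\<in>carrier K. Q' (r x) = r (P x))" for Q'
      using that by (intro uniq) (rule conjunct1, assumption, rule conjunct2, assumption)
  qed
  then show "diffop_ext k K Z r P \<in> carrier DZ" "extZ (diffop_ext k K Z r P) = ext P"
    using QD ext_eq[OF QD Qr] unfolding H.ext_def by simp_all
qed

end

text \<open>\<open>p\<close> abstracts the projection onto the isotypic component. The listed
  properties are all that descent uses of it, so the decomposition into translates stays out of
  sight.\<close>

locale descent_setting = inverse_image_setting K L q k G N s + intermediate_field K L q k G H \<beta>
  for K :: "('a, 'b) ring_scheme" (structure) and L :: "('c, 'd) ring_scheme" (structure)
    and q :: "'a \<Rightarrow> 'c" and k :: "'a set" and G :: "('c \<Rightarrow> 'c) set" and N :: "('a \<Rightarrow> 'a, 'm) module"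
    and s and H :: "('c \<Rightarrow> 'c) set" and \<beta> :: "'c \<Rightarrow> 'e" +
  fixes p :: "('c \<times> 'm \<Rightarrow>\<^sub>0 int) set \<Rightarrow> ('c \<times> 'm \<Rightarrow>\<^sub>0 int) set"
  assumes simple: "simple_module DK N"
    and p_additive: "additive_map Vs Vs p"
    and p_smult: "Q \<in> carrier DL \<Longrightarrow> x \<in> carrier Vs \<Longrightarrow> p (s Q x) = s Q (p x)"
    and p_idem: "x \<in> carrier Vs \<Longrightarrow> p (p x) = p x"
    and p_equivariant: "\<tau> \<in> H \<Longrightarrow> x \<in> carrier Vs \<Longrightarrow> p (gact \<tau> x) = gact \<tau> (p x)"
    and p_translate_zero: "\<tau> \<in> G \<Longrightarrow> \<tau> \<notin> H \<Longrightarrow> x \<in> carrier Vs \<Longrightarrow> p (gact \<tau> (p x)) = \<zero>\<^bsub>Vs\<^esub>"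
    and p_nonzero: "\<exists>x\<in>carrier Vs. p x \<noteq> \<zero>\<^bsub>Vs\<^esub>"
begin

definition "\<theta> n = p (t \<one>\<^bsub>L\<^esub> n)"

lemma \<theta>_additive: "additive_map N Vs \<theta>"
  unfolding \<theta>_def by (rule additive_map_compose[OF t_right_map[OF L.one_closed] p_additive])

lemmas \<theta>_mem = additive_mapD(1)[OF \<theta>_additive]

lemma \<theta>_smult: "P \<in> carrier DK \<Longrightarrow> n \<in> carrier N \<Longrightarrow> \<theta> (P \<odot>\<^bsub>N\<^esub> n) = s (ext P) (\<theta> n)"
  unfolding \<theta>_def using p_smult[OF ext(1) t_mem[OF L.one_closed]] by (simp add: s_ext)

text \<open>The kernel is a submodule of the simple \<open>N\<close>. If it were everything,
  \<open>p\<close> would vanish on all l \<otimes> n by linearity, contrary to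
  \<open>p_nonzero\<close>.\<close>

lemma \<theta>_inj: "inj_on \<theta> (carrier N)"
proof -
  interpret N: left_module DK N by (rule N_module)
  interpret V: left_module DL Vs by (rule Vs_module)
  let ?U = "{n \<in> carrier N. \<theta> n = \<zero>\<^bsub>Vs\<^esub>}"
  have "submodule ?U DK N"
  proof (rule N.submoduleI)
    show "\<zero>\<^bsub>N\<^esub> \<in> ?U" using additive_map_zero[OF abelian_N abelian_V \<theta>_additive] by simp
    show "x \<oplus>\<^bsub>N\<^esub> y \<in> ?U" if "x \<in> ?U" "y \<in> ?U" for x y
      using that additive_mapD(2)[OF \<theta>_additive, of x y] by simp
    show "P \<odot>\<^bsub>N\<^esub> x \<in> ?U" if P: "P \<in> carrier DK" and x: "x \<in> ?U" for P x
      using x \<theta>_smult[OF P, of x] N_smult[OF P, of x] V.smult_zero[OF ext(1)[OF P]] by (simp add: V_simps(4))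
  qed simp
  then have "?U = {\<zero>\<^bsub>N\<^esub>} \<or> ?U = carrier N" using simple by (simp add: simple_module_def)
  then have ker: "?U = {\<zero>\<^bsub>N\<^esub>}"
  proof
    assume U: "?U = carrier N"
    obtain x where x: "x \<in> carrier Vs" "p x \<noteq> \<zero>\<^bsub>Vs\<^esub>" using p_nonzero by blast
    have "p x = \<zero>\<^bsub>Vs\<^esub>"
    proof (rule V_map_eqI[OF abelian_V p_additive _ _ x(1)])
      show "additive_map Vs Vs (\<lambda>x. \<zero>\<^bsub>Vs\<^esub>)" by (rule additive_mapI) auto
      fix l n assume l: "l \<in> carrier L" and n: "n \<in> carrier N"
      then have "\<theta> n = \<zero>\<^bsub>Vs\<^esub>" using U by blast
      then show "p (t l n) = \<zero>\<^bsub>Vs\<^esub>"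
        using p_smult[OF DL_op[OF l] t_mem[OF L.one_closed n]] V.smult_zero[OF DL_op[OF l]]
        by (simp add: s_mult_op_one[OF l n] \<theta>_def V_simps(4))
    qed
    then show ?thesis using x(2) by simp
  qed
  show ?thesis
  proof (rule inj_onI)
    fix x y assume x: "x \<in> carrier N" and y: "y \<in> carrier N" and eq: "\<theta> x = \<theta> y"
    have "\<theta> (x \<ominus>\<^bsub>N\<^esub> y) = \<theta> x \<ominus>\<^bsub>Vs\<^esub> \<theta> y"
      using x y additive_mapD(2)[OF \<theta>_additive, of x "\<ominus>\<^bsub>N\<^esub> y"] additive_map_minus[OF abelian_N abelian_V \<theta>_additive y]
      by (simp add: N.M.minus_eq V.M.minus_eq)
    also have "\<dots> = \<zero>\<^bsub>Vs\<^esub>" using eq \<theta>_mem[OF y] by (simp add: V.M.minus_eq V.M.r_neg)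
    finally have "x \<ominus>\<^bsub>N\<^esub> y \<in> ?U" using x y by simp
    then have "x \<ominus>\<^bsub>N\<^esub> y = \<zero>\<^bsub>N\<^esub>" using ker by blast
    then show "x = y" using N.M.minus_equality[of x "\<ominus>\<^bsub>N\<^esub> y"] x y by (simp add: N.M.minus_eq)
  qed
qed

text \<open>For surjectivity, multiply a given w by c with \<open>H\<close>-trace 1 and take the
  full trace. Projecting it removes the summands outside \<open>H\<close>, and those inside add up
  to the \<open>H\<close>-trace of c times w, which is w.\<close>

lemma \<theta>_image: "\<theta> ` carrier N = {w \<in> carrier Vs. p w = w \<and> (\<forall>\<tau>\<in>H. gact \<tau> w = w)}"
proof (intro equalityI subsetI)
  fix w assume "w \<in> \<theta> ` carrier N"
  then obtain n where n: "n \<in> carrier N" "w = \<theta> n" by blast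
  have "gact \<tau> (\<theta> n) = \<theta> n" if \<tau>: "\<tau> \<in> H" for \<tau>
    using p_equivariant[OF \<tau> t_mem[OF L.one_closed n(1)]] gact_pure[of \<tau>, OF _ L.one_closed n(1)] \<tau> H_sub sigma_simps(4)[of \<tau>]
    by (auto simp: \<theta>_def)
  then show "w \<in> {w \<in> carrier Vs. p w = w \<and> (\<forall>\<tau>\<in>H. gact \<tau> w = w)}"
    using n \<theta>_mem p_idem[OF t_mem[OF L.one_closed n(1)]] by (auto simp: \<theta>_def)
next
  interpret H: galois_setting Z L \<iota> "r ` k" H by (rule galois_Z)
  interpret V: left_module DL Vs by (rule Vs_module)
  fix w assume "w \<in> {w \<in> carrier Vs. p w = w \<and> (\<forall>\<tau>\<in>H. gact \<tau> w = w)}"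
  then have w: "w \<in> carrier Vs" "p w = w" "\<And>\<tau>. \<tau> \<in> H \<Longrightarrow> gact \<tau> w = w" by auto
  obtain c where c: "c \<in> carrier L" "H.tr c = \<one>\<^bsub>L\<^esub>" using H.trace_one_exists by blast
  let ?v = "s (mult_op L c) w"
  have v: "?v \<in> carrier Vs" using s_closed DL_op[OF c(1)] w(1) by blast
  have pv: "p ?v = ?v" using p_smult[OF DL_op[OF c(1)] w(1)] w(2) by simp
  obtain n where n: "n \<in> carrier N" "trV ?v = t \<one>\<^bsub>L\<^esub> n" using trV_in_N[OF v] by blast
  have mem: "gact \<sigma> ?v \<in> carrier Vs" if "\<sigma> \<in> G" for \<sigma>
    by (rule additive_mapD(1)[OF gact_additive[OF that] v])
  \<comment> \<open>Since \<sigma> fixes w, it moves only the scalar c.\<close>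
  have in_H: "p (gact \<sigma> ?v) = s (mult_op L (\<sigma> c)) w" if \<sigma>: "\<sigma> \<in> H" for \<sigma>
  proof -
    have \<sigma>G: "\<sigma> \<in> G" using \<sigma> H_sub by auto
    have "gact \<sigma> ?v = s (mult_op L (\<sigma> c)) w"
      using gact_semilinear[OF \<sigma>G DL_op[OF c(1)] w(1)] cj_mult_op[OF \<sigma>G c(1)] w(3)[OF \<sigma>] by simp
    then show ?thesis using p_smult[OF DL_op[OF sigma_simps(1)[OF \<sigma>G c(1)]] w(1)] w(2) by simp
  qed
  have sum_map: "additive_map L Vs (\<lambda>l. s (mult_op L l) w)"
    using s_closed[OF DL_op w(1)] s_ldistr[OF DL_op DL_op w(1)] by (intro additive_mapI) (auto simp: mult_op_add)
  have "\<theta> n = p (trV ?v)" using n(2) by (simp add: \<theta>_def)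
  also have "\<dots> = (\<Oplus>\<^bsub>Vs\<^esub>\<sigma>\<in>G. p (gact \<sigma> ?v))"
    unfolding trV_def using mem by (intro additive_map_finsum[OF abelian_V abelian_V p_additive G_finite]) auto
  also have "\<dots> = (\<Oplus>\<^bsub>Vs\<^esub>\<sigma>\<in>H. s (mult_op L (\<sigma> c)) w)"
  proof (rule V.M.add.finprod_mono_neutral_cong_right[OF G_finite H_sub])
    show "p (gact \<sigma> ?v) = \<zero>\<^bsub>Vs\<^esub>" if "\<sigma> \<in> G - H" for \<sigma>
      using that p_translate_zero[of \<sigma> ?v] v pv by simp
    show "(\<lambda>\<sigma>. p (gact \<sigma> ?v)) \<in> G \<rightarrow> carrier Vs"
      using mem additive_mapD(1)[OF p_additive] by blast
  qed (rule in_H)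
  also have "\<dots> = s (mult_op L (\<Oplus>\<^bsub>L\<^esub>\<sigma>\<in>H. \<sigma> c)) w"
    using H.G_finite H.sigma_simps(1) c(1)
    by (intro additive_map_finsum[OF L.is_abelian_group abelian_V sum_map, symmetric]) auto
  also have "\<dots> = w" using c(2) s_one[OF w(1)] by (simp add: H.tr_def one_DL)
  finally show "w \<in> \<theta> ` carrier N" using n(1) by blast
qed

text \<open>Operators of \<open>Z\<close> act on the \<open>H\<close>-fixed vectors of the
  component. The action is pulled back along \<theta>, so that the carrier stays that of
  \<open>N\<close> and the type fits \<open>primitive_module\<close>.\<close>

definition "N\<^sub>Z = \<lparr>carrier = carrier N, monoid.mult = undefined, one = undefined, ring.zero = \<zero>\<^bsub>N\<^esub>, ring.add = ring.add N,
  smult = \<lambda>P n. inv_into (carrier N) \<theta> (s (extZ P) (\<theta> n))\<rparr>"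

lemma NZ_simps: "carrier N\<^sub>Z = carrier N" "\<zero>\<^bsub>N\<^sub>Z\<^esub> = \<zero>\<^bsub>N\<^esub>" "x \<oplus>\<^bsub>N\<^sub>Z\<^esub> y = x \<oplus>\<^bsub>N\<^esub> y"
  by (simp_all add: N\<^sub>Z_def)

text \<open>The invariance is \<open>ext_equivariant\<close> for \<open>L\<close> over
  \<open>Z\<close>, whose group is \<open>H\<close>; elements of \<open>G\<close> outside
  \<open>H\<close> need not commute with the operator.\<close>

lemma extZ:
  assumes P: "P \<in> carrier DZ"
  shows extZ_closed: "extZ P \<in> carrier DL" and extZ_cj: "\<tau> \<in> H \<Longrightarrow> cj \<tau> (extZ P) = extZ P"
proof -
  interpret H: galois_setting Z L \<iota> "r ` k" H by (rule galois_Z)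
  have DL: "DL = H.DL" by (simp only: \<iota>_r_image[OF k_subset])
  show c: "extZ P \<in> carrier DL" using H.ext(1)[OF P] by (simp only: DL H.ext_def)
  assume \<tau>: "\<tau> \<in> H"
  then have \<tau>G: "\<tau> \<in> G" using H_sub by auto
  show "cj \<tau> (extZ P) = extZ P"
  proof (rule DL_eqI[OF cj_closed[OF \<tau>G c] c])
    fix x assume x: "x \<in> carrier L"
    then show "cj \<tau> (extZ P) x = extZ P x"
      using H.ext_equivariant[OF \<tau> P, of "ginv \<tau> x"] sigma_simps(1)[OF ginv(1)[OF \<tau>G]] ginv(3)[OF \<tau>G x]
      by (simp add: cj_apply H.ext_def)
  qed
qed

text \<open>The extended operator commutes with \<open>p\<close> and with \<open>H\<close>, so it
  preserves the image of \<theta>, and the inverse of \<theta> is taken at a point of its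
  range.\<close>

lemma NZ_smult:
  assumes P: "P \<in> carrier DZ" and n: "n \<in> carrier N"
  shows "P \<odot>\<^bsub>N\<^sub>Z\<^esub> n \<in> carrier N" and "\<theta> (P \<odot>\<^bsub>N\<^sub>Z\<^esub> n) = s (extZ P) (\<theta> n)"
proof -
  have \<theta>: "\<theta> n \<in> carrier Vs" "p (\<theta> n) = \<theta> n" "\<And>\<tau>. \<tau> \<in> H \<Longrightarrow> gact \<tau> (\<theta> n) = \<theta> n"
    using \<theta>_image n by blast+
  note c = extZ_closed[OF P]
  have "gact \<tau> (s (extZ P) (\<theta> n)) = s (extZ P) (\<theta> n)" if "\<tau> \<in> H" for \<tau>
    using gact_semilinear[OF _ c \<theta>(1), of \<tau>] extZ_cj[OF P that] \<theta>(3)[OF that] that H_sub by auto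
  moreover have "s (extZ P) (\<theta> n) \<in> carrier Vs" "p (s (extZ P) (\<theta> n)) = s (extZ P) (\<theta> n)"
    using s_closed[OF c \<theta>(1)] p_smult[OF c \<theta>(1)] \<theta>(2) by auto
  ultimately have *: "s (extZ P) (\<theta> n) \<in> \<theta> ` carrier N" unfolding \<theta>_image by simp
  show "P \<odot>\<^bsub>N\<^sub>Z\<^esub> n \<in> carrier N" using inv_into_into[OF *] by (simp add: N\<^sub>Z_def)
  show "\<theta> (P \<odot>\<^bsub>N\<^sub>Z\<^esub> n) = s (extZ P) (\<theta> n)" using f_inv_into_f[OF *] by (simp add: N\<^sub>Z_def)
qed

lemma NZ_module: "left_module DZ N\<^sub>Z"
proof -
  interpret H: galois_setting Z L \<iota> "r ` k" H by (rule galois_Z)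
  have DL: "DL = H.DL" by (simp only: \<iota>_r_image[OF k_subset])
  interpret N: left_module DK N by (rule N_module)
  interpret DZ: ring DZ by (rule H.ring_DK)
  note ext_simps = H.ext_mult[unfolded H.ext_def, folded DL] H.ext_add[unfolded H.ext_def, folded DL] H.ext_one[unfolded H.ext_def, folded DL]
  note eqI = inj_onD[OF \<theta>_inj]
  note \<theta>_add = additive_mapD(2)[OF \<theta>_additive]
  have "abelian_group N\<^sub>Z"
  proof (rule abelian_groupI)
    fix x assume "x \<in> carrier N\<^sub>Z"
    then have "x \<in> carrier N" by (simp add: NZ_simps)
    then have "\<ominus>\<^bsub>N\<^esub> x \<oplus>\<^bsub>N\<^sub>Z\<^esub> x = \<zero>\<^bsub>N\<^sub>Z\<^esub>" "\<ominus>\<^bsub>N\<^esub> x \<in> carrier N\<^sub>Z" by (auto simp: NZ_simps N.M.l_neg)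
    then show "\<exists>y\<in>carrier N\<^sub>Z. y \<oplus>\<^bsub>N\<^sub>Z\<^esub> x = \<zero>\<^bsub>N\<^sub>Z\<^esub>" by blast
  qed (auto simp: NZ_simps intro: N.M.a_assoc N.M.a_comm)
  moreover have "left_module_axioms DZ N\<^sub>Z"
  proof (rule left_module_axioms.intro; unfold NZ_simps)
    fix P Q n m assume P: "P \<in> carrier DZ" and n: "n \<in> carrier N"
    note Pn = NZ_smult[OF P n]
    show "P \<odot>\<^bsub>N\<^sub>Z\<^esub> n \<in> carrier N" by (rule Pn(1))
    show "P \<odot>\<^bsub>N\<^sub>Z\<^esub> (n \<oplus>\<^bsub>N\<^esub> m) = P \<odot>\<^bsub>N\<^sub>Z\<^esub> n \<oplus>\<^bsub>N\<^esub> P \<odot>\<^bsub>N\<^sub>Z\<^esub> m" if m: "m \<in> carrier N"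
    proof (rule eqI)
      note Pm = NZ_smult[OF P m] and nm = N.M.a_closed[OF n m]
      show "\<theta> (P \<odot>\<^bsub>N\<^sub>Z\<^esub> (n \<oplus>\<^bsub>N\<^esub> m)) = \<theta> (P \<odot>\<^bsub>N\<^sub>Z\<^esub> n \<oplus>\<^bsub>N\<^esub> P \<odot>\<^bsub>N\<^sub>Z\<^esub> m)"
        by (simp only: NZ_smult(2)[OF P nm] \<theta>_add[OF n m] \<theta>_add[OF Pn(1) Pm(1)] Pn(2) Pm(2)
            s_rdistr[OF extZ_closed[OF P] \<theta>_mem[OF n] \<theta>_mem[OF m]])
      show "P \<odot>\<^bsub>N\<^sub>Z\<^esub> (n \<oplus>\<^bsub>N\<^esub> m) \<in> carrier N" by (rule NZ_smult(1)[OF P nm])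
      show "P \<odot>\<^bsub>N\<^sub>Z\<^esub> n \<oplus>\<^bsub>N\<^esub> P \<odot>\<^bsub>N\<^sub>Z\<^esub> m \<in> carrier N" by (rule N.M.a_closed[OF Pn(1) Pm(1)])
    qed
    assume Q: "Q \<in> carrier DZ"
    note Qn = NZ_smult[OF Q n]
    show "(P \<oplus>\<^bsub>DZ\<^esub> Q) \<odot>\<^bsub>N\<^sub>Z\<^esub> n = P \<odot>\<^bsub>N\<^sub>Z\<^esub> n \<oplus>\<^bsub>N\<^esub> Q \<odot>\<^bsub>N\<^sub>Z\<^esub> n"
    proof (rule eqI)
      note PQ = DZ.a_closed[OF P Q]
      show "\<theta> ((P \<oplus>\<^bsub>DZ\<^esub> Q) \<odot>\<^bsub>N\<^sub>Z\<^esub> n) = \<theta> (P \<odot>\<^bsub>N\<^sub>Z\<^esub> n \<oplus>\<^bsub>N\<^esub> Q \<odot>\<^bsub>N\<^sub>Z\<^esub> n)"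
        by (simp only: NZ_smult(2)[OF PQ n] ext_simps(2)[OF P Q] \<theta>_add[OF Pn(1) Qn(1)] Pn(2) Qn(2)
            s_ldistr[OF extZ_closed[OF P] extZ_closed[OF Q] \<theta>_mem[OF n]])
      show "(P \<oplus>\<^bsub>DZ\<^esub> Q) \<odot>\<^bsub>N\<^sub>Z\<^esub> n \<in> carrier N" by (rule NZ_smult(1)[OF PQ n])
      show "P \<odot>\<^bsub>N\<^sub>Z\<^esub> n \<oplus>\<^bsub>N\<^esub> Q \<odot>\<^bsub>N\<^sub>Z\<^esub> n \<in> carrier N" by (rule N.M.a_closed[OF Pn(1) Qn(1)])
    qed
    show "(P \<otimes>\<^bsub>DZ\<^esub> Q) \<odot>\<^bsub>N\<^sub>Z\<^esub> n = P \<odot>\<^bsub>N\<^sub>Z\<^esub> (Q \<odot>\<^bsub>N\<^sub>Z\<^esub> n)"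
    proof (rule eqI)
      note PQ = DZ.m_closed[OF P Q] and PQn = NZ_smult[OF P Qn(1)]
      show "\<theta> ((P \<otimes>\<^bsub>DZ\<^esub> Q) \<odot>\<^bsub>N\<^sub>Z\<^esub> n) = \<theta> (P \<odot>\<^bsub>N\<^sub>Z\<^esub> (Q \<odot>\<^bsub>N\<^sub>Z\<^esub> n))"
        by (simp only: NZ_smult(2)[OF PQ n] ext_simps(1)[OF P Q] PQn(2) Qn(2)
            s_assoc[OF extZ_closed[OF P] extZ_closed[OF Q] \<theta>_mem[OF n]])
      show "(P \<otimes>\<^bsub>DZ\<^esub> Q) \<odot>\<^bsub>N\<^sub>Z\<^esub> n \<in> carrier N" by (rule NZ_smult(1)[OF PQ n])
      show "P \<odot>\<^bsub>N\<^sub>Z\<^esub> (Q \<odot>\<^bsub>N\<^sub>Z\<^esub> n) \<in> carrier N" by (rule PQn(1))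
    qed
  next
    fix n assume n: "n \<in> carrier N"
    show "\<one>\<^bsub>DZ\<^esub> \<odot>\<^bsub>N\<^sub>Z\<^esub> n = n"
      by (rule eqI[OF _ NZ_smult(1)[OF DZ.one_closed n] n])
        (simp only: NZ_smult(2)[OF DZ.one_closed n] ext_simps(3) s_one[OF \<theta>_mem[OF n]])
  qed
  ultimately show ?thesis by (intro left_module.intro DZ.ring_axioms)
qed

text \<open>The identity map works: extending an operator from \<open>K\<close> to \<open>Z\<close>
  and on to \<open>L\<close> is the same as extending it to \<open>L\<close> directly, so \<theta>
  turns both actions into one.\<close>

lemma direct_image_NZ: "modules_isomorphic DK (direct_image k K Z r N\<^sub>Z) N"
proof -
  have "diffop_ext k K Z r P \<odot>\<^bsub>N\<^sub>Z\<^esub> n = P \<odot>\<^bsub>N\<^esub> n" if P: "P \<in> carrier DK" and n: "n \<in> carrier N" for P n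
  proof (rule inj_onD[OF \<theta>_inj])
    note D = NZ_smult[OF ext_through_Z(1)[OF P] n]
    show "\<theta> (diffop_ext k K Z r P \<odot>\<^bsub>N\<^sub>Z\<^esub> n) = \<theta> (P \<odot>\<^bsub>N\<^esub> n)"
      by (simp only: D(2) ext_through_Z(2)[OF P] \<theta>_smult[OF P n])
  qed (use NZ_smult[OF ext_through_Z(1)[OF P] n] N_smult[OF P n] in auto)
  then show ?thesis
    unfolding modules_isomorphic_def direct_image_def restrict_scalars_def
    by (intro exI[of _ "\<lambda>n. n"]) (simp add: NZ_simps bij_betw_def)
qed

end

text \<open>With \<beta> valued in the type of \<open>K\<close>, both \<open>Z\<close> and
  \<open>N\<^sub>Z\<close> live in the types that primitivity quantifies over; so it forces
  \<open>r\<close> to be an isomorphism.\<close>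

lemma full_if_primitive:
  fixes K :: "'a ring" and \<beta> :: "'c \<Rightarrow> 'a"
  assumes D: "descent_setting K L q k G N s H \<beta> p"
    and fin: "ring.finite_dimension L (q ` carrier K) (carrier L)" and prim: "primitive_module k K N"
  shows "H = G"
proof -
  interpret descent_setting K L q k G N s H \<beta> p by (rule D)
  have "r \<in> ring_iso K Z"
    using prim Z_field r_hom finite_dimension_Z[OF fin] NZ_module direct_image_NZ
    unfolding primitive_module_def by blast
  then show ?thesis by (rule full_if_iso)
qed

theorem corollary3p20:
  fixes K :: "'a ring" and L :: "'b ring" and k :: "'a set" and \<pi> :: "'a \<Rightarrow> 'b"
    and N :: "('a \<Rightarrow> 'a, 'm) module"
  assumes "field K" and "field L"
    and "subfield k K"
    and "algebraically_closed (K\<lparr>carrier := k\<rparr>)"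
    and "\<forall>n::nat. n > 0 \<longrightarrow> [n] \<cdot>\<^bsub>K\<^esub> \<one>\<^bsub>K\<^esub> \<noteq> \<zero>\<^bsub>K\<^esub>"
    and "\<pi> \<in> ring_hom K L"
    and "finitely_generated_field K k"
    and "finitely_generated_field L (\<pi> ` k)"
    and "finite_galois_extension L (\<pi> ` carrier K)"
    and "simple_module (diffop_ring k K) N"
    and "finitely_generated_module K (restrict_scalars (mult_op K) N)"
    and "primitive_module k K N"
  shows "\<exists>(M :: ('b \<Rightarrow> 'b, ('b \<times> 'm \<Rightarrow>\<^sub>0 int) set) module) (e :: nat).
           simple_module (diffop_ring (\<pi> ` k) L) M \<and>
           modules_isomorphic (diffop_ring (\<pi> ` k) L) (inverse_image k K L \<pi> N) (module_power M e)"
proof -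
  have K: "field K" and L: "field L" and hom: "\<pi> \<in> ring_hom K L" and simple: "simple_module (diffop_ring k K) N"
    and fg: "finitely_generated_module K (restrict_scalars (mult_op K) N)" and prim: "primitive_module k K N"
    and k: "k \<subseteq> carrier K" and gal: "finite_galois_extension L (\<pi> ` carrier K)"
    using assms subfieldE(3) by auto
  let ?G = "(\<lambda>\<sigma>. restrict \<sigma> (carrier L)) ` field_automorphisms L (\<pi> ` carrier K)"
  have N: "left_module (diffop_ring k K) N" using simple by (simp add: simple_module_def)
  interpret galois_module K L \<pi> k ?G N
    by (rule galois_module.intro[OF galois_setting_of_finite_galois[OF K L hom k gal] galois_module_axioms.intro[OF N]])
  define s where "s = (SOME s. inverse_image_action k K L \<pi> N s)"
  have "inverse_image_action k K L \<pi> N s"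
    unfolding s_def by (rule someI[of "inverse_image_action k K L \<pi> N"]) (rule inverse_image_action_act)
  then interpret inverse_image_setting K L \<pi> k ?G N s by unfold_locales
  have Vs: "inverse_image k K L \<pi> N = Vs" by (simp add: inverse_image_def s_def)
  obtain W where W: "left_module.minimal DL Vs W" using minimal_submodule_exists[OF simple fg] by blast
  interpret S: semilinear_action DL Vs ?G "compose (carrier L)" "\<lambda>x\<in>carrier L. x" gact cj W
    by (rule semilinear[OF simple W])
  \<comment> \<open>Characteristic 0 makes \<open>K\<close> infinite, so that \<open>L\<close>
    injects into its type.\<close>
  have "infinite (carrier K)" using infinite_carrier_char_zero[OF field.is_ring[OF K]] assms(5) by blast
  then obtain \<beta> :: "'b \<Rightarrow> 'a" where \<beta>: "inj_on \<beta> (carrier L)" using embeds_in_base by blast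
  have full: "S.inertia = ?G"
  proof (rule full_if_primitive[OF _ _ prim])
    show "ring.finite_dimension L (\<pi> ` carrier K) (carrier L)" using gal by (simp add: finite_galois_extension_def)
    \<comment> \<open>The product of \<sigma> and its inverse is the identity, which lies in the
      inertia group; cancelling \<sigma> leaves the inverse there.\<close>
    have inv: "ginv \<sigma> \<in> S.inertia" if \<sigma>: "\<sigma> \<in> S.inertia" for \<sigma>
    proof -
      have \<sigma>G: "\<sigma> \<in> ?G" using \<sigma> S.inertia_sub by blast
      have "compose (carrier L) \<sigma> (ginv \<sigma>) = (\<lambda>x\<in>carrier L. x)"
        using ginv(3)[OF \<sigma>G] by (auto simp: compose_def)
      then show ?thesis using S.inertia_mul_iff(1)[OF \<sigma>G ginv(1)[OF \<sigma>G] \<sigma>] S.inertia_e by simp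
    qed
    have comp: "compose (carrier L) \<sigma> \<tau> \<in> S.inertia" if "\<sigma> \<in> S.inertia" "\<tau> \<in> S.inertia" for \<sigma> \<tau>
      using S.inertia_mul_iff(1)[of \<sigma> \<tau>] that S.inertia_sub by blast
    have int: "intermediate_field K L \<pi> k ?G S.inertia \<beta>"
      by (intro intermediate_field.intro intermediate_field_axioms.intro galois_setting_axioms S.inertia_sub S.inertia_e comp inv \<beta>)
    show "descent_setting K L \<pi> k ?G N s S.inertia \<beta> S.proj"
    proof (intro descent_setting.intro int inverse_image_setting_axioms descent_setting_axioms.intro simple S.proj_additive S.proj_nonzero)
      show "S.proj (s Q x) = s Q (S.proj x)" if "Q \<in> carrier DL" "x \<in> carrier Vs" for Q x
        using S.proj_smult[OF that] by (simp only: V_simps(4))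
    qed (fact S.proj_idem S.proj_equivariant S.proj_translate_zero)+
  qed
  let ?M = "Vs\<lparr>carrier := W\<rparr>"
  obtain f and n :: nat where f: "bij_betw f (carrier Vs) ({..<n} \<rightarrow>\<^sub>E W)"
    "\<And>x y. x \<in> carrier Vs \<Longrightarrow> y \<in> carrier Vs \<Longrightarrow> f (x \<oplus>\<^bsub>Vs\<^esub> y) = (\<lambda>i\<in>{..<n}. f x i \<oplus>\<^bsub>Vs\<^esub> f y i)"
    "\<And>a x. a \<in> carrier DL \<Longrightarrow> x \<in> carrier Vs \<Longrightarrow> f (a \<odot>\<^bsub>Vs\<^esub> x) = (\<lambda>i\<in>{..<n}. a \<odot>\<^bsub>Vs\<^esub> f x i)"
    using S.isotypic_if_inertia_full[OF full] by blast
  have "simple_module DL ?M"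
    unfolding simple_module_def by (rule S.minimal_simple[OF W refl])
  moreover have "modules_isomorphic DL (inverse_image k K L \<pi> N) (module_power ?M n)"
    unfolding Vs modules_isomorphic_def module_power_def using f by (intro exI[of _ f]) simp
  ultimately show ?thesis by blast
qed

end
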